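(* Let $k$ be odd. For any $(k,\eta)$-sparse LPN problem of dimension $n$, given any $\delta\in(0,1)$ satisfying $k=o(n^{\frac{1+\delta}{2}})$, there is a randomized algorithm that takes $$m:=\max\Big\{1,\ \frac{\log n}{k},\ \frac{\eta\, n^{\frac{1+\delta}{2}}\cdot\log n}{k^2}\Big\}\cdot O(n)^{1+(1-\delta)\cdot\frac{k-1}{2}}$$ samples and returns the hidden vector in time $$n^{O(1)}\cdot\Big(e^{O\left(\eta\cdot n^{\frac{1+\delta}{2}}\cdot\max\{1,\frac{\log n}{k}\}\right)}+m\Big)$$ with probability $1-1/n$.
   Context: $(k,\eta)$-sparse LPN of dimension $n$: there is an unknown (possibly dense) vector $s\in\mathbf{F}_2^n$. Each sample is an independent pair $(x,y)$, where $x$ is uniformly random among the vectors of $\mathbf{F}_2^n$ with exactly $k$ nonzero entries, and $y=\langle x,s\rangle+e\in\mathbf{F}_2$ with $e$ an independent Bernoulli noise bit equal to $1$ with probability $\eta$. The algorithm is given $n,k,\eta,\delta$ and access to such samples, and must output the hidden vector $s$. Notation: $O(n)^{a}$ means $(C\cdot n)^{a}$ for a constant $C$.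
   Formalization: The noise rate η is assumed to be at most a fixed constant below 1/2, with the constants hidden in O() depending on that constant; at η = 1/2 the labels carry no information about the hidden vector and the claim fails. *)

theory Defs
  imports
    "Jordan_Normal_Form.Matrix"
    "HOL-Probability.Probability"
    "HOL-Library.Landau_Symbols"
    "HOL-Library.Log_Nat"
    "HOL-Library.Z2"
begin

section \<open>Sparse learning parity with noise\<close>

text \<open>The type \<^typ>\<open>bit\<close> is the two-element field. Vectors are those of
  \<^theory>\<open>Jordan_Normal_Form.Matrix\<close>, since the dimension varies inside the statement; the names
  \<open>vec_index\<close> and \<open>scalar_prod\<close> are written in full because their infix forms clash
  with those of HOL-Analysis.\<close>

definition sparse_vecs :: "nat \<Rightarrow> nat \<Rightarrow> bit Matrix.vec set" where
  "sparse_vecs n k = {x \<in> carrier_vec n. card {i. i < n \<and> vec_index x i \<noteq> 0} = k}"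

definition lpn_sample ::
  "nat \<Rightarrow> nat \<Rightarrow> real \<Rightarrow> bit Matrix.vec \<Rightarrow> (bit Matrix.vec \<times> bit) pmf" where
  "lpn_sample n k \<eta> s =
     bind_pmf (pmf_of_set (sparse_vecs n k)) (\<lambda>x.
     bind_pmf (bernoulli_pmf \<eta>) (\<lambda>e.
     return_pmf (x, scalar_prod x s + of_bool e)))"


section \<open>Randomized algorithms with sample access\<close>

text \<open>
  An algorithm is a single finite program in a while language with finitely many variables
  and finitely many unbounded arrays, all holding natural numbers. This is a random access
  machine with structured control, charged by bit length: every operation pays for the lengths
  of the numbers and addresses involved, and multiplication and division pay the product of the
  operand lengths. Running time is thus the same as bit complexity on a random access machine up
  to factors polynomial in the lengths of the numbers handled.

  The program is given \<open>n\<close> and \<open>k\<close> in variables 0 and 1. The real parameters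
  \<open>\<eta>\<close> and \<open>\<delta>\<close> need not have a finite description; the program reads
  their binary expansions, and reading the digit at position \<open>i\<close> after the binary point
  costs at least \<open>i\<close>.
\<close>

record params =
  dimension :: nat
  sparsity :: nat
  noise :: real
  tradeoff :: real

datatype aexp =
    Num nat
  | Var nat
  | Get nat aexp
  | Add aexp aexp
  | Sub aexp aexp
  | Mul aexp aexp
  | Quo aexp aexp
  | Less aexp aexp
  | NoiseDigit aexp
  | TradeoffDigit aexp

text \<open>
  \<open>Put a i e\<close> writes \<open>e\<close> to cell \<open>i\<close> of array \<open>a\<close>.
  \<open>Flip v\<close> puts a fair coin into variable \<open>v\<close>. \<open>Sample a v\<close> draws a
  fresh sample \<open>(x, y)\<close>, puts \<open>x\<close> into cells \<open>0, \<dots>, n - 1\<close> of array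
  \<open>a\<close> and \<open>y\<close> into variable \<open>v\<close>. Conditions hold when nonzero.
\<close>

datatype com =
    Skip
  | Assign nat aexp
  | Put nat aexp aexp
  | Seq com com
  | Cond aexp com com
  | While aexp com
  | Flip nat
  | Sample nat nat

text \<open>A configuration contains the stack of commands still to be executed, the memory, the cost
  incurred so far and the number of samples drawn so far.\<close>

record config =
  todo :: "com list"
  vars :: "nat \<Rightarrow> nat"
  arrs :: "nat \<Rightarrow> nat \<Rightarrow> nat"
  cost :: nat
  drawn :: nat

definition bits :: "nat \<Rightarrow> nat" where
  "bits m = floorlog 2 m"

text \<open>The digit of weight \<open>2 ^ -(i + 1)\<close>, for a real number in \<open>[0, 1)\<close>.\<close>

definition real_digit :: "real \<Rightarrow> nat \<Rightarrow> nat" where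
  "real_digit r i = nat (\<lfloor>r * 2 ^ Suc i\<rfloor> mod 2)"

definition nat_of_bit :: "bit \<Rightarrow> nat" where
  "nat_of_bit b = of_bool (b = 1)"

fun aval :: "params \<Rightarrow> config \<Rightarrow> aexp \<Rightarrow> nat" where
  "aval P c (Num m) = m"
| "aval P c (Var v) = vars c v"
| "aval P c (Get a e) = arrs c a (aval P c e)"
| "aval P c (Add e f) = aval P c e + aval P c f"
| "aval P c (Sub e f) = aval P c e - aval P c f"
| "aval P c (Mul e f) = aval P c e * aval P c f"
| "aval P c (Quo e f) = aval P c e div aval P c f"
| "aval P c (Less e f) = of_bool (aval P c e < aval P c f)"
| "aval P c (NoiseDigit e) = real_digit (noise P) (aval P c e)"
| "aval P c (TradeoffDigit e) = real_digit (tradeoff P) (aval P c e)"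

fun acost :: "params \<Rightarrow> config \<Rightarrow> aexp \<Rightarrow> nat" where
  "acost P c (Num m) = 1 + bits m"
| "acost P c (Var v) = 1 + bits (vars c v)"
| "acost P c (Get a e) = acost P c e + 1 + bits (aval P c e) + bits (aval P c (Get a e))"
| "acost P c (Add e f) = acost P c e + acost P c f + 1 + bits (aval P c e) + bits (aval P c f)"
| "acost P c (Sub e f) = acost P c e + acost P c f + 1 + bits (aval P c e) + bits (aval P c f)"
| "acost P c (Mul e f) =
     acost P c e + acost P c f + (1 + bits (aval P c e)) * (1 + bits (aval P c f))"
| "acost P c (Quo e f) =
     acost P c e + acost P c f + (1 + bits (aval P c e)) * (1 + bits (aval P c f))"
| "acost P c (Less e f) = acost P c e + acost P c f + 1 + bits (aval P c e) + bits (aval P c f)"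
| "acost P c (NoiseDigit e) = acost P c e + 1 + aval P c e"
| "acost P c (TradeoffDigit e) = acost P c e + 1 + aval P c e"

text \<open>One step of execution as a Markov kernel; \<open>D\<close> is the distribution of a sample.
  Every step of a running program costs at least 1, and a halted configuration stays as it is.\<close>

definition step ::
  "params \<Rightarrow> (bit Matrix.vec \<times> bit) pmf \<Rightarrow> config \<Rightarrow> config pmf" where
  "step P D c = (case todo c of [] \<Rightarrow> return_pmf c | com # rest \<Rightarrow> (case com of
       Skip \<Rightarrow> return_pmf (c\<lparr>todo := rest, cost := cost c + 1\<rparr>)
     | Assign v e \<Rightarrow> return_pmf (c\<lparr>todo := rest,
         vars := (vars c)(v := aval P c e),
         cost := cost c + 1 + acost P c e + bits (aval P c e)\<rparr>)
     | Put a i e \<Rightarrow> return_pmf (c\<lparr>todo := rest,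
         arrs := (arrs c)(a := (arrs c a)(aval P c i := aval P c e)),
         cost := cost c + 1 + acost P c i + acost P c e
                   + bits (aval P c i) + bits (aval P c e)\<rparr>)
     | Seq p q \<Rightarrow> return_pmf (c\<lparr>todo := p # q # rest, cost := cost c + 1\<rparr>)
     | Cond e p q \<Rightarrow> return_pmf (c\<lparr>
         todo := (if aval P c e \<noteq> 0 then p else q) # rest,
         cost := cost c + 1 + acost P c e\<rparr>)
     | While e p \<Rightarrow> return_pmf (c\<lparr>
         todo := (if aval P c e \<noteq> 0 then p # While e p # rest else rest),
         cost := cost c + 1 + acost P c e\<rparr>)
     | Flip v \<Rightarrow> map_pmf (\<lambda>b. c\<lparr>todo := rest,
         vars := (vars c)(v := of_bool b),
         cost := cost c + 1\<rparr>) (bernoulli_pmf (1 / 2))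
     | Sample a v \<Rightarrow> map_pmf (\<lambda>(x, y). c\<lparr>todo := rest,
         vars := (vars c)(v := nat_of_bit y),
         arrs := (arrs c)(a := (\<lambda>i. if i < dimension P
                                  then nat_of_bit (vec_index x i) else arrs c a i)),
         cost := cost c + (dimension P + 1) * (1 + bits (dimension P)),
         drawn := drawn c + 1\<rparr>) D))"

primrec run ::
  "params \<Rightarrow> (bit Matrix.vec \<times> bit) pmf \<Rightarrow> nat \<Rightarrow> config \<Rightarrow> config pmf" where
  "run P D 0 c = return_pmf c"
| "run P D (Suc t) c = bind_pmf (step P D c) (run P D t)"

definition initial :: "com \<Rightarrow> params \<Rightarrow> config" where
  "initial A P = \<lparr>todo = [A],
     vars = (\<lambda>v. if v = 0 then dimension P else if v = 1 then sparsity P else 0),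
     arrs = (\<lambda>_ _. 0), cost = 0, drawn = 0\<rparr>"

text \<open>The output is read from array 0.\<close>

definition outputs :: "params \<Rightarrow> bit Matrix.vec \<Rightarrow> config \<Rightarrow> bool" where
  "outputs P s c \<longleftrightarrow> (\<forall>i < dimension P. arrs c 0 i = nat_of_bit (vec_index s i))"

text \<open>Every run halts within the time and sample bounds, and the output is \<open>s\<close> with
  probability at least \<open>p\<close>.\<close>

definition solves_sparse_LPN ::
  "com \<Rightarrow> params \<Rightarrow> bit Matrix.vec \<Rightarrow> real \<Rightarrow> real \<Rightarrow> real \<Rightarrow> bool" where
  "solves_sparse_LPN A P s m T p \<longleftrightarrow>
     (let D = lpn_sample (dimension P) (sparsity P) (noise P) s in
      \<exists>t. (\<forall>c \<in> set_pmf (run P D t (initial A P)).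
             todo c = [] \<and> real (drawn c) \<le> m \<and> real (cost c) \<le> T) \<and>
          measure_pmf.prob (run P D t (initial A P)) {c. outputs P s c} \<ge> p)"


section \<open>The bounds\<close>

definition sample_bound :: "real \<Rightarrow> nat \<Rightarrow> nat \<Rightarrow> real \<Rightarrow> real \<Rightarrow> real" where
  "sample_bound C n k \<eta> \<delta> =
     Max {1, ln n / k, \<eta> * n powr ((1 + \<delta>) / 2) * ln n / real k ^ 2} *
     (C * n) powr (1 + (1 - \<delta>) * ((real k - 1) / 2))"

definition time_bound ::
  "real \<Rightarrow> real \<Rightarrow> real \<Rightarrow> nat \<Rightarrow> nat \<Rightarrow> real \<Rightarrow> real \<Rightarrow> real" where
  "time_bound C B E n k \<eta> \<delta> =
     n powr E *
     (exp (B * (\<eta> * n powr ((1 + \<delta>) / 2) * max 1 (ln n / k))) + sample_bound C n k \<eta> \<delta>)"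

end

theory Submission
  imports Defs "HOL-Real_Asymp.Real_Asymp"
begin

text \<open>
  Let \<open>q = n powr ((1 + \<delta>) / 2)\<close>. The coordinates of \<open>s\<close> in a window of
  about \<open>q\<close> consecutive positions are recovered from the samples whose support lies in that
  window, a fraction of at least \<open>p = (q / n) ^ k\<close> of all samples; this loss is what makes
  up the sample bound. The samples are divided into \<open>r\<close> blocks, where \<open>r\<close> is of
  order \<open>ln n\<close> plus the expected number of noisy samples in the window, so that a constant
  fraction of the blocks contains no noisy sample of the window. For every one of the \<open>2 ^ r\<close>
  sets of blocks, the linear system given by the window samples in these blocks is solved, and the
  solution disagreeing with the fewest window samples overall is kept.

  The set of all noiseless blocks determines \<open>s\<close> on the window, and every other candidate
  disagrees more often. Both hold because for odd \<open>k\<close> a random \<open>k\<close>-set meets a set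
  \<open>V\<close> in the window in an odd number of points with probability at least
  \<open>min (1 / 16) (card V * k / (2 * Q))\<close>, where \<open>Q\<close> is the window size: this
  probability beats the number of sets \<open>V\<close> of given size in a union bound.

  The real parameters are approximated from \<open>2 * bits n\<close> binary digits. As the program
  draws a fixed number of samples and uses no coins, it is a deterministic function of a tape of
  samples.
\<close>


section \<open>Running a program on a tape of samples\<close>

text \<open>The exponential factor of the time bound may only be added to the sample count, never
  multiplied by it. So the window samples are first collected in a pool of at most
  \<open>cap\<close> entries, \<open>cap\<close> being polynomial in \<open>n\<close>, and the
  \<open>2 ^ r\<close> guesses work on the pool alone. Guessing a set of blocks rather than a set of
  samples keeps the number of guesses at \<open>2 ^ r\<close>; the part of \<open>r\<close> of order
  \<open>ln n\<close> costs a polynomial factor only.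

  Oddness of \<open>k\<close> matters for a candidate that differs from \<open>s\<close> on nearly
  the whole window: for even \<open>k\<close> and a difference equal to the window, no window sample
  would ever notice it.

  The expected number \<open>M\<close> of window samples is of order
  \<open>q * max 1 (ln n / k)\<close>; it balances the large sets \<open>V\<close>, whose number is
  about \<open>2 ^ Q\<close>, against the small ones, whose number is a power of \<open>n\<close>.
  Since a sample falls into a window with probability about \<open>(q / n) ^ k\<close>, this needs
  about \<open>M * (n / q) ^ k\<close> samples, and \<open>q * (n / q) ^ k\<close> is the power of
  \<open>n\<close> in the sample bound. All constants depend only on the gap
  \<open>1 - 2 * \<eta>\<^sub>0\<close>.\<close>

definition dstep :: "params \<Rightarrow> (nat \<Rightarrow> bit Matrix.vec \<times> bit) \<Rightarrow> config \<Rightarrow> config" where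
  "dstep P \<omega> c = (case todo c of [] \<Rightarrow> c | com # rest \<Rightarrow> (case com of
       Skip \<Rightarrow> c\<lparr>todo := rest, cost := cost c + 1\<rparr>
     | Assign v e \<Rightarrow> c\<lparr>todo := rest,
         vars := (vars c)(v := aval P c e),
         cost := cost c + 1 + acost P c e + bits (aval P c e)\<rparr>
     | Put a i e \<Rightarrow> c\<lparr>todo := rest,
         arrs := (arrs c)(a := (arrs c a)(aval P c i := aval P c e)),
         cost := cost c + 1 + acost P c i + acost P c e
                   + bits (aval P c i) + bits (aval P c e)\<rparr>
     | Seq p q \<Rightarrow> c\<lparr>todo := p # q # rest, cost := cost c + 1\<rparr>
     | Cond e p q \<Rightarrow> c\<lparr>
         todo := (if aval P c e \<noteq> 0 then p else q) # rest,
         cost := cost c + 1 + acost P c e\<rparr>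
     | While e p \<Rightarrow> c\<lparr>
         todo := (if aval P c e \<noteq> 0 then p # While e p # rest else rest),
         cost := cost c + 1 + acost P c e\<rparr>
     | Flip v \<Rightarrow> c\<lparr>todo := rest, cost := cost c + 1\<rparr>
     | Sample a v \<Rightarrow> c\<lparr>todo := rest,
         vars := (vars c)(v := nat_of_bit (snd (\<omega> (drawn c)))),
         arrs := (arrs c)(a := (\<lambda>i. if i < dimension P
              then nat_of_bit (vec_index (fst (\<omega> (drawn c))) i) else arrs c a i)),
         cost := cost c + (dimension P + 1) * (1 + bits (dimension P)),
         drawn := drawn c + 1\<rparr>))"

text \<open>The next sample is always cell \<open>drawn c\<close> of the tape, so no cell is read
  twice and the cells can be independent draws.\<close>

primrec drun :: "params \<Rightarrow> (nat \<Rightarrow> bit Matrix.vec \<times> bit) \<Rightarrow> nat \<Rightarrow> config \<Rightarrow> config" where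
  "drun P \<omega> 0 c = c"
| "drun P \<omega> (Suc t) c = drun P \<omega> t (dstep P \<omega> c)"

fun flipless :: "com \<Rightarrow> bool" where
  "flipless (Seq p q) = (flipless p \<and> flipless q)"
| "flipless (Cond e p q) = (flipless p \<and> flipless q)"
| "flipless (While e p) = flipless p"
| "flipless (Flip v) = False"
| "flipless _ = True"

lemma flipless_dstep:
  "\<forall>p \<in> set (todo c). flipless p \<Longrightarrow> \<forall>p \<in> set (todo (dstep P \<omega> c)). flipless p"
  by (auto simp: dstep_def split: list.splits com.splits if_splits)

lemma drawn_dstep: "drawn c \<le> drawn (dstep P \<omega> c)" "drawn (dstep P \<omega> c) \<le> drawn c + 1"
  by (auto simp: dstep_def split: list.splits com.splits if_splits)

lemma dstep_cong: "\<omega> (drawn c) = \<omega>' (drawn c) \<Longrightarrow> dstep P \<omega> c = dstep P \<omega>' c"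
  by (auto simp: dstep_def cong: if_cong split: list.splits com.splits)

text \<open>Cells before \<open>drawn c\<close> are already consumed. This allows a single cell to
  be split off from the tape in \<open>run_eq_drun\<close>.\<close>

lemma drun_cong: "\<forall>i \<ge> drawn c. \<omega> i = \<omega>' i \<Longrightarrow> drun P \<omega> t c = drun P \<omega>' t c"
proof (induction t arbitrary: c)
  case (Suc t)
  then have "dstep P \<omega> c = dstep P \<omega>' c" by (intro dstep_cong) auto
  then show ?case using Suc drawn_dstep(1)[of c P \<omega>'] by (auto intro!: Suc.IH)
qed simp

lemma step_eq_dstep:
  assumes "\<forall>p \<in> set (todo c). flipless p" "\<nexists>a v r. todo c = Sample a v # r"
  shows "step P D c = return_pmf (dstep P \<omega> c)" "drawn (dstep P \<omega> c) = drawn c"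
        "dstep P \<omega> c = dstep P \<omega>' c"
  using assms by (auto simp: step_def dstep_def split: list.splits com.splits)

text \<open>Only a \<open>Sample\<close> step is random. There the product law splits off the
  coordinate \<open>drawn c\<close>, and the rest of the run reads later coordinates only. A step
  draws at most one sample, hence the requirement on the tape length \<open>N\<close>.\<close>

lemma run_eq_drun:
  assumes "\<forall>p \<in> set (todo c). flipless p" "drawn c + t \<le> N"
  shows "run P D t c = map_pmf (\<lambda>\<omega>. drun P \<omega> t c) (Pi_pmf {drawn c..<N} d (\<lambda>_. D))"
  using assms
proof (induction t arbitrary: c)
  case (Suc t)
  show ?case
  proof (cases "\<exists>a v r. todo c = Sample a v # r")
    case False
    note st = step_eq_dstep[OF Suc.prems(1) False]
    have "run P D (Suc t) c = run P D t (dstep P undefined c)"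
      by (simp add: st(1)[of _ _ undefined] bind_return_pmf)
    also have "\<dots> = map_pmf (\<lambda>\<omega>. drun P \<omega> t (dstep P undefined c)) (Pi_pmf {drawn c..<N} d (\<lambda>_. D))"
      using Suc.IH[of "dstep P undefined c"] flipless_dstep[OF Suc.prems(1)] Suc.prems(2)
      by (simp add: st(2))
    also have "\<dots> = map_pmf (\<lambda>\<omega>. drun P \<omega> (Suc t) c) (Pi_pmf {drawn c..<N} d (\<lambda>_. D))"
      using st(3)[of _ _ undefined] by (intro map_pmf_cong) (auto, metis)
    finally show ?thesis .
  next
    case True
    then obtain a v r where td: "todo c = Sample a v # r" by blast
    define upd where "upd z = dstep P (\<lambda>_. z) c" for z
    have upd_drawn: "drawn (upd z) = drawn c + 1" for z
      by (simp add: upd_def dstep_def td)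
    have "step P D c = map_pmf upd D"
      by (auto simp: step_def td upd_def dstep_def cong: if_cong intro!: map_pmf_cong)
    then have "run P D (Suc t) c = bind_pmf D (\<lambda>z. run P D t (upd z))"
      by (simp add: bind_map_pmf)
    also have "\<dots> = bind_pmf D (\<lambda>z. map_pmf (\<lambda>\<omega>. drun P \<omega> t (upd z))
                      (Pi_pmf {drawn c + 1..<N} d (\<lambda>_. D)))"
    proof (intro bind_pmf_cong refl)
      fix z
      have "\<forall>p\<in>set (todo (upd z)). flipless p"
        unfolding upd_def by (rule flipless_dstep[OF Suc.prems(1)])
      then show "run P D t (upd z) = map_pmf (\<lambda>\<omega>. drun P \<omega> t (upd z))
                      (Pi_pmf {drawn c + 1..<N} d (\<lambda>_. D))"
        using Suc.IH[of "upd z"] Suc.prems(2) by (simp add: upd_drawn)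
    qed
    also have "\<dots> = map_pmf (\<lambda>\<omega>. drun P \<omega> (Suc t) c)
        (Pi_pmf (insert (drawn c) {drawn c + 1..<N}) d (\<lambda>_. D))"
    proof -
      have eq: "drun P (f(drawn c := z)) (Suc t) c = drun P f t (upd z)" for f z
      proof -
        have "dstep P (f(drawn c := z)) c = upd z"
          unfolding upd_def by (rule dstep_cong) simp
        then show ?thesis
          by (simp, intro drun_cong) (auto simp: upd_drawn)
      qed
      show ?thesis
        apply (subst Pi_pmf_insert)
          apply simp
         apply simp
        apply (simp add: pmf.map_comp o_def case_prod_beta eq del: drun.simps fun_upd_apply)
        apply (simp add: pair_pmf_def map_bind_pmf map_pmf_def bind_assoc_pmf bind_return_pmf)
        done
    qed
    also have "insert (drawn c) {drawn c + 1..<N} = {drawn c..<N}"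
      using Suc.prems(2) by auto
    finally show ?thesis .
  qed
qed (simp add: map_pmf_const)

section \<open>Halting and cost\<close>

lemma drun_add: "drun P \<omega> (s + t) c = drun P \<omega> t (drun P \<omega> s c)"
  by (induction s arbitrary: c) auto

lemma drun_halted: "todo c = [] \<Longrightarrow> drun P \<omega> t c = c"
  by (induction t) (auto simp: dstep_def)

lemma cost_dstep: "cost c \<le> cost (dstep P \<omega> c)" "todo c \<noteq> [] \<Longrightarrow> cost c < cost (dstep P \<omega> c)"
  by (auto simp: dstep_def split: list.splits com.splits)

lemma cost_drun_mono: "cost c \<le> cost (drun P \<omega> t c)"
  by (induction t arbitrary: c) (auto intro: order.trans[OF cost_dstep(1)])

lemma cost_drun_running: "todo (drun P \<omega> t c) \<noteq> [] \<Longrightarrow> cost c + t \<le> cost (drun P \<omega> t c)"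
proof (induction t arbitrary: c)
  case (Suc t)
  then have "todo c \<noteq> []" using drun_halted[of c P \<omega> "Suc t"] by fastforce
  from cost_dstep(2)[OF this, of P \<omega>] Suc.IH[of "dstep P \<omega> c"] Suc.prems show ?case by auto
qed simp

text \<open>Were the run still going after \<open>t\<close> steps, its cost would be at least
  \<open>t\<close> already, and the next step would push it beyond \<open>t\<close>.\<close>

lemma drun_final:
  assumes "todo (drun P \<omega> s c) = []" "cost (drun P \<omega> s c) \<le> t"
  shows "drun P \<omega> t c = drun P \<omega> s c"
proof (cases "s \<le> t")
  case True
  then show ?thesis using drun_add[of P \<omega> s "t - s" c] drun_halted[OF assms(1)] by simp
next
  case False
  then have s: "s = t + (s - t)" by simp
  have "todo (drun P \<omega> t c) = []"
  proof (rule ccontr)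
    assume r: "todo (drun P \<omega> t c) \<noteq> []"
    let ?c = "drun P \<omega> t c"
    have "s - t = Suc (s - t - 1)" using False by simp
    then have "cost ?c < cost (drun P \<omega> (s - t) ?c)"
      using cost_dstep(2)[OF r, of P \<omega>] cost_drun_mono[of "dstep P \<omega> ?c" P \<omega> "s - t - 1"]
      by (metis drun.simps(2) order.strict_trans2)
    then show False using cost_drun_running[OF r] assms(2) drun_add[of P \<omega> t "s - t" c] s by simp
  qed
  then show ?thesis using drun_add[of P \<omega> t "s - t" c] drun_halted s by metis
qed

text \<open>Since every step costs at least 1, a bound on the cost of the halted runs gives a
  common number of steps after which all runs have halted.\<close>

lemma solves_of_tapes:
  assumes flipless: "flipless A"
    and D: "D = lpn_sample (dimension P) (sparsity P) (noise P) s"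
    and halts: "\<And>\<omega>. \<exists>t. todo (drun P \<omega> t (initial A P)) = [] \<and> drawn (drun P \<omega> t (initial A P)) = m
         \<and> cost (drun P \<omega> t (initial A P)) \<le> T
         \<and> (good \<omega> \<longrightarrow> outputs P s (drun P \<omega> t (initial A P)))"
    and local: "\<And>\<omega> \<omega>'. (\<forall>i<m. \<omega> i = \<omega>' i) \<Longrightarrow> good \<omega> = good \<omega>'"
    and prob: "measure_pmf.prob (Pi_pmf {..<m} d (\<lambda>_. D)) {\<omega>. good \<omega>} \<ge> p"
    and bounds: "real m \<le> mb" "real T \<le> Tb"
  shows "solves_sparse_LPN A P s mb Tb p"
proof -
  let ?c = "initial A P"
  \<comment> \<open>\<open>run_eq_drun\<close> asks for one cell per step, hence at least
    \<open>T\<close> cells, while \<open>good\<close> is about the first \<open>m\<close> cells;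
    \<open>Pi_pmf_subset\<close> passes between the two lengths.\<close>
  define N where "N = max m T"
  have fin: "todo (drun P \<omega> T ?c) = []" "drawn (drun P \<omega> T ?c) = m" "cost (drun P \<omega> T ?c) \<le> T"
      "good \<omega> \<Longrightarrow> outputs P s (drun P \<omega> T ?c)" for \<omega>
    using halts[of \<omega>] drun_final[of P \<omega> _ ?c T] by metis+
  have run: "run P D T ?c = map_pmf (\<lambda>\<omega>. drun P \<omega> T ?c) (Pi_pmf {..<N} d (\<lambda>_. D))"
    using run_eq_drun[of ?c T N P D d] flipless by (simp add: initial_def atLeast0LessThan N_def)
  have "measure_pmf.prob (Pi_pmf {..<m} d (\<lambda>_. D)) {\<omega>. good \<omega>}
      = measure_pmf.prob (map_pmf (\<lambda>f x. if x \<in> {..<m} then f x else d) (Pi_pmf {..<N} d (\<lambda>_. D))) {\<omega>. good \<omega>}"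
    by (subst Pi_pmf_subset[of "{..<N}" "{..<m}"]) (auto simp: N_def)
  also have "\<dots> = measure_pmf.prob (Pi_pmf {..<N} d (\<lambda>_. D)) {\<omega>. good \<omega>}"
    by (simp add: vimage_def) (intro arg_cong[where f="measure_pmf.prob _"] Collect_cong local, simp)
  also have "\<dots> \<le> measure_pmf.prob (Pi_pmf {..<N} d (\<lambda>_. D)) {\<omega>. outputs P s (drun P \<omega> T ?c)}"
    by (intro measure_pmf.finite_measure_mono) (auto intro: fin)
  also have "\<dots> = measure_pmf.prob (run P D T ?c) {c. outputs P s c}"
    by (simp add: run vimage_def)
  finally have "p \<le> measure_pmf.prob (run P D T ?c) {c. outputs P s c}" using prob by simp
  moreover have "\<forall>c\<in>set_pmf (run P D T ?c). todo c = [] \<and> real (drawn c) \<le> mb \<and> real (cost c) \<le> Tb"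
  proof
    fix c assume "c \<in> set_pmf (run P D T ?c)"
    then obtain \<omega> where "c = drun P \<omega> T ?c" unfolding run by auto
    then show "todo c = [] \<and> real (drawn c) \<le> mb \<and> real (cost c) \<le> Tb"
      using fin(1-3)[of \<omega>] bounds by (auto intro: order.trans[OF _ bounds(2)])
  qed
  ultimately show ?thesis
    unfolding solves_sparse_LPN_def D[symmetric] Let_def by blast
qed

section \<open>Bounded-loop programs\<close>

text \<open>A configuration without command stack and cost. Correctness is proved for these alone;
  \<open>simulation\<close> carries it over to the machine together with a cost bound.\<close>

record mem =
  mv :: "nat \<Rightarrow> nat"
  ma :: "nat \<Rightarrow> nat \<Rightarrow> nat"
  md :: nat

definition mem_of :: "config \<Rightarrow> mem" where
  "mem_of c = \<lparr>mv = vars c, ma = arrs c, md = drawn c\<rparr>"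

fun evm :: "params \<Rightarrow> mem \<Rightarrow> aexp \<Rightarrow> nat" where
  "evm P c (Num m) = m"
| "evm P c (Var v) = mv c v"
| "evm P c (Get a e) = ma c a (evm P c e)"
| "evm P c (Add e f) = evm P c e + evm P c f"
| "evm P c (Sub e f) = evm P c e - evm P c f"
| "evm P c (Mul e f) = evm P c e * evm P c f"
| "evm P c (Quo e f) = evm P c e div evm P c f"
| "evm P c (Less e f) = of_bool (evm P c e < evm P c f)"
| "evm P c (NoiseDigit e) = real_digit (noise P) (evm P c e)"
| "evm P c (TradeoffDigit e) = real_digit (tradeoff P) (evm P c e)"

lemma aval_ev: "aval P c e = evm P (mem_of c) e"
  by (induction e) (auto simp: mem_of_def)

text \<open>Every loop runs a number of times read from a variable at its start, so termination and
  step counts follow the syntax.\<close>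

datatype prog =
    PSkip
  | PAsg nat aexp
  | PPut nat aexp aexp
  | PSeq prog prog  (infixr ";;" 60)
  | PIf aexp prog prog
  | PFor nat nat prog
  | PSample nat nat

primrec compile :: "prog \<Rightarrow> com" where
  "compile PSkip = Skip"
| "compile (PAsg v e) = Assign v e"
| "compile (PPut a i e) = Put a i e"
| "compile (p ;; q) = Seq (compile p) (compile q)"
| "compile (PIf e p q) = Cond e (compile p) (compile q)"
| "compile (PFor v N p) = Seq (Assign v (Num 0))
     (While (Less (Var v) (Var N)) (Seq (compile p) (Assign v (Add (Var v) (Num 1)))))"
| "compile (PSample a v) = Sample a v"

lemma flipless_comp: "flipless (compile p)"
  by (induction p) auto

text \<open>The counter is overwritten after each round here but incremented in the compiled code.
  The two agree because \<open>well_formed\<close> forbids the body to write the counter.\<close>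

primrec loop :: "(mem \<Rightarrow> mem) \<Rightarrow> nat \<Rightarrow> nat \<Rightarrow> mem \<Rightarrow> mem" where
  "loop f v 0 m = m\<lparr>mv := (mv m)(v := 0)\<rparr>"
| "loop f v (Suc i) m = (let m' = f (loop f v i m) in m'\<lparr>mv := (mv m')(v := Suc i)\<rparr>)"

primrec den :: "params \<Rightarrow> (nat \<Rightarrow> bit Matrix.vec \<times> bit) \<Rightarrow> prog \<Rightarrow> mem \<Rightarrow> mem" where
  "den P \<omega> PSkip m = m"
| "den P \<omega> (PAsg v e) m = m\<lparr>mv := (mv m)(v := evm P m e)\<rparr>"
| "den P \<omega> (PPut a i e) m = m\<lparr>ma := (ma m)(a := (ma m a)(evm P m i := evm P m e))\<rparr>"
| "den P \<omega> (p ;; q) m = den P \<omega> q (den P \<omega> p m)"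
| "den P \<omega> (PIf e p q) m = (if evm P m e \<noteq> 0 then den P \<omega> p m else den P \<omega> q m)"
| "den P \<omega> (PFor v N p) m = loop (den P \<omega> p) v (mv m N) m"
| "den P \<omega> (PSample a v) m = m\<lparr>
     mv := (mv m)(v := nat_of_bit (snd (\<omega> (md m)))),
     ma := (ma m)(a := (\<lambda>i. if i < dimension P
              then nat_of_bit (vec_index (fst (\<omega> (md m))) i) else ma m a i)),
     md := md m + 1\<rparr>"

fun wv :: "prog \<Rightarrow> nat set" where
  "wv (PAsg v e) = {v}"
| "wv (p ;; q) = wv p \<union> wv q"
| "wv (PIf e p q) = wv p \<union> wv q"
| "wv (PFor v N p) = insert v (wv p)"
| "wv (PSample a v) = {v}"
| "wv _ = {}"

fun wa :: "prog \<Rightarrow> nat set" where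
  "wa (PPut a i e) = {a}"
| "wa (p ;; q) = wa p \<union> wa q"
| "wa (PIf e p q) = wa p \<union> wa q"
| "wa (PFor v N p) = wa p"
| "wa (PSample a v) = {a}"
| "wa _ = {}"

fun samples :: "prog \<Rightarrow> bool" where
  "samples (p ;; q) = (samples p \<or> samples q)"
| "samples (PIf e p q) = (samples p \<or> samples q)"
| "samples (PFor v N p) = samples p"
| "samples (PSample a v) = True"
| "samples _ = False"

lemma loop_frame:
  assumes "\<And>m. mv (f m) w = mv m w" "w \<noteq> v"
  shows "mv (loop f v i m) w = mv m w"
  using assms by (induction i) (auto simp: Let_def)

lemma loop_frame_ma:
  assumes "\<And>m. ma (f m) a = ma m a"
  shows "ma (loop f v i m) a = ma m a"
  using assms by (induction i) (auto simp: Let_def)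

lemma loop_frame_md:
  assumes "\<And>m. md (f m) = md m"
  shows "md (loop f v i m) = md m"
  using assms by (induction i) (auto simp: Let_def)

lemma den_frame: "w \<notin> wv p \<Longrightarrow> mv (den P \<omega> p m) w = mv m w"
  by (induction p arbitrary: m) (auto intro!: loop_frame)

lemma den_frame_ma: "a \<notin> wa p \<Longrightarrow> ma (den P \<omega> p m) a = ma m a"
  by (induction p arbitrary: m) (auto intro!: loop_frame_ma)

lemma den_frame_md: "\<not> samples p \<Longrightarrow> md (den P \<omega> p m) = md m"
  by (induction p arbitrary: m) (auto intro!: loop_frame_md)

lemma loop_var: "mv (loop f v i m) v = i"
  by (cases i) (auto simp: Let_def)

text \<open>The frame conditions are built in, so an invariant need only mention what the body
  changes.\<close>

lemma for_rule:
  assumes "I 0 (m\<lparr>mv := (mv m)(v := 0)\<rparr>)"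
    and "\<And>i m'. i < mv m N \<Longrightarrow> mv m' v = i \<Longrightarrow> (\<And>w. w \<notin> wv (PFor v N p) \<Longrightarrow> mv m' w = mv m w)
          \<Longrightarrow> (\<And>a. a \<notin> wa p \<Longrightarrow> ma m' a = ma m a) \<Longrightarrow> (\<not> samples p \<Longrightarrow> md m' = md m) \<Longrightarrow> I i m'
          \<Longrightarrow> I (Suc i) ((den P \<omega> p m')\<lparr>mv := (mv (den P \<omega> p m'))(v := Suc i)\<rparr>)"
  shows "I (mv m N) (den P \<omega> (PFor v N p) m)"
proof -
  have "i \<le> mv m N \<Longrightarrow> I i (loop (den P \<omega> p) v i m)" for i
  proof (induction i)
    case (Suc i)
    let ?m = "loop (den P \<omega> p) v i m"
    have "I (Suc i) ((den P \<omega> p ?m)\<lparr>mv := (mv (den P \<omega> p ?m))(v := Suc i)\<rparr>)"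
      using Suc by (intro assms(2)) (auto simp: loop_var loop_frame loop_frame_ma loop_frame_md
          den_frame den_frame_ma den_frame_md)
    then show ?case by (simp add: Let_def)
  qed (use assms(1) in simp)
  then show ?thesis by simp
qed

text \<open>\<open>K\<close> is a set of variables that the program does not write; all loop bounds lie in it,
  so that the number of steps depends only on the values of these variables.\<close>

fun well_formed :: "nat set \<Rightarrow> prog \<Rightarrow> bool" where
  "well_formed K (PAsg v e) = (v \<notin> K)"
| "well_formed K (p ;; q) = (well_formed K p \<and> well_formed K q)"
| "well_formed K (PIf e p q) = (well_formed K p \<and> well_formed K q)"
| "well_formed K (PFor v N p) = (v \<notin> K \<and> N \<in> K \<and> v \<notin> wv p \<and> well_formed K p)"
| "well_formed K (PSample a v) = (v \<notin> K)"
| "well_formed K _ = True"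

lemma well_formed_wv: "well_formed K p \<Longrightarrow> v \<in> K \<Longrightarrow> v \<notin> wv p"
  by (induction p) auto

text \<open>A conditional is charged for both branches, which makes the count independent of the
  data. In a loop the first 3 stands for \<open>Seq\<close>, the initial assignment and the last
  test, the second 3 for the test, \<open>Seq\<close> and the increment in each round.\<close>

primrec steps :: "(nat \<Rightarrow> nat) \<Rightarrow> prog \<Rightarrow> nat" where
  "steps V PSkip = 1"
| "steps V (PAsg v e) = 1"
| "steps V (PPut a i e) = 1"
| "steps V (p ;; q) = 1 + steps V p + steps V q"
| "steps V (PIf e p q) = 1 + steps V p + steps V q"
| "steps V (PFor v N p) = 3 + V N * (steps V p + 3)"
| "steps V (PSample a v) = 1"

lemma steps_cong: "well_formed K p \<Longrightarrow> \<forall>v\<in>K. V v = V' v \<Longrightarrow> steps V p = steps V' p"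
  by (induction p) auto

text \<open>Upper bounds for values when the variables in \<open>K\<close> are at most \<open>Y\<close>, and all other
  variables and cells at most \<open>X\<close>.\<close>

fun vbound :: "nat set \<Rightarrow> nat \<Rightarrow> nat \<Rightarrow> aexp \<Rightarrow> nat" where
  "vbound K Y X (Num m) = m"
| "vbound K Y X (Var v) = (if v \<in> K then Y else X)"
| "vbound K Y X (Get a e) = X"
| "vbound K Y X (Add e f) = vbound K Y X e + vbound K Y X f"
| "vbound K Y X (Sub e f) = vbound K Y X e"
| "vbound K Y X (Mul e f) = vbound K Y X e * vbound K Y X f"
| "vbound K Y X (Quo e f) = vbound K Y X e"
| "vbound K Y X (Less e f) = 1"
| "vbound K Y X (NoiseDigit e) = 1"
| "vbound K Y X (TradeoffDigit e) = 1"

definition mem_bounded :: "nat set \<Rightarrow> nat \<Rightarrow> nat \<Rightarrow> mem \<Rightarrow> bool" where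
  "mem_bounded K Y X m \<longleftrightarrow> (\<forall>v\<in>K. mv m v \<le> Y) \<and> (\<forall>v. v \<notin> K \<longrightarrow> mv m v \<le> X)
     \<and> (\<forall>a i. ma m a i \<le> X)"

lemma real_digit_le: "real_digit r i \<le> 1"
  unfolding real_digit_def by linarith

lemma ev_le_vbound: "mem_bounded K Y X m \<Longrightarrow> evm P m e \<le> vbound K Y X e"
  by (induction e)
     (auto simp: mem_bounded_def add_mono mult_mono real_digit_le[simplified]
       intro: order.trans[OF diff_le_self] order.trans[OF div_le_dividend])

text \<open>Only stored values are restricted; addresses may be larger. Loop counters need no
  condition, since \<open>b\<close> increases by at least 1 per step.\<close>

fun grows :: "nat set \<Rightarrow> nat \<Rightarrow> (nat \<Rightarrow> nat) \<Rightarrow> prog \<Rightarrow> bool" where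
  "grows K Y b (PAsg v e) = (\<forall>j. vbound K Y (b j) e \<le> b (Suc j))"
| "grows K Y b (PPut a i e) = (\<forall>j. vbound K Y (b j) e \<le> b (Suc j))"
| "grows K Y b (p ;; q) = (grows K Y b p \<and> grows K Y b q)"
| "grows K Y b (PIf e p q) = (grows K Y b p \<and> grows K Y b q)"
| "grows K Y b (PFor v N p) = grows K Y b p"
| "grows K Y b _ = True"

text \<open>A value below \<open>2 ^ (bitdeg e * \<psi>)\<close> results from values below \<open>2 ^ \<psi>\<close>.\<close>

fun bitdeg :: "aexp \<Rightarrow> nat" where
  "bitdeg (Num m) = bits m + 1"
| "bitdeg (Add e f) = bitdeg e + bitdeg f + 1"
| "bitdeg (Sub e f) = bitdeg e"
| "bitdeg (Mul e f) = bitdeg e + bitdeg f"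
| "bitdeg (Quo e f) = bitdeg e"
| "bitdeg _ = 1"

fun digits :: "aexp \<Rightarrow> bool" where
  "digits (Get a e) = digits e"
| "digits (Add e f) = (digits e \<or> digits f)"
| "digits (Sub e f) = (digits e \<or> digits f)"
| "digits (Mul e f) = (digits e \<or> digits f)"
| "digits (Quo e f) = (digits e \<or> digits f)"
| "digits (Less e f) = (digits e \<or> digits f)"
| "digits (NoiseDigit e) = True"
| "digits (TradeoffDigit e) = True"
| "digits _ = False"

text \<open>A digit is charged its position itself, not the length of the position. With positions
  restricted to variables they are at most \<open>X\<close>, and only programs that read digits have
  to satisfy \<open>X \<le> \<psi>\<close>.\<close>

fun plain_digits :: "aexp \<Rightarrow> bool" where
  "plain_digits (Get a e) = plain_digits e"
| "plain_digits (Add e f) = (plain_digits e \<and> plain_digits f)"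
| "plain_digits (Sub e f) = (plain_digits e \<and> plain_digits f)"
| "plain_digits (Mul e f) = (plain_digits e \<and> plain_digits f)"
| "plain_digits (Quo e f) = (plain_digits e \<and> plain_digits f)"
| "plain_digits (Less e f) = (plain_digits e \<and> plain_digits f)"
| "plain_digits (NoiseDigit e) = (\<exists>v. e = Var v)"
| "plain_digits (TradeoffDigit e) = (\<exists>v. e = Var v)"
| "plain_digits _ = True"

fun weight :: "aexp \<Rightarrow> nat" where
  "weight (Num m) = 1 + bits m"
| "weight (Var v) = 2"
| "weight (Get a e) = weight e + 2 + bitdeg e"
| "weight (Add e f) = weight e + weight f + 1 + bitdeg e + bitdeg f"
| "weight (Sub e f) = weight e + weight f + 1 + bitdeg e + bitdeg f"
| "weight (Mul e f) = weight e + weight f + (1 + bitdeg e) * (1 + bitdeg f)"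
| "weight (Quo e f) = weight e + weight f + (1 + bitdeg e) * (1 + bitdeg f)"
| "weight (Less e f) = weight e + weight f + 1 + bitdeg e + bitdeg f"
| "weight (NoiseDigit e) = weight e + 2"
| "weight (TradeoffDigit e) = weight e + 2"

lemma less_two_power_bits: "m < 2 ^ bits m"
  using floorlog_bounds[of m 2] by (cases "m = 0") (auto simp: bits_def)

lemma bits_le: "m < 2 ^ k \<Longrightarrow> bits m \<le> k"
  unfolding bits_def by (intro floorlog_leI) auto

context
  fixes K Y X m \<psi>
  assumes b: "mem_bounded K Y X m" and YX: "Y \<le> X" and psi: "bits X + 2 \<le> \<psi>"
begin

lemma psi_pos: "1 \<le> \<psi>"
  using psi by simp

lemma X_less: "X < 2 ^ \<psi>"
  using less_two_power_bits[of X] psi by (meson add_leD1 order.strict_trans2 one_le_numeral power_increasing)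

lemma mv_le: "mv m v \<le> X"
proof -
  have "(if v \<in> K then mv m v \<le> Y else mv m v \<le> X)" using b by (simp add: mem_bounded_def)
  then show ?thesis using YX by (auto split: if_splits)
qed

lemma ev_less: "evm P m e < 2 ^ (bitdeg e * \<psi>)"
proof (induction e)
  case (Num x)
  have "2 ^ bits x \<le> (2::nat) ^ ((bits x + 1) * \<psi>)"
    using psi_pos by (intro power_increasing) (auto simp: mult.commute intro: trans_le_add2)
  then show ?case using order.strict_trans2[OF less_two_power_bits[of x]] by simp
next
  case (Var x)
  then show ?case using mv_le[of x] X_less by simp
next
  case (Get x1a e)
  have "ma m x1a (evm P m e) \<le> X" using b unfolding mem_bounded_def by blast
  then show ?case using X_less by simp
next
  case (Add e f)
  have "evm P m e + evm P m f < 2 ^ ((bitdeg e + bitdeg f) * \<psi>) + 2 ^ ((bitdeg e + bitdeg f) * \<psi>)"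
    using Add by (intro add_strict_mono) (auto elim!: order.strict_trans2 intro!: power_increasing simp: algebra_simps)
  also have "\<dots> = 2 ^ ((bitdeg e + bitdeg f) * \<psi> + 1)" by simp
  also have "\<dots> \<le> 2 ^ ((bitdeg e + bitdeg f + 1) * \<psi>)"
    using psi_pos by (intro power_increasing) (auto simp: algebra_simps)
  finally show ?case by simp
next
  case (Mul e f)
  then show ?case by (simp add: add_mult_distrib power_add mult_strict_mono)
next
  case (Less e f)
  then show ?case using psi_pos one_less_power[of "2::nat" \<psi>] by (auto simp: of_bool_def)
next
  case (NoiseDigit e)
  then show ?case using psi_pos one_less_power[of "2::nat" \<psi>] real_digit_le[of "noise P" "evm P m e"] by simp
next
  case (TradeoffDigit e)
  then show ?case using psi_pos one_less_power[of "2::nat" \<psi>] real_digit_le[of "tradeoff P" "evm P m e"] by simp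
qed (auto intro: order.strict_trans1[OF diff_le_self] order.strict_trans1[OF div_le_dividend])

lemma bits_ev: "bits (evm P m e) \<le> bitdeg e * \<psi>"
  by (rule bits_le[OF ev_less])

lemma one_le_psi_sq: "1 \<le> \<psi> * \<psi>"
  using psi_pos by simp

lemma psi_sq: "x * \<psi> \<le> x * (\<psi> * \<psi>)" "x \<le> x * (\<psi> * \<psi>)" "x \<le> x * \<psi>"
  using psi_pos by auto

lemma bits_ev_sq: "bits (evm P m e) \<le> bitdeg e * (\<psi> * \<psi>)"
  by (rule order.trans[OF bits_ev psi_sq(1)])

lemma bits_le_psi: "x \<le> X \<Longrightarrow> bits x \<le> \<psi>"
  using X_less by (intro bits_le) simp

lemma acost_le:
  assumes "mem_of c = m" "plain_digits e" "digits e \<Longrightarrow> X \<le> \<psi>"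
  shows "acost P c e \<le> weight e * (\<psi> * \<psi>)"
proof -
  define u where "u = \<psi> * \<psi>"
  show ?thesis
  using assms(2,3)
proof (induction e)
  case (Num x)
  then show ?case using psi_sq(2)[of "Suc (bits x)"] by simp
next
  case (Var x)
  have "bits (vars c x) \<le> \<psi>"
    using bits_le_psi[OF mv_le[of x]] assms(1) by (auto simp: mem_of_def)
  then have "1 + bits (vars c x) \<le> 2 * \<psi>" using psi_pos by simp
  also note psi_sq(1)[of 2]
  finally show ?case by simp
next
  case (Get a e)
  have "ma m a (evm P m e) \<le> X" using b by (simp add: mem_bounded_def)
  then have "bits (arrs c a (evm P m e)) \<le> \<psi>"
    using bits_le_psi assms(1) by (auto simp: mem_of_def)
  then have "bits (aval P c (Get a e)) \<le> 1 * \<psi>" by (simp add: aval_ev assms(1)) (simp add: mem_of_def flip: assms(1))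
  moreover have "acost P c e \<le> weight e * (\<psi> * \<psi>)" using Get by simp
  moreover have "bits (aval P c e) \<le> bitdeg e * \<psi>" using bits_ev[of P e] by (simp add: aval_ev assms(1))
  ultimately have "acost P c (Get a e) \<le> weight e * (\<psi> * \<psi>) + 1 * (\<psi> * \<psi>) + bitdeg e * (\<psi> * \<psi>) + 1 * (\<psi> * \<psi>)"
    using psi_sq(1)[of 1] psi_sq(1)[of "bitdeg e"] psi_sq(2)[of 1] by (simp only: acost.simps)
  then show ?case by (simp add: add_mult_distrib)
next
  case (Add e f)
  then show ?case
    using bits_ev_sq[of P e] bits_ev_sq[of P f] one_le_psi_sq
    by (simp add: aval_ev assms(1) add_mult_distrib flip: u_def)
next
  case (Sub e f)
  then show ?case
    using bits_ev_sq[of P e] bits_ev_sq[of P f] one_le_psi_sq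
    by (simp add: aval_ev assms(1) add_mult_distrib flip: u_def)
next
  case (Less e f)
  then show ?case
    using bits_ev_sq[of P e] bits_ev_sq[of P f] one_le_psi_sq
    by (simp add: aval_ev assms(1) add_mult_distrib flip: u_def)
next
  case (Mul e f)
  have "(1 + bits (evm P m e)) * (1 + bits (evm P m f)) \<le> ((1 + bitdeg e) * \<psi>) * ((1 + bitdeg f) * \<psi>)"
    using bits_ev[of P e] bits_ev[of P f] psi_pos by (intro mult_mono) (auto simp: add_mult_distrib)
  also have "\<dots> = ((1 + bitdeg e) * (1 + bitdeg f)) * (\<psi> * \<psi>)" by (simp add: algebra_simps)
  finally show ?case using Mul by (simp add: aval_ev assms(1) add_mult_distrib)
next
  case (Quo e f)
  have "(1 + bits (evm P m e)) * (1 + bits (evm P m f)) \<le> ((1 + bitdeg e) * \<psi>) * ((1 + bitdeg f) * \<psi>)"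
    using bits_ev[of P e] bits_ev[of P f] psi_pos by (intro mult_mono) (auto simp: add_mult_distrib)
  also have "\<dots> = ((1 + bitdeg e) * (1 + bitdeg f)) * (\<psi> * \<psi>)" by (simp add: algebra_simps)
  finally show ?case using Quo by (simp add: aval_ev assms(1) add_mult_distrib)
next
  case (NoiseDigit e)
  then obtain v where v: "e = Var v" by auto
  have "mv m v \<le> u" using mv_le[of v] NoiseDigit order.trans[OF _ psi_sq(1)[of 1]] by (simp add: u_def)
  moreover have "acost P c e \<le> weight e * (\<psi> * \<psi>)" using NoiseDigit v by simp
  moreover have "1 \<le> u" using psi_pos by (simp add: u_def)
  ultimately show ?case by (simp add: aval_ev assms(1) v add_mult_distrib flip: u_def)
next
  case (TradeoffDigit e)
  then obtain v where v: "e = Var v" by auto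
  have "mv m v \<le> u" using mv_le[of v] TradeoffDigit order.trans[OF _ psi_sq(1)[of 1]] by (simp add: u_def)
  moreover have "acost P c e \<le> weight e * (\<psi> * \<psi>)" using TradeoffDigit v by simp
  moreover have "1 \<le> u" using psi_pos by (simp add: u_def)
  ultimately show ?case by (simp add: aval_ev assms(1) v add_mult_distrib flip: u_def)
qed
qed

end

fun pdigits :: "prog \<Rightarrow> bool" where
  "pdigits (PAsg v e) = digits e"
| "pdigits (PPut a i e) = (digits i \<or> digits e)"
| "pdigits (p ;; q) = (pdigits p \<or> pdigits q)"
| "pdigits (PIf e p q) = (digits e \<or> pdigits p \<or> pdigits q)"
| "pdigits (PFor v N p) = pdigits p"
| "pdigits _ = False"

fun plain :: "prog \<Rightarrow> bool" where
  "plain (PAsg v e) = plain_digits e"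
| "plain (PPut a i e) = (plain_digits i \<and> plain_digits e)"
| "plain (p ;; q) = (plain p \<and> plain q)"
| "plain (PIf e p q) = (plain_digits e \<and> plain p \<and> plain q)"
| "plain (PFor v N p) = plain p"
| "plain _ = True"

fun pweight :: "prog \<Rightarrow> nat" where
  "pweight (PAsg v e) = 1 + weight e + bitdeg e"
| "pweight (PPut a i e) = 1 + weight i + weight e + bitdeg i + bitdeg e"
| "pweight (p ;; q) = 1 + pweight p + pweight q"
| "pweight (PIf e p q) = 1 + weight e + pweight p + pweight q"
| "pweight (PFor v N p) = 20 + pweight p"
| "pweight _ = 1"

section \<open>Simulation by the machine\<close>

definition reach :: "params \<Rightarrow> (nat \<Rightarrow> bit Matrix.vec \<times> bit) \<Rightarrow> config \<Rightarrow> config \<Rightarrow> bool" where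
  "reach P \<omega> c c' \<longleftrightarrow> (\<exists>t. drun P \<omega> t c = c')"

lemma reach_trans [trans]: "reach P \<omega> c c' \<Longrightarrow> reach P \<omega> c' c'' \<Longrightarrow> reach P \<omega> c c''"
  unfolding reach_def by (metis drun_add)

lemma reach_dstep: "reach P \<omega> c (dstep P \<omega> c)"
  unfolding reach_def by (rule exI[of _ 1]) simp

lemma dstep_Seq:
  assumes "todo c = Seq p q # r"
  shows "todo (dstep P \<omega> c) = p # q # r" "mem_of (dstep P \<omega> c) = mem_of c"
    "cost (dstep P \<omega> c) = cost c + 1"
  using assms by (simp_all add: dstep_def mem_of_def)

text \<open>\<open>b j\<close> bounds all values after \<open>j\<close> steps, and \<open>\<psi>\<close> exceeds the length of the
  largest value that can occur.\<close>

locale growth =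
  fixes P :: params and \<omega> :: "nat \<Rightarrow> bit Matrix.vec \<times> bit" and K :: "nat set" and Y J \<psi> :: nat and b :: "nat \<Rightarrow> nat"
  assumes b_Suc: "\<And>j. b j + 1 \<le> b (Suc j)"
    and Y_le: "Y \<le> b 0"
    and psi: "bits (b J) + 2 \<le> \<psi>"
    and dim: "(dimension P + 1) * (1 + bits (dimension P)) \<le> \<psi> * \<psi>"
begin

lemma b_mono: "i \<le> j \<Longrightarrow> b i \<le> b j"
  using b_Suc by (metis add_leD1 lift_Suc_mono_le)

lemma bits_mono: "x \<le> y \<Longrightarrow> bits x \<le> bits y"
  by (intro bits_le) (use less_two_power_bits[of y] in simp)

lemma psi_at: "j \<le> J \<Longrightarrow> bits (b j) + 2 \<le> \<psi>"
  using bits_mono[OF b_mono, of j J] psi by simp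

lemma Y_at: "Y \<le> b j"
  using Y_le b_mono[of 0 j] by simp

lemma mem_bounded_mono: "i \<le> j \<Longrightarrow> mem_bounded K Y (b i) m \<Longrightarrow> mem_bounded K Y (b j) m"
  unfolding mem_bounded_def using b_mono[of i j] by (metis order.trans)

lemma acost_at:
  assumes "mem_bounded K Y (b j) (mem_of c)" "j \<le> J" "plain_digits e" "digits e \<Longrightarrow> b J \<le> \<psi>"
  shows "acost P c e \<le> weight e * (\<psi> * \<psi>)" "bits (aval P c e) \<le> bitdeg e * (\<psi> * \<psi>)"
proof -
  show "acost P c e \<le> weight e * (\<psi> * \<psi>)"
    using assms b_mono[of j J] by (intro acost_le[OF assms(1) Y_at psi_at]) auto
  have "bits (aval P c e) \<le> bitdeg e * \<psi>"
    unfolding aval_ev using bits_ev[OF assms(1) Y_at psi_at[OF assms(2)]] .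
  also have "\<dots> \<le> bitdeg e * (\<psi> * \<psi>)"
    by (rule psi_sq(1)[OF assms(1) Y_at psi_at[OF assms(2)]])
  finally show "bits (aval P c e) \<le> bitdeg e * (\<psi> * \<psi>)" .
qed

text \<open>The step index \<open>j\<close> is carried along because the bound on values grows with
  time. A run may take fewer steps than \<open>steps\<close> counts, and monotonicity of
  \<open>b\<close> absorbs the difference. The square of \<open>\<psi>\<close> pays for
  multiplication and division, whose cost is a product of two lengths.\<close>

lemma simulation:
  assumes "well_formed K p" "grows K Y b p" "plain p" "pdigits p \<Longrightarrow> b J \<le> \<psi>"
    "mem_bounded K Y (b j) (mem_of c)" "j + steps (vars c) p \<le> J" "todo c = compile p # rest"
  shows "\<exists>c'. reach P \<omega> c c' \<and> todo c' = rest \<and> mem_of c' = den P \<omega> p (mem_of c)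
      \<and> mem_bounded K Y (b (j + steps (vars c) p)) (mem_of c')
      \<and> cost c' \<le> cost c + steps (vars c) p * (pweight p * (\<psi> * \<psi>))"
proof -
  define u where "u = \<psi> * \<psi>"
  show ?thesis
  using assms
proof (induction p arbitrary: c j rest)
  case PSkip
  then show ?case
    using mem_bounded_mono[of j "Suc j" "mem_of c"] psi
    by (intro exI[of _ "dstep P \<omega> c"]) (auto simp: reach_dstep, auto simp: dstep_def mem_of_def)
next
  case (PAsg v e)
  note pre = PAsg.prems
  have jJ: "j \<le> J" using pre by simp
  have e: "acost P c e \<le> weight e * (\<psi> * \<psi>)" "bits (aval P c e) \<le> bitdeg e * (\<psi> * \<psi>)"
    using acost_at[of j c e] pre by auto
  have v: "aval P c e \<le> b (Suc j)"
    using ev_le_vbound[OF pre(5), of P e] pre(2) order.trans unfolding aval_ev by (metis grows.simps(1))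
  have p1: "1 \<le> u" using psi by (simp add: u_def)
  have "mem_bounded K Y (b (Suc j)) (mem_of (dstep P \<omega> c))"
    using mem_bounded_mono[OF _ pre(5), of "Suc j"] v pre(1)
    by (auto simp: dstep_def pre mem_of_def mem_bounded_def)
  then show ?case
    using pre(7) e p1
    by (intro exI[of _ "dstep P \<omega> c"])
       (auto simp: reach_dstep, auto simp: dstep_def mem_of_def aval_ev add_mult_distrib simp flip: u_def)
next
  case (PPut a i e)
  note pre = PPut.prems
  have e: "acost P c e \<le> weight e * (\<psi> * \<psi>)" "bits (aval P c e) \<le> bitdeg e * (\<psi> * \<psi>)"
     "acost P c i \<le> weight i * (\<psi> * \<psi>)" "bits (aval P c i) \<le> bitdeg i * (\<psi> * \<psi>)"
    using acost_at[of j c e] acost_at[of j c i] pre by auto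
  have v: "aval P c e \<le> b (Suc j)"
    using ev_le_vbound[OF pre(5), of P e] pre(2) order.trans unfolding aval_ev by (metis grows.simps(2))
  have p1: "1 \<le> u" using psi by (simp add: u_def)
  have "mem_bounded K Y (b (Suc j)) (mem_of (dstep P \<omega> c))"
    using mem_bounded_mono[OF _ pre(5), of "Suc j"] v pre(1)
    by (auto simp: dstep_def pre mem_of_def mem_bounded_def)
  then show ?case
    using pre(7) e p1
    by (intro exI[of _ "dstep P \<omega> c"])
       (auto simp: reach_dstep, auto simp: dstep_def mem_of_def aval_ev add_mult_distrib simp flip: u_def)
next
  case (PSeq p q)
  note pre = PSeq.prems
  let ?c0 = "dstep P \<omega> c"
  have c0: "todo ?c0 = compile p # compile q # rest" "mem_of ?c0 = mem_of c" "vars ?c0 = vars c" "cost ?c0 = cost c + 1"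
    using pre(7) by (auto simp: dstep_def mem_of_def)
  obtain c1 where c1: "reach P \<omega> ?c0 c1" "todo c1 = compile q # rest" "mem_of c1 = den P \<omega> p (mem_of c)"
    "mem_bounded K Y (b (j + steps (vars c) p)) (mem_of c1)"
    "cost c1 \<le> cost c + 1 + steps (vars c) p * (pweight p * (\<psi> * \<psi>))"
    using PSeq.IH(1)[of j ?c0 "compile q # rest"] pre c0 by auto
  have "steps (vars c1) q = steps (vars c) q"
  proof (rule steps_cong)
    show "\<forall>v\<in>K. vars c1 v = vars c v"
      using den_frame[OF well_formed_wv, of K p _ P \<omega> "mem_of c"] pre(1) c1(3)
      by (metis mem_of_def mem.select_convs(1) well_formed.simps(2))
  qed (use pre in auto)
  with PSeq.IH(2)[of "j + steps (vars c) p" c1 rest] pre c1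
  obtain c2 where c2: "reach P \<omega> c1 c2" "todo c2 = rest" "mem_of c2 = den P \<omega> q (mem_of c1)"
    "mem_bounded K Y (b (j + steps (vars c) p + steps (vars c) q)) (mem_of c2)"
    "cost c2 \<le> cost c1 + steps (vars c) q * (pweight q * (\<psi> * \<psi>))"
    by auto
  have "cost c2 \<le> cost c + steps (vars c) (p ;; q) * (pweight (p ;; q) * (\<psi> * \<psi>))"
  proof -
    let ?a = "steps (vars c) p" and ?b = "steps (vars c) q"
    have "cost c2 \<le> cost c + (1 * 1 + ?a * (pweight p * (\<psi> * \<psi>)) + ?b * (pweight q * (\<psi> * \<psi>)))"
      using c1(5) c2(5) by simp
    also have "\<dots> \<le> cost c + (1 * (pweight (p ;; q) * (\<psi> * \<psi>)) + ?a * (pweight (p ;; q) * (\<psi> * \<psi>))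
        + ?b * (pweight (p ;; q) * (\<psi> * \<psi>)))"
      using psi by (intro add_mono mult_left_mono mult_right_mono mult_mono order.refl)
         (auto simp: add_mult_distrib intro!: trans_le_add1)
    finally show ?thesis by (simp only: steps.simps add_mult_distrib)
  qed
  then show ?case
    using c1 c2 mem_bounded_mono[OF _ c2(4), of "j + steps (vars c) (p ;; q)"]
      reach_trans[OF reach_dstep reach_trans[OF c1(1) c2(1)]]
    by (intro exI[of _ c2]) auto
next
  case (PIf e p q)
  note pre = PIf.prems
  let ?c0 = "dstep P \<omega> c"
  define r where "r = (if aval P c e \<noteq> 0 then p else q)"
  have c0: "todo ?c0 = compile r # rest" "mem_of ?c0 = mem_of c" "vars ?c0 = vars c"
     "cost ?c0 = cost c + 1 + acost P c e"
    using pre(7) by (auto simp: dstep_def mem_of_def r_def)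
  have r: "steps (vars c) r \<le> steps (vars c) p + steps (vars c) q" "pweight r \<le> pweight p + pweight q"
    by (auto simp: r_def)
  have "\<exists>c1. reach P \<omega> ?c0 c1 \<and> todo c1 = rest \<and> mem_of c1 = den P \<omega> r (mem_of c)
    \<and> mem_bounded K Y (b (j + steps (vars c) r)) (mem_of c1)
    \<and> cost c1 \<le> cost ?c0 + steps (vars c) r * (pweight r * (\<psi> * \<psi>))"
    using PIf.IH(1)[of j ?c0 rest] PIf.IH(2)[of j ?c0 rest] pre c0 by (auto simp: r_def)
  then obtain c1 where c1: "reach P \<omega> ?c0 c1" "todo c1 = rest" "mem_of c1 = den P \<omega> r (mem_of c)"
    "mem_bounded K Y (b (j + steps (vars c) r)) (mem_of c1)"
    "cost c1 \<le> cost c + 1 + acost P c e + steps (vars c) r * (pweight r * (\<psi> * \<psi>))"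
    using c0(4) by auto
  have "cost c1 \<le> cost c + steps (vars c) (PIf e p q) * (pweight (PIf e p q) * (\<psi> * \<psi>))"
  proof -
    let ?a = "steps (vars c) p" and ?b = "steps (vars c) q"
    have "1 + acost P c e \<le> pweight (PIf e p q) * (\<psi> * \<psi>)"
    proof -
      have "1 \<le> u" using psi by (simp add: u_def)
      moreover have "acost P c e \<le> weight e * u" using acost_at(1)[of j c e] pre by (simp add: u_def)
      ultimately show ?thesis by (simp add: add_mult_distrib flip: u_def)
    qed
    then have "cost c1 \<le> cost c + (1 * (pweight (PIf e p q) * (\<psi> * \<psi>)) + steps (vars c) r * (pweight r * (\<psi> * \<psi>)))"
      using c1(5) by simp
    also have "\<dots> \<le> cost c + (1 * (pweight (PIf e p q) * (\<psi> * \<psi>)) + (?a + ?b) * (pweight (PIf e p q) * (\<psi> * \<psi>)))"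
      using r by (intro add_mono mult_mono) auto
    finally show ?thesis by (simp only: steps.simps add_mult_distrib add.assoc)
  qed
  then show ?case
    using c1 mem_bounded_mono[OF _ c1(4), of "j + steps (vars c) (PIf e p q)"] r
      reach_trans[OF reach_dstep c1(1)]
    by (intro exI[of _ c1]) (auto simp: r_def aval_ev)
next
  case (PSample a v)
  note pre = PSample.prems
  have p1: "1 \<le> b (Suc j)" using b_Suc[of j] by simp
  have nb: "nat_of_bit z \<le> 1" for z by (simp add: nat_of_bit_def)
  have "mem_bounded K Y (b (Suc j)) (mem_of (dstep P \<omega> c))"
    using mem_bounded_mono[OF _ pre(5), of "Suc j"] order.trans[OF nb p1] pre(1)
    by (auto simp: dstep_def pre mem_of_def mem_bounded_def)
  then show ?case
    using pre(7) dim
    by (intro exI[of _ "dstep P \<omega> c"])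
       (auto simp: reach_dstep, auto simp: dstep_def mem_of_def cong: if_cong)
next
  case (PFor v N p)
  note pre = PFor.prems
  let ?W = "While (Less (Var v) (Var N)) (Seq (compile p) (Assign v (Add (Var v) (Num 1))))"
  let ?S = "steps (vars c) p" and ?U = "pweight (PFor v N p) * (\<psi> * \<psi>)"
  have U1: "1 \<le> ?U" using psi by simp
  have c10: "c10 \<le> 20 * (\<psi> * \<psi>) \<Longrightarrow> c10 \<le> ?U" for c10 by (simp add: add_mult_distrib)
  define n where "n = vars c N"
  have len: "acost P d (Less (Var v) (Var N)) + 1 \<le> ?U"
     "acost P d (Add (Var v) (Num 1)) + bits (aval P d (Add (Var v) (Num 1))) + 1 \<le> ?U"
     if "mem_bounded K Y (b i) (mem_of d)" "i \<le> J" for d i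
  proof -
    have p1: "1 \<le> \<psi> * \<psi>" using psi by simp
    show "acost P d (Less (Var v) (Var N)) + 1 \<le> ?U"
      using acost_at(1)[OF that, of "Less (Var v) (Var N)"] p1 by (intro c10) simp
    show "acost P d (Add (Var v) (Num 1)) + bits (aval P d (Add (Var v) (Num 1))) + 1 \<le> ?U"
      using acost_at[OF that, of "Add (Var v) (Num 1)"] p1
      by (intro c10) (simp add: bits_def compute_floorlog)
  qed
  have body: "\<exists>d. reach P \<omega> c d \<and> todo d = ?W # rest \<and> mem_of d = loop (den P \<omega> p) v i (mem_of c)
     \<and> mem_bounded K Y (b (j + 2 + i * (?S + 3))) (mem_of d) \<and> cost d \<le> cost c + (2 + i * (?S + 3)) * ?U"
    if "i \<le> n" for i
    using that
  proof (induction i)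
    case 0
    let ?d = "dstep P \<omega> (dstep P \<omega> c)"
    have todo: "todo (dstep P \<omega> c) = Assign v (Num 0) # ?W # rest" using pre(7) by (simp add: dstep_def)
    have "mem_bounded K Y (b (j + 2)) (mem_of ?d)"
      using mem_bounded_mono[OF _ pre(5), of "j + 2"] pre(1,7)
      by (auto simp: dstep_def todo mem_of_def mem_bounded_def)
    moreover have "cost ?d \<le> cost c + 2 * ?U"
    proof -
      have "cost ?d = cost c + 3" using pre(7) by (simp add: dstep_def bits_def floorlog_def)
      moreover have "2 \<le> ?U" using psi by (intro c10) simp
      ultimately show ?thesis by linarith
    qed
    moreover have "todo ?d = ?W # rest" "mem_of ?d = loop (den P \<omega> p) v 0 (mem_of c)"
      using pre(7) by (simp_all add: dstep_def mem_of_def)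
    ultimately show ?case using reach_trans[OF reach_dstep[of P \<omega> c] reach_dstep] by auto
  next
    case (Suc i)
    then obtain d where d: "reach P \<omega> c d" "todo d = ?W # rest" "mem_of d = loop (den P \<omega> p) v i (mem_of c)"
      "mem_bounded K Y (b (j + 2 + i * (?S + 3))) (mem_of d)" "cost d \<le> cost c + (2 + i * (?S + 3)) * ?U" by auto
    have vK: "vars d w = vars c w" if "w \<in> K" for w
    proof -
      have "mv (mem_of d) w = mv (mem_of c) w" unfolding d(3)
        using that pre(1) well_formed_wv[of K p w] by (intro loop_frame den_frame) auto
      then show ?thesis by (simp add: mem_of_def)
    qed
    have dv: "vars d v = i"
      using loop_var[of "den P \<omega> p" v i "mem_of c"] d(3) by (metis mem.select_convs(1) mem_of_def)
    have dN: "vars d N = n" using vK pre(1) by (simp add: n_def)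
    have st: "steps (vars d) p = ?S" using pre(1) vK by (intro steps_cong) auto
    have jJ: "j + 2 + i * (?S + 3) + (?S + 3) \<le> J"
    proof -
      have "Suc i * (?S + 3) \<le> n * (?S + 3)" using Suc.prems by (intro mult_right_mono) auto
      then show ?thesis using pre(6) by (simp add: n_def)
    qed
    let ?d1 = "dstep P \<omega> d"
    have d1: "todo ?d1 = Seq (compile p) (Assign v (Add (Var v) (Num 1))) # ?W # rest"
      "mem_of ?d1 = mem_of d" "cost ?d1 \<le> cost d + ?U"
      using d(2) dv dN Suc.prems len(1)[OF d(4)] jJ by (auto simp: dstep_def mem_of_def)
    let ?d2 = "dstep P \<omega> ?d1"
    have d2: "todo ?d2 = compile p # Assign v (Add (Var v) (Num 1)) # ?W # rest"
      "mem_of ?d2 = mem_of d"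
      using dstep_Seq[OF d1(1), of P \<omega>] d1(2) by auto
    have d2c: "cost ?d2 \<le> cost d + 2 * ?U"
      using dstep_Seq(3)[OF d1(1), of P \<omega>] d1(3) U1 by linarith
    have vars_d2: "vars ?d2 = vars d" using d2(2) by (simp add: mem_of_def)
    obtain e where e: "reach P \<omega> ?d2 e" "todo e = Assign v (Add (Var v) (Num 1)) # ?W # rest"
      "mem_of e = den P \<omega> p (mem_of d)"
      "mem_bounded K Y (b (j + 2 + i * (?S + 3) + ?S)) (mem_of e)"
      "cost e \<le> cost ?d2 + ?S * (pweight p * (\<psi> * \<psi>))"
      using PFor.IH[of "j + 2 + i * (?S + 3)" ?d2 "Assign v (Add (Var v) (Num 1)) # ?W # rest"]
        pre d2 d(4) jJ by (auto simp: vars_d2 st)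
    have ve: "vars e v = i"
    proof -
      have "mv (mem_of e) v = mv (mem_of d) v" unfolding e(3) using pre(1) by (intro den_frame) auto
      then show ?thesis using dv by (simp add: mem_of_def)
    qed
    let ?f = "dstep P \<omega> e"
    \<comment> \<open>The increment of the counter is the one assignment not covered by
      \<open>grows\<close>; the growth of \<open>b\<close> by 1 per step pays for it.\<close>
    have "i \<le> b (j + 2 + i * (?S + 3) + ?S)"
      using e(4) ve Y_at[of "j + 2 + i * (?S + 3) + ?S"] pre(1) unfolding mem_bounded_def
      by (metis mem.select_convs(1) mem_of_def well_formed.simps(4))
    then have "Suc i \<le> b (Suc (j + 2 + i * (?S + 3) + ?S))"
      using b_Suc[of "j + 2 + i * (?S + 3) + ?S"] by simp
    then have bf: "mem_bounded K Y (b (Suc (j + 2 + i * (?S + 3) + ?S))) (mem_of ?f)"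
      using mem_bounded_mono[OF _ e(4), of "Suc (j + 2 + i * (?S + 3) + ?S)"] pre(1) e(2)
      by (auto simp: dstep_def mem_of_def mem_bounded_def ve)
    have mf: "mem_of ?f = loop (den P \<omega> p) v (Suc i) (mem_of c)"
    proof -
      have "mem_of ?f = (mem_of e)\<lparr>mv := (mv (mem_of e))(v := Suc i)\<rparr>"
        using e(2) ve by (auto simp: dstep_def mem_of_def)
      then show ?thesis by (simp add: Let_def e(3) d(3))
    qed
    have "cost ?f \<le> cost e + ?U"
      using len(2)[OF e(4)] jJ e(2) by (simp add: dstep_def)
    also have "cost e \<le> cost d + 2 * ?U + ?S * ?U"
    proof -
      have "?S * (pweight p * (\<psi> * \<psi>)) \<le> ?S * ?U" by (intro mult_left_mono mult_right_mono) auto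
      then show ?thesis using e(5) d2c by linarith
    qed
    also have "cost d \<le> cost c + (2 + i * (?S + 3)) * ?U" by (rule d(5))
    finally have cf: "cost ?f \<le> cost c + (2 + Suc i * (?S + 3)) * ?U"
      by (simp add: add_mult_distrib algebra_simps)
    have "reach P \<omega> c ?f"
      by (rule reach_trans[OF d(1) reach_trans[OF reach_dstep reach_trans[OF reach_dstep
           reach_trans[OF e(1) reach_dstep]]]])
    then show ?case
      using mem_bounded_mono[OF _ bf, of "j + 2 + Suc i * (?S + 3)"] mf cf e(2)
      by (intro exI[of _ ?f]) (auto simp: dstep_def)
  qed
  obtain d where d: "reach P \<omega> c d" "todo d = ?W # rest" "mem_of d = loop (den P \<omega> p) v n (mem_of c)"
      "mem_bounded K Y (b (j + 2 + n * (?S + 3))) (mem_of d)" "cost d \<le> cost c + (2 + n * (?S + 3)) * ?U"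
    using body[of n] by auto
  let ?e = "dstep P \<omega> d"
  have "vars d N = n"
  proof -
    have "mv (mem_of d) N = mv (mem_of c) N" unfolding d(3)
      using pre(1) well_formed_wv[of K p N] by (intro loop_frame den_frame) auto
    then show ?thesis by (simp add: mem_of_def n_def)
  qed
  moreover have "vars d v = n"
    using loop_var[of "den P \<omega> p" v n "mem_of c"] d(3) by (metis mem.select_convs(1) mem_of_def)
  moreover have "j + 2 + n * (?S + 3) \<le> J" using pre(6) by (simp add: n_def)
  ultimately have "todo ?e = rest" "mem_of ?e = mem_of d" "cost ?e \<le> cost d + ?U"
    using d(2) len(1)[OF d(4)] by (auto simp: dstep_def mem_of_def)
  moreover have "cost ?e \<le> cost c + steps (vars c) (PFor v N p) * ?U"
  proof -
    have "(2 + a) * w + w = (3 + a) * w" for a w :: nat by (simp add: algebra_simps)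
    then have "(2 + n * (?S + 3)) * ?U + ?U = steps (vars c) (PFor v N p) * ?U"
      unfolding steps.simps n_def .
    then show ?thesis using d(5) calculation(3) by linarith
  qed
  ultimately show ?case
    using d(3) mem_bounded_mono[OF _ d(4), of "j + steps (vars c) (PFor v N p)"]
      reach_trans[OF d(1) reach_dstep]
    by (intro exI[of _ ?e]) (auto simp: n_def mem_of_def)
qed
qed

end

section \<open>Parities of random sparse vectors\<close>

text \<open>A subset either avoids all of \<open>c\<close> marked points or contains one of them,
  and the subsets through a given point number \<open>(N - 1) choose j\<close>.\<close>

lemma choose_le_choose_diff:
  "c \<le> N \<Longrightarrow> (N choose Suc j) \<le> ((N - c) choose Suc j) + c * ((N - 1) choose j)"
proof (induction c)
  case (Suc c)
  have "((N - c) choose Suc j) = ((N - Suc c) choose j) + ((N - Suc c) choose Suc j)"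
    using Suc.prems by (subst Suc_diff_Suc[symmetric]) auto
  moreover have "(N - Suc c) choose j \<le> (N - 1) choose j"
    by (rule binomial_right_mono) auto
  ultimately show ?case using Suc by simp
qed simp

lemma choose_pred_real:
  assumes "0 < N" "0 < j"
  shows "real ((N - 1) choose (j - 1)) = real j / real N * real (N choose j)"
proof -
  have "real j * real (N choose j) = real N * real ((N - 1) choose (j - 1))"
    using binomial_absorption[of "j - 1" N] assms by (simp flip: of_nat_mult)
  then show ?thesis using assms by (simp add: field_simps)
qed

text \<open>A union bound: a random \<open>j\<close>-subset of \<open>N\<close> points contains a
  given point with probability \<open>j / N\<close>, hence meets \<open>c\<close> given points with
  probability at most \<open>c * j / N\<close>.\<close>

lemma choose_diff_ge:
  assumes "c \<le> N" "0 < N"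
  shows "real ((N - c) choose j) \<ge> real (N choose j) * (1 - real c * real j / real N)"
proof (cases j)
  case (Suc i)
  have "real (N choose j) \<le> real ((N - c) choose j) + real c * real ((N - 1) choose (j - 1))"
    using choose_le_choose_diff[OF assms(1), of i] Suc
    by (metis diff_Suc_1 of_nat_add of_nat_le_iff of_nat_mult)
  then show ?thesis using choose_pred_real[of N j] assms Suc by (simp add: algebra_simps)
qed simp

definition ksubsets :: "nat set \<Rightarrow> nat \<Rightarrow> nat set set" where
  "ksubsets I k = {A. A \<subseteq> I \<and> card A = k}"

lemma finite_ksubsets [simp]: "finite I \<Longrightarrow> finite (ksubsets I k)"
  unfolding ksubsets_def by simp

lemma card_ksubsets: "finite I \<Longrightarrow> card (ksubsets I k) = card I choose k"
  unfolding ksubsets_def by (rule n_subsets)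

text \<open>Exactly one element of \<open>V1 \<union> U1\<close> is chosen, in the half that makes the parity odd.\<close>

lemma card_odd_ge_swap:
  assumes I: "finite I" and V1: "V1 \<subseteq> V" "V \<subseteq> I" and U1: "U1 \<subseteq> I - V"
    and card: "card V1 = w" "card U1 = w" and k: "0 < k"
  shows "card {A \<in> ksubsets I k. odd (card (A \<inter> V))} \<ge> w * ((card I - 2 * w) choose (k - 1))"
proof -
  define B where "B = V1 \<union> U1"
  define T where "T = ksubsets (I - B) (k - 1)"
  define F where "F A = (if even (card (A \<inter> V)) then V1 else U1)" for A
  have fin: "finite V1" "finite U1" "finite B" "finite V"
    using I V1 U1 by (auto simp: B_def intro: finite_subset)
  have disj: "V1 \<inter> U1 = {}" using V1 U1 by auto
  have cardB: "card B = 2 * w"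
    unfolding B_def using card disj fin by (simp add: card_Un_disjoint)
  have BI: "B \<subseteq> I" using V1 U1 by (auto simp: B_def)
  have finT: "finite T" unfolding T_def using I by simp
  have finF: "finite (F A)" for A using fin by (auto simp: F_def)
  have FB: "F A \<subseteq> B" for A by (auto simp: F_def B_def)
  \<comment> \<open>The base set avoids \<open>B\<close>, so the inserted point is recovered as the
    only point in \<open>B\<close>.\<close>
  have inj: "inj_on (\<lambda>(A, a). insert a A) (Sigma T F)"
  proof (rule inj_onI, clarify)
    fix A a A' a'
    assume h: "A \<in> T" "a \<in> F A" "A' \<in> T" "a' \<in> F A'" "insert a A = insert a' A'"
    have "a \<in> B" "a' \<in> B" "A \<inter> B = {}" "A' \<inter> B = {}"
      using h FB by (auto simp: T_def ksubsets_def)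
    then have "A = insert a A - B" "A' = insert a' A' - B" "{a} = insert a A \<inter> B" "{a'} = insert a' A' \<inter> B"
      by auto
    then show "A = A' \<and> a = a'" unfolding h(5) by auto
  qed
  have "card (Sigma T F) = (\<Sum>A\<in>T. card (F A))" using finT finF by (intro card_SigmaI) auto
  also have "\<dots> = card T * w"
  proof -
    have "card (F A) = w" for A by (simp add: F_def card)
    then show ?thesis by simp
  qed
  also have "card T = (card I - 2 * w) choose (k - 1)"
    unfolding T_def using I BI fin by (simp add: card_ksubsets card_Diff_subset cardB)
  finally have "card ((\<lambda>(A, a). insert a A) ` Sigma T F) = w * ((card I - 2 * w) choose (k - 1))"
    by (simp add: card_image[OF inj])
  moreover have "(\<lambda>(A, a). insert a A) ` Sigma T F \<subseteq> {A \<in> ksubsets I k. odd (card (A \<inter> V))}"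
  proof (clarify)
    fix A a assume h: "A \<in> T" "a \<in> F A"
    have A: "A \<subseteq> I - B" "card A = k - 1" "finite A"
      using h I by (auto simp: T_def ksubsets_def intro: finite_subset)
    have aB: "a \<in> B" "a \<notin> A" using h FB A by auto
    have "card (insert a A) = k" using A aB k by simp
    moreover have "insert a A \<subseteq> I" using A aB BI by auto
    moreover have "odd (card (insert a A \<inter> V))"
    proof (cases "even (card (A \<inter> V))")
      case True
      then have "a \<in> V" using h V1 by (auto simp: F_def)
      then have "insert a A \<inter> V = insert a (A \<inter> V)" by auto
      then show ?thesis using True aB A by simp
    next
      case False
      then have "a \<notin> V" using h U1 by (auto simp: F_def)
      then have "insert a A \<inter> V = A \<inter> V" by auto
      then show ?thesis using False by simp
    qed
    ultimately show "insert a A \<in> ksubsets I k \<and> odd (card (insert a A \<inter> V))"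
      by (simp add: ksubsets_def)
  qed
  ultimately show ?thesis using I
    by (metis (no_types, lifting) card_mono finite_ksubsets finite_subset mem_Collect_eq subsetI)
qed

text \<open>By \<open>card_odd_ge_swap\<close> there are
  \<open>w * ((Q - 2 * w) choose (k - 1))\<close> sets of odd parity. The condition
  \<open>4 * w * k \<le> Q\<close> keeps at least half of \<open>(Q - 1) choose (k - 1)\<close>,
  which is the fraction \<open>k / Q\<close> of all \<open>k\<close>-subsets.\<close>

lemma card_odd_ge_pivot:
  assumes I: "finite I" and V: "V \<subseteq> I" and w: "w \<le> card V" "w \<le> card (I - V)"
    and k: "0 < k" and small: "4 * w * k \<le> card I" and pos: "0 < card I"
  shows "real (card {A \<in> ksubsets I k. odd (card (A \<inter> V))})
           \<ge> real w * real k / (2 * real (card I)) * real (card I choose k)"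
proof -
  obtain V1 where V1: "V1 \<subseteq> V" "card V1 = w" using w(1) by (meson obtain_subset_with_card_n)
  obtain U1 where U1: "U1 \<subseteq> I - V" "card U1 = w" using w(2) by (meson obtain_subset_with_card_n)
  let ?Q = "card I"
  have w2: "2 * w \<le> ?Q"
  proof -
    have "4 * w * 1 \<le> 4 * w * k" using k by (intro mult_left_mono) auto
    then show ?thesis using small by linarith
  qed
  show ?thesis
  proof (cases "w = 0")
    case False
    \<comment> \<open>Removing \<open>2 * w - 1\<close> points from \<open>Q - 1\<close>, rather
      than \<open>2 * w\<close> points from \<open>Q\<close>, gives the comparison with
      \<open>(Q - 1) choose (k - 1)\<close> directly.\<close>
    have "real ((?Q - 2 * w) choose (k - 1))
        = real (((?Q - 1) - (2 * w - 1)) choose (k - 1))" using False by simp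
    also have "\<dots> \<ge> real ((?Q - 1) choose (k - 1)) * (1 - real (2 * w - 1) * real (k - 1) / real (?Q - 1))"
      using w2 False by (intro choose_diff_ge) auto
    finally have 1: "real ((?Q - 2 * w) choose (k - 1))
        \<ge> real ((?Q - 1) choose (k - 1)) * (1 - real (2 * w - 1) * real (k - 1) / real (?Q - 1))" .
    have "real (2 * w - 1) * real (k - 1) / real (?Q - 1) \<le> 1 / 2"
    proof -
      have "2 * ((2 * w - 1) * (k - 1)) \<le> ?Q - 1"
      proof -
        have "2 * ((2 * w - 1) * (k - 1)) + 1 \<le> 4 * w * k"
        proof -
          obtain w' k' where "w = Suc w'" "k = Suc k'" using False k by (metis not0_implies_Suc not_gr_zero)
          then show ?thesis by (simp add: algebra_simps)
        qed
        then show ?thesis using small by linarith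
      qed
      then have "2 * (real (2 * w - 1) * real (k - 1)) \<le> real (?Q - 1)"
        by (metis of_nat_le_iff of_nat_mult of_nat_numeral)
      moreover have "real (?Q - 1) > 0" using w2 False by simp
      ultimately show ?thesis by (simp add: field_simps)
    qed
    then have "real ((?Q - 1) choose (k - 1)) * (1 / 2)
        \<le> real ((?Q - 1) choose (k - 1)) * (1 - real (2 * w - 1) * real (k - 1) / real (?Q - 1))"
      by (intro mult_left_mono) auto
    then have "real ((?Q - 1) choose (k - 1)) * (1 / 2) \<le> real ((?Q - 2 * w) choose (k - 1))"
      using 1 by (rule order.trans)
    then have "real ((?Q - 2 * w) choose (k - 1)) \<ge> real ((?Q - 1) choose (k - 1)) / 2" by simp
    also have "real ((?Q - 1) choose (k - 1)) = real k / real ?Q * real (?Q choose k)"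
      using pos k by (rule choose_pred_real)
    finally have "real w * (real k / real ?Q * real (?Q choose k) / 2)
        \<le> real w * real ((?Q - 2 * w) choose (k - 1))" by (intro mult_left_mono) auto
    also have "\<dots> \<le> real (card {A \<in> ksubsets I k. odd (card (A \<inter> V))})"
      using card_odd_ge_swap[OF I V1(1) V U1(1) V1(2) U1(2) k]
      by (simp only: of_nat_le_iff flip: of_nat_mult)
    finally show ?thesis by (simp add: field_simps)
  qed simp
qed

text \<open>The pivot argument needs \<open>w\<close> points both in \<open>V\<close> and outside
  it. It is used with \<open>w = card V\<close> if \<open>V\<close> is small, and otherwise with the
  largest admissible \<open>w\<close>. If the complement is too small even for that, most
  \<open>k\<close>-subsets lie inside \<open>V\<close>, and these are odd because \<open>k\<close>
  is.\<close>

lemma card_odd_ge: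
  assumes I: "finite I" and V: "V \<subseteq> I" "V \<noteq> {}" and k: "odd k" "4 * k \<le> card I"
  shows "real (card {A \<in> ksubsets I k. odd (card (A \<inter> V))})
     \<ge> min (1 / 16) (real (card V) * real k / (2 * real (card I))) * real (card I choose k)"
proof -
  let ?Q = "card I" and ?w = "card V"
  have k0: "0 < k" using k(1) by (cases k) auto
  have Q0: "0 < ?Q" using k k0 by linarith
  have finV: "finite V" using V I finite_subset by blast
  have w1: "1 \<le> ?w" using V finV by (simp add: Suc_leI card_gt_0_iff)
  have cU: "card (I - V) = ?Q - ?w" using V finV by (simp add: card_Diff_subset)
  have wQ: "?w \<le> ?Q" using V I by (simp add: card_mono)
  \<comment> \<open>The largest \<open>w\<close> allowed in the pivot argument. As \<open>c\<close>
    is at least 1, rounding loses at most a factor 2, so the fraction \<open>c * k / (2 * Q)\<close>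
    is still at least \<open>1 / 16\<close>.\<close>
  define c where "c = ?Q div (4 * k)"
  have c1: "1 \<le> c" unfolding c_def using k k0 by (simp add: Suc_leI div_greater_zero_iff)
  have c4: "4 * c * k \<le> ?Q" unfolding c_def
    by (metis div_times_less_eq_dividend mult.assoc mult.commute)
  have "?Q < 4 * k * (c + 1)" unfolding c_def using k0
    by (metis add.commute dividend_less_times_div mult_pos_pos plus_1_eq_Suc zero_less_numeral mult_Suc_right)
  also have "\<dots> \<le> 4 * k * (2 * c)" using c1 by (intro mult_left_mono) auto
  finally have c8: "?Q \<le> 8 * c * k" by (simp add: algebra_simps)
  have cc: "1 / 16 \<le> real c * real k / (2 * real ?Q)"
  proof -
    have "real ?Q \<le> 8 * real c * real k" using c8 by (metis of_nat_le_iff of_nat_mult of_nat_numeral)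
    then show ?thesis using Q0 by (simp add: field_simps)
  qed
  have by_pivot: ?thesis
    if "x \<le> ?w" "x \<le> ?Q - ?w" "4 * x * k \<le> ?Q" "x = c \<or> x = ?w" for x
  proof -
    have "min (1 / 16) (real ?w * real k / (2 * real ?Q)) \<le> real x * real k / (2 * real ?Q)"
      using cc that(4) by auto
    then have "min (1 / 16) (real ?w * real k / (2 * real ?Q)) * real (?Q choose k)
        \<le> real x * real k / (2 * real ?Q) * real (?Q choose k)"
      by (intro mult_right_mono) auto
    also have "\<dots> \<le> real (card {A \<in> ksubsets I k. odd (card (A \<inter> V))})"
      using that by (intro card_odd_ge_pivot[OF I V(1) _ _ k0 _ Q0]) (auto simp: cU)
    finally show ?thesis .
  qed
  have wk: "x \<le> c \<Longrightarrow> 4 * x * k \<le> ?Q" for x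
    using c4 by (meson le_trans mult_le_mono order_refl)
  show ?thesis
  proof (cases "2 * ?w \<le> ?Q")
    case True
    show ?thesis
    proof (cases "?w \<le> c")
      case w: True
      show ?thesis using True wQ wk[OF w] by (intro by_pivot[of ?w]) auto
    next
      case w: False
      show ?thesis using True w c4 by (intro by_pivot[of c]) auto
    qed
  next
    case False
    show ?thesis
    proof (cases "c \<le> ?Q - ?w")
      case True
      then show ?thesis using by_pivot[of c] False c4 by auto
    next
      case small: False
      let ?u = "?Q - ?w"
      \<comment> \<open>The place where \<open>k\<close> must be odd: a \<open>k\<close>-subset of
        \<open>V\<close> meets \<open>V\<close> in \<open>k\<close> points.\<close>
      have "ksubsets V k \<subseteq> {A \<in> ksubsets I k. odd (card (A \<inter> V))}"
        using V(1) k(1) by (auto simp: ksubsets_def Int_absorb2)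
      then have "card (ksubsets V k) \<le> card {A \<in> ksubsets I k. odd (card (A \<inter> V))}"
        using I by (intro card_mono) auto
      moreover have "real (card (ksubsets V k)) \<ge> real (?Q choose k) * (1 - real ?u * real k / real ?Q)"
      proof -
        have "?Q - ?u = ?w" using wQ by simp
        then show ?thesis using choose_diff_ge[of ?u ?Q k] Q0 finV by (simp add: card_ksubsets)
      qed
      moreover have "1 - real ?u * real k / real ?Q \<ge> 1 / 16"
      proof -
        have "4 * ?u * k \<le> ?Q" using wk[of ?u] small by simp
        then have "4 * real ?u * real k \<le> real ?Q" by (metis of_nat_le_iff of_nat_mult of_nat_numeral)
        then show ?thesis using Q0 by (simp add: field_simps)
      qed
      then have "real (?Q choose k) * (1 - real ?u * real k / real ?Q) \<ge> real (?Q choose k) * (1/16)"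
        by (intro mult_left_mono) auto
      moreover have "real (?Q choose k) * (1/16)
        \<ge> min (1 / 16) (real ?w * real k / (2 * real ?Q)) * real (?Q choose k)"
        by (subst mult.commute, intro mult_right_mono) auto
      ultimately show ?thesis by linarith
    qed
  qed
qed

section \<open>Concentration over the samples in a window\<close>

text \<open>All the weights on single samples below have this form: one value outside an event for
  the support, and two values inside it according to the noise bit.\<close>

lemma expectation_noise_case:
  fixes a b c \<eta> :: real and M :: "'a pmf"
  assumes \<eta>: "0 \<le> \<eta>" "\<eta> \<le> 1" and X: "countable X"
  shows "measure_pmf.expectation (pair_pmf M (bernoulli_pmf \<eta>))
           (\<lambda>z. if fst z \<in> X then (if snd z then a else b) else c)
       = (let q = measure_pmf.prob M X in q * (\<eta> * a + (1 - \<eta>) * b) + (1 - q) * c)"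
proof -
  let ?N = "pair_pmf M (bernoulli_pmf \<eta>)"
  have eq: "(\<lambda>z. if fst z \<in> X then (if snd z then a else b) else c)
     = (\<lambda>z. c + (a - c) * indicator (X \<times> {True}) z + (b - c) * indicator (X \<times> {False}) z)"
    by (auto simp: fun_eq_iff indicator_def)
  have p: "measure_pmf.prob ?N (X \<times> {True}) = measure_pmf.prob M X * \<eta>"
    "measure_pmf.prob ?N (X \<times> {False}) = measure_pmf.prob M X * (1 - \<eta>)"
    using \<eta> X by (simp_all add: measure_pmf_prob_product measure_pmf_single)
  have "measure_pmf.expectation ?N (\<lambda>z. if fst z \<in> X then (if snd z then a else b) else c)
    = c + (a - c) * measure_pmf.prob ?N (X \<times> {True}) + (b - c) * measure_pmf.prob ?N (X \<times> {False})"
  proof -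
    have int: "integrable (measure_pmf ?N) (indicator S :: _ \<Rightarrow> real)" for S
      by (rule measure_pmf.integrable_const_bound[where B = 1]) auto
    show ?thesis unfolding eq using int[of "X \<times> {True}"] int[of "X \<times> {False}"] by simp
  qed
  then show ?thesis unfolding p Let_def by (simp add: algebra_simps)
qed

text \<open>Markov's inequality, to be used with \<open>f\<close> a product of weights that is at
  least 1 on the bad event.\<close>

lemma prob_le_expectation:
  fixes f :: "'a \<Rightarrow> real"
  assumes fin: "finite (set_pmf M)" and "\<And>x. x \<in> set_pmf M \<Longrightarrow> 0 \<le> f x"
    and "\<And>x. x \<in> set_pmf M \<Longrightarrow> x \<in> E \<Longrightarrow> 1 \<le> f x"
  shows "measure_pmf.prob M E \<le> measure_pmf.expectation M f"
proof -
  have "measure_pmf.prob M E = measure_pmf.expectation M (indicator E)" by simp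
  also have "\<dots> \<le> measure_pmf.expectation M f"
    using assms by (intro integral_mono_AE integrable_measure_pmf_finite)
      (auto simp: AE_measure_pmf_iff indicator_def)
  finally show ?thesis .
qed

lemma finite_set_Pi_pmf:
  assumes "finite A" "finite (set_pmf D)"
  shows "finite (set_pmf (Pi_pmf A d (\<lambda>_. D)))"
  using assms by (auto simp: set_Pi_pmf)

lemma expectation_prod_iid:
  fixes f :: "'a \<Rightarrow> real"
  assumes "finite A" "finite (set_pmf D)" "\<And>x. 0 \<le> f x"
  shows "measure_pmf.expectation (Pi_pmf A d (\<lambda>_. D)) (\<lambda>\<omega>. \<Prod>i\<in>A. f (\<omega> i))
       = measure_pmf.expectation D f ^ card A"
  using assms by (subst expectation_prod_Pi_pmf) (auto intro: integrable_measure_pmf_finite)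

text \<open>The weight of a block is not a product over its samples, only a linear combination of
  such products. Expanding over all choices \<open>\<tau>\<close> of one term per block gives true
  products over independent samples, and the sum is then folded up again.\<close>

lemma expectation_prod_blocks:
  fixes \<kappa> :: "'t \<Rightarrow> real" and \<Phi> :: "'t \<Rightarrow> 'a \<Rightarrow> real"
  assumes D: "finite (set_pmf D)" and T: "finite T" and \<Phi>: "\<And>t x. 0 \<le> \<Phi> t x"
  shows "measure_pmf.expectation (Pi_pmf {..<r * B} d (\<lambda>_. D))
      (\<lambda>\<omega>. \<Prod>g<r. \<Sum>t\<in>T. \<kappa> t * (\<Prod>i\<in>{g * B..<g * B + B}. \<Phi> t (\<omega> i)))
    = (\<Sum>t\<in>T. \<kappa> t * measure_pmf.expectation D (\<Phi> t) ^ B) ^ r"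
proof -
  let ?P = "Pi_pmf {..<r * B} d (\<lambda>_. D)"
  have blk: "i div B = g" if "i \<in> {g * B..<g * B + B}" for i g
    using that by (intro div_nat_eqI) (auto simp: algebra_simps)
  have group: "(\<Prod>g<r. \<Prod>i\<in>{g * B..<g * B + B}. F (\<tau> g) i) = (\<Prod>i<r * B. F (\<tau> (i div B)) i)"
    for F :: "'t \<Rightarrow> nat \<Rightarrow> real" and \<tau>
  proof -
    have "(\<Prod>g<r. \<Prod>i\<in>{g * B..<g * B + B}. F (\<tau> g) i)
      = (\<Prod>g<r. \<Prod>i\<in>{g * B..<g * B + B}. F (\<tau> (i div B)) i)"
      by (intro prod.cong refl) (simp add: blk)
    also have "\<dots> = (\<Prod>i<r * B. F (\<tau> (i div B)) i)"
      using prod.nat_group[of "\<lambda>i. F (\<tau> (i div B)) i" B r] .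
    finally show ?thesis .
  qed
  have "measure_pmf.expectation ?P
      (\<lambda>\<omega>. \<Prod>g<r. \<Sum>t\<in>T. \<kappa> t * (\<Prod>i\<in>{g * B..<g * B + B}. \<Phi> t (\<omega> i)))
    = measure_pmf.expectation ?P (\<lambda>\<omega>. \<Sum>\<tau>\<in>{..<r} \<rightarrow>\<^sub>E T.
         (\<Prod>g<r. \<kappa> (\<tau> g)) * (\<Prod>i<r * B. \<Phi> (\<tau> (i div B)) (\<omega> i)))"
  proof (intro arg_cong[where f = "measure_pmf.expectation ?P"] ext)
    fix \<omega> :: "nat \<Rightarrow> 'a"
    have "(\<Prod>g<r. \<Sum>t\<in>T. \<kappa> t * (\<Prod>i\<in>{g * B..<g * B + B}. \<Phi> t (\<omega> i)))
       = (\<Sum>\<tau>\<in>{..<r} \<rightarrow>\<^sub>E T. \<Prod>g<r. \<kappa> (\<tau> g) * (\<Prod>i\<in>{g * B..<g * B + B}. \<Phi> (\<tau> g) (\<omega> i)))"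
      using T by (subst prod_sum_PiE) auto
    then show "(\<Prod>g<r. \<Sum>t\<in>T. \<kappa> t * (\<Prod>i\<in>{g * B..<g * B + B}. \<Phi> t (\<omega> i)))
       = (\<Sum>\<tau>\<in>{..<r} \<rightarrow>\<^sub>E T. (\<Prod>g<r. \<kappa> (\<tau> g)) * (\<Prod>i<r * B. \<Phi> (\<tau> (i div B)) (\<omega> i)))"
      by (simp add: prod.distrib group[of "\<lambda>t i. \<Phi> t (\<omega> i)"])
  qed
  also have "\<dots> = (\<Sum>\<tau>\<in>{..<r} \<rightarrow>\<^sub>E T. (\<Prod>g<r. \<kappa> (\<tau> g)) *
       measure_pmf.expectation ?P (\<lambda>\<omega>. \<Prod>i<r * B. \<Phi> (\<tau> (i div B)) (\<omega> i)))"
    by (subst Bochner_Integration.integral_sum)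
       (auto intro!: integrable_measure_pmf_finite finite_set_Pi_pmf D)
  also have "\<dots> = (\<Sum>\<tau>\<in>{..<r} \<rightarrow>\<^sub>E T. (\<Prod>g<r. \<kappa> (\<tau> g)) *
       (\<Prod>i<r * B. measure_pmf.expectation D (\<Phi> (\<tau> (i div B)))))"
    by (subst expectation_prod_Pi_pmf) (auto intro!: integrable_measure_pmf_finite D \<Phi>)
  also have "\<dots> = (\<Sum>\<tau>\<in>{..<r} \<rightarrow>\<^sub>E T. \<Prod>g<r. \<kappa> (\<tau> g) * measure_pmf.expectation D (\<Phi> (\<tau> g)) ^ B)"
  proof (intro sum.cong refl)
    fix \<tau> :: "nat \<Rightarrow> 't"
    show "(\<Prod>g<r. \<kappa> (\<tau> g)) * (\<Prod>i<r * B. measure_pmf.expectation D (\<Phi> (\<tau> (i div B))))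
       = (\<Prod>g<r. \<kappa> (\<tau> g) * measure_pmf.expectation D (\<Phi> (\<tau> g)) ^ B)"
      unfolding group[of "\<lambda>t i. measure_pmf.expectation D (\<Phi> t)", symmetric]
      by (simp add: prod.distrib)
  qed
  also have "\<dots> = (\<Prod>g<r. \<Sum>t\<in>T. \<kappa> t * measure_pmf.expectation D (\<Phi> t) ^ B)"
    using T by (subst prod_sum_PiE) auto
  finally show ?thesis by simp
qed

section \<open>Good windows and the bad events\<close>

definition dec_sample :: "nat \<Rightarrow> nat \<Rightarrow> real \<Rightarrow> (nat set \<times> bool) pmf" where
  "dec_sample n k \<eta> = pair_pmf (pmf_of_set (ksubsets {..<n} k)) (bernoulli_pmf \<eta>)"

definition clean_block :: "nat set \<Rightarrow> nat \<Rightarrow> (nat \<Rightarrow> nat set \<times> bool) \<Rightarrow> nat \<Rightarrow> bool" where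
  "clean_block I B \<omega> g \<longleftrightarrow> (\<forall>i\<in>{g * B..<g * B + B}. fst (\<omega> i) \<subseteq> I \<longrightarrow> \<not> snd (\<omega> i))"

text \<open>\<open>V\<close> stands for the positions where a candidate differs from the hidden
  vector. On a window sample of odd parity with \<open>V\<close> the hidden vector errs iff the
  sample is noisy, and the candidate iff it is noiseless; on the other samples they err together. So
  the inequality says that the candidate loses, and the existence statement that the clean blocks
  give a system of full rank.\<close>

definition good_window ::
  "nat set \<Rightarrow> nat \<Rightarrow> nat \<Rightarrow> nat \<Rightarrow> (nat \<Rightarrow> nat set \<times> bool) \<Rightarrow> bool" where
  "good_window I r B cap \<omega> \<longleftrightarrow>
     card {i. i < r * B \<and> fst (\<omega> i) \<subseteq> I} \<le> cap \<and>
     (\<forall>V. V \<subseteq> I \<longrightarrow> V \<noteq> {} \<longrightarrow>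
        card {i. i < r * B \<and> fst (\<omega> i) \<subseteq> I \<and> odd (card (fst (\<omega> i) \<inter> V)) \<and> snd (\<omega> i)}
          < card {i. i < r * B \<and> fst (\<omega> i) \<subseteq> I \<and> odd (card (fst (\<omega> i) \<inter> V)) \<and> \<not> snd (\<omega> i)} \<and>
        (\<exists>i < r * B. fst (\<omega> i) \<subseteq> I \<and> odd (card (fst (\<omega> i) \<inter> V)) \<and> clean_block I B \<omega> (i div B)))"

text \<open>\<open>dirty\<close> says that a block is expected to contain at most
  \<open>3 / 4\<close> noisy samples of the window, and \<open>r'\<close> is the number of clean
  blocks wanted among \<open>8 * r'\<close>.\<close>

locale window =
  fixes n k Q r' B :: nat and \<eta> p :: real and I :: "nat set"
  assumes I: "I \<subseteq> {..<n}" "card I = Q"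
    and k: "odd k" "4 * k \<le> Q"
    and \<eta>: "0 \<le> \<eta>" "\<eta> < 1 / 2"
    and B: "0 < B" and r': "0 < r'"
    and p_def: "p = real (Q choose k) / real (n choose k)"
    and dirty: "p * \<eta> * real B \<le> 3 / 4"
begin

abbreviation "r \<equiv> 8 * r'"
abbreviation "m \<equiv> r * B"
abbreviation "D \<equiv> dec_sample n k \<eta>"
abbreviation "PP \<equiv> Pi_pmf {..<m} ({}, False) (\<lambda>_. D)"

definition oddp :: "nat set \<Rightarrow> real" where
  "oddp V = measure_pmf.prob (pmf_of_set (ksubsets {..<n} k)) {A. A \<subseteq> I \<and> odd (card (A \<inter> V))}"

lemma finI: "finite I" using I finite_subset by blast

lemma Qn: "Q \<le> n" using I card_mono[of "{..<n}" I] by simp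

lemma kn: "k \<le> n" using k Qn by simp

lemma nonempty: "ksubsets {..<n} k \<noteq> {}"
  using card_ksubsets[of "{..<n}" k] kn zero_less_binomial[of k n] by force

lemma finD: "finite (set_pmf D)"
  unfolding dec_sample_def using nonempty by (auto simp: set_pmf_of_set)

lemma finPP: "finite (set_pmf PP)"
  by (intro finite_set_Pi_pmf finD) simp

lemma prob_ksubsets: "measure_pmf.prob (pmf_of_set (ksubsets {..<n} k)) X
    = real (card {A \<in> ksubsets {..<n} k. A \<in> X}) / real (n choose k)"
  using nonempty by (simp add: measure_pmf_of_set card_ksubsets Int_def)

lemma prob_hit: "measure_pmf.prob (pmf_of_set (ksubsets {..<n} k)) {A. A \<subseteq> I} = p"
proof -
  have "{A \<in> ksubsets {..<n} k. A \<in> {A. A \<subseteq> I}} = ksubsets I k"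
    using I by (auto simp: ksubsets_def)
  then show ?thesis by (simp add: prob_ksubsets p_def card_ksubsets finI I)
qed

lemma p01: "0 \<le> p" "p \<le> 1"
  unfolding prob_hit[symmetric] by auto

lemma oddp_le: "0 \<le> oddp V" "oddp V \<le> p"
  unfolding oddp_def prob_hit[symmetric] by (auto intro!: measure_pmf.finite_measure_mono)

lemma oddp_ge:
  assumes "V \<subseteq> I" "V \<noteq> {}"
  shows "oddp V \<ge> p * min (1 / 16) (real (card V) * real k / (2 * real Q))"
proof -
  have "{A \<in> ksubsets {..<n} k. A \<in> {A. A \<subseteq> I \<and> odd (card (A \<inter> V))}}
      = {A \<in> ksubsets I k. odd (card (A \<inter> V))}"
    using I by (auto simp: ksubsets_def)
  then have "oddp V = real (card {A \<in> ksubsets I k. odd (card (A \<inter> V))}) / real (n choose k)"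
    by (simp add: oddp_def prob_ksubsets)
  moreover have "min (1 / 16) (real (card V) * real k / (2 * real Q)) * real (Q choose k)
      \<le> real (card {A \<in> ksubsets I k. odd (card (A \<inter> V))})"
    using card_odd_ge[OF finI assms k(1)] k I by simp
  ultimately have "min (1 / 16) (real (card V) * real k / (2 * real Q)) * real (Q choose k) / real (n choose k)
      \<le> oddp V"
    by (simp only:) (rule divide_right_mono, auto)
  also have "min (1 / 16) (real (card V) * real k / (2 * real Q)) * real (Q choose k) / real (n choose k)
     = p * min (1 / 16) (real (card V) * real k / (2 * real Q))"
    by (simp add: p_def)
  finally show ?thesis .
qed

lemma expectation_D:
  assumes "countable X"
  shows "measure_pmf.expectation D (\<lambda>z. if fst z \<in> X then (if snd z then a else b) else c)
   = (let q = measure_pmf.prob (pmf_of_set (ksubsets {..<n} k)) X in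
       q * (\<eta> * a + (1 - \<eta>) * b) + (1 - q) * c)"
  unfolding dec_sample_def using \<eta> assms by (intro expectation_noise_case) auto

text \<open>Weight 2 for every window sample: the mean weight of one sample is \<open>1 + p\<close>,
  which is at most \<open>exp p\<close>.\<close>

lemma prob_overflow:
  "measure_pmf.prob PP {\<omega>. card {i. i < m \<and> fst (\<omega> i) \<subseteq> I} > cap} \<le> exp (real m * p) / 2 ^ cap"
proof -
  let ?f = "\<lambda>z :: nat set \<times> bool. if fst z \<in> {A. A \<subseteq> I} then (if snd z then 2 else 2) else (1 :: real)"
  have prod: "(\<Prod>i<m. ?f (\<omega> i)) = 2 ^ card {i. i < m \<and> fst (\<omega> i) \<subseteq> I}" for \<omega>
  proof -
    have "(\<Prod>i<m. ?f (\<omega> i)) = (\<Prod>i\<in>{i \<in> {..<m}. fst (\<omega> i) \<subseteq> I}. 2)"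
      by (subst prod.inter_filter) (auto intro!: prod.cong)
    then show ?thesis by simp
  qed
  have cI: "countable {A. A \<subseteq> I}" by (rule countable_finite) (simp add: finI)
  have "measure_pmf.prob PP {\<omega>. card {i. i < m \<and> fst (\<omega> i) \<subseteq> I} > cap}
      \<le> measure_pmf.expectation PP (\<lambda>\<omega>. (\<Prod>i<m. ?f (\<omega> i)) / 2 ^ cap)"
    unfolding prod by (intro prob_le_expectation finPP) (auto simp: power_increasing field_simps)
  also have "\<dots> = (1 + p) ^ m / 2 ^ cap"
    using expectation_prod_iid[where A = "{..<m}" and D = D and d = "({}, False)" and f = ?f] expectation_D[OF cI, of 2 2 1]
    by (simp add: finD prob_hit finI Let_def algebra_simps)
  also have "\<dots> \<le> exp p ^ m / 2 ^ cap"
    using p01 by (intro divide_right_mono power_mono) auto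
  finally show ?thesis by (simp only: exp_of_nat_mult)
qed

text \<open>With \<open>\<eta> = (1 - \<gamma>) / 2\<close> the left side is the mean weight in
  \<open>prob_confused\<close> of a sample of odd parity. The tilt \<open>1 - \<gamma> / 2\<close>
  replaces the optimal one, the square root of \<open>\<eta> / (1 - \<eta>)\<close>: it still gains
  order \<open>\<gamma>\<close> squared, and it stays at least \<open>1 / 2\<close> when there is no
  noise, where the optimal one vanishes.\<close>

lemma tilted_factor:
  assumes "0 < \<gamma>" "\<gamma> \<le> 1"
  shows "(1 - \<gamma>) / 2 * (1 / (1 - \<gamma> / 2)) + (1 + \<gamma>) / 2 * (1 - \<gamma> / 2) \<le> 1 - \<gamma>\<^sup>2 / (16 :: real)"
proof -
  have "1 - \<gamma>\<^sup>2 / 16 - ((1 - \<gamma>) / 2 * (1 / (1 - \<gamma> / 2)) + (1 + \<gamma>) / 2 * (1 - \<gamma> / 2))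
     = \<gamma>\<^sup>2 * (10 - 3 * \<gamma>) / (16 * (2 - \<gamma>))"
    using assms by (simp add: field_simps power2_eq_square)
  moreover have "0 \<le> \<gamma>\<^sup>2 * (10 - 3 * \<gamma>) / (16 * (2 - \<gamma>))"
    using assms by (intro divide_nonneg_nonneg mult_nonneg_nonneg) auto
  ultimately show ?thesis by linarith
qed


text \<open>The left side is the probability that a block is clean; Bernoulli's inequality turns
  \<open>dirty\<close> into a lower bound for it.\<close>

lemma clean_bound: "(1 - p * \<eta>) ^ B \<ge> 1 / 4"
proof -
  have "p * \<eta> \<le> 1" using p01 \<eta> by (intro mult_le_one) auto
  then have "1 + real B * (- (p * \<eta>)) \<le> (1 + - (p * \<eta>)) ^ B"
    by (intro Bernoulli_inequality) simp
  then show ?thesis using dirty by (simp add: algebra_simps)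
qed

lemma expectation_clean:
  "measure_pmf.expectation D (\<lambda>z. if fst z \<in> {A. A \<subseteq> I} then (if snd z then 0 else 1) else 1) = 1 - p * \<eta>"
  by (subst expectation_D) (auto simp: finI prob_hit Let_def algebra_simps intro: countable_finite)

lemma prod_clean:
  "(\<Prod>i\<in>{g * B..<g * B + B}. if fst (\<omega> i) \<in> {A. A \<subseteq> I} then (if snd (\<omega> i) then 0 else 1) else 1)
     = (of_bool (clean_block I B \<omega> g) :: real)"
  by (auto simp: clean_block_def prod_zero_iff intro!: prod.neutral split: if_splits)

text \<open>With weight \<open>1 / 4\<close> for a clean block and 1 for any other, the mean weight
  of a block is at most \<open>1 - 3 / 4 * (1 / 4) = 13 / 16\<close>. The ratio 8 between
  \<open>r\<close> and \<open>r'\<close> makes \<open>4 * (13 / 16) ^ 8\<close> less than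
  \<open>4 / 5\<close>.\<close>

lemma prob_few_clean:
  "measure_pmf.prob PP {\<omega>. card {g. g < r \<and> clean_block I B \<omega> g} < r'} \<le> (4 / 5) ^ r'"
proof -
  \<comment> \<open>The block weight is written as 1 minus \<open>3 / 4\<close> times the indicator
    of a clean block: two terms, each a product over the samples of the block.\<close>
  let ?\<kappa> = "\<lambda>t :: bool. if t then 1 else - 3 / 4 :: real"
  let ?\<Phi> = "\<lambda>t (z :: nat set \<times> bool). if t then 1
     else if fst z \<in> {A. A \<subseteq> I} then (if snd z then 0 else 1) else (1 :: real)"
  let ?F = "\<lambda>\<omega>. \<Prod>g<r. \<Sum>t\<in>UNIV. ?\<kappa> t * (\<Prod>i\<in>{g * B..<g * B + B}. ?\<Phi> t (\<omega> i))"
  have inner: "(\<Sum>t\<in>UNIV. ?\<kappa> t * (\<Prod>i\<in>{g * B..<g * B + B}. ?\<Phi> t (\<omega> i)))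
      = (if clean_block I B \<omega> g then 1 / 4 else 1)" for g and \<omega> :: "nat \<Rightarrow> nat set \<times> bool"
    using prod_clean[of \<omega> g] by (simp add: UNIV_bool)
  have F: "?F \<omega> = (1 / 4) ^ card {g. g < r \<and> clean_block I B \<omega> g}" for \<omega> :: "nat \<Rightarrow> nat set \<times> bool"
  proof -
    have "?F \<omega> = (\<Prod>g\<in>{g \<in> {..<r}. clean_block I B \<omega> g}. 1 / 4)"
      unfolding inner by (subst prod.inter_filter) auto
    then show ?thesis by simp
  qed
  have "measure_pmf.prob PP {\<omega>. card {g. g < r \<and> clean_block I B \<omega> g} < r'}
      \<le> measure_pmf.expectation PP (\<lambda>\<omega>. 4 ^ r' * ?F \<omega>)"
  proof (intro prob_le_expectation finPP)
    fix \<omega> assume "\<omega> \<in> {\<omega>. card {g. g < r \<and> clean_block I B \<omega> g} < r'}"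
    then have "(1 / 4 :: real) ^ r' \<le> (1 / 4) ^ card {g. g < r \<and> clean_block I B \<omega> g}"
      by (intro power_decreasing) auto
    then show "1 \<le> 4 ^ r' * ?F \<omega>"
      unfolding F by (simp add: power_divide field_simps)
  qed (simp only: F, simp)
  also have "\<dots> = 4 ^ r' * (\<Sum>t\<in>UNIV. ?\<kappa> t * measure_pmf.expectation D (?\<Phi> t) ^ B) ^ r"
    using expectation_prod_blocks[where D = D and T = UNIV and \<Phi> = ?\<Phi> and d = "({}, False)" and \<kappa> = ?\<kappa>] finD by simp
  also have "(\<Sum>t\<in>UNIV. ?\<kappa> t * measure_pmf.expectation D (?\<Phi> t) ^ B) = 1 - 3 / 4 * (1 - p * \<eta>) ^ B"
    using expectation_clean by (simp add: UNIV_bool)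
  also have "4 ^ r' * (1 - 3 / 4 * (1 - p * \<eta>) ^ B) ^ r \<le> 4 ^ r' * (13 / 16) ^ r"
  proof -
    have "(1 - p * \<eta>) ^ B \<le> 1"
      using p01 \<eta> mult_le_one[of p \<eta>] by (intro power_le_one) auto
    then show ?thesis using clean_bound by (intro mult_left_mono power_mono) auto
  qed
  also have "\<dots> = (4 * (13 / 16) ^ 8) ^ r'" by (simp add: power_mult power_mult_distrib)
  also have "\<dots> \<le> (4 / 5) ^ r'" by (intro power_mono) (auto simp: power_numeral eval_nat_numeral)
  finally show ?thesis .
qed

text \<open>Weighting each clean block without a hit by \<open>1 / \<rho>\<close> makes the expectation of
  the product at most 1, while on the bad event the product is at least \<open>1 / \<rho> ^ r'\<close>.\<close>

lemma prob_unhit: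
  "measure_pmf.prob PP {\<omega>. r' \<le> card {g. g < r \<and> clean_block I B \<omega> g} \<and>
      \<not> (\<exists>i<m. fst (\<omega> i) \<subseteq> I \<and> odd (card (fst (\<omega> i) \<inter> V)) \<and> clean_block I B \<omega> (i div B))}
    \<le> exp (- (oddp V * real m / 16))"
proof -
  \<comment> \<open>An upper bound for the conditional probability that a clean block has no hit, a
    hit being a window sample of odd parity with \<open>V\<close>.\<close>
  define \<rho> where "\<rho> = exp (- (oddp V * real B / 2))"
  have \<rho>: "0 < \<rho>" "\<rho> \<le> 1" using oddp_le by (auto simp: \<rho>_def)
  define O1 where "O1 = {A. A \<subseteq> I \<and> odd (card (A \<inter> V))}"
  have cO: "countable O1" by (rule countable_finite) (simp add: O1_def finI)
  \<comment> \<open>The three terms are 1, the indicator of a clean block, and the indicator of a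
    clean block without a hit. Combined, a block weighs 1 if it is not clean, 0 if it is clean with
    a hit, and \<open>1 / \<rho>\<close> if it is clean without one.\<close>
  let ?\<kappa> = "\<lambda>t :: nat. if t = 0 then 1 else if t = 1 then - 1 else 1 / \<rho>"
  let ?h = "\<lambda>z :: nat set \<times> bool. (if fst z \<in> {A. A \<subseteq> I} then (if snd z then 0 else 1) else (1 :: real))
      - (if fst z \<in> O1 then (if snd z then 0 else 1) else 0)"
  let ?\<Phi> = "\<lambda>t :: nat. \<lambda>z :: nat set \<times> bool. if t = 0 then 1
     else if t = 1 then (if fst z \<in> {A. A \<subseteq> I} then (if snd z then 0 else 1) else (1 :: real)) else ?h z"
  let ?T = "{0, 1, 2 :: nat}"
  let ?F = "\<lambda>\<omega>. \<Prod>g<r. \<Sum>t\<in>?T. ?\<kappa> t * (\<Prod>i\<in>{g * B..<g * B + B}. ?\<Phi> t (\<omega> i))"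
  define unhit where "unhit \<omega> g \<longleftrightarrow> clean_block I B \<omega> g \<and> (\<forall>i\<in>{g * B..<g * B + B}. fst (\<omega> i) \<notin> O1)"
    for \<omega> :: "nat \<Rightarrow> nat set \<times> bool" and g
  have ph: "(\<Prod>i\<in>{g * B..<g * B + B}. ?h (\<omega> i)) = of_bool (unhit \<omega> g)" for g \<omega>
    by (auto simp: unhit_def clean_block_def prod_zero_iff O1_def intro!: prod.neutral split: if_splits)
  have inner: "(\<Sum>t\<in>?T. ?\<kappa> t * (\<Prod>i\<in>{g * B..<g * B + B}. ?\<Phi> t (\<omega> i)))
      = 1 - of_bool (clean_block I B \<omega> g) + of_bool (unhit \<omega> g) / \<rho>" for g \<omega>
    using prod_clean[of \<omega> g] ph[of \<omega> g] by simp
  have inner_nonneg: "0 \<le> 1 - of_bool (clean_block I B \<omega> g) + of_bool (unhit \<omega> g) / \<rho>" for g \<omega>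
    using \<rho> by (cases "clean_block I B \<omega> g") auto
  have "measure_pmf.prob PP {\<omega>. r' \<le> card {g. g < r \<and> clean_block I B \<omega> g} \<and>
      \<not> (\<exists>i<m. fst (\<omega> i) \<subseteq> I \<and> odd (card (fst (\<omega> i) \<inter> V)) \<and> clean_block I B \<omega> (i div B))}
      \<le> measure_pmf.expectation PP (\<lambda>\<omega>. \<rho> ^ r' * ?F \<omega>)"
  proof (intro prob_le_expectation finPP)
    fix \<omega> assume "\<omega> \<in> {\<omega>. r' \<le> card {g. g < r \<and> clean_block I B \<omega> g} \<and>
      \<not> (\<exists>i<m. fst (\<omega> i) \<subseteq> I \<and> odd (card (fst (\<omega> i) \<inter> V)) \<and> clean_block I B \<omega> (i div B))}"
    then have c: "r' \<le> card {g. g < r \<and> clean_block I B \<omega> g}"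
      and nh: "\<And>i. i < m \<Longrightarrow> fst (\<omega> i) \<in> O1 \<Longrightarrow> \<not> clean_block I B \<omega> (i div B)"
      by (auto simp: O1_def)
    have unhit: "unhit \<omega> g" if "g < r" "clean_block I B \<omega> g" for g
      unfolding unhit_def
    proof (intro conjI ballI that)
      fix i assume i: "i \<in> {g * B..<g * B + B}"
      then have "i div B = g" by (intro div_nat_eqI) (auto simp: algebra_simps)
      moreover have "i < m"
      proof -
        have "(g + 1) * B \<le> r * B" using that(1) by (intro mult_right_mono) auto
        then show ?thesis using i by simp
      qed
      ultimately show "fst (\<omega> i) \<notin> O1" using nh[of i] that(2) by auto
    qed
    have "?F \<omega> = (\<Prod>g<r. if clean_block I B \<omega> g then 1 / \<rho> else 1)"
      unfolding inner
    proof (intro prod.cong refl)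
      fix g assume "g \<in> {..<r}"
      moreover have "\<not> clean_block I B \<omega> g \<Longrightarrow> \<not> unhit \<omega> g" by (simp add: unhit_def)
      ultimately show "1 - of_bool (clean_block I B \<omega> g) + of_bool (unhit \<omega> g) / \<rho>
         = (if clean_block I B \<omega> g then 1 / \<rho> else 1)" using unhit[of g] by auto
    qed
    also have "\<dots> = (\<Prod>g\<in>{g \<in> {..<r}. clean_block I B \<omega> g}. 1 / \<rho>)"
      by (subst prod.inter_filter) auto
    also have "\<dots> = (1 / \<rho>) ^ card {g. g < r \<and> clean_block I B \<omega> g}" by simp
    also have "\<dots> \<ge> (1 / \<rho>) ^ r'" using c \<rho> by (intro power_increasing) auto
    finally have "(1 / \<rho>) ^ r' \<le> ?F \<omega>" .
    then have "\<rho> ^ r' * (1 / \<rho>) ^ r' \<le> \<rho> ^ r' * ?F \<omega>" using \<rho> by (intro mult_left_mono) auto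
    then show "1 \<le> \<rho> ^ r' * ?F \<omega>" using \<rho> by (simp add: power_divide)
  next
    fix \<omega> :: "nat \<Rightarrow> nat set \<times> bool"
    show "0 \<le> \<rho> ^ r' * ?F \<omega>"
      unfolding inner using \<rho> inner_nonneg by (intro mult_nonneg_nonneg prod_nonneg) auto
  qed
  also have "\<dots> = \<rho> ^ r' * (\<Sum>t\<in>?T. ?\<kappa> t * measure_pmf.expectation D (?\<Phi> t) ^ B) ^ r"
  proof -
    have "0 \<le> ?\<Phi> t x" for t x by (auto simp: O1_def)
    then show ?thesis
      using expectation_prod_blocks[where D = D and T = ?T and \<Phi> = ?\<Phi> and d = "({}, False)" and \<kappa> = ?\<kappa>] finD by simp
  qed
  also have "\<dots> \<le> \<rho> ^ r' * 1"
  proof -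
    let ?c = "1 - p * \<eta>" and ?e = "oddp V * (1 - \<eta>)"
    have c: "1 / 2 \<le> ?c" "?c \<le> 1" using p01 \<eta> mult_mono[of p 1 \<eta> "1/2"] by auto
    have "measure_pmf.expectation D ?h = ?c - ?e"
    proof -
      have "measure_pmf.expectation D (\<lambda>z. if fst z \<in> O1 then (if snd z then 0 else 1) else 0) = ?e"
        by (subst expectation_D[OF cO]) (simp add: Let_def oddp_def O1_def)
      then show ?thesis
        using expectation_clean
        by (subst Bochner_Integration.integral_diff) (auto intro!: integrable_measure_pmf_finite finD)
    qed
    then have sum: "(\<Sum>t\<in>?T. ?\<kappa> t * measure_pmf.expectation D (?\<Phi> t) ^ B)
        = 1 - ?c ^ B + (?c - ?e) ^ B / \<rho>"
      using expectation_clean by simp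
    have e0: "0 \<le> ?c - ?e"
    proof -
      have "?e \<le> p * (1 - \<eta>)" using oddp_le \<eta> by (intro mult_right_mono) auto
      then show ?thesis using p01 by (simp add: algebra_simps)
    qed
    \<comment> \<open>The ratio \<open>(c - e) / c\<close> is the conditional probability that a
      sample is no hit, given that it is not a noisy window sample. It is at most
      \<open>1 - oddp V / 2\<close> because \<open>\<eta>\<close> is below \<open>1 / 2\<close> and
      \<open>c\<close> is at most 1.\<close>
    have "?c - ?e \<le> ?c * exp (- (oddp V / 2))"
    proof -
      have "oddp V * (1 / 2) \<le> ?e" using oddp_le \<eta> by (intro mult_left_mono) auto
      moreover have "?c * (oddp V / 2) \<le> 1 * (oddp V / 2)" using c oddp_le by (intro mult_right_mono) auto
      ultimately have "?c - ?e \<le> ?c - ?c * (oddp V / 2)" by linarith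
      also have "\<dots> = ?c * (1 + - (oddp V / 2))" by (simp add: algebra_simps)
      also have "\<dots> \<le> ?c * exp (- (oddp V / 2))" using c(1) by (intro mult_left_mono exp_ge_add_one_self) auto
      finally show ?thesis .
    qed
    then have "(?c - ?e) ^ B \<le> (?c * exp (- (oddp V / 2))) ^ B" using e0 by (rule power_mono)
    also have "\<dots> = ?c ^ B * \<rho>"
      by (simp add: power_mult_distrib \<rho>_def mult.commute flip: exp_of_nat_mult)
    finally have "(?c - ?e) ^ B / \<rho> \<le> ?c ^ B" using \<rho> by (simp add: field_simps)
    moreover have "?c ^ B \<le> 1" using c by (intro power_le_one) auto
    moreover have "0 \<le> (?c - ?e) ^ B / \<rho>" using e0 \<rho> by simp
    ultimately show ?thesis unfolding sum using \<rho> by (intro mult_left_mono power_le_one) auto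
  qed
  also have "\<dots> = exp (- (oddp V * real m / 16))"
    by (simp add: \<rho>_def algebra_simps flip: exp_of_nat_mult)
  finally show ?thesis .
qed

text \<open>A sample of odd parity is weighted by \<open>\<beta>\<close> or \<open>1 / \<beta>\<close> with
  \<open>\<beta> = 1 - \<gamma> / 2\<close>, \<open>\<gamma> = 1 - 2 \<eta>\<close>, according to its noise bit.\<close>

lemma prob_confused:
  "measure_pmf.prob PP {\<omega>. \<not>
        card {i. i < m \<and> fst (\<omega> i) \<subseteq> I \<and> odd (card (fst (\<omega> i) \<inter> V)) \<and> snd (\<omega> i)}
          < card {i. i < m \<and> fst (\<omega> i) \<subseteq> I \<and> odd (card (fst (\<omega> i) \<inter> V)) \<and> \<not> snd (\<omega> i)}}
    \<le> exp (- ((1 - 2 * \<eta>)\<^sup>2 * oddp V * real m / 16))"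
proof -
  define \<gamma> where "\<gamma> = 1 - 2 * \<eta>"
  define \<beta> where "\<beta> = 1 - \<gamma> / 2"
  have \<gamma>: "0 < \<gamma>" "\<gamma> \<le> 1" "\<eta> = (1 - \<gamma>) / 2" "1 - \<eta> = (1 + \<gamma>) / 2"
    using \<eta> by (auto simp: \<gamma>_def field_simps)
  have \<beta>: "1 / 2 \<le> \<beta>" "\<beta> < 1" using \<gamma> by (auto simp: \<beta>_def)
  define O1 where "O1 = {A. A \<subseteq> I \<and> odd (card (A \<inter> V))}"
  have cO: "countable O1" by (rule countable_finite) (simp add: O1_def finI)
  let ?f = "\<lambda>z :: nat set \<times> bool. if fst z \<in> O1 then (if snd z then 1 / \<beta> else \<beta>) else 1"
  have prod: "(\<Prod>i<m. ?f (\<omega> i)) = (1 / \<beta>) ^ card {i. i < m \<and> fst (\<omega> i) \<in> O1 \<and> snd (\<omega> i)}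
      * \<beta> ^ card {i. i < m \<and> fst (\<omega> i) \<in> O1 \<and> \<not> snd (\<omega> i)}" for \<omega>
  proof -
    have "(\<Prod>i<m. ?f (\<omega> i)) = (\<Prod>i<m. (if fst (\<omega> i) \<in> O1 \<and> snd (\<omega> i) then 1 / \<beta> else 1)
        * (if fst (\<omega> i) \<in> O1 \<and> \<not> snd (\<omega> i) then \<beta> else 1))"
      by (intro prod.cong refl) auto
    also have "\<dots> = (\<Prod>i\<in>{i \<in> {..<m}. fst (\<omega> i) \<in> O1 \<and> snd (\<omega> i)}. 1 / \<beta>)
        * (\<Prod>i\<in>{i \<in> {..<m}. fst (\<omega> i) \<in> O1 \<and> \<not> snd (\<omega> i)}. \<beta>)"
      unfolding prod.distrib by (subst (1 2) prod.inter_filter) auto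
    finally show ?thesis by simp
  qed
  have "measure_pmf.prob PP {\<omega>. \<not>
        card {i. i < m \<and> fst (\<omega> i) \<subseteq> I \<and> odd (card (fst (\<omega> i) \<inter> V)) \<and> snd (\<omega> i)}
          < card {i. i < m \<and> fst (\<omega> i) \<subseteq> I \<and> odd (card (fst (\<omega> i) \<inter> V)) \<and> \<not> snd (\<omega> i)}}
      \<le> measure_pmf.expectation PP (\<lambda>\<omega>. \<Prod>i<m. ?f (\<omega> i))"
  proof (intro prob_le_expectation finPP)
    fix \<omega> assume "\<omega> \<in> {\<omega>. \<not>
        card {i. i < m \<and> fst (\<omega> i) \<subseteq> I \<and> odd (card (fst (\<omega> i) \<inter> V)) \<and> snd (\<omega> i)}
          < card {i. i < m \<and> fst (\<omega> i) \<subseteq> I \<and> odd (card (fst (\<omega> i) \<inter> V)) \<and> \<not> snd (\<omega> i)}}"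
    then have le: "card {i. i < m \<and> fst (\<omega> i) \<in> O1 \<and> \<not> snd (\<omega> i)}
        \<le> card {i. i < m \<and> fst (\<omega> i) \<in> O1 \<and> snd (\<omega> i)}"
      by (simp add: O1_def conj_assoc not_less)
    let ?a = "card {i. i < m \<and> fst (\<omega> i) \<in> O1 \<and> \<not> snd (\<omega> i)}"
    have "(1 / \<beta>) ^ ?a * \<beta> ^ ?a \<le> (\<Prod>i<m. ?f (\<omega> i))"
      unfolding prod using \<beta> le by (intro mult_right_mono power_increasing) auto
    then show "1 \<le> (\<Prod>i<m. ?f (\<omega> i))" using \<beta> by (simp flip: power_mult_distrib)
  qed (use \<beta> in \<open>auto intro!: prod_nonneg\<close>)
  also have "\<dots> = (oddp V * (\<eta> * (1 / \<beta>) + (1 - \<eta>) * \<beta>) + (1 - oddp V) * 1) ^ m"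
  proof -
    have "measure_pmf.expectation D ?f = oddp V * (\<eta> * (1 / \<beta>) + (1 - \<eta>) * \<beta>) + (1 - oddp V) * 1"
      by (subst expectation_D[OF cO]) (simp add: Let_def oddp_def O1_def)
    then show ?thesis using \<beta> by (subst expectation_prod_iid) (auto simp: finD)
  qed
  also have "\<dots> \<le> exp (- (\<gamma>\<^sup>2 * oddp V / 16)) ^ m"
  proof (intro power_mono)
    have "\<eta> * (1 / \<beta>) + (1 - \<eta>) * \<beta> \<le> 1 - \<gamma>\<^sup>2 / 16"
    proof -
      have "\<eta> * (1 / \<beta>) + (1 - \<eta>) * \<beta> = (1 - \<gamma>) / 2 * (1 / (1 - \<gamma> / 2)) + (1 + \<gamma>) / 2 * (1 - \<gamma> / 2)"
        unfolding \<gamma>(4) \<beta>_def by (subst \<gamma>(3)) (rule refl)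
      then show ?thesis using tilted_factor[OF \<gamma>(1,2)] by simp
    qed
    then have "oddp V * (\<eta> * (1 / \<beta>) + (1 - \<eta>) * \<beta>) \<le> oddp V * (1 - \<gamma>\<^sup>2 / 16)"
      using oddp_le by (intro mult_left_mono) auto
    then have "oddp V * (\<eta> * (1 / \<beta>) + (1 - \<eta>) * \<beta>) + (1 - oddp V) * 1 \<le> 1 + - (\<gamma>\<^sup>2 * oddp V / 16)"
      by (simp add: algebra_simps)
    also have "\<dots> \<le> exp (- (\<gamma>\<^sup>2 * oddp V / 16))" by (rule exp_ge_add_one_self)
    finally show "oddp V * (\<eta> * (1 / \<beta>) + (1 - \<eta>) * \<beta>) + (1 - oddp V) * 1 \<le> exp (- (\<gamma>\<^sup>2 * oddp V / 16))" .
  next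
    have "oddp V \<le> 1" using oddp_le p01 by (meson order.trans)
    then show "0 \<le> oddp V * (\<eta> * (1 / \<beta>) + (1 - \<eta>) * \<beta>) + (1 - oddp V) * 1"
      using oddp_le \<eta> \<beta> by (intro add_nonneg_nonneg mult_nonneg_nonneg) auto
  qed
  also have "\<dots> = exp (- ((1 - 2 * \<eta>)\<^sup>2 * oddp V * real m / 16))"
    by (simp add: \<gamma>_def algebra_simps flip: exp_of_nat_mult)
  finally show ?thesis .
qed

lemma sum_card_power:
  fixes t :: real
  assumes "finite J"
  shows "(\<Sum>V\<in>Pow J. t ^ card V) = (1 + t) ^ card J"
  using assms
proof (induction J)
  case (insert x J)
  have "(\<Sum>V\<in>Pow (insert x J). t ^ card V)
      = (\<Sum>V\<in>Pow J. t ^ card V) + (\<Sum>V\<in>insert x ` Pow J. t ^ card V)"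
    unfolding Pow_insert using insert by (intro sum.union_disjoint) auto
  also have "(\<Sum>V\<in>insert x ` Pow J. t ^ card V) = (\<Sum>V\<in>Pow J. t ^ card (insert x V))"
    using insert by (subst sum.reindex) (auto simp: inj_on_def)
  also have "\<dots> = (\<Sum>V\<in>Pow J. t * t ^ card V)"
  proof (intro sum.cong refl)
    fix V assume "V \<in> Pow J"
    then have "finite V" "x \<notin> V" using insert finite_subset by auto
    then show "t ^ card (insert x V) = t * t ^ card V" by simp
  qed
  finally show ?case using insert by (simp add: sum_distrib_left[symmetric] algebra_simps)
qed simp

text \<open>For every \<open>V\<close> the assumption makes the exponent of both failure bounds at
  least \<open>min (2 * Q) (16 * l * card V)\<close>. The first value beats the \<open>2 ^ Q\<close>
  sets altogether, the second is summed over all \<open>V\<close> by the binomial theorem. The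
  constant 512 is \<open>16 * 32\<close>: 16 for the denominator of the exponents, and 32 to turn
  the \<open>1 / 16\<close> of \<open>card_odd_ge\<close> into 2.\<close>

lemma prob_not_good:
  assumes \<mu>: "(1 - 2 * \<eta>)\<^sup>2 * p * real m \<ge> 512 * (real Q + real Q * l / real k)" and l: "0 \<le> l"
  shows "measure_pmf.prob PP {\<omega>. \<not> good_window I r B cap \<omega>}
     \<le> exp (real m * p) / 2 ^ cap + (4 / 5) ^ r' + 2 * (exp (- real Q) + ((1 + exp (- (16 * l))) ^ Q - 1))"
proof -
  define \<gamma> where "\<gamma> = 1 - 2 * \<eta>"
  have \<gamma>: "0 < \<gamma>" "\<gamma>\<^sup>2 \<le> 1" using \<eta> by (auto simp: \<gamma>_def power_le_one)
  have k0: "0 < k" using k(1) by (cases k) auto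
  have Q0: "0 < Q" using k k0 by linarith
  define E0 where "E0 = {\<omega> :: nat \<Rightarrow> nat set \<times> bool. card {i. i < m \<and> fst (\<omega> i) \<subseteq> I} > cap}"
  define E1 where "E1 = {\<omega> :: nat \<Rightarrow> nat set \<times> bool. card {g. g < r \<and> clean_block I B \<omega> g} < r'}"
  define E2 where "E2 V = {\<omega> :: nat \<Rightarrow> nat set \<times> bool. r' \<le> card {g. g < r \<and> clean_block I B \<omega> g} \<and>
      \<not> (\<exists>i<m. fst (\<omega> i) \<subseteq> I \<and> odd (card (fst (\<omega> i) \<inter> V)) \<and> clean_block I B \<omega> (i div B))}" for V
  define E3 where "E3 V = {\<omega> :: nat \<Rightarrow> nat set \<times> bool. \<not>
        card {i. i < m \<and> fst (\<omega> i) \<subseteq> I \<and> odd (card (fst (\<omega> i) \<inter> V)) \<and> snd (\<omega> i)}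
          < card {i. i < m \<and> fst (\<omega> i) \<subseteq> I \<and> odd (card (fst (\<omega> i) \<inter> V)) \<and> \<not> snd (\<omega> i)}}" for V
  let ?S = "Pow I - {{}}"
  \<comment> \<open>One summand for each value of the minimum.\<close>
  let ?b = "\<lambda>V. exp (- (2 * real Q)) + exp (- (16 * l)) ^ card V"
  have bound: "exp (- (\<gamma>\<^sup>2 * oddp V * real m / 16)) \<le> ?b V" if "V \<in> ?S" for V
  proof -
    let ?x = "real (card V) * real k / (2 * real Q)"
    let ?M = "512 * (real Q + real Q * l / real k)"
    have "?M * min (1 / 16) ?x \<le> (\<gamma>\<^sup>2 * p * real m) * min (1 / 16) ?x"
      using \<mu> by (intro mult_right_mono) (auto simp: \<gamma>_def)
    also have "\<dots> = \<gamma>\<^sup>2 * real m * (p * min (1 / 16) ?x)" by simp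
    also have "\<dots> \<le> \<gamma>\<^sup>2 * real m * oddp V"
      using oddp_ge[of V] that by (intro mult_left_mono) auto
    finally have "?M * min (1 / 16) ?x / 16 \<le> \<gamma>\<^sup>2 * real m * oddp V / 16"
      by (rule divide_right_mono) simp
    then have ge: "?M * min (1 / 16) ?x / 16 \<le> \<gamma>\<^sup>2 * oddp V * real m / 16"
      by (simp only: mult.assoc mult.commute[of "oddp V"])
    have "0 \<le> real Q * l / real k" using l by simp
    then have a: "2 * real Q \<le> ?M * (1 / 16) / 16" by simp
    have "?M * ?x / 16 = 16 * (real (card V) * (real k + l))"
      using Q0 k0 by (simp add: field_simps)
    moreover have "real (card V) * (real k + l) \<ge> real (card V) * l" by (intro mult_left_mono) auto
    ultimately have b: "16 * l * real (card V) \<le> ?M * ?x / 16" by (simp add: algebra_simps)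
    have "min (2 * real Q) (16 * l * real (card V)) \<le> ?M * min (1 / 16) ?x / 16"
      using a b by (cases "1 / 16 \<le> ?x") (auto simp: min_def)
    then have "min (2 * real Q) (16 * l * real (card V)) \<le> \<gamma>\<^sup>2 * oddp V * real m / 16"
      using ge by (rule order.trans)
    then have "exp (- (\<gamma>\<^sup>2 * oddp V * real m / 16)) \<le> exp (- min (2 * real Q) (16 * l * real (card V)))"
      by (simp only: exp_le_cancel_iff neg_le_iff_le)
    also have "\<dots> \<le> exp (- (2 * real Q)) + exp (- (16 * l * real (card V)))"
      by (auto simp: min_def)
    also have "exp (- (16 * l * real (card V))) = exp (- (16 * l)) ^ card V"
      by (simp add: mult.commute flip: exp_of_nat_mult)
    finally show ?thesis by simp
  qed
  have p2: "measure_pmf.prob PP (E2 V) \<le> ?b V" if "V \<in> ?S" for V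
  proof -
    have "measure_pmf.prob PP (E2 V) \<le> exp (- (oddp V * real m / 16))"
      unfolding E2_def by (rule prob_unhit)
    also have "\<dots> \<le> exp (- (\<gamma>\<^sup>2 * oddp V * real m / 16))"
    proof -
      have "\<gamma>\<^sup>2 * (oddp V * real m) \<le> 1 * (oddp V * real m)"
        using \<gamma> oddp_le by (intro mult_right_mono) auto
      then show ?thesis by (simp add: mult.assoc)
    qed
    finally show ?thesis using bound[OF that] by simp
  qed
  have p3: "measure_pmf.prob PP (E3 V) \<le> ?b V" if "V \<in> ?S" for V
    using prob_confused[of V] bound[OF that] unfolding E3_def \<gamma>_def by simp
  \<comment> \<open>Leaving out the empty set is what gives the \<open>- 1\<close>, without which
    the bound would not be small.\<close>
  have sumb: "(\<Sum>V\<in>?S. ?b V) \<le> exp (- real Q) + ((1 + exp (- (16 * l))) ^ Q - 1)"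
  proof -
    have "(\<Sum>V\<in>?S. ?b V) = (\<Sum>V\<in>Pow I. exp (- (2 * real Q))) - exp (- (2 * real Q))
       + ((\<Sum>V\<in>Pow I. exp (- (16 * l)) ^ card V) - 1)"
      using finI by (simp add: sum.distrib sum_diff1 del: sum_constant)
    also have "\<dots> \<le> 2 ^ Q * exp (- (2 * real Q)) + ((1 + exp (- (16 * l))) ^ Q - 1)"
      using finI I by (simp add: sum_card_power card_Pow)
    also have "2 ^ Q * exp (- (2 * real Q)) \<le> exp (real Q) * exp (- (2 * real Q))"
    proof -
      have "(2 :: real) ^ Q \<le> exp 1 ^ Q" using exp_ge_add_one_self[of 1] by (intro power_mono) auto
      also have "\<dots> = exp (real Q)" by (simp flip: exp_of_nat_mult)
      finally show ?thesis by (intro mult_right_mono) auto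
    qed
    finally show ?thesis by (simp flip: exp_add)
  qed
  have "{\<omega>. \<not> good_window I r B cap \<omega>} \<subseteq> E0 \<union> (E1 \<union> ((\<Union>V\<in>?S. E2 V) \<union> (\<Union>V\<in>?S. E3 V)))"
  proof
    fix \<omega> assume bad: "\<omega> \<in> {\<omega>. \<not> good_window I r B cap \<omega>}"
    show "\<omega> \<in> E0 \<union> (E1 \<union> ((\<Union>V\<in>?S. E2 V) \<union> (\<Union>V\<in>?S. E3 V)))"
    proof (rule ccontr)
      assume n: "\<not> ?thesis"
      have e0: "card {i. i < m \<and> fst (\<omega> i) \<subseteq> I} \<le> cap" using n unfolding E0_def by (simp add: not_less)
      have e1: "r' \<le> card {g. g < r \<and> clean_block I B \<omega> g}" using n unfolding E1_def by (simp add: not_less)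
      have e2: "\<exists>i<m. fst (\<omega> i) \<subseteq> I \<and> odd (card (fst (\<omega> i) \<inter> V)) \<and> clean_block I B \<omega> (i div B)"
        if "V \<subseteq> I" "V \<noteq> {}" for V
      proof -
        have "\<omega> \<notin> E2 V" using n that by blast
        then show ?thesis using e1 unfolding E2_def by blast
      qed
      have e3: "card {i. i < m \<and> fst (\<omega> i) \<subseteq> I \<and> odd (card (fst (\<omega> i) \<inter> V)) \<and> snd (\<omega> i)}
          < card {i. i < m \<and> fst (\<omega> i) \<subseteq> I \<and> odd (card (fst (\<omega> i) \<inter> V)) \<and> \<not> snd (\<omega> i)}"
        if "V \<subseteq> I" "V \<noteq> {}" for V
      proof -
        have "\<omega> \<notin> E3 V" using n that by blast
        then show ?thesis unfolding E3_def by simp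
      qed
      have "good_window I r B cap \<omega>" unfolding good_window_def by (intro conjI allI impI e0 e2 e3)
      then show False using bad by simp
    qed
  qed
  then have "measure_pmf.prob PP {\<omega>. \<not> good_window I r B cap \<omega>}
     \<le> measure_pmf.prob PP (E0 \<union> (E1 \<union> ((\<Union>V\<in>?S. E2 V) \<union> (\<Union>V\<in>?S. E3 V))))"
    by (intro measure_pmf.finite_measure_mono) auto
  also have "\<dots> \<le> measure_pmf.prob PP E0 + (measure_pmf.prob PP E1 +
     (measure_pmf.prob PP (\<Union>V\<in>?S. E2 V) + measure_pmf.prob PP (\<Union>V\<in>?S. E3 V)))"
  proof -
    have sub: "measure_pmf.prob PP (X \<union> Y) \<le> measure_pmf.prob PP X + measure_pmf.prob PP Y" for X Y
      by (rule measure_subadditive) auto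
    show ?thesis
      using sub[of E0 "E1 \<union> ((\<Union>V\<in>?S. E2 V) \<union> (\<Union>V\<in>?S. E3 V))"]
        sub[of E1 "(\<Union>V\<in>?S. E2 V) \<union> (\<Union>V\<in>?S. E3 V)"] sub[of "\<Union>V\<in>?S. E2 V" "\<Union>V\<in>?S. E3 V"]
      by linarith
  qed
  also have "\<dots> \<le> exp (real m * p) / 2 ^ cap + ((4 / 5) ^ r' + ((\<Sum>V\<in>?S. ?b V) + (\<Sum>V\<in>?S. ?b V)))"
  proof (intro add_mono)
    show "measure_pmf.prob PP E0 \<le> exp (real m * p) / 2 ^ cap" unfolding E0_def by (rule prob_overflow)
    show "measure_pmf.prob PP E1 \<le> (4 / 5) ^ r'" unfolding E1_def by (rule prob_few_clean)
    show "measure_pmf.prob PP (\<Union>V\<in>?S. E2 V) \<le> (\<Sum>V\<in>?S. ?b V)"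
    proof -
      have "measure_pmf.prob PP (\<Union>V\<in>?S. E2 V) \<le> (\<Sum>V\<in>?S. measure_pmf.prob PP (E2 V))"
        using finI by (intro measure_pmf.finite_measure_subadditive_finite) auto
      also have "\<dots> \<le> (\<Sum>V\<in>?S. ?b V)" by (intro sum_mono p2)
      finally show ?thesis .
    qed
    show "measure_pmf.prob PP (\<Union>V\<in>?S. E3 V) \<le> (\<Sum>V\<in>?S. ?b V)"
    proof -
      have "measure_pmf.prob PP (\<Union>V\<in>?S. E3 V) \<le> (\<Sum>V\<in>?S. measure_pmf.prob PP (E3 V))"
        using finI by (intro measure_pmf.finite_measure_subadditive_finite) auto
      also have "\<dots> \<le> (\<Sum>V\<in>?S. ?b V)" by (intro sum_mono p3)
      finally show ?thesis .
    qed
  qed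
  also have "\<dots> \<le> exp (real m * p) / 2 ^ cap + (4 / 5) ^ r'
      + 2 * (exp (- real Q) + ((1 + exp (- (16 * l))) ^ Q - 1))"
    using sumb by simp
  finally show ?thesis .
qed

end

section \<open>The program\<close>

abbreviation (input) "v_n \<equiv> 0 :: nat"
abbreviation (input) "v_k \<equiv> 1 :: nat"
abbreviation (input) "v_l \<equiv> 2 :: nat"
abbreviation (input) "v_pw \<equiv> 3 :: nat"
abbreviation (input) "v_c \<equiv> 4 :: nat"
abbreviation (input) "v_l2 \<equiv> 5 :: nat"
abbreviation (input) "v_N \<equiv> 6 :: nat"
abbreviation (input) "v_ae \<equiv> 7 :: nat"
abbreviation (input) "v_ad \<equiv> 8 :: nat"
abbreviation (input) "v_h \<equiv> 9 :: nat"
abbreviation (input) "v_W \<equiv> 10 :: nat"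
abbreviation (input) "v_Q \<equiv> 11 :: nat"
abbreviation (input) "v_G \<equiv> 12 :: nat"
abbreviation (input) "v_M \<equiv> 13 :: nat"
abbreviation (input) "v_r' \<equiv> 14 :: nat"
abbreviation (input) "v_r \<equiv> 15 :: nat"
abbreviation (input) "v_cap \<equiv> 16 :: nat"
abbreviation (input) "v_num \<equiv> 17 :: nat"
abbreviation (input) "v_den \<equiv> 18 :: nat"
abbreviation (input) "v_B \<equiv> 19 :: nat"
abbreviation (input) "v_m \<equiv> 20 :: nat"
abbreviation (input) "v_NM \<equiv> 21 :: nat"
abbreviation (input) "v_Q1 \<equiv> 22 :: nat"
abbreviation (input) "v_nw \<equiv> 23 :: nat"
abbreviation (input) "v_i0 \<equiv> 30 :: nat"
abbreviation (input) "v_i \<equiv> 31 :: nat"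
abbreviation (input) "v_j \<equiv> 32 :: nat"
abbreviation (input) "v_t \<equiv> 33 :: nat"
abbreviation (input) "v_d \<equiv> 34 :: nat"
abbreviation (input) "v_p \<equiv> 35 :: nat"
abbreviation (input) "v_mask \<equiv> 36 :: nat"
abbreviation (input) "v_a \<equiv> 37 :: nat"
abbreviation (input) "v_cnt \<equiv> 38 :: nat"
abbreviation (input) "v_best \<equiv> 39 :: nat"
abbreviation (input) "v_z \<equiv> 40 :: nat"
abbreviation (input) "v_e \<equiv> 41 :: nat"

abbreviation (input) "a_out \<equiv> 0 :: nat"
abbreviation (input) "a_raw \<equiv> 1 :: nat"
abbreviation (input) "a_X \<equiv> 2 :: nat"
abbreviation (input) "a_Y \<equiv> 3 :: nat"
abbreviation (input) "a_pool \<equiv> 4 :: nat"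
abbreviation (input) "a_V \<equiv> 5 :: nat"
abbreviation (input) "a_pow \<equiv> 7 :: nat"
abbreviation (input) "a_\<beta> \<equiv> 8 :: nat"
abbreviation (input) "a_piv \<equiv> 9 :: nat"

text \<open>The outermost operator is \<^const>\<open>Less\<close>, so that the value is bounded by 1
  syntactically.\<close>

definition mod2 :: "aexp \<Rightarrow> aexp" where
  "mod2 e = Less (Num 0) (Sub e (Mul (Num 2) (Quo e (Num 2))))"

lemma evm_mod2 [simp]: "evm P m (mod2 e) = evm P m e mod 2"
  unfolding mod2_def by (simp add: minus_mult_div_eq_mod mod2_eq_if flip: mod2_eq_if)

definition dotP :: prog where
  "dotP = PAsg v_d (Num 0) ;; PFor v_t v_Q (PAsg v_d (mod2 (Add (Var v_d)
     (Mul (Get a_X (Add (Add (Mul (Var v_i) (Var v_n)) (Var v_i0)) (Var v_t)))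
          (Get a_V (Add (Mul (Var v_j) (Var v_Q)) (Var v_t)))))))"

definition matrixP :: "aexp \<Rightarrow> prog" where
  "matrixP e = PFor v_j v_Q1 (PFor v_t v_Q (PPut a_V (Add (Mul (Var v_j) (Var v_Q)) (Var v_t)) e))"

text \<open>The two truncated differences add up to the distance of \<open>j\<close> and
  \<open>t\<close>. So rows below \<open>Q\<close> are the unit vectors and row \<open>Q\<close> is
  zero: without equations, the solution space is everything.\<close>

definition initP :: prog where
  "initP = matrixP (Less (Add (Sub (Var v_j) (Var v_t)) (Sub (Var v_t) (Var v_j))) (Num 1))"

text \<open>Since \<open>j\<close> is at most \<open>Q\<close>, the truncated expression
  \<open>1 - (Q - j)\<close> is the indicator of \<open>j = Q\<close>: only the particular solution
  in row \<open>Q\<close> is compared with the label. A row becomes pivot only if it is below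
  \<open>Q\<close>.\<close>

definition betaP :: prog where
  "betaP = PFor v_j v_Q1 (dotP ;;
     PPut a_\<beta> (Var v_j) (mod2 (Add (Var v_d) (Mul (Sub (Num 1) (Sub (Var v_Q) (Var v_j))) (Get a_Y (Var v_i))))) ;;
     PIf (Mul (Get a_\<beta> (Var v_j)) (Less (Var v_j) (Var v_Q))) (PAsg v_p (Var v_j)) PSkip)"

text \<open>The pivot row is saved because \<open>updateP\<close> turns it into zero while later
  rows still need it.\<close>

definition copyP :: prog where
  "copyP = PFor v_t v_Q (PPut a_piv (Var v_t) (Get a_V (Add (Mul (Var v_p) (Var v_Q)) (Var v_t))))"

definition updateP :: prog where
  "updateP = matrixP (mod2 (Add (Get a_V (Add (Mul (Var v_j) (Var v_Q)) (Var v_t)))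
      (Mul (Get a_\<beta> (Var v_j)) (Get a_piv (Var v_t)))))"

text \<open>The preset \<open>v_p = Q\<close> survives if no direction row has odd product with the
  sample. For a sample consistent with \<open>s\<close> the residual of row \<open>Q\<close> is then
  even too, and the update changes nothing.\<close>

definition elimP :: prog where
  "elimP = PAsg v_p (Var v_Q) ;; betaP ;; copyP ;; updateP"

text \<open>The loop runs to \<open>v_cap\<close> with a guard, not to the pool size, because loop
  bounds must be variables that the program never writes. The bit of the mask for the block of a
  sample is read with a table of powers of 2.\<close>

definition candP :: prog where
  "candP = initP ;; PFor v_a v_cap (PIf (Less (Var v_a) (Var v_cnt))
     (PAsg v_i (Get a_pool (Var v_a)) ;;
      PIf (mod2 (Quo (Var v_mask) (Get a_pow (Quo (Var v_i) (Var v_B))))) elimP PSkip) PSkip)"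

definition disP :: prog where
  "disP = PAsg v_e (Num 0) ;; PAsg v_j (Var v_Q) ;; PFor v_a v_cap (PIf (Less (Var v_a) (Var v_cnt))
     (PAsg v_i (Get a_pool (Var v_a)) ;; dotP ;;
      PIf (mod2 (Add (Var v_d) (Get a_Y (Var v_i)))) (PAsg v_e (Add (Var v_e) (Num 1))) PSkip) PSkip)"

definition scanP :: prog where
  "scanP = PAsg v_z (Num 0) ;; PFor v_j v_n (PIf (Get a_X (Add (Mul (Var v_i) (Var v_n)) (Var v_j)))
     (PIf (Less (Var v_j) (Var v_i0)) (PAsg v_z (Num 1))
        (PIf (Less (Var v_j) (Add (Var v_i0) (Var v_Q))) PSkip (PAsg v_z (Num 1)))) PSkip)"

definition poolP :: prog where
  "poolP = PAsg v_cnt (Num 0) ;; PFor v_i v_m (scanP ;; PIf (Var v_z) PSkip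
     (PIf (Less (Var v_cnt) (Var v_cap))
       (PPut a_pool (Var v_cnt) (Var v_i) ;; PAsg v_cnt (Add (Var v_cnt) (Num 1))) PSkip))"

definition outP :: prog where
  "outP = PFor v_t v_Q (PPut a_out (Add (Var v_i0) (Var v_t))
     (Get a_V (Add (Mul (Var v_Q) (Var v_Q)) (Var v_t))))"

definition maskP :: prog where
  "maskP = candP ;; disP ;; PIf (Less (Var v_e) (Var v_best)) (PAsg v_best (Var v_e) ;; outP) PSkip"

text \<open>\<open>cap + 1\<close> exceeds any number of disagreements with the pool, so the first
  candidate is always accepted.\<close>

definition winP :: prog where
  "winP = poolP ;; PAsg v_best (Add (Var v_cap) (Num 1)) ;; PFor v_mask v_NM maskP"

definition solveP :: prog where
  "solveP = PFor v_i0 v_nw winP"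

definition sampleP :: prog where
  "sampleP = PFor v_i v_m (PSample a_raw v_d ;;
     PFor v_j v_n (PPut a_X (Add (Mul (Var v_i) (Var v_n)) (Var v_j)) (Get a_raw (Var v_j))) ;;
     PPut a_Y (Var v_i) (Var v_d))"

lemma wv_simps [simp]:
  "wv dotP = {v_d, v_t}" "wv (matrixP e) = {v_j, v_t}" "wv initP = {v_j, v_t}"
  "wv betaP = {v_j, v_t, v_d, v_p}" "wv copyP = {v_t}" "wv updateP = {v_j, v_t}"
  "wv elimP = {v_j, v_t, v_d, v_p}" "wv candP = {v_j, v_t, v_d, v_p, v_a, v_i}"
  "wv disP = {v_e, v_j, v_a, v_i, v_d, v_t}" "wv scanP = {v_z, v_j}"
  "wv poolP = {v_cnt, v_i, v_z, v_j}" "wv outP = {v_t}"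
  "wv maskP = {v_j, v_t, v_d, v_p, v_a, v_i, v_e, v_best}"
  "wv winP = {v_cnt, v_z, v_j, v_t, v_d, v_p, v_a, v_i, v_e, v_best, v_mask}"
  unfolding dotP_def matrixP_def initP_def betaP_def copyP_def updateP_def elimP_def candP_def
    disP_def scanP_def poolP_def outP_def maskP_def winP_def
  by auto

lemma wa_simps [simp]:
  "wa dotP = {}" "wa (matrixP e) = {a_V}" "wa initP = {a_V}"
  "wa betaP = {a_\<beta>}" "wa copyP = {a_piv}" "wa updateP = {a_V}"
  "wa elimP = {a_\<beta>, a_piv, a_V}" "wa candP = {a_\<beta>, a_piv, a_V}"
  "wa disP = {}" "wa scanP = {}" "wa poolP = {a_pool}" "wa outP = {a_out}"
  "wa maskP = {a_\<beta>, a_piv, a_V, a_out}" "wa winP = {a_pool, a_\<beta>, a_piv, a_V, a_out}"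
  unfolding dotP_def matrixP_def initP_def betaP_def copyP_def updateP_def elimP_def candP_def
    disP_def scanP_def poolP_def outP_def maskP_def winP_def
  by auto

section \<open>Correctness of the matrix operations\<close>

lemma dotP_correct:
  "mv (den P \<omega> dotP m) v_d =
     (\<Sum>t < mv m v_Q. ma m a_X (mv m v_i * mv m v_n + mv m v_i0 + t) * ma m a_V (mv m v_j * mv m v_Q + t)) mod 2"
proof -
  let ?m = "den P \<omega> (PAsg v_d (Num 0)) m"
  let ?f = "\<lambda>t. ma m a_X (mv m v_i * mv m v_n + mv m v_i0 + t) * ma m a_V (mv m v_j * mv m v_Q + t)"
  have "(\<lambda>i m'. mv m' v_d = (\<Sum>t < i. ?f t) mod 2) (mv ?m v_Q) (den P \<omega> (PFor v_t v_Q (PAsg v_d (mod2 (Add (Var v_d)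
     (Mul (Get a_X (Add (Add (Mul (Var v_i) (Var v_n)) (Var v_i0)) (Var v_t)))
          (Get a_V (Add (Mul (Var v_j) (Var v_Q)) (Var v_t)))))))) ?m)"
    by (rule for_rule) (simp_all add: mod_add_left_eq)
  then show ?thesis by (simp add: dotP_def)
qed

lemma index_inj:
  fixes j j' t t' Q :: nat
  assumes "t < Q" "t' < Q"
  shows "j * Q + t = j' * Q + t' \<longleftrightarrow> j = j' \<and> t = t'"
proof
  assume h: "j * Q + t = j' * Q + t'"
  have "(j * Q + t) div Q = j" "(j' * Q + t') div Q = j'" using assms by auto
  then show "j = j' \<and> t = t'" using h by simp
qed simp

text \<open>The expression \<open>e\<close> may read the very cell that is being written, as in
  \<open>updateP\<close>. When cell \<open>(j, t)\<close> is reached it still has its old content,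
  since no other index pair addresses it.\<close>

lemma matrixP_correct:
  assumes e: "\<And>m' j t. j < mv m v_Q1 \<Longrightarrow> t < mv m v_Q \<Longrightarrow> mv m' v_j = j \<Longrightarrow> mv m' v_t = t
      \<Longrightarrow> (\<And>w. w \<noteq> v_j \<Longrightarrow> w \<noteq> v_t \<Longrightarrow> mv m' w = mv m w) \<Longrightarrow> (\<And>a. a \<noteq> a_V \<Longrightarrow> ma m' a = ma m a)
      \<Longrightarrow> ma m' a_V (j * mv m v_Q + t) = ma m a_V (j * mv m v_Q + t)
      \<Longrightarrow> evm P m' e = F j t"
  shows "j < mv m v_Q1 \<Longrightarrow> t < mv m v_Q \<Longrightarrow> ma (den P \<omega> (matrixP e) m) a_V (j * mv m v_Q + t) = F j t"
proof -
  let ?Q = "mv m v_Q"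
  let ?put = "PPut a_V (Add (Mul (Var v_j) (Var v_Q)) (Var v_t)) e"
  define I where "I jj tt m' \<longleftrightarrow> (\<forall>j t. t < ?Q \<longrightarrow> ma m' a_V (j * ?Q + t) =
     (if j < jj \<or> j = jj \<and> t < tt then F j t else ma m a_V (j * ?Q + t)))" for jj tt :: nat and m' :: mem
  have "I (mv m v_Q1) 0 (den P \<omega> (matrixP e) m)"
    unfolding matrixP_def
  proof (rule for_rule[where I = "\<lambda>j m'. I j 0 m'"])
    show "I 0 0 (m\<lparr>mv := (mv m)(v_j := 0)\<rparr>)" by (simp add: I_def)
  next
    fix jj m'
    assume jj: "jj < mv m v_Q1" and vj: "mv m' v_j = jj"
      and fr: "\<And>w. w \<notin> wv (PFor v_j v_Q1 (PFor v_t v_Q ?put)) \<Longrightarrow> mv m' w = mv m w"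
      and fa: "\<And>a. a \<notin> wa (PFor v_t v_Q ?put) \<Longrightarrow> ma m' a = ma m a"
      and I: "I jj 0 m'"
    have "I jj (mv m' v_Q) (den P \<omega> (PFor v_t v_Q ?put) m')"
    proof (rule for_rule[where I = "\<lambda>t m'. I jj t m'"])
      show "I jj 0 (m'\<lparr>mv := (mv m')(v_t := 0)\<rparr>)" using I by (simp add: I_def)
    next
      fix tt m2
      assume tt: "tt < mv m' v_Q" and vt: "mv m2 v_t = tt"
        and fr2: "\<And>w. w \<notin> wv (PFor v_t v_Q ?put) \<Longrightarrow> mv m2 w = mv m' w"
        and fa2: "\<And>a. a \<notin> wa ?put \<Longrightarrow> ma m2 a = ma m' a"
        and I2: "I jj tt m2"
      have Q2: "mv m2 v_Q = ?Q" "mv m' v_Q = ?Q" and j2: "mv m2 v_j = jj" using fr2 fr vj by auto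
      have ttQ: "tt < ?Q" using tt Q2 by simp
      have ev: "evm P m2 e = F jj tt"
      proof (rule e[OF jj ttQ j2 vt])
        show "ma m2 a_V (jj * ?Q + tt) = ma m a_V (jj * ?Q + tt)" using I2 ttQ by (simp add: I_def)
      qed (use fr fr2 fa fa2 in auto)
      show "I jj (Suc tt) ((den P \<omega> ?put m2)\<lparr>mv := (mv (den P \<omega> ?put m2))(v_t := Suc tt)\<rparr>)"
        unfolding I_def
      proof (intro allI impI)
        fix j t assume t: "t < ?Q"
        show "ma ((den P \<omega> ?put m2)\<lparr>mv := (mv (den P \<omega> ?put m2))(v_t := Suc tt)\<rparr>) a_V (j * ?Q + t) =
            (if j < jj \<or> j = jj \<and> t < Suc tt then F j t else ma m a_V (j * ?Q + t))"
          using I2 t index_inj[OF t ttQ, of j jj]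
          by (auto simp: I_def ev Q2 j2 vt less_Suc_eq)
      qed
    qed
    moreover have "mv m' v_Q = ?Q" using fr by auto
    ultimately show "I (Suc jj) 0 ((den P \<omega> (PFor v_t v_Q ?put) m')\<lparr>mv := (mv (den P \<omega> (PFor v_t v_Q ?put) m'))(v_j := Suc jj)\<rparr>)"
      by (auto simp: I_def less_Suc_eq)
  qed
  then show "j < mv m v_Q1 \<Longrightarrow> t < mv m v_Q \<Longrightarrow> ma (den P \<omega> (matrixP e) m) a_V (j * mv m v_Q + t) = F j t"
    by (simp add: I_def)
qed

lemma initP_correct:
  assumes "j < mv m v_Q1" "t < mv m v_Q"
  shows "ma (den P \<omega> initP m) a_V (j * mv m v_Q + t) = of_bool (j = t)"
  unfolding initP_def
  by (rule matrixP_correct[where F = "\<lambda>j t. of_bool (j = t)"]) (use assms in auto)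

lemma updateP_correct:
  assumes "j < mv m v_Q1" "t < mv m v_Q"
  shows "ma (den P \<omega> updateP m) a_V (j * mv m v_Q + t)
     = (ma m a_V (j * mv m v_Q + t) + ma m a_\<beta> j * ma m a_piv t) mod 2"
  unfolding updateP_def
  by (rule matrixP_correct[where F = "\<lambda>j t. (ma m a_V (j * mv m v_Q + t) + ma m a_\<beta> j * ma m a_piv t) mod 2"])
     (use assms in auto)

lemma copyP_correct:
  assumes "t < mv m v_Q"
  shows "ma (den P \<omega> copyP m) a_piv t = ma m a_V (mv m v_p * mv m v_Q + t)"
proof -
  have "(\<lambda>i m'. \<forall>t<i. ma m' a_piv t = ma m a_V (mv m v_p * mv m v_Q + t)) (mv m v_Q) (den P \<omega> copyP m)"
    unfolding copyP_def by (rule for_rule) (auto simp: less_Suc_eq)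
  then show ?thesis using assms by simp
qed

text \<open>For \<open>j < Q\<close> this tells whether direction \<open>j\<close> violates the
  homogeneous equation, for \<open>j = Q\<close> whether the particular solution violates the full
  one.\<close>

definition beta :: "mem \<Rightarrow> nat \<Rightarrow> nat" where
  "beta m j = ((\<Sum>t < mv m v_Q. ma m a_X (mv m v_i * mv m v_n + mv m v_i0 + t) * ma m a_V (j * mv m v_Q + t))
      + (if j = mv m v_Q then ma m a_Y (mv m v_i) else 0)) mod 2"

lemma betaP_correct:
  fixes P \<omega> m
  assumes Q1: "mv m v_Q1 = mv m v_Q + 1" and p: "mv m v_p = mv m v_Q"
  defines "m' \<equiv> den P \<omega> betaP m"
  shows "\<And>j. j \<le> mv m v_Q \<Longrightarrow> ma m' a_\<beta> j = beta m j" "mv m' v_p \<le> mv m v_Q"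
    "mv m' v_p < mv m v_Q \<Longrightarrow> beta m (mv m' v_p) = 1"
    "\<And>j. j < mv m v_Q \<Longrightarrow> beta m j \<noteq> 0 \<Longrightarrow> mv m' v_p < mv m v_Q"
proof -
  let ?Q = "mv m v_Q"
  define I where "I jj m' \<longleftrightarrow> (\<forall>j<jj. ma m' a_\<beta> j = beta m j) \<and> mv m' v_p \<le> ?Q
     \<and> (mv m' v_p < ?Q \<longrightarrow> beta m (mv m' v_p) = 1) \<and> (\<forall>j<jj. j < ?Q \<longrightarrow> beta m j \<noteq> 0 \<longrightarrow> mv m' v_p < ?Q)"
    for jj :: nat and m' :: mem
  have "I (mv m v_Q1) m'"
    unfolding betaP_def m'_def
  proof (rule for_rule)
    show "I 0 (m\<lparr>mv := (mv m)(v_j := 0)\<rparr>)" using p by (simp add: I_def)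
  next
    fix jj m2
    let ?body = "dotP ;;
     PPut a_\<beta> (Var v_j) (mod2 (Add (Var v_d) (Mul (Sub (Num 1) (Sub (Var v_Q) (Var v_j))) (Get a_Y (Var v_i))))) ;;
     PIf (Mul (Get a_\<beta> (Var v_j)) (Less (Var v_j) (Var v_Q))) (PAsg v_p (Var v_j)) PSkip"
    assume jj: "jj < mv m v_Q1" and vj: "mv m2 v_j = jj"
      and fr: "\<And>w. w \<notin> wv (PFor v_j v_Q1 ?body) \<Longrightarrow> mv m2 w = mv m w"
      and fa: "\<And>a. a \<notin> wa ?body \<Longrightarrow> ma m2 a = ma m a"
      and I: "I jj m2"
    let ?m3 = "den P \<omega> dotP m2"
    have fr': "mv m2 v_Q = ?Q" "mv m2 v_n = mv m v_n" "mv m2 v_i0 = mv m v_i0" "mv m2 v_i = mv m v_i"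
      "ma m2 a_X = ma m a_X" "ma m2 a_Y = ma m a_Y" "ma m2 a_V = ma m a_V"
      using fr fa by auto
    have fr3: "mv ?m3 v_Q = ?Q" "mv ?m3 v_i = mv m v_i" "mv ?m3 v_j = jj" "ma ?m3 = ma m2" "mv ?m3 v_p = mv m2 v_p"
      using fr' vj by (auto simp: den_frame den_frame_ma)
    have b: "(mv ?m3 v_d + (1 - (?Q - jj)) * ma m a_Y (mv m v_i)) mod 2 = beta m jj"
    proof -
      have "1 - (?Q - jj) = of_bool (jj = ?Q)" using jj Q1 by auto
      then show ?thesis
        unfolding dotP_correct beta_def using fr' vj by (auto simp: mod_add_left_eq)
    qed
    have b2: "beta m j < 2" for j by (simp add: beta_def)
    have b3: "beta m j \<noteq> 0 \<Longrightarrow> beta m j = 1" for j using b2[of j] by linarith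
    show "I (Suc jj) ((den P \<omega> ?body m2)\<lparr>mv := (mv (den P \<omega> ?body m2))(v_j := Suc jj)\<rparr>)"
      using I b b3[of jj] jj Q1 unfolding I_def by (auto simp: fr3 fr' less_Suc_eq)
  qed
  then have I: "I (?Q + 1) m'" using Q1 by simp
  show "\<And>j. j \<le> mv m v_Q \<Longrightarrow> ma m' a_\<beta> j = beta m j" "mv m' v_p \<le> mv m v_Q"
    "mv m' v_p < mv m v_Q \<Longrightarrow> beta m (mv m' v_p) = 1"
    using I unfolding I_def by (simp_all add: less_Suc_eq_le)
  show "mv m' v_p < mv m v_Q" if "j < mv m v_Q" "beta m j \<noteq> 0" for j
    using I that unfolding I_def by (meson less_add_one order.strict_trans)
qed

lemma elimP_correct:
  assumes Q1: "mv m v_Q1 = mv m v_Q + 1"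
  obtains p where "p \<le> mv m v_Q" "p < mv m v_Q \<Longrightarrow> beta m p = 1"
    "\<And>j. j < mv m v_Q \<Longrightarrow> beta m j \<noteq> 0 \<Longrightarrow> p < mv m v_Q"
    "\<And>j t. j \<le> mv m v_Q \<Longrightarrow> t < mv m v_Q \<Longrightarrow> ma (den P \<omega> elimP m) a_V (j * mv m v_Q + t)
       = (ma m a_V (j * mv m v_Q + t) + beta m j * ma m a_V (p * mv m v_Q + t)) mod 2"
proof -
  let ?m1 = "m\<lparr>mv := (mv m)(v_p := mv m v_Q)\<rparr>"
  let ?m2 = "den P \<omega> betaP ?m1"
  let ?m3 = "den P \<omega> copyP ?m2"
  have beta1: "beta ?m1 = beta m" by (simp add: beta_def fun_eq_iff)
  note b = betaP_correct[where m = ?m1 and P = P and \<omega> = \<omega>, unfolded beta1, simplified, OF Q1[simplified]]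
  show thesis
  proof (rule that[of "mv ?m2 v_p"])
    fix j t assume j: "j \<le> mv m v_Q" and t: "t < mv m v_Q"
    have eqs: "mv ?m3 v_Q = mv m v_Q" "mv ?m3 v_Q1 = mv m v_Q1" "mv ?m2 v_Q = mv m v_Q"
      "ma ?m3 a_V = ma m a_V" "ma ?m3 a_\<beta> = ma ?m2 a_\<beta>" "ma ?m2 a_V = ma m a_V"
      by (simp_all add: den_frame den_frame_ma)
    show "ma (den P \<omega> elimP m) a_V (j * mv m v_Q + t)
       = (ma m a_V (j * mv m v_Q + t) + beta m j * ma m a_V (mv ?m2 v_p * mv m v_Q + t)) mod 2"
      using updateP_correct[of j ?m3 t P \<omega>] copyP_correct[of t ?m2 P \<omega>] b(1)[OF j] j t Q1
      by (simp add: elimP_def eqs)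
  qed (use b in auto)
qed

text \<open>The solutions of the equations processed so far lie in \<open>V Q + span {V j | j < Q}\<close>, and a
  solution \<open>s\<close> always has the coefficients \<open>s j\<close>.\<close>

lemma eliminate:
  fixes V W :: "nat \<Rightarrow> nat \<Rightarrow> 'a :: comm_ring_1" and x s \<beta> :: "nat \<Rightarrow> 'a"
  assumes two: "\<And>z :: 'a. z + z = 0"
    and \<beta>: "\<And>j. j < Q \<Longrightarrow> \<beta> j = (\<Sum>t<Q. x t * V j t)" "\<beta> Q = (\<Sum>t<Q. x t * V Q t) + y"
    and p: "p < Q \<Longrightarrow> \<beta> p = 1" "\<And>j. j < Q \<Longrightarrow> \<beta> j \<noteq> 0 \<Longrightarrow> p < Q"
    and W: "\<And>j t. j \<le> Q \<Longrightarrow> t < Q \<Longrightarrow> W j t = V j t + \<beta> j * V p t"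
    and rep: "\<And>t. t < Q \<Longrightarrow> s t = V Q t + (\<Sum>j<Q. s j * V j t)"
    and y: "y = (\<Sum>t<Q. x t * s t)"
  shows "\<And>t. t < Q \<Longrightarrow> s t = W Q t + (\<Sum>j<Q. s j * W j t)"
    and "\<And>j. j < Q \<Longrightarrow> (\<Sum>t<Q. x t * W j t) = 0"
    and "\<And>x' j. j < Q \<Longrightarrow> (\<And>j. j < Q \<Longrightarrow> (\<Sum>t<Q. x' t * V j t) = 0) \<Longrightarrow> (\<Sum>t<Q. x' t * W j t) = 0"
proof -
  \<comment> \<open>Pairing the representation of \<open>s\<close> with \<open>x\<close> gives
    \<open>\<beta> Q = (\<Sum>j<Q. s j * \<beta> j)\<close> in characteristic 2. So adding
    \<open>\<beta> j * V p\<close> to every row changes the representation by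
    \<open>\<beta> Q * V p\<close> twice, that is, not at all.\<close>
  have "(\<Sum>t<Q. x t * s t) = (\<Sum>t<Q. x t * (V Q t + (\<Sum>j<Q. s j * V j t)))"
    using rep by (intro sum.cong) auto
  also have "\<dots> = (\<Sum>t<Q. x t * V Q t) + (\<Sum>t<Q. \<Sum>j<Q. s j * (x t * V j t))"
    by (simp add: distrib_left sum.distrib sum_distrib_left mult.left_commute)
  also have "(\<Sum>t<Q. \<Sum>j<Q. s j * (x t * V j t)) = (\<Sum>j<Q. s j * \<beta> j)"
    by (subst sum.swap) (simp add: \<beta>(1) sum_distrib_left)
  finally have e: "y = (\<Sum>t<Q. x t * V Q t) + (\<Sum>j<Q. s j * \<beta> j)"
    unfolding y[symmetric] .
  have "\<beta> Q + y + (\<Sum>j<Q. s j * \<beta> j) = (\<Sum>t<Q. x t * V Q t) + (y + y) + (\<Sum>j<Q. s j * \<beta> j)"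
    by (simp only: \<beta>(2) add.assoc)
  also have "\<dots> = (\<Sum>t<Q. x t * V Q t) + (\<Sum>j<Q. s j * \<beta> j)" unfolding two by simp
  also note e[symmetric]
  finally have "y = \<beta> Q + y + (\<Sum>j<Q. s j * \<beta> j)" by (rule sym)
  then have z: "\<beta> Q = (\<Sum>j<Q. s j * \<beta> j)"
    using two[of "\<beta> Q"] by (metis add.assoc add.left_commute add_cancel_right_right add_left_cancel)
  show "s t = W Q t + (\<Sum>j<Q. s j * W j t)" if "t < Q" for t
  proof -
    have "(\<Sum>j<Q. s j * W j t) = (\<Sum>j<Q. s j * V j t) + (\<Sum>j<Q. s j * \<beta> j) * V p t"
      using that by (simp add: W distrib_left sum.distrib sum_distrib_right mult.assoc)
    then have "W Q t + (\<Sum>j<Q. s j * W j t) = (V Q t + (\<Sum>j<Q. s j * V j t)) + (\<beta> Q * V p t + \<beta> Q * V p t)"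
      using that by (simp add: W z add.assoc add.left_commute add.commute)
    then show ?thesis using rep[OF that] two by simp
  qed
  have sumW: "(\<Sum>t<Q. x' t * W j t) = (\<Sum>t<Q. x' t * V j t) + \<beta> j * (\<Sum>t<Q. x' t * V p t)" if "j < Q" for x' j
    using that by (simp add: W distrib_left sum.distrib sum_distrib_left mult.left_commute)
  show "(\<Sum>t<Q. x t * W j t) = 0" if j: "j < Q" for j
  proof (cases "\<beta> j = 0")
    case False
    then have "p < Q" "\<beta> p = 1" using p j by auto
    then show ?thesis using sumW[OF j, of x] \<beta>(1)[of p] \<beta>(1)[OF j] two by simp
  qed (use sumW[OF j, of x] \<beta>(1)[OF j] in simp)
  show "(\<Sum>t<Q. x' t * W j t) = 0" if j: "j < Q" and h: "\<And>j. j < Q \<Longrightarrow> (\<Sum>t<Q. x' t * V j t) = 0" for x' j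
  proof (cases "\<beta> j = 0")
    case False
    then show ?thesis using p(2)[OF j] sumW[OF j, of x'] h[of p] h[of j] j by auto
  qed (use sumW[OF j, of x'] h[OF j] in simp)
qed

section \<open>Arithmetic in the two-element field\<close>

declare add_bit_eq_xor [simp del] mult_bit_eq_and [simp del]

lemma bit_add_self: "(z :: bit) + z = 0"
  by (cases z) simp_all

abbreviation par :: "nat \<Rightarrow> bit" where
  "par \<equiv> of_nat"

lemma par_mod2: "par (x mod 2) = par x"
proof -
  have "par x = par (2 * (x div 2) + x mod 2)" by simp
  then show ?thesis by (simp only: of_nat_add of_nat_mult of_nat_numeral bit_2_eq_0) simp
qed

lemma par_eq_iff: "par x = par y \<longleftrightarrow> x mod 2 = y mod 2"
proof -
  have "x mod 2 = 0 \<or> x mod 2 = 1" "y mod 2 = 0 \<or> y mod 2 = 1" by auto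
  then have "par (x mod 2) = par (y mod 2) \<longleftrightarrow> x mod 2 = y mod 2" by auto
  then show ?thesis by (simp only: par_mod2)
qed

section \<open>Correctness of the search on fixed tables of samples\<close>

locale solver =
  fixes P :: params and \<omega> :: "nat \<Rightarrow> bit Matrix.vec \<times> bit"
    and n Q cap B r :: nat
    and X :: "nat \<Rightarrow> nat \<Rightarrow> nat" and Y S :: "nat \<Rightarrow> nat"
  assumes B: "0 < B"
    and S01: "\<And>j. S j \<le> 1"
begin

abbreviation "m \<equiv> r * B"

definition ctx :: "mem \<Rightarrow> bool" where
  "ctx M \<longleftrightarrow> mv M v_n = n \<and> mv M v_Q = Q \<and> mv M v_Q1 = Q + 1 \<and> mv M v_m = m \<and> mv M v_cap = cap
     \<and> mv M v_B = B \<and> mv M v_NM = 2 ^ r \<and> (\<forall>i<m. \<forall>j<n. ma M a_X (i * n + j) = X i j)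
     \<and> (\<forall>i<m. ma M a_Y i = Y i) \<and> (\<forall>g<r. ma M a_pow g = 2 ^ g)"

lemma ctx_cong:
  assumes "ctx M" "\<And>w. w \<in> {v_n, v_Q, v_Q1, v_m, v_cap, v_B, v_NM} \<Longrightarrow> mv M' w = mv M w"
    "\<And>a. a \<in> {a_X, a_Y, a_pow} \<Longrightarrow> ma M' a = ma M a"
  shows "ctx M'"
  using assms by (simp add: ctx_def)

abbreviation V :: "mem \<Rightarrow> nat \<Rightarrow> nat \<Rightarrow> nat" where
  "V M j t \<equiv> ma M a_V (j * Q + t)"

lemma block_less: "i < m \<Longrightarrow> i div B < r"
  using B by (simp add: less_mult_imp_div_less)

lemma X_at:
  assumes "ctx M" "i < m" "i0 + Q \<le> n" "t < Q"
  shows "ma M a_X (i * n + i0 + t) = X i (i0 + t)"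
  using assms by (simp add: ctx_def add.assoc)

lemma beta_ctx:
  assumes "ctx M" "mv M v_i < m" "mv M v_i0 + Q \<le> n"
  shows "par (beta M j) = (\<Sum>t<Q. par (X (mv M v_i) (mv M v_i0 + t)) * par (V M j t))
     + (if j = Q then par (Y (mv M v_i)) else 0)"
proof -
  have "(\<Sum>t<Q. ma M a_X (mv M v_i * n + mv M v_i0 + t) * V M j t)
     = (\<Sum>t<Q. X (mv M v_i) (mv M v_i0 + t) * V M j t)"
    using X_at[OF assms(1,2,3)] by (intro sum.cong) auto
  then show ?thesis
    using assms(1,2) by (simp add: beta_def par_mod2 ctx_def)
qed

lemma dotP_ctx:
  assumes "ctx M" "mv M v_i < m" "mv M v_i0 + Q \<le> n"
  shows "mv (den P \<omega> dotP M) v_d = (\<Sum>t<Q. X (mv M v_i) (mv M v_i0 + t) * V M (mv M v_j) t) mod 2"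
proof -
  have "(\<Sum>t<Q. ma M a_X (mv M v_i * n + mv M v_i0 + t) * V M (mv M v_j) t)
     = (\<Sum>t<Q. X (mv M v_i) (mv M v_i0 + t) * V M (mv M v_j) t)"
    using X_at[OF assms(1,2,3)] by (intro sum.cong) auto
  then show ?thesis using assms(1) by (simp add: dotP_correct ctx_def)
qed

definition masked :: "nat \<Rightarrow> nat \<Rightarrow> bool" where
  "masked \<mu> i \<longleftrightarrow> odd (\<mu> div 2 ^ (i div B))"

definition consistent :: "nat \<Rightarrow> nat \<Rightarrow> bool" where
  "consistent i0 i \<longleftrightarrow> par (Y i) = (\<Sum>t<Q. par (X i (i0 + t)) * par (S (i0 + t)))"

text \<open>\<open>Z\<close> is the set of samples processed so far. The flag \<open>ok\<close> is
  false for masks that admit a noisy sample: then only the bound on the entries is known, but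
  \<open>winP_correct\<close> needs that for every mask.\<close>

definition cand_inv :: "nat \<Rightarrow> bool \<Rightarrow> nat set \<Rightarrow> mem \<Rightarrow> bool" where
  "cand_inv i0 ok Z M \<longleftrightarrow> (\<forall>j\<le>Q. \<forall>t<Q. V M j t \<le> 1) \<and> (ok \<longrightarrow>
     (\<forall>t<Q. par (S (i0 + t)) = par (V M Q t) + (\<Sum>j<Q. par (S (i0 + j)) * par (V M j t))) \<and>
     (\<forall>i\<in>Z. \<forall>j<Q. (\<Sum>t<Q. par (X i (i0 + t)) * par (V M j t)) = 0))"

lemma cand_inv_init:
  assumes "ctx M"
  shows "cand_inv i0 ok {} (den P \<omega> initP M)"
proof -
  have V: "V (den P \<omega> initP M) j t = of_bool (j = t)" if "j \<le> Q" "t < Q" for j t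
    using initP_correct[of j M t P \<omega>] assms that by (simp add: ctx_def)
  have "(\<Sum>j<Q. par (S (i0 + j)) * par (V (den P \<omega> initP M) j t)) = par (S (i0 + t))" if "t < Q" for t
  proof -
    have "(\<Sum>j<Q. par (S (i0 + j)) * par (V (den P \<omega> initP M) j t))
        = (\<Sum>j<Q. if j = t then par (S (i0 + j)) else 0)"
      using that by (intro sum.cong) (auto simp: V)
    also have "\<dots> = par (S (i0 + t))" using that by (subst sum.delta) auto
    finally show ?thesis .
  qed
  then show ?thesis unfolding cand_inv_def by (auto simp: V)
qed

lemma cand_inv_cong: "ma M' a_V = ma M a_V \<Longrightarrow> cand_inv i0 ok Z M' = cand_inv i0 ok Z M"
  by (simp add: cand_inv_def)

lemma cand_inv_upd: "cand_inv i0 ok Z (M\<lparr>mv := f\<rparr>) = cand_inv i0 ok Z M"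
  by (simp add: cand_inv_def)

lemma cand_inv_elim:
  assumes M: "ctx M" "mv M v_i < m" "mv M v_i0 = i0" "i0 + Q \<le> n"
    and inv: "cand_inv i0 ok Z M" and ok: "ok \<Longrightarrow> consistent i0 (mv M v_i)"
  shows "cand_inv i0 ok (insert (mv M v_i) Z) (den P \<omega> elimP M)"
proof -
  let ?W = "V (den P \<omega> elimP M)" and ?i = "mv M v_i"
  have Q1: "mv M v_Q1 = mv M v_Q + 1" and Q: "mv M v_Q = Q" using M by (auto simp: ctx_def)
  obtain p where p: "p \<le> Q" "p < Q \<Longrightarrow> beta M p = 1"
    "\<And>j. j < Q \<Longrightarrow> beta M j \<noteq> 0 \<Longrightarrow> p < Q"
    "\<And>j t. j \<le> Q \<Longrightarrow> t < Q \<Longrightarrow> ?W j t = (V M j t + beta M j * V M p t) mod 2"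
    by (rule elimP_correct[OF Q1, where P = P and \<omega> = \<omega>, unfolded Q]) blast
  have le1: "\<forall>j\<le>Q. \<forall>t<Q. ?W j t \<le> 1" using p(4) by auto
  have b2: "beta M j < 2" for j by (simp add: beta_def)
  have bn: "par (beta M j) \<noteq> 0 \<Longrightarrow> beta M j \<noteq> 0" for j by (metis of_nat_0)
  show ?thesis
  proof (cases ok)
    case True
    define Vp where "Vp j t = par (V M j t)" for j t
    define Wp where "Wp j t = par (?W j t)" for j t
    define bp where "bp j = par (beta M j)" for j
    define xp where "xp i t = par (X i (i0 + t))" for i t
    define sp where "sp t = par (S (i0 + t))" for t
    define yp where "yp = par (Y ?i)"
    have old: "\<And>t. t < Q \<Longrightarrow> sp t = Vp Q t + (\<Sum>j<Q. sp j * Vp j t)"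
       "\<And>i j. i \<in> Z \<Longrightarrow> j < Q \<Longrightarrow> (\<Sum>t<Q. xp i t * Vp j t) = 0"
      using inv True unfolding cand_inv_def Vp_def sp_def xp_def by blast+
    have \<beta>: "\<And>j. j < Q \<Longrightarrow> bp j = (\<Sum>t<Q. xp ?i t * Vp j t)" "bp Q = (\<Sum>t<Q. xp ?i t * Vp Q t) + yp"
      using beta_ctx[OF M(1,2)] M(3,4) by (simp_all add: bp_def xp_def Vp_def yp_def)
    have p1: "p < Q \<Longrightarrow> bp p = 1" using p(2) by (simp add: bp_def)
    have p2: "\<And>j. j < Q \<Longrightarrow> bp j \<noteq> 0 \<Longrightarrow> p < Q" using p(3) bn unfolding bp_def by blast
    have W: "\<And>j t. j \<le> Q \<Longrightarrow> t < Q \<Longrightarrow> Wp j t = Vp j t + bp j * Vp p t"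
      unfolding Wp_def Vp_def bp_def by (simp only: p(4) par_mod2 of_nat_add of_nat_mult)
    have y: "yp = (\<Sum>t<Q. xp ?i t * sp t)"
      using ok[OF True] by (simp only: consistent_def yp_def xp_def sp_def)
    note el = eliminate[where V = Vp and W = Wp and x = "xp ?i" and s = sp and \<beta> = bp and p = p
        and y = yp and Q = Q, OF bit_add_self]
    have "sp t = Wp Q t + (\<Sum>j<Q. sp j * Wp j t)" if "t < Q" for t
      by (rule el(1)) (use \<beta> p1 p2 W old(1) y that in blast)+
    moreover have "(\<Sum>t<Q. xp ?i t * Wp j t) = 0" if "j < Q" for j
      by (rule el(2)) (use \<beta> p1 p2 W old(1) y that in blast)+
    moreover have "(\<Sum>t<Q. xp i t * Wp j t) = 0" if "j < Q" "i \<in> Z" for i j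
      by (rule el(3)) (use \<beta> p1 p2 W old y that in blast)+
    ultimately have "\<forall>t<Q. sp t = Wp Q t + (\<Sum>j<Q. sp j * Wp j t)"
      "\<forall>i\<in>insert ?i Z. \<forall>j<Q. (\<Sum>t<Q. xp i t * Wp j t) = 0" by blast+
    then show ?thesis using le1 unfolding cand_inv_def Wp_def sp_def xp_def by blast
  qed (use le1 in \<open>simp add: cand_inv_def\<close>)
qed

definition full_rank :: "nat \<Rightarrow> nat set \<Rightarrow> bool" where
  "full_rank i0 Z \<longleftrightarrow> (\<forall>v. (\<forall>i\<in>Z. (\<Sum>t<Q. par (X i (i0 + t)) * par (v t)) = 0) \<longrightarrow> (\<forall>t<Q. par (v t) = 0))"

text \<open>Each direction solves all the homogeneous equations, so full rank makes it zero and only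
  row \<open>Q\<close> is left in the representation of \<open>S\<close>.\<close>

lemma cand_inv_final:
  assumes "cand_inv i0 True Z M" "full_rank i0 Z" "t < Q"
  shows "par (V M Q t) = par (S (i0 + t))"
proof -
  have "par (V M j t) = 0" if "j < Q" for j
  proof -
    have "\<forall>i\<in>Z. (\<Sum>t<Q. par (X i (i0 + t)) * par (V M j t)) = 0"
      using assms(1) that unfolding cand_inv_def by blast
    then have "\<forall>t<Q. par (V M j t) = 0"
      using assms(2)[unfolded full_rank_def, rule_format, of "V M j"] by blast
    then show ?thesis using assms(3) by blast
  qed
  then have "(\<Sum>j<Q. par (S (i0 + j)) * par (V M j t)) = 0" by simp
  moreover have "par (S (i0 + t)) = par (V M Q t) + (\<Sum>j<Q. par (S (i0 + j)) * par (V M j t))"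
    using assms unfolding cand_inv_def by blast
  ultimately show ?thesis by simp
qed

definition pool_ok :: "mem \<Rightarrow> bool" where
  "pool_ok M \<longleftrightarrow> mv M v_cnt \<le> cap \<and> (\<forall>a < mv M v_cnt. ma M a_pool a < m)"

lemma candP_correct:
  assumes M: "ctx M" "pool_ok M" "mv M v_i0 + Q \<le> n"
  defines "i0 \<equiv> mv M v_i0" and "Z \<equiv> {i \<in> ma M a_pool ` {..<mv M v_cnt}. masked (mv M v_mask) i}"
  shows "\<forall>t<Q. V (den P \<omega> candP M) Q t \<le> 1"
    "(\<And>i. i \<in> Z \<Longrightarrow> consistent i0 i) \<Longrightarrow> full_rank i0 Z \<Longrightarrow> t < Q \<Longrightarrow>
       par (V (den P \<omega> candP M) Q t) = par (S (i0 + t))"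
proof -
  define ok where "ok \<longleftrightarrow> (\<forall>i\<in>Z. consistent i0 i)"
  define \<mu> where "\<mu> = mv M v_mask"
  let ?c = "mv M v_cnt" and ?pl = "ma M a_pool"
  let ?Z = "\<lambda>a. {i \<in> ?pl ` {..<min a ?c}. masked \<mu> i}"
  let ?body = "PIf (Less (Var v_a) (Var v_cnt))
     (PAsg v_i (Get a_pool (Var v_a)) ;;
      PIf (mod2 (Quo (Var v_mask) (Get a_pow (Quo (Var v_i) (Var v_B))))) elimP PSkip) PSkip"
  let ?M1 = "den P \<omega> initP M"
  have M1: "mv ?M1 v_cap = cap" using M(1) by (simp add: den_frame ctx_def)
  have "(\<lambda>a (M' :: mem). cand_inv i0 ok (?Z a) M') (mv ?M1 v_cap) (den P \<omega> (PFor v_a v_cap ?body) ?M1)"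
  proof (rule for_rule)
    show "cand_inv i0 ok (?Z 0) (?M1\<lparr>mv := (mv ?M1)(v_a := 0)\<rparr>)"
      using cand_inv_init[OF M(1)] by (simp add: cand_inv_cong[of "?M1\<lparr>mv := (mv ?M1)(v_a := 0)\<rparr>" ?M1])
  next
    fix a and M' :: mem
    assume a: "a < mv ?M1 v_cap" and va: "mv M' v_a = a"
      and fr: "\<And>w. w \<notin> wv (PFor v_a v_cap ?body) \<Longrightarrow> mv M' w = mv ?M1 w"
      and fa: "\<And>b. b \<notin> wa ?body \<Longrightarrow> ma M' b = ma ?M1 b"
      and I: "cand_inv i0 ok (?Z a) M'"
    have fr': "mv M' v_cnt = ?c" "mv M' v_mask = \<mu>" "mv M' v_B = B" "mv M' v_i0 = i0"
      "ma M' a_pool = ?pl" "ma M' a_pow = ma M a_pow"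
      using fr fa M(1) by (auto simp: den_frame den_frame_ma ctx_def \<mu>_def i0_def)
    have ctx': "ctx M'" by (rule ctx_cong[OF M(1)]) (use fr fa in \<open>auto simp: den_frame den_frame_ma\<close>)
    let ?M2 = "den P \<omega> ?body M'"
    have "cand_inv i0 ok (?Z (Suc a)) ?M2"
    proof (cases "a < ?c")
      case False
      then have "?M2 = M'" using va fr' by simp
      moreover have "?Z (Suc a) = ?Z a" using False by (simp add: min_def)
      ultimately show ?thesis using I by simp
    next
      case True
      let ?i = "?pl a" and ?M3 = "M'\<lparr>mv := (mv M')(v_i := ?pl a)\<rparr>"
      have im: "?i < m" using M(2) True by (simp add: pool_ok_def)
      have Zs: "?Z (Suc a) = (if masked \<mu> ?i then insert ?i (?Z a) else ?Z a)"
        using True by (auto simp: less_Suc_eq min_def)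
      have pw: "ma M a_pow (?i div B) = 2 ^ (?i div B)" using M(1) block_less[OF im] by (simp add: ctx_def)
      have M2: "?M2 = (if masked \<mu> ?i then den P \<omega> elimP ?M3 else ?M3)"
        using True va fr' pw by (simp add: masked_def odd_iff_mod_2_eq_one)
      have I3: "cand_inv i0 ok (?Z a) ?M3" using I by (simp add: cand_inv_cong[of ?M3 M'])
      show ?thesis
      proof (cases "masked \<mu> ?i")
        case False
        then show ?thesis using I3 by (simp only: Zs M2 if_False)
      next
        case mk: True
        have "ctx ?M3" by (rule ctx_cong[OF ctx']) auto
        moreover have "ok \<Longrightarrow> consistent i0 ?i"
          using mk True unfolding ok_def Z_def \<mu>_def by blast
        ultimately have "cand_inv i0 ok (insert (mv ?M3 v_i) (?Z a)) (den P \<omega> elimP ?M3)"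
          using im fr' M(3) I3 by (intro cand_inv_elim) (auto simp: i0_def)
        then show ?thesis using mk by (simp only: Zs M2 if_True) simp
      qed
    qed
    then show "cand_inv i0 ok (?Z (Suc a)) (?M2\<lparr>mv := (mv ?M2)(v_a := Suc a)\<rparr>)"
      by (simp only: cand_inv_upd)
  qed
  moreover have "?Z cap = Z" using M(2) by (simp add: pool_ok_def min_absorb2 Z_def \<mu>_def)
  ultimately have fin: "cand_inv i0 ok Z (den P \<omega> candP M)" by (simp add: M1 candP_def)
  then show "\<forall>t<Q. V (den P \<omega> candP M) Q t \<le> 1" unfolding cand_inv_def by blast
  show "par (V (den P \<omega> candP M) Q t) = par (S (i0 + t))"
    if "\<And>i. i \<in> Z \<Longrightarrow> consistent i0 i" "full_rank i0 Z" "t < Q"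
  proof -
    have "ok = True" using that(1) by (auto simp: ok_def)
    then show ?thesis using cand_inv_final[OF _ that(2,3)] fin by simp
  qed
qed

definition dis :: "nat \<Rightarrow> (nat \<Rightarrow> nat) \<Rightarrow> nat set \<Rightarrow> nat" where
  "dis i0 u Z = card {i \<in> Z. odd ((\<Sum>t<Q. X i (i0 + t) * u t) + Y i)}"

lemma dis_cong: "(\<And>t. t < Q \<Longrightarrow> u t = u' t) \<Longrightarrow> dis i0 u Z = dis i0 u' Z"
proof -
  assume "\<And>t. t < Q \<Longrightarrow> u t = u' t"
  then have "(\<Sum>t<Q. X i (i0 + t) * u t) = (\<Sum>t<Q. X i (i0 + t) * u' t)" for i by (intro sum.cong) auto
  then show ?thesis by (simp add: dis_def)
qed

lemma disP_correct:
  assumes M: "ctx M" "pool_ok M" "mv M v_i0 + Q \<le> n" "inj_on (ma M a_pool) {..<mv M v_cnt}"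
  shows "mv (den P \<omega> disP M) v_e = dis (mv M v_i0) (V M Q) (ma M a_pool ` {..<mv M v_cnt})"
proof -
  let ?c = "mv M v_cnt" and ?pl = "ma M a_pool" and ?start = "mv M v_i0"
  let ?body = "PIf (Less (Var v_a) (Var v_cnt))
     (PAsg v_i (Get a_pool (Var v_a)) ;; dotP ;;
      PIf (mod2 (Add (Var v_d) (Get a_Y (Var v_i)))) (PAsg v_e (Add (Var v_e) (Num 1))) PSkip) PSkip"
  let ?M1 = "den P \<omega> (PAsg v_e (Num 0) ;; PAsg v_j (Var v_Q)) M"
  have M1: "mv ?M1 v_cap = cap" "mv ?M1 v_j = Q" using M(1) by (simp_all add: ctx_def)
  define I where "I a M' \<longleftrightarrow> mv M' v_e = dis ?start (V M Q) (?pl ` {..<min a ?c})" for a and M' :: mem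
  have "I (mv ?M1 v_cap) (den P \<omega> (PFor v_a v_cap ?body) ?M1)"
  proof (rule for_rule)
    show "I 0 (?M1\<lparr>mv := (mv ?M1)(v_a := 0)\<rparr>)"
      by (simp add: dis_def I_def)
  next
    fix a and M' :: mem
    assume a: "a < mv ?M1 v_cap" and va: "mv M' v_a = a"
      and fr: "\<And>w. w \<notin> wv (PFor v_a v_cap ?body) \<Longrightarrow> mv M' w = mv ?M1 w"
      and fa: "\<And>b. b \<notin> wa ?body \<Longrightarrow> ma M' b = ma ?M1 b"
      and "I a M'"
    then have I: "mv M' v_e = dis ?start (V M Q) (?pl ` {..<min a ?c})" by (simp add: I_def)
    have fr': "mv M' v_cnt = ?c" "mv M' v_i0 = ?start" "ma M' = ma M" "mv M' v_j = Q"
      using fr fa M1 by (auto simp: fun_eq_iff)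
    have ctx': "ctx M'" by (rule ctx_cong[OF M(1)]) (use fr fa in auto)
    have "mv (den P \<omega> ?body M') v_e = dis ?start (V M Q) (?pl ` {..<min (Suc a) ?c})"
    proof (cases "a < ?c")
      case False
      then show ?thesis using va fr' I by (simp add: min_def)
    next
      case True
      let ?i = "?pl a" and ?M3 = "M'\<lparr>mv := (mv M')(v_i := ?pl a)\<rparr>"
      let ?bad = "\<lambda>i. odd ((\<Sum>t<Q. X i (?start + t) * V M Q t) + Y i)"
      have im: "?i < m" using M(2) True by (simp add: pool_ok_def)
      have c3: "ctx ?M3" by (rule ctx_cong[OF ctx']) auto
      have d: "mv (den P \<omega> dotP ?M3) v_d = (\<Sum>t<Q. X ?i (?start + t) * V M Q t) mod 2"
        using dotP_ctx[OF c3] im M(3) by (simp add: fr')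
      have e: "mv (den P \<omega> ?body M') v_e = mv M' v_e + of_bool (?bad ?i)"
      proof -
        have Y: "ma M a_Y ?i = Y ?i" using M(1) im by (simp add: ctx_def)
        have "mv (den P \<omega> ?body M') v_e = (if (mv (den P \<omega> dotP ?M3) v_d + Y ?i) mod 2 \<noteq> 0
            then mv M' v_e + 1 else mv M' v_e)"
          using True va fr' Y by (simp add: den_frame den_frame_ma)
        also have "(mv (den P \<omega> dotP ?M3) v_d + Y ?i) mod 2 \<noteq> 0 \<longleftrightarrow> ?bad ?i"
          unfolding d mod_add_left_eq by (simp only: odd_iff_mod_2_eq_one not_mod_2_eq_0_eq_1)
        finally show ?thesis by simp
      qed
      have "?pl ` {..<min (Suc a) ?c} = insert ?i (?pl ` {..<min a ?c})"
        using True by (auto simp: less_Suc_eq min_def)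
      moreover have "?i \<notin> ?pl ` {..<min a ?c}"
      proof
        assume "?i \<in> ?pl ` {..<min a ?c}"
        then obtain x where x: "x < a" "?pl x = ?i" by auto
        have "x = a" by (rule inj_onD[OF M(4) x(2)]) (use x(1) True in simp_all)
        then show False using x(1) by simp
      qed
      ultimately have "dis ?start (V M Q) (?pl ` {..<min (Suc a) ?c})
          = dis ?start (V M Q) (?pl ` {..<min a ?c}) + of_bool (?bad ?i)"
      proof -
        assume h: "?pl ` {..<min (Suc a) ?c} = insert ?i (?pl ` {..<min a ?c})" "?i \<notin> ?pl ` {..<min a ?c}"
        have "{i \<in> insert ?i (?pl ` {..<min a ?c}). ?bad i}
           = (if ?bad ?i then insert ?i {i \<in> ?pl ` {..<min a ?c}. ?bad i} else {i \<in> ?pl ` {..<min a ?c}. ?bad i})"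
          by auto
        then show ?thesis using h by (simp add: dis_def)
      qed
      then show ?thesis using e I by simp
    qed
    then show "I (Suc a) ((den P \<omega> ?body M')\<lparr>mv := (mv (den P \<omega> ?body M'))(v_a := Suc a)\<rparr>)"
      unfolding I_def by (simp del: den.simps)
  qed
  then show ?thesis using M(2) M1 by (simp add: I_def disP_def pool_ok_def min_absorb2)
qed

definition inw :: "nat \<Rightarrow> nat \<Rightarrow> bool" where
  "inw i0 i \<longleftrightarrow> (\<forall>j<n. X i j \<noteq> 0 \<longrightarrow> i0 \<le> j \<and> j < i0 + Q)"

lemma scanP_correct:
  assumes M: "ctx M" "mv M v_i < m"
  shows "mv (den P \<omega> scanP M) v_z = 0 \<longleftrightarrow> inw (mv M v_i0) (mv M v_i)"
proof -
  let ?body = "PIf (Get a_X (Add (Mul (Var v_i) (Var v_n)) (Var v_j)))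
     (PIf (Less (Var v_j) (Var v_i0)) (PAsg v_z (Num 1))
        (PIf (Less (Var v_j) (Add (Var v_i0) (Var v_Q))) PSkip (PAsg v_z (Num 1)))) PSkip"
  let ?M1 = "den P \<omega> (PAsg v_z (Num 0)) M"
  have M1: "mv ?M1 v_n = n" using M(1) by (simp add: ctx_def)
  define I where "I a M' \<longleftrightarrow> (mv M' v_z = 0 \<longleftrightarrow> (\<forall>j'<a. X (mv M v_i) j' \<noteq> 0 \<longrightarrow> mv M v_i0 \<le> j' \<and> j' < mv M v_i0 + Q))" for a and M' :: mem
  have "I (mv ?M1 v_n) (den P \<omega> (PFor v_j v_n ?body) ?M1)"
  proof (rule for_rule)
    fix j and M' :: mem
    assume j: "j < mv ?M1 v_n" and vj: "mv M' v_j = j"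
      and fr: "\<And>w. w \<notin> wv (PFor v_j v_n ?body) \<Longrightarrow> mv M' w = mv ?M1 w"
      and fa: "\<And>b. b \<notin> wa ?body \<Longrightarrow> ma M' b = ma ?M1 b"
      and "I j M'"
    then have I: "mv M' v_z = 0 \<longleftrightarrow> (\<forall>j'<j. X (mv M v_i) j' \<noteq> 0 \<longrightarrow> mv M v_i0 \<le> j' \<and> j' < mv M v_i0 + Q)" by (simp add: I_def)
    have fr': "mv M' v_n = n" "mv M' v_i0 = mv M v_i0" "ma M' = ma M" "mv M' v_i = mv M v_i" "mv M' v_Q = Q"
      using fr fa M(1) by (auto simp: fun_eq_iff ctx_def)
    have "ma M a_X (mv M v_i * n + j) = X (mv M v_i) j" using M j by (simp add: ctx_def)
    then show "I (Suc j) ((den P \<omega> ?body M')\<lparr>mv := (mv (den P \<omega> ?body M'))(v_j := Suc j)\<rparr>)"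
    proof -
      have "mv (den P \<omega> ?body M') v_z = 0 \<longleftrightarrow> mv M' v_z = 0 \<and>
          (X (mv M v_i) j \<noteq> 0 \<longrightarrow> mv M v_i0 \<le> j \<and> j < mv M v_i0 + Q)"
        using \<open>ma M a_X (mv M v_i * n + j) = X (mv M v_i) j\<close> by (auto simp: fr' vj)
      then show ?thesis unfolding I I_def by (simp del: den.simps add: less_Suc_eq) blast
    qed
  qed (simp add: I_def)
  then show ?thesis using M(1) by (simp add: I_def scanP_def inw_def ctx_def)
qed

definition wset :: "nat \<Rightarrow> nat set" where
  "wset i0 = {i. i < m \<and> inw i0 i}"

text \<open>If the window set does not fit, the pool remains well formed but may miss samples; a
  bijection is claimed only below \<open>cap\<close>.\<close>

lemma poolP_correct:
  assumes M: "ctx M"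
  shows "pool_ok (den P \<omega> poolP M)"
    "card (wset (mv M v_i0)) \<le> cap \<Longrightarrow>
      bij_betw (ma (den P \<omega> poolP M) a_pool) {..<mv (den P \<omega> poolP M) v_cnt} (wset (mv M v_i0))"
proof -
  let ?i0 = "mv M v_i0"
  let ?w = "\<lambda>i. {i'. i' < i \<and> inw ?i0 i'}"
  let ?body = "scanP ;; PIf (Var v_z) PSkip (PIf (Less (Var v_cnt) (Var v_cap))
       (PPut a_pool (Var v_cnt) (Var v_i) ;; PAsg v_cnt (Add (Var v_cnt) (Num 1))) PSkip)"
  let ?M1 = "den P \<omega> (PAsg v_cnt (Num 0)) M"
  have M1: "mv ?M1 v_m = m" using M by (simp add: ctx_def)
  define I where "I i M' \<longleftrightarrow> mv M' v_cnt \<le> cap \<and> (\<forall>a < mv M' v_cnt. ma M' a_pool a < m) \<and>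
     (card (?w i) \<le> cap \<longrightarrow> bij_betw (ma M' a_pool) {..<mv M' v_cnt} (?w i))" for i and M' :: mem
  have I_upd: "I i (M'\<lparr>mv := (mv M')(v_i := x)\<rparr>) = I i M'" for i x M' by (simp add: I_def)
  have "I (mv ?M1 v_m) (den P \<omega> (PFor v_i v_m ?body) ?M1)"
  proof (rule for_rule)
    show "I 0 (?M1\<lparr>mv := (mv ?M1)(v_i := 0)\<rparr>)" by (simp add: I_def bij_betw_def)
  next
    fix i and M' :: mem
    assume i: "i < mv ?M1 v_m" and vi: "mv M' v_i = i"
      and fr: "\<And>w. w \<notin> wv (PFor v_i v_m ?body) \<Longrightarrow> mv M' w = mv ?M1 w"
      and fa: "\<And>b. b \<notin> wa ?body \<Longrightarrow> ma M' b = ma ?M1 b"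
      and II: "I i M'"
    have im: "i < m" using i M1 by simp
    have ctx': "ctx M'" by (rule ctx_cong[OF M]) (use fr fa in auto)
    have fr': "mv M' v_i0 = ?i0" "mv M' v_cap = cap" using fr M by (auto simp: ctx_def)
    have z: "mv (den P \<omega> scanP M') v_z = 0 \<longleftrightarrow> inw ?i0 i"
      using scanP_correct[OF ctx'] vi im fr' by simp
    let ?M2 = "den P \<omega> ?body M'"
    have wS: "?w (Suc i) = (if inw ?i0 i then insert i (?w i) else ?w i)" by (auto simp: less_Suc_eq)
    have finw: "finite (?w i)" "i \<notin> ?w i" by auto
    let ?c = "mv M' v_cnt"
    consider (out) "\<not> inw ?i0 i" | (full) "inw ?i0 i" "\<not> ?c < cap" | (push) "inw ?i0 i" "?c < cap" by blast
    then have "I (Suc i) ?M2"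
    proof cases
      case out
      then have "mv ?M2 v_cnt = ?c" "ma ?M2 a_pool = ma M' a_pool" using z by (auto simp: den_frame den_frame_ma)
      then show ?thesis using II out by (simp add: I_def wS)
    next
      case full
      then have e: "mv ?M2 v_cnt = ?c" "ma ?M2 a_pool = ma M' a_pool"
        using z fr' by (auto simp: den_frame den_frame_ma)
      have "\<not> card (?w (Suc i)) \<le> cap"
      proof
        assume h: "card (?w (Suc i)) \<le> cap"
        then have c: "card (?w i) < cap" using full finw by (simp add: wS)
        then have "card (?w i) = ?c" using II by (auto simp: I_def dest!: bij_betw_same_card)
        then show False using c full by simp
      qed
      then show ?thesis using II e by (simp add: I_def)
    next
      case push
      then have e: "mv ?M2 v_cnt = Suc ?c" "ma ?M2 a_pool = (ma M' a_pool)(?c := i)"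
        using z fr' vi by (auto simp: den_frame den_frame_ma)
      have "bij_betw (ma ?M2 a_pool) {..<Suc ?c} (?w (Suc i))" if h: "card (?w (Suc i)) \<le> cap"
      proof -
        have "card (?w i) \<le> cap" using h push finw by (simp add: wS)
        then have b: "bij_betw (ma M' a_pool) {..<?c} (?w i)" using II by (simp add: I_def)
        have "bij_betw ((ma M' a_pool)(?c := i)) {..<?c} (?w i)"
          using b by (subst bij_betw_cong[of _ _ "ma M' a_pool"]) auto
        then have "bij_betw ((ma M' a_pool)(?c := i)) ({..<?c} \<union> {?c}) (?w i \<union> {i})"
          by (intro bij_betw_combine) (auto simp: bij_betw_def)
        moreover have "{..<?c} \<union> {?c} = {..<Suc ?c}" "?w i \<union> {i} = ?w (Suc i)" using push by (auto simp: less_Suc_eq)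
        ultimately show ?thesis using e by simp
      qed
      then show ?thesis using II e push im by (auto simp: I_def less_Suc_eq)
    qed
    then show "I (Suc i) (?M2\<lparr>mv := (mv ?M2)(v_i := Suc i)\<rparr>)" by (simp only: I_upd)
  qed
  then have I: "I m (den P \<omega> poolP M)" by (simp add: M1[simplified] poolP_def)
  then show "pool_ok (den P \<omega> poolP M)" by (simp add: I_def pool_ok_def)
  show "bij_betw (ma (den P \<omega> poolP M) a_pool) {..<mv (den P \<omega> poolP M) v_cnt} (wset ?i0)"
    if "card (wset ?i0) \<le> cap"
    using I that by (simp add: I_def wset_def)
qed

lemma outP_correct:
  assumes M: "mv M v_Q = Q"
  shows "t < Q \<Longrightarrow> ma (den P \<omega> outP M) a_out (mv M v_i0 + t) = V M Q t"
    "\<not> (mv M v_i0 \<le> x \<and> x < mv M v_i0 + Q) \<Longrightarrow> ma (den P \<omega> outP M) a_out x = ma M a_out x"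
proof -
  have "(\<lambda>i (M' :: mem). (\<forall>t<i. ma M' a_out (mv M v_i0 + t) = V M Q t) \<and>
     (\<forall>x. \<not> (mv M v_i0 \<le> x \<and> x < mv M v_i0 + i) \<longrightarrow> ma M' a_out x = ma M a_out x)) (mv M v_Q) (den P \<omega> outP M)"
    unfolding outP_def by (rule for_rule) (use M in \<open>auto simp: less_Suc_eq\<close>)
  then show "t < Q \<Longrightarrow> ma (den P \<omega> outP M) a_out (mv M v_i0 + t) = V M Q t"
    "\<not> (mv M v_i0 \<le> x \<and> x < mv M v_i0 + Q) \<Longrightarrow> ma (den P \<omega> outP M) a_out x = ma M a_out x"
    using M by auto
qed

text \<open>What a good window provides in terms of the tables: \<open>\<mu>\<close> will be the
  mask of all clean blocks.\<close>

definition good_at :: "nat \<Rightarrow> bool" where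
  "good_at i0 \<longleftrightarrow> card (wset i0) \<le> cap \<and>
     (\<forall>u. (\<forall>t<Q. u t \<le> 1) \<longrightarrow> (\<exists>t<Q. u t \<noteq> S (i0 + t)) \<longrightarrow>
         dis i0 (\<lambda>t. S (i0 + t)) (wset i0) < dis i0 u (wset i0)) \<and>
     (\<exists>\<mu> < 2 ^ r. (\<forall>i \<in> wset i0. masked \<mu> i \<longrightarrow> consistent i0 i) \<and>
         full_rank i0 {i \<in> wset i0. masked \<mu> i})"

text \<open>After the mask \<open>\<mu>\<close> the best count is at most that of the hidden vector.
  The stored output attains the best count, and any other vector with entries 0 and 1 is strictly
  worse.\<close>

lemma winP_correct:
  assumes M: "ctx M" "mv M v_i0 + Q \<le> n" and good: "good_at (mv M v_i0)"
  shows "t < Q \<Longrightarrow> ma (den P \<omega> winP M) a_out (mv M v_i0 + t) = S (mv M v_i0 + t)"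
    "\<not> (mv M v_i0 \<le> x \<and> x < mv M v_i0 + Q) \<Longrightarrow> ma (den P \<omega> winP M) a_out x = ma M a_out x"
proof -
  define i0 where "i0 = mv M v_i0"
  let ?Mp = "den P \<omega> poolP M"
  let ?M1 = "den P \<omega> (PAsg v_best (Add (Var v_cap) (Num 1))) ?Mp"
  define Z where "Z = wset i0"
  have good': "card Z \<le> cap"
     "\<And>u. (\<forall>t<Q. u t \<le> 1) \<Longrightarrow> (\<exists>t<Q. u t \<noteq> S (i0 + t)) \<Longrightarrow> dis i0 (\<lambda>t. S (i0 + t)) Z < dis i0 u Z"
    using good unfolding good_at_def i0_def Z_def by blast+
  obtain \<mu> where \<mu>: "\<mu> < 2 ^ r" "\<forall>i\<in>Z. masked \<mu> i \<longrightarrow> consistent i0 i" "full_rank i0 {i \<in> Z. masked \<mu> i}"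
    using good unfolding good_at_def i0_def Z_def by blast
  have pool: "pool_ok ?Mp" "bij_betw (ma ?Mp a_pool) {..<mv ?Mp v_cnt} Z"
    using poolP_correct[OF M(1)] good'(1) by (auto simp: i0_def Z_def)
  have img: "ma ?Mp a_pool ` {..<mv ?Mp v_cnt} = Z" and inj: "inj_on (ma ?Mp a_pool) {..<mv ?Mp v_cnt}"
    using pool(2) by (auto simp: bij_betw_def)
  let ?dS = "dis i0 (\<lambda>t. S (i0 + t)) Z"
  have finZ: "finite Z" by (simp add: Z_def wset_def)
  have dScap: "?dS \<le> cap"
    unfolding dis_def by (rule order.trans[OF card_mono[OF finZ] good'(1)]) auto
  have M1: "ctx ?M1" "mv ?M1 v_i0 = i0" "mv ?M1 v_best = cap + 1" "mv ?M1 v_NM = 2 ^ r"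
    "ma ?M1 a_out = ma M a_out" "mv ?M1 v_cnt = mv ?Mp v_cnt" "ma ?M1 a_pool = ma ?Mp a_pool"
  proof -
    show "ctx ?M1" by (rule ctx_cong[OF M(1)]) (auto simp: den_frame den_frame_ma)
    then show "mv ?M1 v_best = cap + 1" "mv ?M1 v_NM = 2 ^ r" by (auto simp: ctx_def)
  qed (auto simp: den_frame den_frame_ma i0_def)
  define I where "I b M' \<longleftrightarrow> (\<mu> < b \<longrightarrow> mv M' v_best \<le> ?dS)
     \<and> (mv M' v_best \<le> cap \<longrightarrow> (\<forall>t<Q. ma M' a_out (i0 + t) \<le> 1) \<and> dis i0 (\<lambda>t. ma M' a_out (i0 + t)) Z = mv M' v_best)
     \<and> (\<forall>x. \<not> (i0 \<le> x \<and> x < i0 + Q) \<longrightarrow> ma M' a_out x = ma M a_out x)" for b and M' :: mem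
  have I_upd: "I i (M'\<lparr>mv := (mv M')(v_mask := x)\<rparr>) = I i M'" for i x M' by (simp add: I_def)
  have "I (mv ?M1 v_NM) (den P \<omega> (PFor v_mask v_NM maskP) ?M1)"
  proof (rule for_rule)
    show "I 0 (?M1\<lparr>mv := (mv ?M1)(v_mask := 0)\<rparr>)" using M1 by (simp add: I_def)
  next
    fix b and M' :: mem
    assume b: "b < mv ?M1 v_NM" and vb: "mv M' v_mask = b"
      and fr: "\<And>w. w \<notin> wv (PFor v_mask v_NM maskP) \<Longrightarrow> mv M' w = mv ?M1 w"
      and fa: "\<And>b. b \<notin> wa maskP \<Longrightarrow> ma M' b = ma ?M1 b"
      and II: "I b M'"
    have ctx': "ctx M'" by (rule ctx_cong[OF M1(1)]) (use fr fa in auto)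
    have fr': "mv M' v_i0 = i0" "mv M' v_cnt = mv ?Mp v_cnt" "ma M' a_pool = ma ?Mp a_pool"
      using fr fa M1 by auto
    have pok: "pool_ok M'" using pool(1) fr' by (simp add: pool_ok_def)
    have iQ: "mv M' v_i0 + Q \<le> n" using M(2) fr' by (simp add: i0_def)
    let ?C = "den P \<omega> candP M'" and ?D = "den P \<omega> disP (den P \<omega> candP M')"
    have cC: "ctx ?C" by (rule ctx_cong[OF ctx']) (auto simp: den_frame den_frame_ma)
    have frC: "mv ?C v_i0 = i0" "mv ?C v_cnt = mv ?Mp v_cnt" "ma ?C a_pool = ma ?Mp a_pool"
      "ma ?C a_out = ma M' a_out" "mv ?C v_best = mv M' v_best" "mv ?C v_Q = Q"
      using fr' ctx' by (auto simp: den_frame den_frame_ma ctx_def)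
    have pC: "pool_ok ?C" using pool(1) frC by (simp add: pool_ok_def)
    have C01: "\<forall>t<Q. V ?C Q t \<le> 1" using candP_correct(1)[OF ctx' pok iQ] .
    have frD: "mv ?D v_i0 = i0" "ma ?D = ma ?C" "mv ?D v_best = mv M' v_best" "mv ?D v_Q = Q"
      using frC by (auto simp: den_frame den_frame_ma fun_eq_iff)
    have eD: "mv ?D v_e = dis i0 (V ?C Q) Z"
      using disP_correct[OF cC pC] M(2) frC img inj by (simp add: i0_def)
    let ?upd = "dis i0 (V ?C Q) Z < mv M' v_best"
    let ?M2 = "den P \<omega> maskP M'"
    let ?D' = "?D\<lparr>mv := (mv ?D)(v_best := mv ?D v_e)\<rparr>"
    have M2: "?M2 = (if ?upd then den P \<omega> outP ?D' else ?D)"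
      by (simp add: maskP_def eD frD)
    have \<mu>b: "dis i0 (V ?C Q) Z = ?dS" if "b = \<mu>"
    proof -
      have "V ?C Q t = S (i0 + t)" if t: "t < Q" for t
      proof -
        have "par (V ?C Q t) = par (S (i0 + t))"
          using candP_correct(2)[OF ctx' pok iQ, of t] \<mu>(2,3) t \<open>b = \<mu>\<close> by (simp add: fr' vb img)
        then have "V ?C Q t mod 2 = S (i0 + t) mod 2" by (simp only: par_eq_iff)
        moreover have "V ?C Q t \<le> 1" using C01 t by blast
        moreover have "S (i0 + t) \<le> 1" by (rule S01)
        moreover have "x mod 2 = x" if "x \<le> 1" for x :: nat using that by simp
        ultimately show ?thesis by metis
      qed
      then show ?thesis by (intro dis_cong) auto
    qed
    have "I (Suc b) ?M2"
    proof (cases ?upd)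
      case True
      have o: "ma ?M2 a_out (i0 + t) = V ?C Q t" if "t < Q" for t
        using outP_correct(1)[of ?D' t] that True frD by (simp add: M2)
      have o': "ma ?M2 a_out x = ma M' a_out x" if "\<not> (i0 \<le> x \<and> x < i0 + Q)" for x
        using outP_correct(2)[of ?D' x] that True frD frC by (simp add: M2)
      have best: "mv ?M2 v_best = dis i0 (V ?C Q) Z"
        using True eD by (simp add: M2 den_frame)
      have "dis i0 (\<lambda>t. ma ?M2 a_out (i0 + t)) Z = dis i0 (V ?C Q) Z"
        by (rule dis_cong) (rule o)
      moreover have "\<mu> < Suc b \<Longrightarrow> dis i0 (V ?C Q) Z \<le> ?dS"
        using II True \<mu>b by (auto simp: I_def less_Suc_eq)
      ultimately show ?thesis using II C01 o o' best by (auto simp: I_def)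
    next
      case False
      then have "mv ?M2 v_best = mv M' v_best" "ma ?M2 a_out = ma M' a_out"
        by (simp_all add: M2 frD frC)
      moreover have "\<mu> < Suc b \<Longrightarrow> mv M' v_best \<le> ?dS"
        using II False \<mu>b by (auto simp: I_def less_Suc_eq not_less)
      ultimately show ?thesis using II by (auto simp: I_def)
    qed
    then show "I (Suc b) (?M2\<lparr>mv := (mv ?M2)(v_mask := Suc b)\<rparr>)" by (simp only: I_upd)
  qed
  then have "I (2 ^ r) (den P \<omega> (PFor v_mask v_NM maskP) ?M1)" unfolding M1(4) .
  then have I: "I (2 ^ r) (den P \<omega> winP M)" by (simp only: winP_def den.simps)
  let ?W = "den P \<omega> winP M"
  have le: "mv ?W v_best \<le> ?dS" using I \<mu>(1) by (simp add: I_def)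
  then have c: "mv ?W v_best \<le> cap" using dScap by simp
  then have u: "\<forall>t<Q. ma ?W a_out (i0 + t) \<le> 1" "dis i0 (\<lambda>t. ma ?W a_out (i0 + t)) Z \<le> ?dS"
    using I le by (auto simp: I_def)
  have "\<not> (\<exists>t<Q. ma ?W a_out (i0 + t) \<noteq> S (i0 + t))"
    using good'(2)[of "\<lambda>t. ma ?W a_out (i0 + t)"] u by auto
  then show "t < Q \<Longrightarrow> ma ?W a_out (mv M v_i0 + t) = S (mv M v_i0 + t)" by (auto simp: i0_def)
  show "\<not> (mv M v_i0 \<le> x \<and> x < mv M v_i0 + Q) \<Longrightarrow> ma ?W a_out x = ma M a_out x"
    using I by (simp add: I_def i0_def)
qed

text \<open>Successive windows overlap in all but one position. Every window writes correct values,
  so overwriting is harmless, and the window starting at \<open>n - Q\<close> covers the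
  end.\<close>

lemma solveP_correct:
  assumes M: "ctx M" "mv M v_nw = n - Q + 1" and Q: "0 < Q" "Q \<le> n"
    and good: "\<And>i0. i0 + Q \<le> n \<Longrightarrow> good_at i0" and x: "x < n"
  shows "ma (den P \<omega> solveP M) a_out x = S x"
proof -
  have "(\<lambda>i (M' :: mem). \<forall>i0<i. \<forall>t<Q. ma M' a_out (i0 + t) = S (i0 + t)) (mv M v_nw) (den P \<omega> solveP M)"
    unfolding solveP_def
  proof (rule for_rule)
    fix i and M' :: mem
    assume i: "i < mv M v_nw" and vi: "mv M' v_i0 = i"
      and fr: "\<And>w. w \<notin> wv (PFor v_i0 v_nw winP) \<Longrightarrow> mv M' w = mv M w"
      and fa: "\<And>b. b \<notin> wa winP \<Longrightarrow> ma M' b = ma M b"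
      and I: "\<forall>i0<i. \<forall>t<Q. ma M' a_out (i0 + t) = S (i0 + t)"
    have ctx': "ctx M'" by (rule ctx_cong[OF M(1)]) (use fr fa in auto)
    have iQ: "mv M' v_i0 + Q \<le> n" using i vi M(2) Q by simp
    note w = winP_correct[OF ctx' iQ good[OF iQ], unfolded vi]
    show "\<forall>i0<Suc i. \<forall>t<Q. ma ((den P \<omega> winP M')\<lparr>mv := (mv (den P \<omega> winP M'))(v_i0 := Suc i)\<rparr>) a_out (i0 + t) = S (i0 + t)"
    proof (intro allI impI)
      fix i0 t assume h: "i0 < Suc i" "t < Q"
      have "ma (den P \<omega> winP M') a_out (i0 + t) = S (i0 + t)"
      proof (cases "i \<le> i0 + t")
        case True
        then have "i0 + t = i + (i0 + t - i)" "i0 + t - i < Q" using h by auto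
        then show ?thesis using w(1)[of "i0 + t - i"] by metis
      next
        case False
        then have "ma (den P \<omega> winP M') a_out (i0 + t) = ma M' a_out (i0 + t)" by (intro w(2)) auto
        moreover have "i0 < i" using False by simp
        ultimately show ?thesis using I h by simp
      qed
      then show "ma ((den P \<omega> winP M')\<lparr>mv := (mv (den P \<omega> winP M'))(v_i0 := Suc i)\<rparr>) a_out (i0 + t) = S (i0 + t)" by simp
    qed
  qed simp
  then have all: "\<And>i0 t. i0 < n - Q + 1 \<Longrightarrow> t < Q \<Longrightarrow> ma (den P \<omega> solveP M) a_out (i0 + t) = S (i0 + t)"
    using M(2) by simp
  show ?thesis
  proof (cases "x < n - Q")
    case True
    then show ?thesis using all[of x 0] Q by simp
  next
    case False
    then show ?thesis using all[of "n - Q" "x - (n - Q)"] x Q by simp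
  qed
qed

end

section \<open>Good tapes\<close>

text \<open>The support and the noise bit of a sample. Their law does not depend on
  \<open>s\<close>, which is why the probabilistic part never mentions the hidden vector.\<close>

definition dec :: "nat \<Rightarrow> bit Matrix.vec \<Rightarrow> bit Matrix.vec \<times> bit \<Rightarrow> nat set \<times> bool" where
  "dec n s z = ({j. j < n \<and> vec_index (fst z) j \<noteq> 0}, snd z \<noteq> scalar_prod (fst z) s)"

lemma par_nat_of_bit: "par (nat_of_bit b) = b"
  by (cases b) (simp_all add: nat_of_bit_def)

lemma par_eq_1: "par x = 1 \<longleftrightarrow> odd x"
  using par_eq_iff[of x 1] by (simp add: odd_iff_mod_2_eq_one)

lemma mask_exists: "\<exists>\<mu> :: nat. \<mu> < 2 ^ r \<and> (\<forall>g < r. odd (\<mu> div 2 ^ g) \<longleftrightarrow> g \<in> C)"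
proof -
  let ?bs = "map (\<lambda>g. g \<in> C) [0..<r]"
  let ?\<mu> = "horner_sum of_bool 2 ?bs :: nat"
  have "?\<mu> < 2 ^ r" using horner_sum_bound[of ?bs] by simp
  moreover have "\<forall>g < r. odd (?\<mu> div 2 ^ g) \<longleftrightarrow> g \<in> C"
    using bit_horner_sum_bit_iff[of ?bs, where 'a = nat] by (auto simp: bit_iff_odd)
  ultimately show ?thesis by blast
qed

locale tape =
  fixes P :: params and \<omega> :: "nat \<Rightarrow> bit Matrix.vec \<times> bit" and n Q cap B r :: nat and s :: "bit Matrix.vec"
  assumes s: "s \<in> carrier_vec n" and B0: "0 < B"
begin

definition "X i j = nat_of_bit (vec_index (fst (\<omega> i)) j)"
definition "Y i = nat_of_bit (snd (\<omega> i))"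
definition "S j = nat_of_bit (vec_index s j)"

sublocale solver P \<omega> n Q cap B r X Y S
  by unfold_locales (simp_all add: B0 S_def nat_of_bit_def)

abbreviation "\<omega>' \<equiv> \<lambda>i. dec n s (\<omega> i)"

lemma X_nonzero: "j < n \<Longrightarrow> X i j \<noteq> 0 \<longleftrightarrow> j \<in> fst (\<omega>' i)"
  by (simp add: X_def dec_def nat_of_bit_def)

lemma X_le: "X i j \<le> 1"
  by (simp add: X_def nat_of_bit_def)

lemma inw_iff: "inw i0 i \<longleftrightarrow> fst (\<omega>' i) \<subseteq> {i0..<i0 + Q}"
proof -
  have "fst (\<omega>' i) \<subseteq> {..<n}" by (auto simp: dec_def)
  then show ?thesis unfolding inw_def using X_nonzero by fastforce
qed

lemma par_X: "i0 + t < n \<Longrightarrow> par (X i (i0 + t)) * par (w t) = of_bool (i0 + t \<in> fst (\<omega>' i) \<and> odd (w t))"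
  using X_nonzero[of "i0 + t" i] X_le[of i "i0 + t"] par_eq_1[of "w t"]
  by (cases "X i (i0 + t) = 0") (auto simp: le_Suc_eq)

lemma par_sum_card:
  assumes "i0 + Q \<le> n"
  shows "(\<Sum>t<Q. par (X i (i0 + t)) * par (w t))
     = par (card (fst (\<omega>' i) \<inter> (\<lambda>t. i0 + t) ` {t. t < Q \<and> odd (w t)}))"
proof -
  have "(\<Sum>t<Q. par (X i (i0 + t)) * par (w t)) = (\<Sum>t<Q. of_bool (i0 + t \<in> fst (\<omega>' i) \<and> odd (w t)))"
    using assms by (intro sum.cong refl par_X) auto
  also have "\<dots> = par (card {t. t < Q \<and> i0 + t \<in> fst (\<omega>' i) \<and> odd (w t)})"
    by (simp add: sum.If_cases Int_def)
  also have "card {t. t < Q \<and> i0 + t \<in> fst (\<omega>' i) \<and> odd (w t)}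
      = card ((\<lambda>t. i0 + t) ` {t. t < Q \<and> i0 + t \<in> fst (\<omega>' i) \<and> odd (w t)})"
    by (subst card_image) auto
  also have "(\<lambda>t. i0 + t) ` {t. t < Q \<and> i0 + t \<in> fst (\<omega>' i) \<and> odd (w t)}
      = fst (\<omega>' i) \<inter> (\<lambda>t. i0 + t) ` {t. t < Q \<and> odd (w t)}" by auto
  finally show ?thesis .
qed

lemma product_in_window:
  assumes "i0 + Q \<le> n" "inw i0 i"
  shows "scalar_prod (fst (\<omega> i)) s = (\<Sum>t<Q. par (X i (i0 + t)) * par (S (i0 + t)))"
proof -
  have "scalar_prod (fst (\<omega> i)) s = (\<Sum>j\<in>{0..<n}. vec_index (fst (\<omega> i)) j * vec_index s j)"
    using s by (simp add: scalar_prod_def)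
  also have "\<dots> = (\<Sum>j\<in>{i0..<i0 + Q}. vec_index (fst (\<omega> i)) j * vec_index s j)"
  proof (rule sum.mono_neutral_right)
    show "\<forall>j\<in>{0..<n} - {i0..<i0 + Q}. vec_index (fst (\<omega> i)) j * vec_index s j = 0"
    proof
      fix j assume j: "j \<in> {0..<n} - {i0..<i0 + Q}"
      then have "j \<notin> fst (\<omega>' i)" using assms(2) unfolding inw_iff by auto
      then have "vec_index (fst (\<omega> i)) j = 0" using j by (simp add: dec_def)
      then show "vec_index (fst (\<omega> i)) j * vec_index s j = 0" by simp
    qed
  qed (use assms in auto)
  also have "\<dots> = (\<Sum>t<Q. vec_index (fst (\<omega> i)) (i0 + t) * vec_index s (i0 + t))"
    by (rule sum.reindex_bij_witness[of _ "\<lambda>t. i0 + t" "\<lambda>j. j - i0"]) auto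
  finally show ?thesis by (simp add: X_def S_def par_nat_of_bit)
qed

lemma consistent_iff:
  assumes "i0 + Q \<le> n" "inw i0 i"
  shows "consistent i0 i \<longleftrightarrow> \<not> snd (\<omega>' i)"
  using product_in_window[OF assms] by (simp add: consistent_def Y_def par_nat_of_bit dec_def)

text \<open>The label is the product with \<open>s\<close> plus noise, so the error of a candidate
  \<open>u\<close> is the noise plus the product with \<open>u + s\<close>, whose support is the set
  of differences.\<close>

lemma disagree_iff:
  assumes i0: "i0 + Q \<le> n" "inw i0 i" and u: "\<forall>t<Q. u t \<le> 1"
  shows "odd ((\<Sum>t<Q. X i (i0 + t) * u t) + Y i) \<longleftrightarrow>
     snd (\<omega>' i) \<noteq> odd (card (fst (\<omega>' i) \<inter> (\<lambda>t. i0 + t) ` {t. t < Q \<and> u t \<noteq> S (i0 + t)}))"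
proof -
  let ?V = "(\<lambda>t. i0 + t) ` {t. t < Q \<and> u t \<noteq> S (i0 + t)}"
  let ?w = "\<lambda>t. u t + S (i0 + t)"
  have odd_w: "odd (?w t) \<longleftrightarrow> u t \<noteq> S (i0 + t)" if "t < Q" for t
  proof -
    have "u t = 0 \<or> u t = 1" "S (i0 + t) = 0 \<or> S (i0 + t) = 1"
      using u that S01[of "i0 + t"] by (auto simp: le_Suc_eq)
    then show ?thesis by auto
  qed
  have V: "?V = (\<lambda>t. i0 + t) ` {t. t < Q \<and> odd (?w t)}" using odd_w by auto
  have "(\<Sum>t<Q. par (X i (i0 + t)) * par (u t)) + (\<Sum>t<Q. par (X i (i0 + t)) * par (S (i0 + t)))
     = par (card (fst (\<omega>' i) \<inter> ?V))"
    unfolding V par_sum_card[OF i0(1), of i ?w, symmetric] by (simp add: distrib_left sum.distrib)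
  then have e: "(\<Sum>t<Q. par (X i (i0 + t)) * par (u t)) + scalar_prod (fst (\<omega> i)) s = par (card (fst (\<omega>' i) \<inter> ?V))"
    by (simp only: product_in_window[OF i0])
  have "odd ((\<Sum>t<Q. X i (i0 + t) * u t) + Y i) \<longleftrightarrow> (\<Sum>t<Q. par (X i (i0 + t)) * par (u t)) + snd (\<omega> i) = 1"
    by (subst par_eq_1[symmetric]) (simp add: Y_def par_nat_of_bit)
  also have "\<dots> \<longleftrightarrow> snd (\<omega>' i) \<noteq> odd (card (fst (\<omega>' i) \<inter> ?V))"
  proof -
    let ?a = "\<Sum>t<Q. par (X i (i0 + t)) * par (u t)" and ?b = "scalar_prod (fst (\<omega> i)) s" and ?y = "snd (\<omega> i)"
    have "odd (card (fst (\<omega>' i) \<inter> ?V)) \<longleftrightarrow> ?a + ?b = 1" by (simp only: e par_eq_1)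
    moreover have "snd (\<omega>' i) \<longleftrightarrow> ?y \<noteq> ?b" by (simp add: dec_def)
    moreover have "?a + ?y = 1 \<longleftrightarrow> (?y \<noteq> ?b) \<noteq> (?a + ?b = 1)"
      by (cases ?a; cases ?b; cases ?y) simp_all
    ultimately show ?thesis by simp
  qed
  finally show ?thesis .
qed

lemma good_at_of_good_window:
  assumes i0: "i0 + Q \<le> n" and good: "good_window {i0..<i0 + Q} r B cap \<omega>'"
  shows "good_at i0"
proof -
  let ?I = "{i0..<i0 + Q}"
  let ?h = "\<lambda>i. i < r * B \<and> fst (\<omega>' i) \<subseteq> ?I"
  have ws: "wset i0 = {i. ?h i}" by (auto simp: wset_def inw_iff)
  have g0: "card {i. ?h i} \<le> cap"
    and g1: "\<And>V. V \<subseteq> ?I \<Longrightarrow> V \<noteq> {} \<Longrightarrow>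
        card {i. i < r * B \<and> fst (\<omega>' i) \<subseteq> ?I \<and> odd (card (fst (\<omega>' i) \<inter> V)) \<and> snd (\<omega>' i)}
          < card {i. i < r * B \<and> fst (\<omega>' i) \<subseteq> ?I \<and> odd (card (fst (\<omega>' i) \<inter> V)) \<and> \<not> snd (\<omega>' i)}"
    and g2: "\<And>V. V \<subseteq> ?I \<Longrightarrow> V \<noteq> {} \<Longrightarrow>
        \<exists>i < r * B. fst (\<omega>' i) \<subseteq> ?I \<and> odd (card (fst (\<omega>' i) \<inter> V)) \<and> clean_block ?I B \<omega>' (i div B)"
    using good unfolding good_window_def by blast+
  show ?thesis
    unfolding good_at_def
  proof (intro conjI allI impI)
    show "card (wset i0) \<le> cap" using g0 ws by simp
  next
    fix u :: "nat \<Rightarrow> nat" assume u: "\<forall>t<Q. u t \<le> 1" and ne: "\<exists>t<Q. u t \<noteq> S (i0 + t)"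
    let ?V = "(\<lambda>t. i0 + t) ` {t. t < Q \<and> u t \<noteq> S (i0 + t)}"
    let ?o = "\<lambda>i. odd (card (fst (\<omega>' i) \<inter> ?V))"
    have V: "?V \<subseteq> ?I" "?V \<noteq> {}" using ne by auto
    have du: "dis i0 u (wset i0) = card {i. ?h i \<and> snd (\<omega>' i) \<noteq> ?o i}"
    proof -
      have "{i \<in> wset i0. odd ((\<Sum>t<Q. X i (i0 + t) * u t) + Y i)} = {i. ?h i \<and> snd (\<omega>' i) \<noteq> ?o i}"
        unfolding ws using disagree_iff[OF i0 _ u] by (auto simp: inw_iff)
      then show ?thesis by (simp only: dis_def)
    qed
    have dS: "dis i0 (\<lambda>t. S (i0 + t)) (wset i0) = card {i. ?h i \<and> snd (\<omega>' i)}"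
    proof -
      have "{i \<in> wset i0. odd ((\<Sum>t<Q. X i (i0 + t) * S (i0 + t)) + Y i)} = {i. ?h i \<and> snd (\<omega>' i)}"
        unfolding ws using disagree_iff[OF i0, of _ "\<lambda>t. S (i0 + t)"] S01 by (auto simp: inw_iff)
      then show ?thesis by (simp only: dis_def)
    qed
    \<comment> \<open>Noisy samples of even parity with \<open>V\<close> are counted for the
      candidate and for the hidden vector alike; after cancelling them, the comparison is the one in
      \<open>good_window\<close>.\<close>
    have split_u: "card {i. ?h i \<and> snd (\<omega>' i) \<noteq> ?o i}
       = card {i. ?h i \<and> snd (\<omega>' i) \<and> \<not> ?o i} + card {i. ?h i \<and> ?o i \<and> \<not> snd (\<omega>' i)}"
    proof -
      have "{i. ?h i \<and> snd (\<omega>' i) \<noteq> ?o i}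
         = {i. ?h i \<and> snd (\<omega>' i) \<and> \<not> ?o i} \<union> {i. ?h i \<and> ?o i \<and> \<not> snd (\<omega>' i)}" by blast
      then show ?thesis by (simp only:) (subst card_Un_disjoint, auto)
    qed
    have split_S: "card {i. ?h i \<and> snd (\<omega>' i)}
       = card {i. ?h i \<and> snd (\<omega>' i) \<and> \<not> ?o i} + card {i. ?h i \<and> ?o i \<and> snd (\<omega>' i)}"
    proof -
      have "{i. ?h i \<and> snd (\<omega>' i)}
         = {i. ?h i \<and> snd (\<omega>' i) \<and> \<not> ?o i} \<union> {i. ?h i \<and> ?o i \<and> snd (\<omega>' i)}" by blast
      then show ?thesis by (simp only:) (subst card_Un_disjoint, auto)
    qed
    show "dis i0 (\<lambda>t. S (i0 + t)) (wset i0) < dis i0 u (wset i0)"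
      unfolding du dS split_u split_S using g1[OF V] by (simp only: conj_assoc nat_add_left_cancel_less)
  next
    obtain \<mu> :: nat where \<mu>: "\<mu> < 2 ^ r" "\<And>g. g < r \<Longrightarrow> odd (\<mu> div 2 ^ g) \<longleftrightarrow> g \<in> {g. clean_block ?I B \<omega>' g}"
      using mask_exists[of r "{g. clean_block ?I B \<omega>' g}"] by blast
    have masked: "masked \<mu> i \<longleftrightarrow> clean_block ?I B \<omega>' (i div B)" if "i < r * B" for i
      using \<mu>(2)[OF block_less[OF that]] by (simp add: masked_def)
    have inblk: "i \<in> {(i div B) * B..<(i div B) * B + B}" for i
      using dividend_less_div_times[OF B0, of i] by (simp add: add.commute)
    show "\<exists>\<mu> < 2 ^ r. (\<forall>i \<in> wset i0. masked \<mu> i \<longrightarrow> consistent i0 i) \<and>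
         full_rank i0 {i \<in> wset i0. masked \<mu> i}"
    proof (intro exI[of _ \<mu>] conjI ballI impI \<mu>(1))
      fix i assume i: "i \<in> wset i0" "masked \<mu> i"
      then have "clean_block ?I B \<omega>' (i div B)" using masked by (simp add: wset_def)
      then have "\<not> snd (\<omega>' i)" using inblk[of i] i(1) unfolding clean_block_def ws by blast
      then show "consistent i0 i" using consistent_iff[OF i0] i(1) by (simp add: wset_def)
    next
      show "full_rank i0 {i \<in> wset i0. masked \<mu> i}"
        unfolding full_rank_def
      proof (intro allI impI, rule ccontr)
        fix v :: "nat \<Rightarrow> nat" and t
        assume h: "\<forall>i\<in>{i \<in> wset i0. masked \<mu> i}. (\<Sum>t<Q. par (X i (i0 + t)) * par (v t)) = 0"
          and t: "t < Q" "par (v t) \<noteq> 0"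
        let ?V = "(\<lambda>t. i0 + t) ` {t. t < Q \<and> odd (v t)}"
        have "odd (v t)" using t(2) par_eq_1[of "v t"] by simp
        then have V: "?V \<subseteq> ?I" "?V \<noteq> {}" using t(1) by auto
        obtain i where i: "i < r * B" "fst (\<omega>' i) \<subseteq> ?I" "odd (card (fst (\<omega>' i) \<inter> ?V))"
           "clean_block ?I B \<omega>' (i div B)" using g2[OF V] by blast
        have "i \<in> {i \<in> wset i0. masked \<mu> i}" using i masked by (simp add: ws)
        then have "par (card (fst (\<omega>' i) \<inter> ?V)) = 0" using h par_sum_card[OF i0, of i v] by simp
        then show False using i(3) par_eq_1[of "card (fst (\<omega>' i) \<inter> ?V)"] by simp
      qed
    qed
  qed
qed

end

section \<open>The law of a decoded sample\<close>

lemma bij_betw_support: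
  "bij_betw (\<lambda>x. {j. j < n \<and> vec_index x j \<noteq> 0}) (sparse_vecs n k) (ksubsets {..<n} k)"
proof (rule bij_betw_byWitness[where f' = "\<lambda>A. Matrix.vec n (\<lambda>j. of_bool (j \<in> A))"])
  show "\<forall>x\<in>sparse_vecs n k. Matrix.vec n (\<lambda>j. of_bool (j \<in> {j. j < n \<and> vec_index x j \<noteq> 0})) = x"
    by (auto simp: sparse_vecs_def)
  show "\<forall>A\<in>ksubsets {..<n} k. {j. j < n \<and> vec_index (Matrix.vec n (\<lambda>j. of_bool (j \<in> A)) :: bit Matrix.vec) j \<noteq> 0} = A"
    by (auto simp: ksubsets_def)
  show "(\<lambda>x. {j. j < n \<and> vec_index x j \<noteq> 0}) ` sparse_vecs n k \<subseteq> ksubsets {..<n} k"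
    by (auto simp: sparse_vecs_def ksubsets_def)
  show "(\<lambda>A. Matrix.vec n (\<lambda>j. of_bool (j \<in> A))) ` ksubsets {..<n} k \<subseteq> sparse_vecs n k"
  proof clarify
    fix A assume "A \<in> ksubsets {..<n} k"
    moreover from this have "{i. i < n \<and> vec_index (Matrix.vec n (\<lambda>j. of_bool (j \<in> A)) :: bit Matrix.vec) i \<noteq> 0} = A"
      by (auto simp: ksubsets_def)
    ultimately show "Matrix.vec n (\<lambda>j. of_bool (j \<in> A)) \<in> sparse_vecs n k"
      by (simp add: sparse_vecs_def ksubsets_def)
  qed
qed

lemma map_dec_sample:
  assumes "k \<le> n"
  shows "map_pmf (dec n s) (lpn_sample n k \<eta> s) = dec_sample n k \<eta>"
proof -
  have ne: "ksubsets {..<n} k \<noteq> {}" "finite (ksubsets {..<n} k)"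
    using card_ksubsets[of "{..<n}" k] assms zero_less_binomial[of k n] by force+
  have b: "bij_betw (\<lambda>x. {j. j < n \<and> vec_index x j \<noteq> 0}) (sparse_vecs n k) (ksubsets {..<n} k)"
    by (rule bij_betw_support)
  have ne': "sparse_vecs n k \<noteq> {}" "finite (sparse_vecs n k)"
    using b ne bij_betw_finite[OF b] by (auto simp: bij_betw_def)
  have "map_pmf (dec n s) (lpn_sample n k \<eta> s)
     = bind_pmf (pmf_of_set (sparse_vecs n k)) (\<lambda>x. bind_pmf (bernoulli_pmf \<eta>) (\<lambda>e.
         return_pmf ({j. j < n \<and> vec_index x j \<noteq> 0}, e)))"
    unfolding lpn_sample_def map_bind_pmf map_return_pmf
  proof (intro bind_pmf_cong refl arg_cong[where f = return_pmf])
    fix x e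
    have "(scalar_prod x s + of_bool e \<noteq> scalar_prod x s) \<longleftrightarrow> e"
      by (cases e) simp_all
    then show "dec n s (x, scalar_prod x s + of_bool e) = ({j. j < n \<and> vec_index x j \<noteq> 0}, e)"
      by (simp add: dec_def)
  qed
  also have "\<dots> = bind_pmf (map_pmf (\<lambda>x. {j. j < n \<and> vec_index x j \<noteq> 0}) (pmf_of_set (sparse_vecs n k)))
       (\<lambda>A. bind_pmf (bernoulli_pmf \<eta>) (\<lambda>e. return_pmf (A, e)))"
    by (simp add: bind_map_pmf)
  also have "map_pmf (\<lambda>x. {j. j < n \<and> vec_index x j \<noteq> 0}) (pmf_of_set (sparse_vecs n k))
     = pmf_of_set (ksubsets {..<n} k)"
    using map_pmf_of_set_inj[of "\<lambda>x. {j. j < n \<and> vec_index x j \<noteq> 0}" "sparse_vecs n k"] b ne'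
    by (simp add: bij_betw_def)
  finally show ?thesis by (simp add: dec_sample_def pair_pmf_def)
qed

lemma Pi_pmf_dec:
  assumes "k \<le> n" "finite A" "dec n s d = d'"
  shows "map_pmf (\<lambda>\<omega> i. dec n s (\<omega> i)) (Pi_pmf A d (\<lambda>_. lpn_sample n k \<eta> s))
     = Pi_pmf A d' (\<lambda>_. dec_sample n k \<eta>)"
  using Pi_pmf_map[of A "dec n s" d d' "\<lambda>_. lpn_sample n k \<eta> s"] assms
  by (simp add: map_dec_sample o_def)

section \<open>Computing the parameters\<close>

definition lengthP :: prog where
  "lengthP = PAsg v_l (Num 0) ;; PAsg v_pw (Num 1) ;;
     PFor v_c v_n (PIf (Less (Var v_n) (Var v_pw)) PSkip
       (PAsg v_pw (Add (Var v_pw) (Var v_pw)) ;; PAsg v_l (Add (Var v_l) (Num 1)))) ;;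
     PAsg v_l2 (Add (Var v_l) (Var v_l))"

text \<open>With \<open>2 * l\<close> digits both truncation errors are below \<open>1 / N\<close>,
  where \<open>N\<close> is at least \<open>n\<close> squared, and reading the digits is still
  cheap.\<close>

definition digitP :: prog where
  "digitP = PAsg v_N (Num 1) ;; PAsg v_ae (Num 0) ;; PAsg v_ad (Num 0) ;;
     PFor v_c v_l2 (PAsg v_N (Add (Var v_N) (Var v_N)) ;;
       PAsg v_ae (Add (Add (Var v_ae) (Var v_ae)) (NoiseDigit (Var v_c))) ;;
       PAsg v_ad (Add (Add (Var v_ad) (Var v_ad)) (TradeoffDigit (Var v_c))))"

text \<open>\<open>l\<close> replaces the binary logarithm of \<open>n\<close> and
  \<open>ad / N\<close> replaces \<open>\<delta>\<close>, so that \<open>2 ^ h\<close> is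
  \<open>q\<close> up to a constant factor; see \<open>power_h\<close>.\<close>

definition expP :: prog where
  "expP = PAsg v_h (Add (Quo (Mul (Var v_l) (Add (Add (Var v_N) (Var v_ad)) (Num 1)))
      (Add (Var v_N) (Var v_N))) (Num 2)) ;; PAsg v_W (Num 1)"

definition powerP :: prog where
  "powerP = PFor v_c v_h (PAsg v_W (Add (Var v_W) (Var v_W)))"

text \<open>\<open>v_G\<close> overestimates \<open>1 / (1 - 2 * \<eta>)\<close>. \<open>v_M\<close>
  is the number of window samples that \<open>prob_not_good\<close> asks for. \<open>v_r'\<close> is
  at least \<open>32 * l\<close>, for the failure probability, and at least the expected number
  \<open>\<eta> * M\<close> of noisy samples among \<open>M\<close>. \<open>v_cap\<close> is four
  times a bound on the expected pool size.\<close>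

definition sizeP :: prog where
  "sizeP = PIf (Less (Var v_W) (Var v_n)) (PAsg v_Q (Var v_W)) (PAsg v_Q (Var v_n)) ;;
     PAsg v_G (Add (Quo (Var v_N) (Sub (Var v_N) (Add (Add (Var v_ae) (Var v_ae)) (Num 2)))) (Num 1)) ;;
     PAsg v_M (Mul (Num 512) (Mul (Mul (Var v_G) (Var v_G))
       (Add (Add (Var v_Q) (Quo (Mul (Var v_Q) (Var v_l)) (Var v_k))) (Num 1)))) ;;
     PAsg v_r' (Add (Add (Mul (Num 32) (Var v_l))
       (Quo (Mul (Add (Var v_ae) (Num 1)) (Var v_M)) (Var v_N))) (Num 1)) ;;
     PAsg v_r (Mul (Num 8) (Var v_r')) ;;
     PAsg v_cap (Mul (Num 4) (Add (Add (Var v_M) (Var v_r)) (Num 1))) ;;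
     PAsg v_num (Num 1) ;; PAsg v_den (Num 1)"

text \<open>The quotient of the two falling factorials is \<open>1 / p\<close>, the mean number of
  samples drawn per window sample.\<close>

definition ratioP :: prog where
  "ratioP = PFor v_c v_k (PAsg v_num (Mul (Var v_num) (Sub (Var v_n) (Var v_c))) ;;
     PAsg v_den (Mul (Var v_den) (Sub (Var v_Q) (Var v_c))))"

definition countP :: prog where
  "countP = PAsg v_B (Add (Quo (Add (Quo (Mul (Var v_M) (Var v_num)) (Var v_den)) (Num 1)) (Var v_r)) (Num 1)) ;;
     PAsg v_m (Mul (Var v_r) (Var v_B)) ;; PAsg v_Q1 (Add (Var v_Q) (Num 1)) ;;
     PAsg v_nw (Add (Sub (Var v_n) (Var v_Q)) (Num 1)) ;; PAsg v_NM (Num 1)"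

definition tableP :: prog where
  "tableP = PFor v_c v_r (PPut a_pow (Var v_c) (Var v_NM) ;; PAsg v_NM (Add (Var v_NM) (Var v_NM)))"

lemma wv_prep [simp]:
  "wv lengthP = {v_l, v_pw, v_c, v_l2}" "wv digitP = {v_N, v_ae, v_ad, v_c}" "wv expP = {v_h, v_W}"
  "wv powerP = {v_c, v_W}" "wv sizeP = {v_Q, v_G, v_M, v_r', v_r, v_cap, v_num, v_den}"
  "wv ratioP = {v_c, v_num, v_den}" "wv countP = {v_B, v_m, v_Q1, v_nw, v_NM}"
  "wv tableP = {v_c, v_NM}" "wv sampleP = {v_i, v_d, v_j}"
  unfolding lengthP_def digitP_def expP_def powerP_def sizeP_def ratioP_def countP_def tableP_def sampleP_def
  by auto

lemma wa_prep [simp]: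
  "wa lengthP = {}" "wa digitP = {}" "wa expP = {}" "wa powerP = {}" "wa sizeP = {}"
  "wa ratioP = {}" "wa countP = {}" "wa tableP = {a_pow}" "wa sampleP = {a_raw, a_X, a_Y}"
  unfolding lengthP_def digitP_def expP_def powerP_def sizeP_def ratioP_def countP_def tableP_def sampleP_def
  by auto

lemma samples_prep [simp]:
  "\<not> samples lengthP" "\<not> samples digitP" "\<not> samples expP" "\<not> samples powerP" "\<not> samples sizeP"
  "\<not> samples ratioP" "\<not> samples countP" "\<not> samples tableP" "\<not> samples solveP"
  unfolding lengthP_def digitP_def expP_def powerP_def sizeP_def ratioP_def countP_def tableP_def
    solveP_def winP_def maskP_def outP_def poolP_def scanP_def disP_def candP_def elimP_def updateP_def
    copyP_def betaP_def initP_def matrixP_def dotP_def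
  by auto

section \<open>Correctness of the parameter computation\<close>

lemma bits_eqI:
  assumes "n < 2 ^ l" "l = 0 \<or> 2 ^ (l - 1) \<le> n"
  shows "bits n = l"
proof (rule antisym)
  show "bits n \<le> l" by (rule bits_le[OF assms(1)])
  show "l \<le> bits n"
  proof (rule ccontr)
    assume "\<not> l \<le> bits n"
    then have "(2 :: nat) ^ bits n \<le> 2 ^ (l - 1)" "2 ^ (l - 1) \<le> n"
      using assms(2) by (auto intro!: power_increasing)
    then show False using less_two_power_bits[of n] by linarith
  qed
qed

lemma two_power_bits_le: "0 < n \<Longrightarrow> 2 ^ bits n \<le> 2 * n"
  using floorlog_bounds[of n 2] by (cases "bits n") (auto simp: bits_def)

lemma lengthP_correct:
  "mv (den P \<omega> lengthP M) v_l = bits (mv M v_n)" "mv (den P \<omega> lengthP M) v_l2 = 2 * bits (mv M v_n)"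
  "mv (den P \<omega> lengthP M) v_pw = 2 ^ bits (mv M v_n)" "mv (den P \<omega> lengthP M) v_c = mv M v_n"
proof -
  let ?n = "mv M v_n"
  let ?body = "PIf (Less (Var v_n) (Var v_pw)) PSkip
       (PAsg v_pw (Add (Var v_pw) (Var v_pw)) ;; PAsg v_l (Add (Var v_l) (Num 1)))"
  let ?M1 = "den P \<omega> (PAsg v_l (Num 0) ;; PAsg v_pw (Num 1)) M"
  let ?M2 = "den P \<omega> (PFor v_c v_n ?body) ?M1"
  \<comment> \<open>Either every round so far has doubled or \<open>2 ^ l\<close> exceeds
    \<open>n\<close>. After \<open>n\<close> rounds the first case implies the second, as
    \<open>2 ^ n\<close> exceeds \<open>n\<close>.\<close>
  define I where "I i M' \<longleftrightarrow> mv M' v_pw = 2 ^ mv M' v_l \<and> (mv M' v_l = 0 \<or> 2 ^ (mv M' v_l - 1) \<le> ?n)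
     \<and> (mv M' v_l = i \<or> ?n < 2 ^ mv M' v_l)" for i and M' :: mem
  have "I (mv ?M1 v_n) ?M2"
  proof (rule for_rule)
    show "I 0 (?M1\<lparr>mv := (mv ?M1)(v_c := 0)\<rparr>)" by (simp add: I_def)
  next
    fix i and M' :: mem
    assume "\<And>w. w \<notin> wv (PFor v_c v_n ?body) \<Longrightarrow> mv M' w = mv ?M1 w" and I: "I i M'"
    then have n: "mv M' v_n = ?n" by simp
    show "I (Suc i) ((den P \<omega> ?body M')\<lparr>mv := (mv (den P \<omega> ?body M'))(v_c := Suc i)\<rparr>)"
      using I n by (auto simp: I_def not_less)
  qed
  then have I: "I ?n ?M2" by simp
  have "?n < 2 ^ mv ?M2 v_l"
    using I less_exp[of ?n] by (auto simp: I_def)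
  then have l: "bits ?n = mv ?M2 v_l" using I by (intro bits_eqI) (auto simp: I_def)
  have c: "mv ?M2 v_c = ?n" using loop_var[of _ v_c "mv ?M1 v_n"] by simp
  have D: "den P \<omega> lengthP M = ?M2\<lparr>mv := (mv ?M2)(v_l2 := mv ?M2 v_l + mv ?M2 v_l)\<rparr>"
    by (simp only: lengthP_def den.simps evm.simps)
  show "mv (den P \<omega> lengthP M) v_l = bits ?n" "mv (den P \<omega> lengthP M) v_l2 = 2 * bits ?n"
    "mv (den P \<omega> lengthP M) v_pw = 2 ^ bits ?n" "mv (den P \<omega> lengthP M) v_c = ?n"
    unfolding D using l c I by (simp_all add: I_def del: den.simps)
qed

lemma nat_floor_double:
  assumes "0 \<le> x"
  shows "nat \<lfloor>x * 2 ^ Suc i\<rfloor> = nat \<lfloor>x * 2 ^ i\<rfloor> + nat \<lfloor>x * 2 ^ i\<rfloor> + real_digit x i"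
proof -
  let ?a = "\<lfloor>x * 2 ^ i\<rfloor>" and ?b = "\<lfloor>x * 2 ^ Suc i\<rfloor>"
  have a0: "0 \<le> ?a" using assms by simp
  have "?b = \<lfloor>2 * (x * 2 ^ i)\<rfloor>" by (simp add: mult_ac)
  then have "2 * ?a \<le> ?b" "?b \<le> 2 * ?a + 1" by linarith+
  then have "?b = 2 * ?a \<or> ?b = 2 * ?a + 1" by linarith
  then have "?b = 2 * ?a + ?b mod 2" by presburger
  then have "nat ?b = nat (2 * ?a + ?b mod 2)" by simp
  also have "\<dots> = nat ?a + nat ?a + nat (?b mod 2)" using a0 by (simp add: nat_add_distrib nat_mult_distrib)
  finally show ?thesis by (simp add: real_digit_def)
qed

lemma digitP_correct:
  assumes "0 \<le> noise P" "0 \<le> tradeoff P" "noise P < 1" "tradeoff P < 1"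
  shows "mv (den P \<omega> digitP M) v_N = 2 ^ mv M v_l2"
    "mv (den P \<omega> digitP M) v_ae = nat \<lfloor>noise P * 2 ^ mv M v_l2\<rfloor>"
    "mv (den P \<omega> digitP M) v_ad = nat \<lfloor>tradeoff P * 2 ^ mv M v_l2\<rfloor>"
proof -
  let ?body = "PAsg v_N (Add (Var v_N) (Var v_N)) ;;
       PAsg v_ae (Add (Add (Var v_ae) (Var v_ae)) (NoiseDigit (Var v_c))) ;;
       PAsg v_ad (Add (Add (Var v_ad) (Var v_ad)) (TradeoffDigit (Var v_c)))"
  let ?M1 = "den P \<omega> (PAsg v_N (Num 1) ;; PAsg v_ae (Num 0) ;; PAsg v_ad (Num 0)) M"
  define I where "I i M' \<longleftrightarrow> mv M' v_N = 2 ^ i \<and> mv M' v_ae = nat \<lfloor>noise P * 2 ^ i\<rfloor>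
     \<and> mv M' v_ad = nat \<lfloor>tradeoff P * 2 ^ i\<rfloor>" for i and M' :: mem
  have "I (mv ?M1 v_l2) (den P \<omega> (PFor v_c v_l2 ?body) ?M1)"
  proof (rule for_rule)
    show "I 0 (?M1\<lparr>mv := (mv ?M1)(v_c := 0)\<rparr>)"
      using assms by (simp add: I_def floor_eq_iff)
  next
    fix i and M' :: mem
    assume "mv M' v_c = i" "I i M'"
    then show "I (Suc i) ((den P \<omega> ?body M')\<lparr>mv := (mv (den P \<omega> ?body M'))(v_c := Suc i)\<rparr>)"
      using nat_floor_double[OF assms(1), of i] nat_floor_double[OF assms(2), of i] by (simp add: I_def)
  qed
  then have I: "I (mv M v_l2) (den P \<omega> digitP M)" by (simp add: digitP_def)
  then show "mv (den P \<omega> digitP M) v_N = 2 ^ mv M v_l2"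
    "mv (den P \<omega> digitP M) v_ae = nat \<lfloor>noise P * 2 ^ mv M v_l2\<rfloor>"
    "mv (den P \<omega> digitP M) v_ad = nat \<lfloor>tradeoff P * 2 ^ mv M v_l2\<rfloor>"
    unfolding I_def by blast+
qed

lemma powerP_correct:
  assumes "mv M v_W = 1"
  shows "mv (den P \<omega> powerP M) v_W = 2 ^ mv M v_h"
proof -
  define I where "I i M' \<longleftrightarrow> mv M' v_W = 2 ^ i" for i and M' :: mem
  have "I (mv M v_h) (den P \<omega> powerP M)"
    unfolding powerP_def by (rule for_rule) (use assms in \<open>auto simp: I_def\<close>)
  then show ?thesis by (simp add: I_def)
qed

lemma ratioP_correct:
  assumes "mv M v_num = 1" "mv M v_den = 1"
  shows "mv (den P \<omega> ratioP M) v_num = (\<Prod>i < mv M v_k. mv M v_n - i)"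
    "mv (den P \<omega> ratioP M) v_den = (\<Prod>i < mv M v_k. mv M v_Q - i)"
proof -
  define I where "I j M' \<longleftrightarrow> mv M' v_num = (\<Prod>i<j. mv M v_n - i) \<and> mv M' v_den = (\<Prod>i<j. mv M v_Q - i)"
    for j and M' :: mem
  have "I (mv M v_k) (den P \<omega> ratioP M)"
    unfolding ratioP_def by (rule for_rule) (use assms in \<open>auto simp: I_def\<close>)
  then show "mv (den P \<omega> ratioP M) v_num = (\<Prod>i < mv M v_k. mv M v_n - i)"
    "mv (den P \<omega> ratioP M) v_den = (\<Prod>i < mv M v_k. mv M v_Q - i)"
    by (simp_all add: I_def)
qed

lemma tableP_correct:
  assumes "mv M v_NM = 1"
  shows "mv (den P \<omega> tableP M) v_NM = 2 ^ mv M v_r"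
    "g < mv M v_r \<Longrightarrow> ma (den P \<omega> tableP M) a_pow g = 2 ^ g"
proof -
  define I where "I j M' \<longleftrightarrow> mv M' v_NM = 2 ^ j \<and> (\<forall>g<j. ma M' a_pow g = 2 ^ g)" for j and M' :: mem
  have "I (mv M v_r) (den P \<omega> tableP M)"
    unfolding tableP_def by (rule for_rule) (use assms in \<open>auto simp: I_def less_Suc_eq\<close>)
  then show "mv (den P \<omega> tableP M) v_NM = 2 ^ mv M v_r"
    "g < mv M v_r \<Longrightarrow> ma (den P \<omega> tableP M) a_pow g = 2 ^ g"
    by (simp_all add: I_def)
qed

lemma sampleP_correct:
  assumes n: "mv M v_n = dimension P" and d: "md M = 0"
  shows "md (den P \<omega> sampleP M) = mv M v_m"
    "i < mv M v_m \<Longrightarrow> j < dimension P \<Longrightarrow>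
       ma (den P \<omega> sampleP M) a_X (i * dimension P + j) = nat_of_bit (vec_index (fst (\<omega> i)) j)"
    "i < mv M v_m \<Longrightarrow> ma (den P \<omega> sampleP M) a_Y i = nat_of_bit (snd (\<omega> i))"
proof -
  let ?n = "dimension P"
  let ?row = "PPut a_X (Add (Mul (Var v_i) (Var v_n)) (Var v_j)) (Get a_raw (Var v_j))"
  let ?body = "PSample a_raw v_d ;; PFor v_j v_n ?row ;; PPut a_Y (Var v_i) (Var v_d)"
  define I where "I c M' \<longleftrightarrow> md M' = c \<and> (\<forall>i<c. \<forall>j<?n. ma M' a_X (i * ?n + j) = nat_of_bit (vec_index (fst (\<omega> i)) j))
     \<and> (\<forall>i<c. ma M' a_Y i = nat_of_bit (snd (\<omega> i)))" for c and M' :: mem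
  have "I (mv M v_m) (den P \<omega> sampleP M)"
    unfolding sampleP_def
  proof (rule for_rule)
    show "I 0 (M\<lparr>mv := (mv M)(v_i := 0)\<rparr>)" using d by (simp add: I_def)
  next
    fix c and M' :: mem
    assume vi: "mv M' v_i = c"
      and fr: "\<And>w. w \<notin> wv (PFor v_i v_m ?body) \<Longrightarrow> mv M' w = mv M w"
      and I: "I c M'"
    have n': "mv M' v_n = ?n" using fr n by simp
    have c: "md M' = c" using I by (simp add: I_def)
    let ?M1 = "den P \<omega> (PSample a_raw v_d) M'"
    let ?M2 = "den P \<omega> (PFor v_j v_n ?row) ?M1"
    have M1: "ma ?M1 a_raw j = nat_of_bit (vec_index (fst (\<omega> c)) j)" if "j < ?n" for j
      using that by (simp add: c)
    have M1': "mv ?M1 v_n = ?n" "mv ?M1 v_i = c" "ma ?M1 a_X = ma M' a_X" "ma ?M1 a_Y = ma M' a_Y" "md ?M1 = Suc c"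
      "mv ?M1 v_d = nat_of_bit (snd (\<omega> c))" using n' vi c by simp_all
    define R where "R jj M'' \<longleftrightarrow> (\<forall>i j. j < ?n \<longrightarrow> ma M'' a_X (i * ?n + j) =
        (if i = c \<and> j < jj then nat_of_bit (vec_index (fst (\<omega> c)) j) else ma M' a_X (i * ?n + j)))" for jj and M'' :: mem
    have "R (mv ?M1 v_n) ?M2"
    proof (rule for_rule)
      show "R 0 (?M1\<lparr>mv := (mv ?M1)(v_j := 0)\<rparr>)" using M1' by (simp add: R_def)
    next
      fix jj and M'' :: mem
      assume jj: "jj < mv ?M1 v_n" and vj: "mv M'' v_j = jj"
        and fr2: "\<And>w. w \<notin> wv (PFor v_j v_n ?row) \<Longrightarrow> mv M'' w = mv ?M1 w"
        and fa2: "\<And>a. a \<notin> wa ?row \<Longrightarrow> ma M'' a = ma ?M1 a"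
        and R: "R jj M''"
      have jn: "jj < ?n" using jj M1' by simp
      have f: "mv M'' v_n = ?n" "mv M'' v_i = c" "ma M'' a_raw jj = nat_of_bit (vec_index (fst (\<omega> c)) jj)"
        using fr2 fa2 M1'(1,2) M1[OF jn] by auto
      show "R (Suc jj) ((den P \<omega> ?row M'')\<lparr>mv := (mv (den P \<omega> ?row M''))(v_j := Suc jj)\<rparr>)"
        unfolding R_def
      proof (intro allI impI)
        fix i j assume j: "j < ?n"
        show "ma ((den P \<omega> ?row M'')\<lparr>mv := (mv (den P \<omega> ?row M''))(v_j := Suc jj)\<rparr>) a_X (i * ?n + j)
          = (if i = c \<and> j < Suc jj then nat_of_bit (vec_index (fst (\<omega> c)) j) else ma M' a_X (i * ?n + j))"
          using R j index_inj[OF j jn, of i c] by (auto simp: R_def f f[simplified] vj less_Suc_eq)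
      qed
    qed
    then have R: "R ?n ?M2" using M1' by simp
    have M2: "md ?M2 = Suc c" "mv ?M2 v_i = c" "mv ?M2 v_d = nat_of_bit (snd (\<omega> c))" "ma ?M2 a_Y = ma M' a_Y"
      using den_frame_md[of "PFor v_j v_n ?row" P \<omega> ?M1] den_frame[of _ "PFor v_j v_n ?row" P \<omega> ?M1]
        den_frame_ma[of _ "PFor v_j v_n ?row" P \<omega> ?M1] M1' by auto
    have D: "den P \<omega> ?body M' = ?M2\<lparr>ma := (ma ?M2)(a_Y := (ma ?M2 a_Y)(c := nat_of_bit (snd (\<omega> c))))\<rparr>"
      using M2 by (simp only: den.simps evm.simps)
    show "I (Suc c) ((den P \<omega> ?body M')\<lparr>mv := (mv (den P \<omega> ?body M'))(v_i := Suc c)\<rparr>)"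
      unfolding D I_def using I R M2 by (auto simp: I_def R_def less_Suc_eq simp del: den.simps)
  qed
  then show "md (den P \<omega> sampleP M) = mv M v_m"
    "i < mv M v_m \<Longrightarrow> j < dimension P \<Longrightarrow>
       ma (den P \<omega> sampleP M) a_X (i * dimension P + j) = nat_of_bit (vec_index (fst (\<omega> i)) j)"
    "i < mv M v_m \<Longrightarrow> ma (den P \<omega> sampleP M) a_Y i = nat_of_bit (snd (\<omega> i))"
    by (simp_all add: I_def)
qed

section \<open>The whole program\<close>

definition fullP :: prog where
  "fullP = lengthP ;; digitP ;; expP ;; powerP ;; sizeP ;; ratioP ;; countP ;; tableP ;; sampleP ;; solveP"

definition "par_l P = bits (dimension P)"
definition "par_N P = (2 :: nat) ^ (2 * par_l P)"
definition "par_ae P = nat \<lfloor>noise P * 2 ^ (2 * par_l P)\<rfloor>"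
definition "par_ad P = nat \<lfloor>tradeoff P * 2 ^ (2 * par_l P)\<rfloor>"
definition "par_h P = par_l P * (par_N P + par_ad P + 1) div (par_N P + par_N P) + 2"
definition "par_Q P = (if 2 ^ par_h P < dimension P then 2 ^ par_h P else dimension P)"
definition "par_G P = par_N P div (par_N P - (par_ae P + par_ae P + 2)) + 1"
definition "par_M P = 512 * (par_G P * par_G P * (par_Q P + par_Q P * par_l P div sparsity P + 1))"
definition "par_r' P = 32 * par_l P + (par_ae P + 1) * par_M P div par_N P + 1"
definition "par_r P = 8 * par_r' P"
definition "par_cap P = 4 * (par_M P + par_r P + 1)"
definition "par_num P = (\<Prod>i < sparsity P. dimension P - i)"
definition "par_den P = (\<Prod>i < sparsity P. par_Q P - i)"
definition "par_B P = (par_M P * par_num P div par_den P + 1) div par_r P + 1"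
definition "par_m P = par_r P * par_B P"

definition valid :: "params \<Rightarrow> bool" where
  "valid P \<longleftrightarrow> 2 \<le> dimension P \<and> 0 < sparsity P \<and> sparsity P \<le> dimension P \<and> 0 \<le> noise P \<and> noise P < 1
     \<and> 0 \<le> tradeoff P \<and> tradeoff P < 1 \<and> par_G P \<le> dimension P"

locale machine =
  fixes P :: params and \<omega> :: "nat \<Rightarrow> bit Matrix.vec \<times> bit"
  assumes valid: "valid P"
begin

abbreviation "n \<equiv> dimension P"
abbreviation "l \<equiv> par_l P"

definition "M0 = mem_of (initial (compile fullP) P)"
definition "M1 = den P \<omega> lengthP M0"
definition "M2 = den P \<omega> digitP M1"
definition "M3 = den P \<omega> expP M2"
definition "M4 = den P \<omega> powerP M3"
definition "M5 = den P \<omega> sizeP M4"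
definition "M6 = den P \<omega> ratioP M5"
definition "M7 = den P \<omega> countP M6"
definition "M8 = den P \<omega> tableP M7"
definition "M9 = den P \<omega> sampleP M8"
definition "M10 = den P \<omega> solveP M9"

lemma M0: "mv M0 v_n = n" "mv M0 v_k = sparsity P" "\<And>v. v \<noteq> v_n \<Longrightarrow> v \<noteq> v_k \<Longrightarrow> mv M0 v = 0"
  "md M0 = 0" "ma M0 a i = 0"
  by (simp_all add: M0_def initial_def mem_of_def)

lemma M1: "mv M1 v_n = n" "mv M1 v_k = sparsity P" "mv M1 v_l = l" "mv M1 v_l2 = 2 * l" "mv M1 v_pw = 2 ^ l"
  "mv M1 v_c = n" "md M1 = 0"
  using lengthP_correct[of P \<omega> M0]
  by (simp_all add: M1_def M0 M0[simplified] den_frame den_frame_md par_l_def)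

lemma M2: "mv M2 v_n = n" "mv M2 v_k = sparsity P" "mv M2 v_l = l" "mv M2 v_N = par_N P"
  "mv M2 v_ae = par_ae P" "mv M2 v_ad = par_ad P" "md M2 = 0"
  using digitP_correct[of P \<omega> M1] valid
  by (simp_all add: M2_def M1 M1[simplified] den_frame den_frame_md valid_def par_N_def par_ae_def par_ad_def)

lemma M3: "mv M3 v_n = n" "mv M3 v_k = sparsity P" "mv M3 v_l = l" "mv M3 v_N = par_N P"
  "mv M3 v_ae = par_ae P" "mv M3 v_h = par_h P" "mv M3 v_W = 1" "md M3 = 0"
  by (simp_all add: M3_def expP_def M2 M2[simplified] par_h_def)

lemma M4: "mv M4 v_n = n" "mv M4 v_k = sparsity P" "mv M4 v_l = l" "mv M4 v_N = par_N P"
  "mv M4 v_ae = par_ae P" "mv M4 v_W = 2 ^ par_h P" "md M4 = 0"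
  using powerP_correct[of M3 P \<omega>]
  by (simp_all add: M4_def M3 M3[simplified] den_frame den_frame_md)

lemma den_Asg: "mv (den P \<omega> (PAsg v e) m) w = (if w = v then evm P m e else mv m w)"
  "md (den P \<omega> (PAsg v e) m) = md m"
  by simp_all

lemma M5: "mv M5 v_n = n" "mv M5 v_k = sparsity P" "mv M5 v_Q = par_Q P" "mv M5 v_M = par_M P"
  "mv M5 v_r = par_r P" "mv M5 v_cap = par_cap P" "mv M5 v_num = 1" "mv M5 v_den = 1" "md M5 = 0"
proof -
  define Qa where "Qa = den P \<omega> (PIf (Less (Var v_W) (Var v_n)) (PAsg v_Q (Var v_W)) (PAsg v_Q (Var v_n))) M4"
  have Qa: "mv Qa v_n = n" "mv Qa v_k = sparsity P" "mv Qa v_l = l" "mv Qa v_N = par_N P"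
    "mv Qa v_ae = par_ae P" "mv Qa v_Q = par_Q P" "md Qa = 0"
    by (simp_all add: Qa_def par_Q_def M4 M4[simplified])
  define Ga where "Ga = den P \<omega> (PAsg v_G (Add (Quo (Var v_N)
     (Sub (Var v_N) (Add (Add (Var v_ae) (Var v_ae)) (Num 2)))) (Num 1))) Qa"
  have Ga: "mv Ga v_n = n" "mv Ga v_k = sparsity P" "mv Ga v_l = l" "mv Ga v_N = par_N P"
    "mv Ga v_ae = par_ae P" "mv Ga v_Q = par_Q P" "mv Ga v_G = par_G P" "md Ga = 0"
    by (simp_all add: Ga_def den_Asg Qa Qa[simplified] par_G_def del: den.simps)
  define Ma where "Ma = den P \<omega> (PAsg v_M (Mul (Num 512) (Mul (Mul (Var v_G) (Var v_G))
       (Add (Add (Var v_Q) (Quo (Mul (Var v_Q) (Var v_l)) (Var v_k))) (Num 1))))) Ga"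
  have Ma: "mv Ma v_n = n" "mv Ma v_k = sparsity P" "mv Ma v_l = l" "mv Ma v_N = par_N P"
    "mv Ma v_ae = par_ae P" "mv Ma v_Q = par_Q P" "mv Ma v_M = par_M P" "md Ma = 0"
    by (simp_all add: Ma_def den_Asg Ga Ga[simplified] par_M_def del: den.simps)
  define Ra where "Ra = den P \<omega> (PAsg v_r' (Add (Add (Mul (Num 32) (Var v_l))
       (Quo (Mul (Add (Var v_ae) (Num 1)) (Var v_M)) (Var v_N))) (Num 1))) Ma"
  have Ra: "mv Ra v_n = n" "mv Ra v_k = sparsity P" "mv Ra v_Q = par_Q P" "mv Ra v_M = par_M P"
    "mv Ra v_r' = par_r' P" "md Ra = 0"
    by (simp_all add: Ra_def den_Asg Ma Ma[simplified] par_r'_def del: den.simps)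
  define Rb where "Rb = den P \<omega> (PAsg v_r (Mul (Num 8) (Var v_r'))) Ra"
  have Rb: "mv Rb v_n = n" "mv Rb v_k = sparsity P" "mv Rb v_Q = par_Q P" "mv Rb v_M = par_M P"
    "mv Rb v_r = par_r P" "md Rb = 0"
    by (simp_all add: Rb_def den_Asg Ra Ra[simplified] par_r_def del: den.simps)
  have "M5 = den P \<omega> (PAsg v_cap (Mul (Num 4) (Add (Add (Var v_M) (Var v_r)) (Num 1))) ;;
     PAsg v_num (Num 1) ;; PAsg v_den (Num 1)) Rb"
    by (simp only: M5_def sizeP_def den.simps(4) Rb_def Ra_def Ma_def Ga_def Qa_def)
  then show "mv M5 v_n = n" "mv M5 v_k = sparsity P" "mv M5 v_Q = par_Q P" "mv M5 v_M = par_M P"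
  "mv M5 v_r = par_r P" "mv M5 v_cap = par_cap P" "mv M5 v_num = 1" "mv M5 v_den = 1" "md M5 = 0"
    by (simp_all add: Rb Rb[simplified] par_cap_def)
qed

lemma M6: "mv M6 v_n = n" "mv M6 v_Q = par_Q P" "mv M6 v_M = par_M P"
  "mv M6 v_r = par_r P" "mv M6 v_cap = par_cap P" "mv M6 v_num = par_num P" "mv M6 v_den = par_den P" "md M6 = 0"
  using ratioP_correct[of M5 P \<omega>]
  by (simp_all add: M6_def M5 M5[simplified] den_frame den_frame_md par_num_def par_den_def)

lemma M7: "mv M7 v_n = n" "mv M7 v_Q = par_Q P" "mv M7 v_r = par_r P" "mv M7 v_cap = par_cap P"
  "mv M7 v_B = par_B P" "mv M7 v_m = par_m P" "mv M7 v_Q1 = par_Q P + 1" "mv M7 v_nw = n - par_Q P + 1"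
  "mv M7 v_NM = 1" "md M7 = 0"
  by (simp_all add: M7_def countP_def M6 M6[simplified] par_B_def par_m_def)

lemma M8: "mv M8 v_n = n" "mv M8 v_Q = par_Q P" "mv M8 v_r = par_r P" "mv M8 v_cap = par_cap P"
  "mv M8 v_B = par_B P" "mv M8 v_m = par_m P" "mv M8 v_Q1 = par_Q P + 1" "mv M8 v_nw = n - par_Q P + 1"
  "mv M8 v_NM = 2 ^ par_r P" "md M8 = 0" "g < par_r P \<Longrightarrow> ma M8 a_pow g = 2 ^ g"
  using tableP_correct[where M = M7 and P = P and \<omega> = \<omega>]
  by (simp_all add: M8_def M7 M7[simplified] den_frame den_frame_md)

lemma M9: "mv M9 v_n = n" "mv M9 v_Q = par_Q P" "mv M9 v_cap = par_cap P"
  "mv M9 v_B = par_B P" "mv M9 v_m = par_m P" "mv M9 v_Q1 = par_Q P + 1" "mv M9 v_nw = n - par_Q P + 1"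
  "mv M9 v_NM = 2 ^ par_r P" "md M9 = par_m P" "g < par_r P \<Longrightarrow> ma M9 a_pow g = 2 ^ g"
  "i < par_m P \<Longrightarrow> j < n \<Longrightarrow> ma M9 a_X (i * n + j) = nat_of_bit (vec_index (fst (\<omega> i)) j)"
  "i < par_m P \<Longrightarrow> ma M9 a_Y i = nat_of_bit (snd (\<omega> i))"
  using sampleP_correct[where M = M8 and P = P and \<omega> = \<omega>] M8(11)[of g]
  by (simp_all add: M9_def M8(1-10) M8(1-10)[simplified] den_frame den_frame_ma)

lemma M10_md: "md M10 = par_m P"
  by (simp add: M10_def den_frame_md M9(1-9) del: den.simps)

lemma Q_pos: "0 < par_Q P"
  using valid by (auto simp: par_Q_def valid_def)

lemma Q_le: "par_Q P \<le> n"
  by (auto simp: par_Q_def)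

lemma M10_correct:
  assumes s: "s \<in> carrier_vec n"
    and good: "\<And>i0. i0 + par_Q P \<le> n \<Longrightarrow>
      good_window {i0..<i0 + par_Q P} (par_r P) (par_B P) (par_cap P) (\<lambda>i. dec n s (\<omega> i))"
    and x: "x < n"
  shows "ma M10 a_out x = nat_of_bit (vec_index s x)"
proof -
  interpret tape P \<omega> n "par_Q P" "par_cap P" "par_B P" "par_r P" s
    by unfold_locales (use s in \<open>simp_all add: par_B_def\<close>)
  have "ctx M9"
    unfolding ctx_def using M9 by (simp add: par_m_def X_def Y_def)
  then show ?thesis
    unfolding M10_def using M9(7) Q_pos Q_le good_at_of_good_window[OF _ good] x
    by (subst solveP_correct) (auto simp: S_def)
qed

end

section \<open>Running time\<close>

text \<open>A single power without a constant factor: as \<open>valid\<close> makes the dimension at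
  least 2, constants and sums are absorbed by a larger exponent.\<close>

definition poly_bounded :: "(params \<Rightarrow> nat) \<Rightarrow> bool" where
  "poly_bounded f \<longleftrightarrow> (\<exists>e. \<forall>P. valid P \<longrightarrow> f P \<le> dimension P ^ e)"

lemma valid_dim: "valid P \<Longrightarrow> 2 \<le> dimension P"
  by (simp add: valid_def)

lemma poly_bounded_mono: "poly_bounded g \<Longrightarrow> (\<And>P. valid P \<Longrightarrow> f P \<le> g P) \<Longrightarrow> poly_bounded f"
  unfolding poly_bounded_def by (meson order.trans)

lemma poly_bounded_const: "poly_bounded (\<lambda>_. c)"
  unfolding poly_bounded_def
proof (intro exI[of _ c] allI impI)
  fix P :: params assume "valid P"
  have "c \<le> 2 ^ c" using less_exp[of c] by simp
  also have "\<dots> \<le> dimension P ^ c" using valid_dim[OF \<open>valid P\<close>] by (intro power_mono) auto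
  finally show "c \<le> dimension P ^ c" .
qed

lemma poly_bounded_dim: "poly_bounded dimension"
  unfolding poly_bounded_def by (intro exI[of _ 1]) simp

lemma poly_bounded_mult:
  assumes "poly_bounded f" "poly_bounded g"
  shows "poly_bounded (\<lambda>P. f P * g P)"
proof -
  obtain a b where "\<And>P. valid P \<Longrightarrow> f P \<le> dimension P ^ a" "\<And>P. valid P \<Longrightarrow> g P \<le> dimension P ^ b"
    using assms unfolding poly_bounded_def by blast
  then show ?thesis unfolding poly_bounded_def
    by (intro exI[of _ "a + b"]) (simp add: power_add mult_mono)
qed

lemma poly_bounded_Suc:
  assumes "poly_bounded f"
  shows "poly_bounded (\<lambda>P. f P + 1)"
proof -
  obtain a where a: "\<And>P. valid P \<Longrightarrow> f P \<le> dimension P ^ a"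
    using assms unfolding poly_bounded_def by blast
  have "f P + 1 \<le> dimension P ^ (a + 1)" if "valid P" for P
  proof -
    have "1 \<le> dimension P ^ a" using valid_dim[OF that] by (intro one_le_power) simp
    then have "f P + 1 \<le> dimension P ^ a * 2" using a[OF that] by linarith
    also have "\<dots> \<le> dimension P ^ a * dimension P" using valid_dim[OF that] by (intro mult_left_mono) auto
    finally show ?thesis by (simp add: mult.commute)
  qed
  then show ?thesis unfolding poly_bounded_def by blast
qed

lemma poly_bounded_add:
  assumes "poly_bounded f" "poly_bounded g"
  shows "poly_bounded (\<lambda>P. f P + g P)"
  by (rule poly_bounded_mono[OF poly_bounded_mult[OF poly_bounded_Suc[OF assms(1)] poly_bounded_Suc[OF assms(2)]]]) simp

lemma poly_bounded_power: "poly_bounded f \<Longrightarrow> poly_bounded (\<lambda>P. f P ^ c)"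
  by (induction c) (auto intro: poly_bounded_const poly_bounded_mult)

lemmas poly_bounded_intros = poly_bounded_const poly_bounded_dim poly_bounded_add poly_bounded_mult poly_bounded_power

lemma poly_bounded_two_power_l: "poly_bounded (\<lambda>P. 2 ^ par_l P)"
proof (rule poly_bounded_mono)
  show "poly_bounded (\<lambda>P. 2 * dimension P)" by (intro poly_bounded_intros)
  show "2 ^ par_l P \<le> 2 * dimension P" if "valid P" for P
    unfolding par_l_def using valid_dim[OF that] by (intro two_power_bits_le) simp
qed

lemma poly_bounded_l: "poly_bounded par_l"
  by (rule poly_bounded_mono[OF poly_bounded_two_power_l]) (use less_exp in \<open>simp add: less_imp_le\<close>)

lemma digits_less:
  assumes "0 \<le> x" "x < 1"
  shows "nat \<lfloor>x * 2 ^ i\<rfloor> < 2 ^ i"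
proof -
  have "x * 2 ^ i < 2 ^ i" using assms by simp
  then have "\<lfloor>x * 2 ^ i\<rfloor> < 2 ^ i" by (simp add: floor_less_iff)
  then show ?thesis using assms by (simp add: nat_less_iff)
qed

lemma par_ae_less: "valid P \<Longrightarrow> par_ae P < par_N P"
  unfolding par_ae_def par_N_def valid_def by (intro digits_less) auto

lemma par_ad_less: "valid P \<Longrightarrow> par_ad P < par_N P"
  unfolding par_ad_def par_N_def valid_def by (intro digits_less) auto

lemma poly_bounded_N: "poly_bounded par_N"
  unfolding par_N_def power_mult power2_eq_square power_mult_distrib
  by (rule poly_bounded_mono[OF poly_bounded_power[OF poly_bounded_two_power_l, of 2]])
     (simp add: power_mult power2_eq_square flip: power_mult_distrib)

lemma poly_bounded_h: "poly_bounded par_h"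
proof (rule poly_bounded_mono)
  show "poly_bounded (\<lambda>P. par_l P + 2)" by (intro poly_bounded_intros poly_bounded_l)
  show "par_h P \<le> par_l P + 2" if "valid P" for P
  proof -
    have "par_l P * (par_N P + par_ad P + 1) \<le> par_l P * (par_N P + par_N P)"
      using par_ad_less[OF that] by (intro mult_left_mono) auto
    then have "par_l P * (par_N P + par_ad P + 1) div (par_N P + par_N P)
        \<le> par_l P * (par_N P + par_N P) div (par_N P + par_N P)" by (rule div_le_mono)
    also have "\<dots> = par_l P" by (simp add: par_N_def)
    finally show ?thesis by (simp add: par_h_def)
  qed
qed

lemma poly_bounded_k: "poly_bounded sparsity"
  by (rule poly_bounded_mono[OF poly_bounded_dim]) (simp add: valid_def)

lemma poly_bounded_Q: "poly_bounded par_Q"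
  by (rule poly_bounded_mono[OF poly_bounded_dim]) (simp add: par_Q_def)

lemma poly_bounded_G: "poly_bounded par_G"
  by (rule poly_bounded_mono[OF poly_bounded_dim]) (simp add: valid_def)

lemma poly_bounded_M: "poly_bounded par_M"
  by (rule poly_bounded_mono[of "\<lambda>P. 512 * (par_G P * par_G P * (par_Q P + par_Q P * par_l P + 1))"])
     (auto simp: par_M_def intro!: poly_bounded_intros poly_bounded_G poly_bounded_Q poly_bounded_l
        mult_left_mono div_le_dividend)

lemma poly_bounded_r: "poly_bounded par_r"
proof (rule poly_bounded_mono)
  show "poly_bounded (\<lambda>P. 8 * (32 * par_l P + par_N P * par_M P + 1))"
    by (intro poly_bounded_intros poly_bounded_l poly_bounded_N poly_bounded_M)
  show "par_r P \<le> 8 * (32 * par_l P + par_N P * par_M P + 1)" if "valid P" for P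
  proof -
    have "(par_ae P + 1) * par_M P div par_N P \<le> (par_ae P + 1) * par_M P" by (rule div_le_dividend)
    also have "\<dots> \<le> par_N P * par_M P" using par_ae_less[OF that] by (intro mult_right_mono) auto
    finally show ?thesis by (simp add: par_r_def par_r'_def)
  qed
qed

lemma poly_bounded_cap: "poly_bounded par_cap"
  unfolding par_cap_def by (intro poly_bounded_intros poly_bounded_M poly_bounded_r)

definition load :: "params \<Rightarrow> nat" where
  "load P = 1 + par_m P + 2 ^ par_r P"

text \<open>\<open>load\<close> holds the two quantities that may exceed every polynomial. Being
  linear in it with a polynomial coefficient is the shape of the time bound; as this is not closed
  under products, the loops over samples and over masks must not be nested.\<close>

definition load_bounded :: "(params \<Rightarrow> nat) \<Rightarrow> bool" where
  "load_bounded f \<longleftrightarrow> (\<exists>g. poly_bounded g \<and> (\<forall>P. valid P \<longrightarrow> f P \<le> g P * load P))"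

lemma load_bounded_poly: "poly_bounded f \<Longrightarrow> load_bounded f"
  unfolding load_bounded_def load_def by (intro exI[of _ f]) auto

lemma load_bounded_m: "load_bounded par_m"
  unfolding load_bounded_def load_def by (intro exI[of _ "\<lambda>_. 1"]) (auto intro: poly_bounded_const)

lemma load_bounded_r: "load_bounded (\<lambda>P. 2 ^ par_r P)"
  unfolding load_bounded_def load_def by (intro exI[of _ "\<lambda>_. 1"]) (auto intro: poly_bounded_const)

lemma load_bounded_add:
  assumes "load_bounded f" "load_bounded g"
  shows "load_bounded (\<lambda>P. f P + g P)"
proof -
  obtain a b where "poly_bounded a" "\<And>P. valid P \<Longrightarrow> f P \<le> a P * load P"
     "poly_bounded b" "\<And>P. valid P \<Longrightarrow> g P \<le> b P * load P"
    using assms unfolding load_bounded_def by blast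
  then show ?thesis unfolding load_bounded_def
    by (intro exI[of _ "\<lambda>P. a P + b P"]) (auto intro: poly_bounded_add add_mono simp: add_mult_distrib)
qed

lemma load_bounded_mult:
  assumes "poly_bounded f" "load_bounded g"
  shows "load_bounded (\<lambda>P. f P * g P)" "load_bounded (\<lambda>P. g P * f P)"
proof -
  obtain b where "poly_bounded b" "\<And>P. valid P \<Longrightarrow> g P \<le> b P * load P"
    using assms unfolding load_bounded_def by blast
  then show "load_bounded (\<lambda>P. f P * g P)" unfolding load_bounded_def
    using assms(1) by (intro exI[of _ "\<lambda>P. f P * b P"]) (auto intro: poly_bounded_mult simp: mult.assoc)
  then show "load_bounded (\<lambda>P. g P * f P)" by (simp add: mult.commute)
qed

fun exps :: "prog \<Rightarrow> aexp set" where
  "exps (PAsg v e) = {e}"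
| "exps (PPut a i e) = {e}"
| "exps (p ;; q) = exps p \<union> exps q"
| "exps (PIf e p q) = exps p \<union> exps q"
| "exps (PFor v N p) = exps p"
| "exps _ = {}"

section \<open>Cost of a single phase\<close>

lemma grows_exps: "(\<And>e j. e \<in> exps p \<Longrightarrow> vbound K Y (b j) e \<le> b (Suc j)) \<Longrightarrow> grows K Y b p"
  by (induction p) auto

definition all_le :: "nat \<Rightarrow> mem \<Rightarrow> bool" where
  "all_le X m \<longleftrightarrow> (\<forall>v. mv m v \<le> X) \<and> (\<forall>a i. ma m a i \<le> X)"

lemma all_le_bounded: "all_le X m \<Longrightarrow> (\<And>v. v \<in> K \<Longrightarrow> mv m v \<le> Y) \<Longrightarrow> mem_bounded K Y X m"
  by (simp add: all_le_def mem_bounded_def)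

lemma bounded_all_le: "mem_bounded K Y X m \<Longrightarrow> Y \<le> X \<Longrightarrow> all_le X m"
  unfolding all_le_def mem_bounded_def by (meson order.trans)

lemma phase:
  assumes b: "\<And>j. b j + 1 \<le> b (Suc j)" and Y: "Y \<le> b 0" "\<And>v. v \<in> K \<Longrightarrow> mv (mem_of c) v \<le> Y"
    and big: "bits (b J) + 2 \<le> \<psi>" "dimension P + bits (dimension P) + 1 \<le> \<psi>" "pdigits p \<Longrightarrow> b J \<le> \<psi>"
    and p: "well_formed K p" "plain p" "\<And>e j. e \<in> exps p \<Longrightarrow> vbound K Y (b j) e \<le> b (Suc j)"
    and J: "J = steps (mv (mem_of c)) p" and le: "all_le (b 0) (mem_of c)" and todo: "todo c = compile p # rest"
  shows "\<exists>c'. reach P \<omega> c c' \<and> todo c' = rest \<and> mem_of c' = den P \<omega> p (mem_of c) \<and> all_le (b J) (mem_of c')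
     \<and> cost c' \<le> cost c + J * (pweight p * (\<psi> * \<psi>))"
proof -
  interpret growth P \<omega> K Y J \<psi> b
  proof
    have "(dimension P + 1) * (1 + bits (dimension P)) \<le> (dimension P + bits (dimension P) + 1) * (dimension P + bits (dimension P) + 1)"
      by (intro mult_mono) auto
    also have "\<dots> \<le> \<psi> * \<psi>" using big by (intro mult_mono) auto
    finally show "(dimension P + 1) * (1 + bits (dimension P)) \<le> \<psi> * \<psi>" .
  qed (use b Y big in auto)
  have v: "vars c = mv (mem_of c)" by (simp add: mem_of_def)
  have g: "grows K Y b p" by (rule grows_exps) (rule p(3))
  obtain c' where c': "reach P \<omega> c c'" "todo c' = rest" "mem_of c' = den P \<omega> p (mem_of c)"
      "mem_bounded K Y (b J) (mem_of c')" "cost c' \<le> cost c + J * (pweight p * (\<psi> * \<psi>))"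
    using simulation[OF p(1) g p(2) big(3) all_le_bounded[OF le Y(2)] _ todo]
    unfolding v J[symmetric] by auto
  then show ?thesis using bounded_all_le[OF c'(4)] Y_at[of J] by blast
qed

lemma phase_seq:
  assumes "\<And>j. b j + 1 \<le> b (Suc j)" "Y \<le> b 0" "\<And>v. v \<in> K \<Longrightarrow> mv (mem_of c) v \<le> Y"
    "bits (b J) + 2 \<le> \<psi>" "dimension P + bits (dimension P) + 1 \<le> \<psi>" "pdigits p \<Longrightarrow> b J \<le> \<psi>"
    "well_formed K p" "plain p" "\<And>e j. e \<in> exps p \<Longrightarrow> vbound K Y (b j) e \<le> b (Suc j)"
    "J = steps (mv (mem_of c)) p" "all_le (b 0) (mem_of c)" and todo: "todo c = [compile (p ;; q)]"
  shows "\<exists>c'. reach P \<omega> c c' \<and> todo c' = [compile q] \<and> mem_of c' = den P \<omega> p (mem_of c) \<and> all_le (b J) (mem_of c')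
     \<and> cost c' \<le> cost c + 1 + J * (pweight p * (\<psi> * \<psi>))"
proof -
  let ?d = "dstep P \<omega> c"
  have d: "todo ?d = [compile p, compile q]" "mem_of ?d = mem_of c" "cost ?d = cost c + 1"
    using dstep_Seq[of c "compile p" "compile q" "[]" P \<omega>] todo by auto
  have "\<exists>c'. reach P \<omega> ?d c' \<and> todo c' = [compile q] \<and> mem_of c' = den P \<omega> p (mem_of ?d) \<and> all_le (b J) (mem_of c')
     \<and> cost c' \<le> cost ?d + J * (pweight p * (\<psi> * \<psi>))"
    by (rule phase[of b Y K]) (use assms d in simp_all)
  then show ?thesis using reach_trans[OF reach_dstep] unfolding d by blast
qed

lemma bits_two_power: "bits (2 ^ w) \<le> w + 1"
  by (intro bits_le) simp

text \<open>The three ways in which values grow before the sampling phase: doubling, straight-line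
  arithmetic, and multiplication by numbers below \<open>2 ^ l\<close>.\<close>

lemma vbound_mono: "Y \<le> X \<Longrightarrow> vbound K Y X e \<le> vbound K X X e"
  by (induction e) (auto intro: add_mono mult_mono)

lemma phase_doubling:
  assumes "all_le (2 ^ w) (mem_of c)" "well_formed K p" "plain p" "pdigits p \<Longrightarrow> 2 ^ (w + 2 * J) \<le> \<psi>"
    "\<And>e X. e \<in> exps p \<Longrightarrow> 1 \<le> X \<Longrightarrow> vbound K X X e \<le> 4 * X" "todo c = [compile (p ;; q)]"
    and J: "J = steps (mv (mem_of c)) p"
    and \<psi>: "w + 2 * J + dimension P + bits (dimension P) + 3 \<le> \<psi>"
  shows "\<exists>c'. reach P \<omega> c c' \<and> todo c' = [compile q] \<and> mem_of c' = den P \<omega> p (mem_of c)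
     \<and> all_le (2 ^ (w + 2 * J)) (mem_of c') \<and> cost c' \<le> cost c + 1 + J * (pweight p * (\<psi> * \<psi>))"
proof -
  have "vbound K (2 ^ w) (2 ^ (w + 2 * j)) e \<le> 2 ^ (w + 2 * Suc j)" if "e \<in> exps p" for e j
    using order.trans[OF vbound_mono[of "2 ^ w" "2 ^ (w + 2 * j)" K e] assms(5)[OF that, of "2 ^ (w + 2 * j)"]]
    by (simp add: power_add)
  moreover have "2 ^ (w + 2 * j) + 1 \<le> (2 :: nat) ^ (w + 2 * Suc j)" for j
    using one_le_power[of "2 :: nat" "w + 2 * j"] by (simp add: power_add)
  moreover have "bits (2 ^ (w + 2 * J)) + 2 \<le> \<psi>" using bits_two_power[of "w + 2 * J"] \<psi> by simp
  ultimately show ?thesis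
    using assms by (intro phase_seq[where Y = "2 ^ w" and K = K and b = "\<lambda>j. 2 ^ (w + 2 * j)"])
      (auto simp: all_le_def)
qed

text \<open>Each step raises values to at most the fifth power and so multiplies their length by 5.
  That is affordable because the phases treated in this way have a constant number of steps. The
  summand 12 makes the starting bound exceed the constants in the programs.\<close>

lemma phase_straight:
  assumes le: "all_le (2 ^ w) (mem_of c)" and p: "well_formed {} p" "plain p" "\<not> pdigits p"
    "\<And>e X. e \<in> exps p \<Longrightarrow> 2048 \<le> X \<Longrightarrow> vbound {} 0 X e \<le> X ^ 5" and todo: "todo c = [compile (p ;; q)]"
    and J: "J = steps (mv (mem_of c)) p"
    and \<psi>: "\<psi> = (w + 12) * 5 ^ J + dimension P + bits (dimension P) + 3"
  shows "\<exists>c'. reach P \<omega> c c' \<and> todo c' = [compile q] \<and> mem_of c' = den P \<omega> p (mem_of c)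
     \<and> all_le (2 ^ ((w + 12) * 5 ^ J)) (mem_of c') \<and> cost c' \<le> cost c + 1 + J * (pweight p * (\<psi> * \<psi>))"
proof -
  have big: "2048 \<le> (2 :: nat) ^ ((w + 12) * 5 ^ j)" for j
  proof -
    have "12 * 1 \<le> (w + 12) * 5 ^ j" by (intro mult_mono) auto
    then have "(2 :: nat) ^ 12 \<le> 2 ^ ((w + 12) * 5 ^ j)" by (intro power_increasing) auto
    then show ?thesis by simp
  qed
  have e5: "(2 :: nat) ^ ((w + 12) * 5 ^ Suc j) = (2 ^ ((w + 12) * 5 ^ j)) ^ 5" for j
    by (simp add: mult_ac flip: power_mult)
  have "vbound {} 0 (2 ^ ((w + 12) * 5 ^ j)) e \<le> 2 ^ ((w + 12) * 5 ^ Suc j)" if "e \<in> exps p" for e j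
    unfolding e5 by (rule p(4)[OF that big])
  moreover have "2 ^ ((w + 12) * 5 ^ j) + 1 \<le> (2 :: nat) ^ ((w + 12) * 5 ^ Suc j)" for j
  proof -
    have "1 * 1 \<le> (w + 12) * 5 ^ j" by (intro mult_mono) auto
    moreover have "(w + 12) * 5 ^ Suc j = 5 * ((w + 12) * 5 ^ j)" by simp
    ultimately have "(w + 12) * 5 ^ j + 1 \<le> (w + 12) * 5 ^ Suc j" by linarith
    then have "(2 :: nat) ^ ((w + 12) * 5 ^ j + 1) \<le> 2 ^ ((w + 12) * 5 ^ Suc j)" by (intro power_increasing) auto
    then show ?thesis using big[of j] by simp
  qed
  moreover have "bits (2 ^ ((w + 12) * 5 ^ J)) + 2 \<le> \<psi>" using bits_two_power[of "(w + 12) * 5 ^ J"] \<psi> by simp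
  moreover have "all_le (2 ^ ((w + 12) * 5 ^ 0)) (mem_of c)"
  proof -
    have "(2 :: nat) ^ w \<le> 2 ^ ((w + 12) * 5 ^ 0)" by (intro power_increasing) auto
    then show ?thesis using le unfolding all_le_def by (meson order.trans)
  qed
  ultimately show ?thesis
    using p(1-3) todo J \<psi>
    by (intro phase_seq[where Y = 0 and K = "{}" and b = "\<lambda>j. 2 ^ ((w + 12) * 5 ^ j)"]) auto
qed

text \<open>One factor of each product is built from variables in \<open>K\<close>, which stay at
  most \<open>2 ^ l\<close>, so a step adds only \<open>l\<close> bits. A bound by squaring would be
  useless for a loop of \<open>k\<close> rounds.\<close>

lemma phase_multiply:
  assumes le: "all_le (2 ^ w) (mem_of c)" and p: "well_formed K p" "plain p" "\<not> pdigits p"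
    "\<And>e X. e \<in> exps p \<Longrightarrow> vbound K (2 ^ l) X e \<le> X * 2 ^ l" and todo: "todo c = [compile (p ;; q)]"
    and K: "\<And>v. v \<in> K \<Longrightarrow> mv (mem_of c) v \<le> 2 ^ l" and l: "1 \<le> l" "l \<le> w"
    and J: "J = steps (mv (mem_of c)) p"
    and \<psi>: "\<psi> = w + l * J + dimension P + bits (dimension P) + 3"
  shows "\<exists>c'. reach P \<omega> c c' \<and> todo c' = [compile q] \<and> mem_of c' = den P \<omega> p (mem_of c)
     \<and> all_le (2 ^ (w + l * J)) (mem_of c') \<and> cost c' \<le> cost c + 1 + J * (pweight p * (\<psi> * \<psi>))"
proof -
  have "vbound K (2 ^ l) (2 ^ (w + l * j)) e \<le> 2 ^ (w + l * Suc j)" if "e \<in> exps p" for e j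
    using p(4)[OF that, of "2 ^ (w + l * j)"] by (simp add: power_add mult_ac)
  moreover have "2 ^ (w + l * j) + 1 \<le> (2 :: nat) ^ (w + l * Suc j)" for j
  proof -
    have "(2 :: nat) ^ (w + l * j + 1) \<le> 2 ^ (w + l * Suc j)" using l by (intro power_increasing) auto
    moreover have "(2 :: nat) ^ (w + l * j + 1) = 2 * 2 ^ (w + l * j)" by simp
    moreover have "1 \<le> (2 :: nat) ^ (w + l * j)" by (rule one_le_power) simp
    ultimately show ?thesis by linarith
  qed
  moreover have "bits (2 ^ (w + l * J)) + 2 \<le> \<psi>" using bits_two_power[of "w + l * J"] \<psi> by simp
  moreover have "(2 :: nat) ^ l \<le> 2 ^ w" using l by (intro power_increasing) auto
  ultimately show ?thesis
    using p(1-3) todo J \<psi> le K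
    by (intro phase_seq[where Y = "2 ^ l" and K = K and b = "\<lambda>j. 2 ^ (w + l * j)"]) auto
qed

text \<open>Sampling and solving only count and copy, so values grow additively. Even a huge number
  \<open>J\<close> of steps enters \<open>\<psi>\<close> only through its length.\<close>

lemma phase_slow:
  assumes le: "all_le X (mem_of c)" and p: "well_formed K p" "plain p" "\<not> pdigits p"
    "\<And>e X. e \<in> exps p \<Longrightarrow> 1 \<le> X \<Longrightarrow> vbound K X X e \<le> X + 1" and X: "1 \<le> X"
    and J: "J = steps (mv (mem_of c)) p" and todo: "todo c = compile p # rest"
    and \<psi>: "bits (X + J) + 2 \<le> \<psi>" "dimension P + bits (dimension P) + 1 \<le> \<psi>"
  shows "\<exists>c'. reach P \<omega> c c' \<and> todo c' = rest \<and> mem_of c' = den P \<omega> p (mem_of c)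
     \<and> all_le (X + J) (mem_of c') \<and> cost c' \<le> cost c + J * (pweight p * (\<psi> * \<psi>))"
proof -
  have "vbound K X (X + j) e \<le> X + Suc j" if "e \<in> exps p" for e j
    using order.trans[OF vbound_mono[of X "X + j" K e] p(4)[OF that, of "X + j"]] X by simp
  then show ?thesis
    using assms by (intro phase[where Y = X and K = K and b = "\<lambda>j. X + j"]) (auto simp: all_le_def)
qed

section \<open>Step counts\<close>

fun loop_bounds :: "prog \<Rightarrow> nat set" where
  "loop_bounds (p ;; q) = loop_bounds p \<union> loop_bounds q"
| "loop_bounds (PIf e p q) = loop_bounds p \<union> loop_bounds q"
| "loop_bounds (PFor v N p) = insert N (loop_bounds p)"
| "loop_bounds _ = {}"

lemma poly_bounded_steps:
  "(\<And>v. v \<in> loop_bounds p \<Longrightarrow> poly_bounded (\<lambda>P. V P v)) \<Longrightarrow> poly_bounded (\<lambda>P. steps (V P) p)"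
  by (induction p) (auto intro!: poly_bounded_intros simp del: add_Suc add_Suc_right)

definition "solve_vals P v = (if v = v_n then dimension P else if v = v_m then par_m P
   else if v = v_NM then 2 ^ par_r P else if v = v_cap then par_cap P
   else if v = v_Q then par_Q P else if v = v_Q1 then par_Q P + 1 else dimension P - par_Q P + 1)"

lemma poly_bounded_solve_vals:
  assumes "v \<noteq> v_m" "v \<noteq> v_NM"
  shows "poly_bounded (\<lambda>P. solve_vals P v)"
proof -
  have "poly_bounded (\<lambda>P. dimension P - par_Q P + 1)"
  proof (rule poly_bounded_mono)
    show "poly_bounded (\<lambda>P. dimension P + 1)" by (intro poly_bounded_intros)
  qed simp
  moreover have "poly_bounded (\<lambda>P. par_Q P + 1)" by (intro poly_bounded_add poly_bounded_Q poly_bounded_const)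
  ultimately show ?thesis using assms
    unfolding solve_vals_def
    by (cases "v = v_n"; cases "v = v_cap"; cases "v = v_Q"; cases "v = v_Q1")
       (simp_all add: poly_bounded_dim poly_bounded_cap poly_bounded_Q)
qed

lemma load_bounded_const: "load_bounded (\<lambda>_. c)"
  by (intro load_bounded_poly poly_bounded_const)

lemma load_bounded_sample: "load_bounded (\<lambda>P. steps (solve_vals P) sampleP)"
proof -
  let ?body = "PSample a_raw v_d ;;
     PFor v_j v_n (PPut a_X (Add (Mul (Var v_i) (Var v_n)) (Var v_j)) (Get a_raw (Var v_j))) ;;
     PPut a_Y (Var v_i) (Var v_d)"
  have b: "poly_bounded (\<lambda>P. steps (solve_vals P) ?body)"
    by (intro poly_bounded_steps poly_bounded_solve_vals) auto
  have m: "load_bounded (\<lambda>P. solve_vals P v_m)" using load_bounded_m by (simp add: solve_vals_def)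
  show ?thesis
    unfolding sampleP_def steps.simps(6)
    by (intro load_bounded_add load_bounded_const load_bounded_mult(2)[OF _ m] poly_bounded_add b poly_bounded_const)
qed

text \<open>The loop over samples and the loop over masks both lie inside the loop over windows, but
  neither lies inside the other. All remaining loop bounds are polynomial.\<close>

lemma load_bounded_solve: "load_bounded (\<lambda>P. steps (solve_vals P) solveP)"
proof -
  let ?V = solve_vals
  let ?push = "PIf (Var v_z) PSkip
     (PIf (Less (Var v_cnt) (Var v_cap))
       (PPut a_pool (Var v_cnt) (Var v_i) ;; PAsg v_cnt (Add (Var v_cnt) (Num 1))) PSkip)"
  have m: "load_bounded (\<lambda>P. ?V P v_m)" using load_bounded_m by (simp add: solve_vals_def)
  have NM: "load_bounded (\<lambda>P. ?V P v_NM)" using load_bounded_r by (simp add: solve_vals_def)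
  have nw: "poly_bounded (\<lambda>P. ?V P v_nw)" by (rule poly_bounded_solve_vals) auto
  have scan: "poly_bounded (\<lambda>P. steps (?V P) scanP)"
  proof (rule poly_bounded_steps)
    fix v assume "v \<in> loop_bounds scanP"
    then show "poly_bounded (\<lambda>P. ?V P v)" by (intro poly_bounded_solve_vals) (auto simp: scanP_def)
  qed
  have push: "poly_bounded (\<lambda>P. steps (?V P) ?push)" by (rule poly_bounded_steps) simp
  have mask: "poly_bounded (\<lambda>P. steps (?V P) maskP)"
  proof (rule poly_bounded_steps)
    fix v assume "v \<in> loop_bounds maskP"
    then show "poly_bounded (\<lambda>P. ?V P v)"
      by (intro poly_bounded_solve_vals)
      (auto simp: maskP_def outP_def disP_def candP_def elimP_def updateP_def copyP_def betaP_def
         initP_def matrixP_def dotP_def)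
  qed
  show ?thesis
    unfolding solveP_def winP_def poolP_def steps.simps(2,4,6)
    by (intro load_bounded_add load_bounded_const load_bounded_mult(1)[OF nw] load_bounded_mult(2)[OF _ m]
        load_bounded_mult(2)[OF _ NM] scan push mask poly_bounded_const poly_bounded_add)
qed

lemma sample_solve_load:
  obtains F where "poly_bounded F"
    "\<And>P. valid P \<Longrightarrow> steps (solve_vals P) sampleP + steps (solve_vals P) solveP \<le> F P * load P"
  using load_bounded_add[OF load_bounded_sample load_bounded_solve] unfolding load_bounded_def by blast

lemma fifth_power_ge:
  fixes X :: nat
  assumes "2048 \<le> X"
  shows "40 + 40 * X + 40 * (X * X) \<le> X ^ 5" "512 * (X * X * (X + X * X + 1)) \<le> X ^ 5"
proof -
  have X5: "X ^ 5 = X * (X * (X * (X * X)))" by (simp add: eval_nat_numeral)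
  have m: "2048 * Y \<le> X * Y" for Y using assms by (intro mult_right_mono) auto
  show "40 + 40 * X + 40 * (X * X) \<le> X ^ 5"
    unfolding X5 using m[of 1] m[of X] m[of "X * X"] m[of "X * (X * X)"] m[of "X * (X * (X * X))"] assms by linarith
  have "512 * (X * X * (X + X * X + 1)) = 512 * (X * (X * X)) + 512 * (X * (X * (X * X))) + 512 * (X * X)"
    by (simp add: algebra_simps)
  then show "512 * (X * X * (X + X * X + 1)) \<le> X ^ 5"
    unfolding X5 using m[of "X * X"] m[of "X * (X * X)"] m[of "X * (X * (X * X))"] by linarith
qed

lemma exps_mod2: "vbound K Y X (mod2 e) = 1"
  by (simp add: mod2_def)

lemma exps_length: "e \<in> exps lengthP \<Longrightarrow> 1 \<le> X \<Longrightarrow> vbound K X X e \<le> 4 * X"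
  by (auto simp: lengthP_def)

lemma exps_digit: "e \<in> exps digitP \<Longrightarrow> 1 \<le> X \<Longrightarrow> vbound K X X e \<le> 4 * X"
  by (auto simp: digitP_def)

lemma exps_exp: "e \<in> exps expP \<Longrightarrow> 2048 \<le> X \<Longrightarrow> vbound {} 0 X e \<le> X ^ 5"
  using fifth_power_ge[of X] by (auto simp: expP_def algebra_simps)

lemma exps_power: "e \<in> exps powerP \<Longrightarrow> 1 \<le> X \<Longrightarrow> vbound K X X e \<le> 4 * X"
  by (auto simp: powerP_def)

lemma exps_size: "e \<in> exps sizeP \<Longrightarrow> 2048 \<le> X \<Longrightarrow> vbound {} 0 X e \<le> X ^ 5"
  using fifth_power_ge[of X] by (auto simp: sizeP_def algebra_simps)

lemma exps_ratio: "e \<in> exps ratioP \<Longrightarrow> vbound {v_n, v_k, v_Q} (2 ^ l) X e \<le> X * 2 ^ l"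
  by (auto simp: ratioP_def)

lemma exps_count: "e \<in> exps countP \<Longrightarrow> 2048 \<le> X \<Longrightarrow> vbound {} 0 X e \<le> X ^ 5"
  using fifth_power_ge[of X] by (auto simp: countP_def algebra_simps)

lemma exps_table: "e \<in> exps tableP \<Longrightarrow> 1 \<le> X \<Longrightarrow> vbound K X X e \<le> 4 * X"
  by (auto simp: tableP_def)

lemma exps_sample: "e \<in> exps sampleP \<Longrightarrow> 1 \<le> X \<Longrightarrow> vbound K X X e \<le> X + 1"
  by (auto simp: sampleP_def)

lemma exps_solve: "e \<in> exps solveP \<Longrightarrow> 1 \<le> X \<Longrightarrow> vbound K X X e \<le> X + 1"
  by (auto simp: solveP_def winP_def maskP_def outP_def poolP_def scanP_def disP_def candP_def elimP_def
    updateP_def copyP_def betaP_def initP_def matrixP_def dotP_def exps_mod2)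

abbreviation (input) "solve_consts \<equiv> {v_n, v_m, v_NM, v_cap, v_Q, v_Q1, v_nw}"

lemma well_formed_programs:
  "well_formed {v_n} lengthP" "well_formed {v_l2} digitP" "well_formed {} expP" "well_formed {v_h} powerP"
  "well_formed {} sizeP" "well_formed {v_n, v_k, v_Q} ratioP" "well_formed {} countP" "well_formed {v_r} tableP"
  "well_formed solve_consts sampleP" "well_formed solve_consts solveP"
  by (simp_all add: lengthP_def digitP_def expP_def powerP_def sizeP_def ratioP_def countP_def tableP_def
    sampleP_def solveP_def winP_def maskP_def outP_def poolP_def scanP_def disP_def candP_def elimP_def
    updateP_def copyP_def betaP_def initP_def matrixP_def dotP_def)

lemma plain_programs:
  "plain lengthP" "plain digitP" "plain expP" "plain powerP" "plain sizeP" "plain ratioP" "plain countP"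
  "plain tableP" "plain sampleP" "plain solveP"
  by (simp_all add: lengthP_def digitP_def expP_def powerP_def sizeP_def ratioP_def countP_def tableP_def
    sampleP_def solveP_def winP_def maskP_def outP_def poolP_def scanP_def disP_def candP_def elimP_def
    updateP_def copyP_def betaP_def initP_def matrixP_def dotP_def mod2_def)

lemma pdigits_programs:
  "\<not> pdigits lengthP" "\<not> pdigits expP" "\<not> pdigits powerP" "\<not> pdigits sizeP" "\<not> pdigits ratioP"
  "\<not> pdigits countP" "\<not> pdigits tableP" "\<not> pdigits sampleP" "\<not> pdigits solveP"
  by (simp_all add: lengthP_def digitP_def expP_def powerP_def sizeP_def ratioP_def countP_def tableP_def
    sampleP_def solveP_def winP_def maskP_def outP_def poolP_def scanP_def disP_def candP_def elimP_def
    updateP_def copyP_def betaP_def initP_def matrixP_def dotP_def mod2_def)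

section \<open>Lengths of values after each phase, and the total cost\<close>

definition "st1 P = steps (\<lambda>_. dimension P) lengthP"
definition "st2 P = steps (\<lambda>_. 2 * par_l P) digitP"
definition "st3 = steps (\<lambda>_. 0) expP"
definition "st4 P = steps (\<lambda>_. par_h P) powerP"
definition "st5 = steps (\<lambda>_. 0) sizeP"
definition "st6 P = steps (\<lambda>_. sparsity P) ratioP"
definition "st7 = steps (\<lambda>_. 0) countP"
definition "st8 P = steps (\<lambda>_. par_r P) tableP"
definition "st9 P = steps (solve_vals P) sampleP"
definition "st10 P = steps (solve_vals P) solveP"

text \<open>After phase \<open>i\<close> all values are at most 2 to the power
  \<open>wi P\<close>.\<close>

definition "w2 P = par_l P + 1 + 2 * st2 P"
definition "w3 P = (w2 P + 12) * 5 ^ st3"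
definition "w4 P = w3 P + 2 * st4 P"
definition "w5 P = (w4 P + 12) * 5 ^ st5"
definition "w6 P = w5 P + par_l P * st6 P"
definition "w7 P = (w6 P + 12) * 5 ^ st7"
definition "w8 P = w7 P + 2 * st8 P"

definition "slack P = dimension P + par_l P + 3"

text \<open>In the last two phases values are at most \<open>2 ^ w8 P\<close> plus the number of
  steps, which is at most \<open>3 * F P * 2 ^ w8 P\<close>; the factor \<open>1 + 3 * F P\<close>
  adds at most \<open>3 * F P\<close> bits.\<close>

definition "final_psi F P = w8 P + 3 * F P + 2 + slack P"

definition "total_cost F P =
   (1 + st1 P * (pweight lengthP * ((par_l P + 2 * st1 P + slack P) * (par_l P + 2 * st1 P + slack P)))) +
   (1 + st2 P * (pweight digitP * ((2 ^ w2 P + w2 P + slack P) * (2 ^ w2 P + w2 P + slack P)))) +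
   (1 + st3 * (pweight expP * ((w3 P + slack P) * (w3 P + slack P)))) +
   (1 + st4 P * (pweight powerP * ((w4 P + slack P) * (w4 P + slack P)))) +
   (1 + st5 * (pweight sizeP * ((w5 P + slack P) * (w5 P + slack P)))) +
   (1 + st6 P * (pweight ratioP * ((w6 P + slack P) * (w6 P + slack P)))) +
   (1 + st7 * (pweight countP * ((w7 P + slack P) * (w7 P + slack P)))) +
   (1 + st8 P * (pweight tableP * ((w8 P + slack P) * (w8 P + slack P)))) +
   (1 + st9 P * (pweight sampleP * (final_psi F P * final_psi F P))) +
   st10 P * (pweight solveP * (final_psi F P * final_psi F P))"

text \<open>In the digit phase \<open>\<psi>\<close> must bound the values themselves. The number of
  its steps is linear in \<open>l\<close>, so \<open>2 ^ w2 P\<close> is a constant times a fixed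
  power of \<open>2 ^ l\<close>.\<close>

lemma poly_bounded_two_power_w2: "poly_bounded (\<lambda>P. 2 ^ w2 P)"
proof -
  obtain a b where ab: "\<And>x. steps (\<lambda>_. x) digitP = a + b * x"
  proof
    show "steps (\<lambda>_. x) digitP = steps (\<lambda>_. 0) digitP + (steps (\<lambda>_. 1) digitP - steps (\<lambda>_. 0) digitP) * x" for x
      by (simp add: digitP_def)
  qed
  have "(2 :: nat) ^ w2 (P :: params) = 2 ^ par_l P * 2 ^ (1 + 2 * a) * (2 ^ par_l P) ^ (4 * b)" for P
    by (simp add: w2_def st2_def ab power_add power_mult[symmetric] algebra_simps)
  then have "(\<lambda>P :: params. 2 ^ w2 P) = (\<lambda>P. 2 ^ par_l P * 2 ^ (1 + 2 * a) * (2 ^ par_l P) ^ (4 * b) :: nat)" by (rule ext)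
  then show ?thesis
    by (simp only:) (intro poly_bounded_mult poly_bounded_power poly_bounded_two_power_l poly_bounded_const)
qed

lemma load_bounded_total_cost:
  assumes "poly_bounded F"
  shows "load_bounded (total_cost F)"
proof -
  have slack: "poly_bounded slack" unfolding slack_def by (intro poly_bounded_intros poly_bounded_l)
  have st: "poly_bounded st1" "poly_bounded st2" "poly_bounded st4" "poly_bounded st6" "poly_bounded st8"
    unfolding st1_def st2_def st4_def st6_def st8_def
    by (intro poly_bounded_steps poly_bounded_intros poly_bounded_l poly_bounded_h poly_bounded_k poly_bounded_r)+
  have w2: "poly_bounded w2" unfolding w2_def by (intro poly_bounded_intros poly_bounded_l st)
  have w3: "poly_bounded w3" unfolding w3_def by (intro poly_bounded_mult poly_bounded_add poly_bounded_const w2)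
  have w4: "poly_bounded w4" unfolding w4_def by (intro poly_bounded_mult poly_bounded_add poly_bounded_const w3 st)
  have w5: "poly_bounded w5" unfolding w5_def by (intro poly_bounded_mult poly_bounded_add poly_bounded_const w4)
  have w6: "poly_bounded w6" unfolding w6_def by (intro poly_bounded_mult poly_bounded_add poly_bounded_const w5 poly_bounded_l st)
  have w7: "poly_bounded w7" unfolding w7_def by (intro poly_bounded_mult poly_bounded_add poly_bounded_const w6)
  have w8: "poly_bounded w8" unfolding w8_def by (intro poly_bounded_mult poly_bounded_add poly_bounded_const w7 st)
  have psi: "poly_bounded (final_psi F)"
    unfolding final_psi_def by (intro poly_bounded_mult poly_bounded_add poly_bounded_const w8 slack assms)
  have ps: "poly_bounded (\<lambda>P. c * (final_psi F P * final_psi F P))" for c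
    by (intro poly_bounded_mult poly_bounded_const psi)
  have st': "load_bounded st9" "load_bounded st10"
    unfolding st9_def st10_def by (rule load_bounded_sample load_bounded_solve)+
  show ?thesis
    unfolding total_cost_def
    by (intro load_bounded_add load_bounded_const load_bounded_mult(2)[OF ps] st')
       (intro load_bounded_poly poly_bounded_mult poly_bounded_add poly_bounded_const
         poly_bounded_l st w2 w3 w4 w5 w6 w7 w8 slack poly_bounded_two_power_w2)+
qed

context machine
begin

lemma l_pos: "1 \<le> l"
  using valid less_two_power_bits[of n] unfolding par_l_def valid_def
  by (cases "bits n") auto

lemma n_less: "n < 2 ^ l"
  unfolding par_l_def by (rule less_two_power_bits)

lemma all_le_M0: "all_le (2 ^ l) M0"
proof -
  have "mv M0 v \<le> 2 ^ l" for v
    using M0(1-3) n_less valid by (cases "v = v_n \<or> v = v_k") (auto simp: valid_def)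
  then show ?thesis by (simp add: all_le_def M0)
qed

text \<open>The general estimate would give \<open>2 ^ (l + 2 * st1 P)\<close> with
  \<open>st1 P\<close> linear in \<open>n\<close>, too much for the digit phase. The values left by
  \<open>lengthP\<close> are known exactly and are bounded directly.\<close>

lemma all_le_M1: "all_le (2 ^ (l + 1)) M1"
proof -
  have l: "2 * l \<le> 2 * 2 ^ l" using less_exp[of l] by simp
  have "mv M1 v \<le> 2 ^ (l + 1)" for v
  proof (cases "v \<in> {v_l, v_l2, v_pw, v_c}")
    case True
    define Z where "Z = (2 :: nat) ^ (l + 1)"
    have "l \<le> Z" "2 * l \<le> Z" "2 ^ l \<le> Z" "n \<le> Z"
      using less_exp[of l] n_less unfolding Z_def power_add power_one_right by linarith+
    then show ?thesis using True M1 unfolding Z_def[symmetric] by auto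
  next
    case False
    then have "mv M1 v = mv M0 v" by (simp add: M1_def den_frame)
    moreover have "mv M0 v \<le> 2 ^ l" using all_le_M0 unfolding all_le_def by blast
    ultimately show ?thesis by simp
  qed
  moreover have "ma M1 a i = 0" for a i by (simp add: M1_def den_frame_ma M0)
  ultimately show ?thesis by (simp add: all_le_def)
qed

lemma steps_eq:
  "st1 P = steps (mv M0) lengthP" "st2 P = steps (mv M1) digitP" "st3 = steps (mv M2) expP"
  "st4 P = steps (mv M3) powerP" "st5 = steps (mv M4) sizeP" "st6 P = steps (mv M5) ratioP"
  "st7 = steps (mv M6) countP" "st8 P = steps (mv M7) tableP" "st9 P = steps (mv M8) sampleP"
  "st10 P = steps (mv M9) solveP"
proof -
  note [simp] = M0(1-4) M1 M2 M3 M4 M5 M6 M7 M8(1-10) M9(1-9)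
  show "st1 P = steps (mv M0) lengthP" unfolding st1_def by (rule steps_cong[of "{v_n}"]) (simp_all add: well_formed_programs)
  show "st2 P = steps (mv M1) digitP" unfolding st2_def by (rule steps_cong[of "{v_l2}"]) (simp_all add: well_formed_programs)
  show "st3 = steps (mv M2) expP" unfolding st3_def by (rule steps_cong[of "{}"]) (simp_all add: well_formed_programs)
  show "st4 P = steps (mv M3) powerP" unfolding st4_def by (rule steps_cong[of "{v_h}"]) (simp_all add: well_formed_programs)
  show "st5 = steps (mv M4) sizeP" unfolding st5_def by (rule steps_cong[of "{}"]) (simp_all add: well_formed_programs)
  show "st6 P = steps (mv M5) ratioP"
    unfolding st6_def using M5(2) by (simp add: ratioP_def)
  show "st7 = steps (mv M6) countP" unfolding st7_def by (rule steps_cong[of "{}"]) (simp_all add: well_formed_programs)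
  show "st8 P = steps (mv M7) tableP" unfolding st8_def by (rule steps_cong[of "{v_r}"]) (simp_all add: well_formed_programs)
  show "st9 P = steps (mv M8) sampleP" unfolding st9_def
    by (rule steps_cong[OF well_formed_programs(9)]) (use M8 in \<open>auto simp: solve_vals_def\<close>)
  show "st10 P = steps (mv M9) solveP" unfolding st10_def
    by (rule steps_cong[OF well_formed_programs(10)]) (use M9 in \<open>auto simp: solve_vals_def\<close>)
qed

lemma run_prefix:
  shows "\<exists>c. reach P \<omega> (initial (compile fullP) P) c \<and> todo c = [compile (sampleP ;; solveP)] \<and> mem_of c = M8
    \<and> all_le (2 ^ w8 P) M8 \<and> cost c \<le>
   (1 + st1 P * (pweight lengthP * ((par_l P + 2 * st1 P + slack P) * (par_l P + 2 * st1 P + slack P)))) +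
   (1 + st2 P * (pweight digitP * ((2 ^ w2 P + w2 P + slack P) * (2 ^ w2 P + w2 P + slack P)))) +
   (1 + st3 * (pweight expP * ((w3 P + slack P) * (w3 P + slack P)))) +
   (1 + st4 P * (pweight powerP * ((w4 P + slack P) * (w4 P + slack P)))) +
   (1 + st5 * (pweight sizeP * ((w5 P + slack P) * (w5 P + slack P)))) +
   (1 + st6 P * (pweight ratioP * ((w6 P + slack P) * (w6 P + slack P)))) +
   (1 + st7 * (pweight countP * ((w7 P + slack P) * (w7 P + slack P)))) +
   (1 + st8 P * (pweight tableP * ((w8 P + slack P) * (w8 P + slack P))))"
proof -
  let ?c0 = "initial (compile fullP) P"
  have sl: "slack P = n + bits n + 3" by (simp add: slack_def par_l_def)
  have c0: "mem_of ?c0 = M0" "cost ?c0 = 0" by (simp_all add: M0_def initial_def)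
  have t0: "todo ?c0 = [compile (lengthP ;; digitP ;; expP ;; powerP ;; sizeP ;; ratioP ;; countP ;; tableP ;; sampleP ;; solveP)]"
    by (simp add: initial_def fullP_def)
  have "\<exists>c'. reach P \<omega> ?c0 c' \<and> todo c' = [compile (digitP ;; expP ;; powerP ;; sizeP ;; ratioP ;; countP ;; tableP ;; sampleP ;; solveP)]
     \<and> mem_of c' = den P \<omega> lengthP (mem_of ?c0) \<and> all_le (2 ^ (l + 2 * st1 P)) (mem_of c')
     \<and> cost c' \<le> cost ?c0 + 1 + st1 P * (pweight lengthP * ((l + 2 * st1 P + slack P) * (l + 2 * st1 P + slack P)))"
    by (rule phase_doubling[where K = "{v_n}"])
       (use all_le_M0 t0 in \<open>auto simp: c0 well_formed_programs plain_programs pdigits_programs steps_eq(1) sl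
          intro: exps_length[simplified]\<close>)
  then obtain c1 where c1: "reach P \<omega> ?c0 c1"
    "todo c1 = [compile (digitP ;; expP ;; powerP ;; sizeP ;; ratioP ;; countP ;; tableP ;; sampleP ;; solveP)]"
    "mem_of c1 = M1"
    "cost c1 \<le> 1 + st1 P * (pweight lengthP * ((l + 2 * st1 P + slack P) * (l + 2 * st1 P + slack P)))"
    by (auto simp: c0 M1_def)
  have "\<exists>c'. reach P \<omega> c1 c' \<and> todo c' = [compile (expP ;; powerP ;; sizeP ;; ratioP ;; countP ;; tableP ;; sampleP ;; solveP)]
     \<and> mem_of c' = den P \<omega> digitP (mem_of c1) \<and> all_le (2 ^ ((l + 1) + 2 * st2 P)) (mem_of c')
     \<and> cost c' \<le> cost c1 + 1 + st2 P * (pweight digitP * ((2 ^ w2 P + w2 P + slack P) * (2 ^ w2 P + w2 P + slack P)))"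
    by (rule phase_doubling[where K = "{v_l2}"])
       (use all_le_M1 c1 in \<open>auto simp: well_formed_programs plain_programs steps_eq(2) sl w2_def
          intro: exps_digit[simplified]\<close>)
  then obtain c2 where c2: "reach P \<omega> c1 c2"
    "todo c2 = [compile (expP ;; powerP ;; sizeP ;; ratioP ;; countP ;; tableP ;; sampleP ;; solveP)]"
    "mem_of c2 = M2" "all_le (2 ^ w2 P) M2"
    "cost c2 \<le> cost c1 + 1 + st2 P * (pweight digitP * ((2 ^ w2 P + w2 P + slack P) * (2 ^ w2 P + w2 P + slack P)))"
    by (auto simp: c1 M2_def w2_def)
  have "\<exists>c'. reach P \<omega> c2 c' \<and> todo c' = [compile (powerP ;; sizeP ;; ratioP ;; countP ;; tableP ;; sampleP ;; solveP)]
     \<and> mem_of c' = den P \<omega> expP (mem_of c2) \<and> all_le (2 ^ ((w2 P + 12) * 5 ^ st3)) (mem_of c')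
     \<and> cost c' \<le> cost c2 + 1 + st3 * (pweight expP * ((w3 P + slack P) * (w3 P + slack P)))"
    by (rule phase_straight)
       (use c2 in \<open>auto simp: well_formed_programs plain_programs pdigits_programs steps_eq(3) sl w3_def
          intro: exps_exp\<close>)
  then obtain c3 where c3: "reach P \<omega> c2 c3"
    "todo c3 = [compile (powerP ;; sizeP ;; ratioP ;; countP ;; tableP ;; sampleP ;; solveP)]"
    "mem_of c3 = M3" "all_le (2 ^ w3 P) M3"
    "cost c3 \<le> cost c2 + 1 + st3 * (pweight expP * ((w3 P + slack P) * (w3 P + slack P)))"
    by (auto simp: c2 M3_def w3_def)
  have "\<exists>c'. reach P \<omega> c3 c' \<and> todo c' = [compile (sizeP ;; ratioP ;; countP ;; tableP ;; sampleP ;; solveP)]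
     \<and> mem_of c' = den P \<omega> powerP (mem_of c3) \<and> all_le (2 ^ (w3 P + 2 * st4 P)) (mem_of c')
     \<and> cost c' \<le> cost c3 + 1 + st4 P * (pweight powerP * ((w4 P + slack P) * (w4 P + slack P)))"
    by (rule phase_doubling[where K = "{v_h}"])
       (use c3 in \<open>auto simp: well_formed_programs plain_programs pdigits_programs steps_eq(4) sl w4_def
          intro: exps_power[simplified]\<close>)
  then obtain c4 where c4: "reach P \<omega> c3 c4"
    "todo c4 = [compile (sizeP ;; ratioP ;; countP ;; tableP ;; sampleP ;; solveP)]"
    "mem_of c4 = M4" "all_le (2 ^ w4 P) M4"
    "cost c4 \<le> cost c3 + 1 + st4 P * (pweight powerP * ((w4 P + slack P) * (w4 P + slack P)))"
    by (auto simp: c3 M4_def w4_def)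
  have "\<exists>c'. reach P \<omega> c4 c' \<and> todo c' = [compile (ratioP ;; countP ;; tableP ;; sampleP ;; solveP)]
     \<and> mem_of c' = den P \<omega> sizeP (mem_of c4) \<and> all_le (2 ^ ((w4 P + 12) * 5 ^ st5)) (mem_of c')
     \<and> cost c' \<le> cost c4 + 1 + st5 * (pweight sizeP * ((w5 P + slack P) * (w5 P + slack P)))"
    by (rule phase_straight)
       (use c4 in \<open>auto simp: well_formed_programs plain_programs pdigits_programs steps_eq(5) sl w5_def
          intro: exps_size\<close>)
  then obtain c5 where c5: "reach P \<omega> c4 c5"
    "todo c5 = [compile (ratioP ;; countP ;; tableP ;; sampleP ;; solveP)]"
    "mem_of c5 = M5" "all_le (2 ^ w5 P) M5"
    "cost c5 \<le> cost c4 + 1 + st5 * (pweight sizeP * ((w5 P + slack P) * (w5 P + slack P)))"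
    by (auto simp: c4 M5_def w5_def)
  have lw5: "l \<le> w5 P"
  proof -
    have "x \<le> (x + 12) * 5 ^ k" for x k :: nat
    proof -
      have "x * 1 \<le> (x + 12) * 5 ^ k" by (intro mult_mono) auto
      then show ?thesis by simp
    qed
    from this[of "w4 P" st5] this[of "w2 P" st3] show ?thesis
      unfolding w5_def w4_def w3_def by (simp add: w2_def)
  qed
  have "\<exists>c'. reach P \<omega> c5 c' \<and> todo c' = [compile (countP ;; tableP ;; sampleP ;; solveP)]
     \<and> mem_of c' = den P \<omega> ratioP (mem_of c5) \<and> all_le (2 ^ (w5 P + l * st6 P)) (mem_of c')
     \<and> cost c' \<le> cost c5 + 1 + st6 P * (pweight ratioP * ((w6 P + slack P) * (w6 P + slack P)))"
    by (rule phase_multiply[where K = "{v_n, v_k, v_Q}"])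
       (use c5 l_pos lw5 n_less Q_le valid in \<open>auto simp: well_formed_programs[simplified] plain_programs pdigits_programs
          steps_eq(6) sl w6_def M5 M5[simplified] valid_def intro: exps_ratio[simplified]\<close>)
  then obtain c6 where c6: "reach P \<omega> c5 c6"
    "todo c6 = [compile (countP ;; tableP ;; sampleP ;; solveP)]"
    "mem_of c6 = M6" "all_le (2 ^ w6 P) M6"
    "cost c6 \<le> cost c5 + 1 + st6 P * (pweight ratioP * ((w6 P + slack P) * (w6 P + slack P)))"
    by (auto simp: c5 M6_def w6_def)
  have "\<exists>c'. reach P \<omega> c6 c' \<and> todo c' = [compile (tableP ;; sampleP ;; solveP)]
     \<and> mem_of c' = den P \<omega> countP (mem_of c6) \<and> all_le (2 ^ ((w6 P + 12) * 5 ^ st7)) (mem_of c')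
     \<and> cost c' \<le> cost c6 + 1 + st7 * (pweight countP * ((w7 P + slack P) * (w7 P + slack P)))"
    by (rule phase_straight)
       (use c6 in \<open>auto simp: well_formed_programs plain_programs pdigits_programs steps_eq(7) sl w7_def
          intro: exps_count\<close>)
  then obtain c7 where c7: "reach P \<omega> c6 c7"
    "todo c7 = [compile (tableP ;; sampleP ;; solveP)]"
    "mem_of c7 = M7" "all_le (2 ^ w7 P) M7"
    "cost c7 \<le> cost c6 + 1 + st7 * (pweight countP * ((w7 P + slack P) * (w7 P + slack P)))"
    by (auto simp: c6 M7_def w7_def)
  have "\<exists>c'. reach P \<omega> c7 c' \<and> todo c' = [compile (sampleP ;; solveP)]
     \<and> mem_of c' = den P \<omega> tableP (mem_of c7) \<and> all_le (2 ^ (w7 P + 2 * st8 P)) (mem_of c')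
     \<and> cost c' \<le> cost c7 + 1 + st8 P * (pweight tableP * ((w8 P + slack P) * (w8 P + slack P)))"
    by (rule phase_doubling[where K = "{v_r}"])
       (use c7 in \<open>auto simp: well_formed_programs plain_programs pdigits_programs steps_eq(8) sl w8_def
          intro: exps_table[simplified]\<close>)
  then obtain c8 where c8: "reach P \<omega> c7 c8" "todo c8 = [compile (sampleP ;; solveP)]"
    "mem_of c8 = M8" "all_le (2 ^ w8 P) M8"
    "cost c8 \<le> cost c7 + 1 + st8 P * (pweight tableP * ((w8 P + slack P) * (w8 P + slack P)))"
    by (auto simp: c7 M8_def w8_def)
  have "reach P \<omega> ?c0 c8"
    using c1(1) c2(1) c3(1) c4(1) c5(1) c6(1) c7(1) c8(1) by (meson reach_trans)
  then show ?thesis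
    using c1(4) c2(5) c3(5) c4(5) c5(5) c6(5) c7(5) c8(2-5) by (intro exI[of _ c8]) linarith
qed

lemma run_complete:
  assumes F: "st9 P + st10 P \<le> F P * load P"
  shows "\<exists>c. reach P \<omega> (initial (compile fullP) P) c \<and> todo c = [] \<and> mem_of c = M10 \<and> cost c \<le> total_cost F P"
proof -
  let ?c0 = "initial (compile fullP) P" and ?X = "2 ^ w8 P :: nat"
  obtain c8 where c8: "reach P \<omega> ?c0 c8" "todo c8 = [compile (sampleP ;; solveP)]" "mem_of c8 = M8" "all_le ?X M8"
    and cost8: "cost c8 \<le> total_cost F P - (1 + st9 P * (pweight sampleP * (final_psi F P * final_psi F P)))
        - st10 P * (pweight solveP * (final_psi F P * final_psi F P))"
    using run_prefix unfolding total_cost_def by fastforce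
  have sl: "slack P = n + bits n + 3" by (simp add: slack_def par_l_def)
  have X1: "1 \<le> ?X" by (rule one_le_power) simp
  \<comment> \<open>The sample count and \<open>2 ^ r\<close> are themselves stored in variables, so
    the bound on values bounds them too.\<close>
  have "load P \<le> 3 * ?X"
  proof -
    have "mv M8 v_m \<le> ?X" "mv M8 v_NM \<le> ?X" using c8(4) unfolding all_le_def by blast+
    then show ?thesis using X1 unfolding M8 load_def by linarith
  qed
  then have "st9 P + st10 P \<le> F P * (3 * ?X)" using F by (meson mult_left_mono order.trans zero_le)
  then have "?X + st9 P + st10 P \<le> ?X * (1 + 3 * F P)" by (simp add: algebra_simps)
  also have "?X * (1 + 3 * F P) \<le> ?X * 2 ^ (3 * F P)"
  proof (rule mult_left_mono)
    show "1 + 3 * F P \<le> 2 ^ (3 * F P)" using less_exp[of "3 * F P"] by linarith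
  qed simp
  also have "?X * 2 ^ (3 * F P) < 2 ^ (w8 P + 3 * F P + 1)" by (simp add: power_add)
  finally have b10: "bits (?X + st9 P + st10 P) \<le> w8 P + 3 * F P + 1" by (intro bits_le)
  have b9: "bits (?X + st9 P) \<le> w8 P + 3 * F P + 1"
    using bits_le[of "?X + st9 P" "bits (?X + st9 P + st10 P)"] less_two_power_bits[of "?X + st9 P + st10 P"] b10
    by linarith
  have X9: "1 \<le> ?X + st9 P" using X1 by linarith
  let ?d = "dstep P \<omega> c8"
  have d: "todo ?d = [compile sampleP, compile solveP]" "mem_of ?d = M8" "cost ?d = cost c8 + 1"
    using dstep_Seq[of c8 "compile sampleP" "compile solveP" "[]" P \<omega>] c8(2,3) by auto
  have "\<exists>c'. reach P \<omega> ?d c' \<and> todo c' = [compile solveP] \<and> mem_of c' = den P \<omega> sampleP (mem_of ?d)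
     \<and> all_le (?X + st9 P) (mem_of c') \<and> cost c' \<le> cost ?d + st9 P * (pweight sampleP * (final_psi F P * final_psi F P))"
    by (rule phase_slow[OF _ well_formed_programs(9) _ _ _ X1])
       (use c8(4) d b9 in \<open>auto simp: plain_programs pdigits_programs steps_eq(9) sl final_psi_def
          intro: exps_sample[simplified]\<close>)
  then obtain c9 where c9: "reach P \<omega> ?d c9" "todo c9 = [compile solveP]" "mem_of c9 = M9" "all_le (?X + st9 P) M9"
     "cost c9 \<le> cost c8 + 1 + st9 P * (pweight sampleP * (final_psi F P * final_psi F P))"
    by (auto simp: d M9_def)
  have "\<exists>c'. reach P \<omega> c9 c' \<and> todo c' = [] \<and> mem_of c' = den P \<omega> solveP (mem_of c9)
     \<and> all_le (?X + st9 P + st10 P) (mem_of c') \<and> cost c' \<le> cost c9 + st10 P * (pweight solveP * (final_psi F P * final_psi F P))"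
    by (rule phase_slow[OF _ well_formed_programs(10) _ _ _ X9])
       (use c9 b10 X1 in \<open>auto simp: plain_programs pdigits_programs steps_eq(10) sl final_psi_def
          intro: exps_solve[simplified]\<close>)
  then obtain c10 where c10: "reach P \<omega> c9 c10" "todo c10 = []" "mem_of c10 = M10"
     "cost c10 \<le> cost c9 + st10 P * (pweight solveP * (final_psi F P * final_psi F P))"
    by (auto simp: c9 M10_def)
  have "reach P \<omega> ?c0 c10"
    using c8(1) reach_dstep[of P \<omega> c8] c9(1) c10(1) by (meson reach_trans)
  moreover have "cost c10 \<le> total_cost F P"
  proof -
    have "(1 + st9 P * (pweight sampleP * (final_psi F P * final_psi F P)))
        + st10 P * (pweight solveP * (final_psi F P * final_psi F P)) \<le> total_cost F P"
      unfolding total_cost_def by linarith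
    then show ?thesis using c10(4) c9(5) cost8 by linarith
  qed
  ultimately show ?thesis using c10 by blast
qed

end

theorem program_cost:
  "\<exists>E. \<forall>P \<omega>. valid P \<longrightarrow> (\<exists>c. reach P \<omega> (initial (compile fullP) P) c \<and> todo c = []
      \<and> mem_of c = machine.M10 P \<omega> \<and> cost c \<le> dimension P ^ E * load P)"
proof -
  obtain F where F: "poly_bounded F"
    "\<And>P. valid P \<Longrightarrow> steps (solve_vals P) sampleP + steps (solve_vals P) solveP \<le> F P * load P"
    by (rule sample_solve_load) blast
  obtain g where g: "poly_bounded g" "\<And>P. valid P \<Longrightarrow> total_cost F P \<le> g P * load P"
    using load_bounded_total_cost[OF F(1)] unfolding load_bounded_def by blast
  obtain E where E: "\<And>P. valid P \<Longrightarrow> g P \<le> dimension P ^ E"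
    using g(1) unfolding poly_bounded_def by blast
  show ?thesis
  proof (intro exI[of _ E] allI impI)
    fix P \<omega> assume v: "valid P"
    interpret machine P \<omega> by unfold_locales (rule v)
    obtain c where c: "reach P \<omega> (initial (compile fullP) P) c" "todo c = []" "mem_of c = M10" "cost c \<le> total_cost F P"
      using run_complete[of F] F(2)[OF v] unfolding st9_def st10_def by blast
    have "total_cost F P \<le> dimension P ^ E * load P"
      using g(2)[OF v] mult_right_mono[OF E[OF v], of "load P"] by linarith
    then show "\<exists>c. reach P \<omega> (initial (compile fullP) P) c \<and> todo c = [] \<and> mem_of c = M10
        \<and> cost c \<le> dimension P ^ E * load P" using c by auto
  qed
qed

section \<open>Parameters for a single problem size\<close>

lemma prod_choose: "k \<le> n \<Longrightarrow> (\<Prod>i<k. n - i) = fact k * (n choose k)"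
proof (induction k)
  case (Suc k)
  have "(\<Prod>i<Suc k. n - i) = fact k * ((n - k) * (n choose k))" using Suc by simp
  also have "(n - k) * (n choose k) = Suc k * (n choose Suc k)"
    unfolding binomial_absorb_comp binomial_absorption ..
  finally show ?case by (simp only: fact_Suc of_nat_id mult_ac)
qed simp

lemma real_div_le: "real (a div b) \<le> real a / real b"
  using floor_divide_of_nat_eq[of a b, where 'a = real, symmetric] of_int_floor_le[of "real a / real b"]
  by (metis of_int_of_nat_eq)

lemma real_div_ge: "real a / real b < real (a div b) + 1"
  using floor_divide_of_nat_eq[of a b, where 'a = real, symmetric] real_of_int_floor_add_one_gt[of "real a / real b"]
  by (metis of_int_of_nat_eq)

text \<open>All that is used of a large \<open>n\<close>. In particular \<open>nM\<close> makes
  \<open>M\<close> at most \<open>N\<close>, so that truncating \<open>\<eta>\<close> changes the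
  number of noisy samples by at most 1, and \<open>nln\<close> makes \<open>exp (- Q)\<close> at
  most \<open>1 / n ^ 3\<close>.\<close>

locale regime =
  fixes P :: params and n k :: nat and \<eta> \<delta> \<gamma>\<^sub>0 Gc :: real
  assumes P: "n = dimension P" "k = sparsity P" "\<eta> = noise P" "\<delta> = tradeoff P"
    and k: "odd k" "8 * real k \<le> real n powr ((1 + \<delta>) / 2)"
    and \<eta>: "0 \<le> \<eta>" "\<gamma>\<^sub>0 \<le> 1 - 2 * \<eta>"
    and \<delta>: "0 < \<delta>" "\<delta> < 1"
    and \<gamma>0: "0 < \<gamma>\<^sub>0" and Gc: "Gc = 2 / \<gamma>\<^sub>0 + 1"
    and n8: "8 \<le> n" and nGc: "Gc \<le> real n" and n\<gamma>: "4 \<le> \<gamma>\<^sub>0 * real n"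
    and nM: "512 * Gc\<^sup>2 * (real n + 3 * real n * ln (real n) + 1) \<le> (real n)\<^sup>2"
    and nln: "3 * ln (real n) \<le> sqrt (real n)"
begin

abbreviation "q \<equiv> real n powr ((1 + \<delta>) / 2)"
abbreviation "l \<equiv> par_l P"
abbreviation "N \<equiv> par_N P"
abbreviation "Q \<equiv> par_Q P"
abbreviation "G \<equiv> par_G P"
abbreviation "M \<equiv> par_M P"
abbreviation "r' \<equiv> par_r' P"
abbreviation "r \<equiv> par_r P"
abbreviation "m \<equiv> par_m P"
abbreviation "B \<equiv> par_B P"
abbreviation "cap \<equiv> par_cap P"
abbreviation "mx \<equiv> max 1 (ln (real n) / real k)"

definition "p = real (Q choose k) / real (n choose k)"

lemma k0: "0 < k" using k(1) by (cases k) auto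

lemma n_pos: "0 < real n" "1 < real n" using n8 by auto

lemma n_less: "real n < 2 ^ l"
  using less_two_power_bits[of n] P by (simp add: par_l_def flip: of_nat_less_iff)

lemma two_l: "2 ^ l \<le> 2 * real n"
proof -
  have "2 ^ l \<le> 2 * n" using two_power_bits_le[of n] n8 P by (simp add: par_l_def)
  then have "real (2 ^ l) \<le> real (2 * n)" by (simp only: of_nat_le_iff)
  then show ?thesis by simp
qed

lemma ln_n: "1 \<le> ln (real n)"
proof -
  have "exp 1 \<le> (3 :: real)" by (rule exp_le)
  then have "exp 1 \<le> real n" using n8 by simp
  then show ?thesis using n_pos by (simp add: ln_ge_iff)
qed

lemma l_le_ln: "real l \<le> 3 * ln (real n)"
proof -
  have "real l * ln 2 = ln (2 ^ l)" by (simp add: ln_realpow)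
  also have "\<dots> \<le> ln (2 * real n)" using two_l n_pos by (subst ln_le_cancel_iff) auto
  also have "\<dots> = ln 2 + ln (real n)" using n_pos by (simp add: ln_mult)
  also have "\<dots> \<le> 2 * ln (real n)"
  proof -
    have "ln 2 \<le> ln (real n)" using n8 by simp
    then show ?thesis by simp
  qed
  finally have "real l * ln 2 \<le> 2 * ln (real n)" .
  moreover have "real l * (2 / 3) \<le> real l * ln 2" using ln2_ge_two_thirds by (intro mult_left_mono) auto
  ultimately show ?thesis by simp
qed

lemma N_real: "real N = 2 ^ l * 2 ^ l"
  by (simp add: par_N_def power_add mult_2)

lemma N_ge: "(real n)\<^sup>2 \<le> real N"
  using n_less n_pos unfolding N_real power2_eq_square by (intro mult_mono) auto

lemma N_pos: "0 < real N"
  by (simp add: N_real)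

lemma floor_scaled:
  fixes x :: real
  assumes "0 \<le> x"
  shows "real (nat \<lfloor>x * real N\<rfloor>) \<le> x * real N" "x * real N < real (nat \<lfloor>x * real N\<rfloor>) + 1"
  using assms by (auto simp: of_nat_nat)

lemma ae: "real (par_ae P) \<le> \<eta> * real N" "\<eta> * real N < real (par_ae P) + 1"
  using floor_scaled[OF \<eta>(1)] P by (simp_all add: par_ae_def par_N_def)

lemma ad: "real (par_ad P) \<le> \<delta> * real N" "\<delta> * real N < real (par_ad P) + 1"
  using floor_scaled[of \<delta>] \<delta> P by (simp_all add: par_ad_def par_N_def)

lemma q_le_n: "q \<le> real n"
  using powr_mono[of "(1 + \<delta>) / 2" 1 "real n"] \<delta> n_pos by simp

lemma q_ge_sqrt: "sqrt (real n) \<le> q"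
  using powr_mono[of "1 / 2" "(1 + \<delta>) / 2" "real n"] \<delta> n_pos by (simp add: powr_half_sqrt)

lemma q_ge1: "1 \<le> q"
  using q_ge_sqrt real_sqrt_ge_one[of "real n"] n_pos by linarith

text \<open>As \<open>2 ^ l\<close> lies between \<open>n\<close> and \<open>2 * n\<close>, the
  exponent \<open>l * (1 + \<delta>) / 2\<close> is right up to a constant, and truncating
  \<open>\<delta>\<close> adds at most 1. Of the summand 2 in \<open>par_h\<close>, half makes up
  for rounding down and half gives the factor 2 needed in \<open>p_ge\<close>.\<close>

lemma power_h: "2 * q \<le> 2 ^ par_h P" "2 ^ par_h P \<le> 16 * q"
proof -
  let ?x = "real l * (real N + real (par_ad P) + 1) / (2 * real N)"
  have h: "real (par_h P) = real_of_int \<lfloor>?x\<rfloor> + 2"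
  proof -
    have "real (l * (N + par_ad P + 1) div (N + N)) = real_of_int \<lfloor>real (l * (N + par_ad P + 1)) / real (N + N)\<rfloor>"
      by (simp only: floor_divide_of_nat_eq of_int_of_nat_eq)
    moreover have "real (l * (N + par_ad P + 1)) / real (N + N) = ?x"
      by (simp only: of_nat_mult of_nat_add of_nat_1 mult_2)
    ultimately show ?thesis by (simp only: par_h_def of_nat_add of_nat_numeral)
  qed
  have x1: "real l * ((1 + \<delta>) / 2) \<le> ?x"
  proof -
    have "(1 + \<delta>) * real N \<le> real N + real (par_ad P) + 1" using ad by (simp add: algebra_simps)
    then have "real l * ((1 + \<delta>) * real N) \<le> real l * (real N + real (par_ad P) + 1)" by (intro mult_left_mono) auto
    then show ?thesis using N_pos by (simp add: field_simps)
  qed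
  have x2: "?x \<le> real l * ((1 + \<delta>) / 2) + 1"
  proof -
    have "real l \<le> real N"
    proof -
      have "real l < 2 ^ l" by (rule of_nat_less_two_power)
      also have "(2 :: real) ^ l \<le> 2 ^ l * 2 ^ l" by simp
      finally show ?thesis by (simp add: N_real)
    qed
    moreover have "real l * (real N + real (par_ad P) + 1) \<le> real l * ((1 + \<delta>) * real N) + real l"
      using mult_left_mono[of "real N + real (par_ad P)" "(1 + \<delta>) * real N" "real l"] ad
      by (simp add: algebra_simps)
    ultimately have "real l * (real N + real (par_ad P) + 1) \<le> real l * ((1 + \<delta>) * real N) + 2 * real N"
      using N_pos by linarith
    then show ?thesis using N_pos by (simp add: field_simps)
  qed
  have eq: "2 ^ par_h P = 2 powr real (par_h P)" by (simp add: powr_realpow)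
  have "2 * q \<le> 2 * (2 powr real l) powr ((1 + \<delta>) / 2)"
    using n_less n_pos \<delta> by (intro mult_left_mono powr_mono2) (auto simp: powr_realpow)
  also have "\<dots> = 2 powr (real l * ((1 + \<delta>) / 2) + 1)" by (simp add: powr_powr powr_add)
  also have "\<dots> \<le> 2 powr real (par_h P)" using x1 h by (intro powr_mono) linarith+
  finally show "2 * q \<le> 2 ^ par_h P" using eq by simp
  have "2 powr real (par_h P) \<le> 2 powr (real l * ((1 + \<delta>) / 2) + 3)" using x2 h by (intro powr_mono) linarith+
  also have "\<dots> = 8 * (2 powr real l) powr ((1 + \<delta>) / 2)" by (simp add: powr_powr powr_add powr_numeral)
  also have "\<dots> \<le> 8 * (2 * real n) powr ((1 + \<delta>) / 2)"
    using two_l \<delta> by (intro mult_left_mono powr_mono2) (auto simp: powr_realpow)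
  also have "\<dots> = 8 * (2 powr ((1 + \<delta>) / 2) * q)" by (simp add: powr_mult)
  also have "\<dots> \<le> 8 * (2 * q)"
  proof -
    have "2 powr ((1 + \<delta>) / 2) \<le> (2 :: real) powr 1" using \<delta> by (intro powr_mono) auto
    then show ?thesis by (intro mult_left_mono mult_right_mono) auto
  qed
  finally show "2 ^ par_h P \<le> 16 * q" using eq by simp
qed

lemma Q_bounds: "q \<le> real Q" "real Q \<le> 16 * q" "Q \<le> n"
proof -
  have h: "real (2 ^ par_h P) = 2 ^ par_h P" by simp
  have "Q = 2 ^ par_h P \<or> Q = n \<and> n \<le> 2 ^ par_h P" using P by (auto simp: par_Q_def)
  moreover have "real n \<le> 16 * q" if "n \<le> 2 ^ par_h P"
  proof -
    have "real n \<le> real (2 ^ par_h P)" using that by (simp only: of_nat_le_iff)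
    then show ?thesis using power_h(2) h by linarith
  qed
  ultimately show "q \<le> real Q" "real Q \<le> 16 * q"
    using power_h q_le_n q_ge1 h by (elim disjE; simp; linarith?)+
  show "Q \<le> n" using P by (simp add: par_Q_def)
qed

lemma k4: "4 * k \<le> Q"
proof -
  have "real (4 * k) \<le> real Q" using k(2) Q_bounds(1) by simp
  then show ?thesis by (simp only: of_nat_le_iff)
qed

lemma kn: "k \<le> n" using k4 Q_bounds(3) by simp

lemma p_pos: "0 < p" "p \<le> 1"
proof -
  have "Q choose k \<le> n choose k" by (rule binomial_right_mono[OF Q_bounds(3)])
  moreover have "0 < Q choose k" using k4 by (intro zero_less_binomial) simp
  ultimately show "0 < p" "p \<le> 1" using kn by (auto simp: p_def zero_less_binomial)
qed

lemma p_prod: "p = (\<Prod>i<k. real (Q - i) / real (n - i))"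
proof -
  have "real (\<Prod>i<k. Q - i) = fact k * real (Q choose k)" "real (\<Prod>i<k. n - i) = fact k * real (n choose k)"
    using k4 kn by (subst prod_choose; simp)+
  then show ?thesis unfolding p_def prod_dividef by (simp only: of_nat_prod[symmetric]) simp
qed

text \<open>This holds factor by factor. If the window is not the whole range, then \<open>Q\<close>
  is at least \<open>2 * q\<close> while \<open>i < k\<close> is at most \<open>q\<close>, so
  \<open>Q - i\<close> is at least \<open>q\<close>.\<close>

lemma p_ge: "(q / real n) ^ k \<le> p"
proof -
  have "(q / real n) ^ k = (\<Prod>i<k. q / real n)" by simp
  also have "\<dots> \<le> (\<Prod>i<k. real (Q - i) / real (n - i))"
  proof (intro prod_mono conjI)
    fix i assume i: "i \<in> {..<k}"
    show "0 \<le> q / real n" by simp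
    have ni: "0 < real (n - i)" using i kn by simp
    show "q / real n \<le> real (Q - i) / real (n - i)"
    proof (cases "Q = n")
      case True
      then show ?thesis using q_le_n n_pos ni by simp
    next
      case False
      then have "Q = 2 ^ par_h P" using P by (auto simp: par_Q_def split: if_splits)
      then have "2 * q \<le> real Q" using power_h(1) by simp
      moreover have "real i \<le> q" using i k(2) by simp
      moreover have "i \<le> Q" using i k4 by simp
      ultimately have "q \<le> real (Q - i)" by (simp add: of_nat_diff)
      then have "q / real n \<le> real (Q - i) / real n" using n_pos by (intro divide_right_mono) auto
      also have "\<dots> \<le> real (Q - i) / real (n - i)" using ni by (intro divide_left_mono) auto
      finally show ?thesis .
    qed
  qed
  finally show ?thesis by (simp only: p_prod)
qed

text \<open>The 2 in the denominator of \<open>par_G\<close> exceeds the truncation error of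
  \<open>2 * \<eta> * N\<close>, so the denominator is at most \<open>(1 - 2 * \<eta>) * N\<close>.
  It is at least half of \<open>\<gamma>\<^sub>0 * N\<close> because that number is at least
  4.\<close>

lemma G_bounds: "1 \<le> real G * (1 - 2 * \<eta>)" "real G \<le> Gc"
proof -
  let ?g = "N - (par_ae P + par_ae P + 2)"
  have "4 \<le> \<gamma>\<^sub>0 * real N"
  proof -
    have "real n \<le> (real n)\<^sup>2" using n_pos by (simp add: power2_eq_square)
    then have "\<gamma>\<^sub>0 * real n \<le> \<gamma>\<^sub>0 * real N" using N_ge \<gamma>0 by (intro mult_left_mono) auto
    then show ?thesis using n\<gamma> by simp
  qed
  moreover have "\<gamma>\<^sub>0 * real N \<le> (1 - 2 * \<eta>) * real N" using \<eta> by (intro mult_right_mono) auto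
  ultimately have g: "real N - (2 * real (par_ae P) + 2) \<ge> \<gamma>\<^sub>0 * real N / 2"
    "real N - (2 * real (par_ae P) + 2) \<le> (1 - 2 * \<eta>) * real N"
    using ae by (auto simp: algebra_simps)
  have le: "par_ae P + par_ae P + 2 \<le> N"
  proof -
    have "0 \<le> \<gamma>\<^sub>0 * real N / 2" using \<gamma>0 by simp
    then have "real (par_ae P + par_ae P + 2) \<le> real N" using g(1) by simp
    then show ?thesis by (simp only: of_nat_le_iff)
  qed
  then have gr: "real ?g = real N - (2 * real (par_ae P) + 2)" by (simp add: of_nat_diff)
  have g0: "0 < real ?g" 
  proof -
    have "0 < \<gamma>\<^sub>0 * real N / 2" using \<gamma>0 N_pos by simp
    then show ?thesis using g(1) unfolding gr by linarith
  qed
  have d: "real (N div ?g) \<le> real N / real ?g" "real N / real ?g < real (N div ?g) + 1" by (rule real_div_le, rule real_div_ge)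
  have G: "real G = real (N div ?g) + 1" by (simp add: par_G_def)
  have "real ?g \<le> (1 - 2 * \<eta>) * real N" using g(2) gr by simp
  then have "1 \<le> real N / real ?g * (1 - 2 * \<eta>)" using g0 by (simp add: field_simps)
  also have "\<dots> \<le> real G * (1 - 2 * \<eta>)"
    using d(2) G \<eta> \<gamma>0 by (intro mult_right_mono) auto
  finally show "1 \<le> real G * (1 - 2 * \<eta>)" .
  have "real N / real ?g \<le> 2 / \<gamma>\<^sub>0" using g(1) g0 \<gamma>0 gr by (simp add: field_simps)
  then show "real G \<le> Gc" using d(1) G Gc by simp
qed

lemma M_ge: "512 * (real G)\<^sup>2 * (real Q + real Q * real l / real k) \<le> real M"
proof -
  have "real Q * real l / real k \<le> real (Q * l div k) + 1"
    using real_div_ge[of "Q * l" k] by simp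
  then have "real Q + real Q * real l / real k \<le> real (Q + Q * l div k + 1)" by simp
  then have "512 * (real G)\<^sup>2 * (real Q + real Q * real l / real k)
      \<le> 512 * (real G)\<^sup>2 * real (Q + Q * l div k + 1)" by (intro mult_left_mono) auto
  also have "\<dots> = real M" unfolding par_M_def P by (simp only: of_nat_mult of_nat_numeral power2_eq_square mult.assoc)
  finally show ?thesis .
qed

lemma M_le: "real M \<le> 512 * Gc\<^sup>2 * (real Q + real Q * real l / real k + 1)"
proof -
  have "real (Q * l div k) \<le> real Q * real l / real k"
    using real_div_le[of "Q * l" k] by simp
  then have "real (Q + Q * l div k + 1) \<le> real Q + real Q * real l / real k + 1" by simp
  moreover have "(real G)\<^sup>2 \<le> Gc\<^sup>2" using G_bounds(2) by (intro power_mono) auto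
  ultimately have "512 * (real G)\<^sup>2 * real (Q + Q * l div k + 1)
      \<le> 512 * Gc\<^sup>2 * (real Q + real Q * real l / real k + 1)" by (intro mult_mono) auto
  moreover have "real M = 512 * (real G)\<^sup>2 * real (Q + Q * l div k + 1)"
    unfolding par_M_def P by (simp only: of_nat_mult of_nat_numeral power2_eq_square mult.assoc)
  ultimately show ?thesis by simp
qed

lemma M_le_mx: "real M \<le> 512 * 65 * Gc\<^sup>2 * (q * mx)"
proof -
  have "real Q * real l / real k \<le> 16 * q * (3 * ln (real n)) / real k"
    using Q_bounds(2) l_le_ln q_ge1 by (intro divide_right_mono mult_mono) auto
  also have "\<dots> = 48 * (q * (ln (real n) / real k))" by simp
  also have "\<dots> \<le> 48 * (q * mx)" by (intro mult_left_mono) auto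
  finally have "real Q + real Q * real l / real k + 1 \<le> 16 * q + 48 * (q * mx) + q"
    using Q_bounds(2) q_ge1 by linarith
  \<comment> \<open>\<open>65 = 16 + 48 + 1\<close>, all terms being at most multiples of
    \<open>q * mx\<close>.\<close>
  also have "\<dots> \<le> 65 * (q * mx)"
    using mult_left_mono[of 1 mx q] by (simp add: mult.commute)
  finally have "512 * Gc\<^sup>2 * (real Q + real Q * real l / real k + 1) \<le> 512 * Gc\<^sup>2 * (65 * (q * mx))"
    by (intro mult_left_mono) auto
  from order.trans[OF M_le this] show ?thesis by (simp only: mult.assoc mult.left_commute)
qed

lemma G_ge1: "1 \<le> G"
  by (simp add: par_G_def)

lemma M_ge_Q: "512 * real Q \<le> real M"
proof -
  have "512 * 1 * (real Q + 0) \<le> 512 * (real G)\<^sup>2 * (real Q + real Q * real l / real k)"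
    using G_ge1 by (intro mult_mono add_mono) auto
  then show ?thesis using M_ge by simp
qed

lemma l_le_M: "real l \<le> real M" "1 \<le> real M"
proof -
  have "real l \<le> real Q" using l_le_ln nln q_ge_sqrt Q_bounds(1) by linarith
  then show "real l \<le> real M" using M_ge_Q by linarith
  show "1 \<le> real M" using M_ge_Q Q_bounds(1) q_ge1 by linarith
qed

lemma M_le_N: "real M \<le> real N"
proof -
  have "real Q * real l / real k \<le> real n * (3 * ln (real n)) / 1"
    using Q_bounds(3) l_le_ln k0 by (intro frac_le mult_mono) auto
  then have "real Q + real Q * real l / real k + 1 \<le> real n + 3 * real n * ln (real n) + 1"
    using Q_bounds(3) by simp
  then have "512 * Gc\<^sup>2 * (real Q + real Q * real l / real k + 1)
      \<le> 512 * Gc\<^sup>2 * (real n + 3 * real n * ln (real n) + 1)" by (intro mult_left_mono) auto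
  then show ?thesis using M_le nM N_ge by linarith
qed

lemma r'_bounds: "\<eta> * real M \<le> real r'" "32 * real l \<le> real r'" "1 \<le> r'"
  "real r' \<le> 32 * real l + \<eta> * real M + 2"
proof -
  have r': "real r' = 32 * real l + real ((par_ae P + 1) * M div N) + 1" by (simp add: par_r'_def)
  have "real (par_ae P + 1) * real M / real N \<le> real ((par_ae P + 1) * M div N) + 1"
    using real_div_ge[of "(par_ae P + 1) * M" N] by (simp only: of_nat_mult)
  moreover have "\<eta> * real M \<le> real (par_ae P + 1) * real M / real N"
  proof -
    have "\<eta> * real N * real M \<le> real (par_ae P + 1) * real M" using ae by (intro mult_right_mono) auto
    then show ?thesis using N_pos by (simp add: field_simps)
  qed
  ultimately show "\<eta> * real M \<le> real r'" using r' by linarith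
  show "32 * real l \<le> real r'" "1 \<le> r'" using r' by (simp_all add: par_r'_def)
  have "real ((par_ae P + 1) * M div N) \<le> real (par_ae P + 1) * real M / real N"
    using real_div_le[of "(par_ae P + 1) * M" N] by (simp only: of_nat_mult)
  also have "\<dots> \<le> (\<eta> * real N + 1) * real M / real N"
    using ae N_pos by (intro divide_right_mono mult_right_mono) auto
  also have "\<dots> = \<eta> * real M + real M / real N" using N_pos by (simp add: field_simps)
  also have "\<dots> \<le> \<eta> * real M + 1" using M_le_N N_pos by simp
  finally show "real r' \<le> 32 * real l + \<eta> * real M + 2" using r' by linarith
qed

definition "m0 = M * par_num P div par_den P + 1"

lemma m0_bounds: "real M / p \<le> real m0" "real m0 \<le> real M / p + 1"
proof -
  have num: "real (par_num P) = fact k * real (n choose k)" "real (par_den P) = fact k * real (Q choose k)"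
    using prod_choose[OF kn] prod_choose[of k Q] k4 P by (simp_all add: par_num_def par_den_def)
  have "real M * real (par_num P) / real (par_den P) = real M / p"
    by (simp add: num p_def)
  then show "real M / p \<le> real m0" "real m0 \<le> real M / p + 1"
    using real_div_ge[of "M * par_num P" "par_den P"] real_div_le[of "M * par_num P" "par_den P"]
    by (simp_all add: m0_def)
qed

lemma r_eq: "r = 8 * r'" "0 < r" using r'_bounds(3) by (simp_all add: par_r_def)

lemma B_bounds: "real B \<le> real m0 / real r + 1" "real m0 \<le> real m" "real m \<le> real m0 + real r"
proof -
  have B: "B = m0 div r + 1" by (simp add: par_B_def m0_def)
  show "real B \<le> real m0 / real r + 1" using real_div_le[of m0 r] B by simp
  have m: "m = r * (m0 div r) + r" by (simp add: par_m_def B)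
  have "m0 < r + r * (m0 div r)" using r_eq(2) by (rule dividend_less_times_div)
  then have "m0 \<le> m" using m by linarith
  then show "real m0 \<le> real m" by (simp only: of_nat_le_iff)
  have "r * (m0 div r) \<le> m0" by simp
  then have "m \<le> m0 + r" using m by simp
  then show "real m \<le> real m0 + real r" by (simp only: of_nat_le_iff flip: of_nat_add)
qed

lemma pm: "real M \<le> p * real m" "p * real m \<le> real (M + r + 1)"
proof -
  have "real M = p * (real M / p)" using p_pos by simp
  also have "\<dots> \<le> p * real m" using m0_bounds(1) B_bounds(2) p_pos by (intro mult_left_mono) linarith+
  finally show "real M \<le> p * real m" .
  have "p * real m \<le> p * (real M / p + 1 + real r)"
    using m0_bounds(2) B_bounds(3) p_pos by (intro mult_left_mono) linarith+
  also have "\<dots> = real M + p * (1 + real r)" using p_pos by (simp add: field_simps)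
  also have "p * (1 + real r) \<le> 1 * (1 + real r)" using p_pos by (intro mult_right_mono) auto
  finally show "p * real m \<le> real (M + r + 1)" by simp
qed

lemma \<eta>_half: "\<eta> < 1 / 2" using \<eta> \<gamma>0 by simp

text \<open>The main term is at most \<open>1 / 8\<close> since \<open>r = 8 * r'\<close> and
  \<open>r'\<close> is at least \<open>\<eta> * M\<close>. Rounding adds at most
  \<open>1 / 16\<close> inside the quotient and \<open>1 / 2\<close> for the extra sample in
  \<open>B\<close>.\<close>

lemma dirty: "p * \<eta> * real B \<le> 3 / 4"
proof -
  have r8: "8 \<le> real r" using r_eq r'_bounds(3) by simp
  have pe: "0 \<le> p * \<eta>" "p * \<eta> \<le> 1 / 2"
    using p_pos \<eta> \<eta>_half mult_mono[of p 1 \<eta> "1/2"] by auto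
  have "p * \<eta> * real B \<le> p * \<eta> * ((real M / p + 1) / real r + 1)"
    using B_bounds(1) m0_bounds(2) r8 pe
    by (intro mult_left_mono order.trans[OF B_bounds(1)] add_mono divide_right_mono) auto
  also have "\<dots> = \<eta> * real M / real r + p * \<eta> / real r + p * \<eta>"
    using p_pos r8 by (simp add: field_simps)
  also have "\<eta> * real M / real r \<le> 1 / 8" using r'_bounds(1) r_eq r8 by (simp add: field_simps)
  also have "p * \<eta> / real r \<le> (1 / 2) / 8" using pe r8 by (intro frac_le) auto
  finally show ?thesis using pe by simp
qed

section \<open>Success probability\<close>

lemma two_power_l_ge: "(1 / 2 :: real) ^ (j * l) \<le> 1 / real n ^ j"
proof -
  have "real n ^ j \<le> (2 ^ l) ^ j" using n_less n_pos by (intro power_mono) auto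
  then have "1 / (2 ^ l) ^ j \<le> 1 / real n ^ j" using n_pos by (intro divide_left_mono) auto
  then show ?thesis by (simp add: power_one_over mult.commute flip: power_mult)
qed

lemma n_powers: "1 / real n ^ 8 \<le> 1 / real n ^ 3" "real n / real n ^ 16 \<le> 1 / real n ^ 3"
proof -
  show "1 / real n ^ 8 \<le> 1 / real n ^ 3" using n_pos by (intro divide_left_mono power_increasing) auto
  have "real n / real n ^ 16 = 1 / real n ^ 15" using n_pos by (simp add: field_simps eval_nat_numeral)
  also have "\<dots> \<le> 1 / real n ^ 3" using n_pos by (intro divide_left_mono power_increasing) auto
  finally show "real n / real n ^ 16 \<le> 1 / real n ^ 3" .
qed

text \<open>The fourth power of \<open>4 / 5\<close> is below \<open>1 / 2\<close>, so the
  \<open>32 * l\<close> in \<open>r'\<close> yields \<open>(1 / 2) ^ (8 * l)\<close>.\<close>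

lemma four_fifths: "(4 / 5 :: real) ^ r' \<le> 1 / real n ^ 3"
proof -
  have "32 * l \<le> r'" using r'_bounds(2) by (simp flip: of_nat_le_iff)
  then have "(4 / 5 :: real) ^ r' \<le> (4 / 5) ^ (32 * l)" by (intro power_decreasing) auto
  also have "\<dots> = ((4 / 5) ^ 4) ^ (8 * l)" by (simp flip: power_mult)
  also have "\<dots> \<le> (1 / 2) ^ (8 * l)" by (intro power_mono) (auto simp: power_numeral eval_nat_numeral)
  also have "\<dots> \<le> 1 / real n ^ 8" by (rule two_power_l_ge)
  also note n_powers(1)
  finally show ?thesis .
qed

text \<open>\<open>cap\<close> is four times a bound \<open>z\<close> on the expected pool size, and
  \<open>exp z\<close> is at most \<open>3 ^ z\<close>, so the ratio is at most
  \<open>(3 / 16) ^ z\<close>.\<close>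

lemma overflow_small: "exp (real m * p) / 2 ^ cap \<le> 1 / real n ^ 3"
proof -
  let ?z = "M + r + 1"
  have "exp (real m * p) \<le> exp (real ?z)" using pm(2) by (simp add: mult.commute)
  also have "\<dots> = exp 1 ^ ?z" using exp_of_nat_mult[of ?z "1 :: real"] by (simp only: mult_1_right)
  also have "\<dots> \<le> 3 ^ ?z" using exp_le by (intro power_mono) auto
  finally have "exp (real m * p) / 2 ^ cap \<le> 3 ^ ?z / 2 ^ cap" by (intro divide_right_mono) auto
  also have "\<dots> = (3 / 16) ^ ?z"
    by (simp only: par_cap_def power_mult) (simp add: power_divide)
  also have "\<dots> \<le> (4 / 5) ^ ?z" by (intro power_mono) auto
  also have "\<dots> \<le> (4 / 5) ^ r'" using r_eq(1) by (intro power_decreasing) auto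
  also note four_fifths
  finally show ?thesis .
qed

lemma exp_Q_small: "exp (- real Q) \<le> 1 / real n ^ 3"
proof -
  have "3 * ln (real n) \<le> real Q" using nln q_ge_sqrt Q_bounds(1) by linarith
  then have "exp (- real Q) \<le> exp (- (3 * ln (real n)))" by simp
  also have "\<dots> = 1 / real n ^ 3" using n_pos
    by (simp add: exp_minus exp_of_nat_mult[of 3 "ln (real n)", simplified] inverse_eq_divide)
  finally show ?thesis .
qed

lemma union_small: "(1 + exp (- (16 * real l))) ^ Q - 1 \<le> 2 / real n ^ 3"
proof -
  define t where "t = exp (- (16 * real l))"
  have t0: "0 \<le> t" by (simp add: t_def)
  have "t = exp (- 1) ^ (16 * l)" by (simp add: t_def flip: exp_of_nat_mult)
  also have "\<dots> \<le> (1 / 2) ^ (16 * l)"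
  proof (intro power_mono)
    have "(2 :: real) \<le> exp 1" using exp_ge_add_one_self[of 1] by simp
    then show "exp (- 1) \<le> (1 / 2 :: real)" by (simp add: exp_minus field_simps)
  qed simp
  also have "\<dots> \<le> 1 / real n ^ 16" by (rule two_power_l_ge)
  finally have "real Q * t \<le> real n * (1 / real n ^ 16)" using Q_bounds(3) t0 by (intro mult_mono) auto
  then have Qt: "real Q * t \<le> 1 / real n ^ 3" using n_powers(2) by simp
  also have "\<dots> \<le> 1" using n_pos by simp
  finally have Qt1: "real Q * t \<le> 1" .
  have "(1 + t) ^ Q \<le> exp t ^ Q" using t0 by (intro power_mono) auto
  also have "\<dots> = exp (real Q * t)" by (simp add: exp_of_nat_mult)
  also have "\<dots> \<le> 1 + real Q * t + (real Q * t)\<^sup>2" using t0 Qt1 by (intro exp_bound) auto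
  also have "(real Q * t)\<^sup>2 \<le> real Q * t" using t0 Qt1 by (simp add: power2_eq_square mult_left_le)
  finally have "(1 + t) ^ Q - 1 \<le> 2 * (real Q * t)" by linarith
  then show ?thesis using Qt by (simp add: t_def)
qed

lemma prob_bad_window:
  assumes "i0 + Q \<le> n"
  shows "measure_pmf.prob (Pi_pmf {..<m} ({}, False) (\<lambda>_. dec_sample n k \<eta>))
     {\<omega>. \<not> good_window {i0..<i0 + Q} r B cap \<omega>} \<le> 1 / (real n)\<^sup>2"
proof -
  have w: "window n k Q r' B \<eta> p {i0..<i0 + Q}"
    using assms k k4 \<eta> \<eta>_half r'_bounds(3) dirty by unfold_locales (auto simp: p_def par_B_def)
  have r: "8 * r' = r" using r_eq by simp
  have "(1 - 2 * \<eta>)\<^sup>2 * p * real (8 * r' * B) \<ge> 512 * (real Q + real Q * real l / real k)"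
  proof -
    let ?A = "real Q + real Q * real l / real k" and ?g = "1 - 2 * \<eta>"
    have "1 \<le> (real G * ?g)\<^sup>2" using G_bounds(1) by (rule one_le_power)
    then have "512 * ?A * 1 \<le> 512 * ?A * (real G * ?g)\<^sup>2" by (intro mult_left_mono) auto
    also have "\<dots> = ?g\<^sup>2 * (512 * (real G)\<^sup>2 * ?A)" by (simp add: power_mult_distrib)
    also have "\<dots> \<le> ?g\<^sup>2 * real M" using M_ge by (intro mult_left_mono) auto
    also have "\<dots> \<le> ?g\<^sup>2 * (p * real m)" using pm(1) by (intro mult_left_mono) auto
    finally show ?thesis unfolding r by (simp add: par_m_def mult.assoc)
  qed
  from window.prob_not_good[OF w this, of cap] have
    "measure_pmf.prob (Pi_pmf {..<m} ({}, False) (\<lambda>_. dec_sample n k \<eta>)) {\<omega>. \<not> good_window {i0..<i0 + Q} r B cap \<omega>}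
     \<le> exp (real m * p) / 2 ^ cap + (4 / 5) ^ r' + 2 * (exp (- real Q) + ((1 + exp (- (16 * real l))) ^ Q - 1))"
    unfolding r by (simp add: par_m_def)
  also have "\<dots> \<le> 1 / real n ^ 3 + 1 / real n ^ 3 + 2 * (1 / real n ^ 3 + 2 / real n ^ 3)"
    by (intro add_mono mult_left_mono overflow_small four_fifths exp_Q_small union_small) auto
  also have "\<dots> = 8 / real n ^ 3" by simp
  \<comment> \<open>\<open>8 \<le> n\<close> trades the constant for one power of \<open>n\<close>;
    the other power pays for the union over at most \<open>n\<close> windows.\<close>
  also have "\<dots> \<le> real n / real n ^ 3" using n8 by (intro divide_right_mono) auto
  also have "\<dots> = 1 / (real n)\<^sup>2" using n_pos by (simp add: field_simps eval_nat_numeral)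
  finally show ?thesis .
qed

lemma prob_all_windows:
  "measure_pmf.prob (Pi_pmf {..<m} ({}, False) (\<lambda>_. dec_sample n k \<eta>))
     {\<omega>. \<forall>i0. i0 + Q \<le> n \<longrightarrow> good_window {i0..<i0 + Q} r B cap \<omega>} \<ge> 1 - 1 / real n"
proof -
  let ?D = "Pi_pmf {..<m} ({}, False) (\<lambda>_. dec_sample n k \<eta>)"
  let ?bad = "\<lambda>i0. {\<omega>. \<not> good_window {i0..<i0 + Q} r B cap \<omega>}"
  let ?I = "{i0. i0 + Q \<le> n}"
  have Q0: "1 \<le> Q" using k4 k0 by linarith
  have sub: "?I \<subseteq> {..<n}" using Q0 by auto
  then have fin: "finite ?I" by (rule finite_subset) simp
  have cI: "card ?I \<le> n" using card_mono[OF _ sub] by simp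
  have "measure_pmf.prob ?D (\<Union>i0\<in>?I. ?bad i0) \<le> (\<Sum>i0\<in>?I. measure_pmf.prob ?D (?bad i0))"
    by (intro measure_pmf.finite_measure_subadditive_finite fin) auto
  also have "\<dots> \<le> (\<Sum>i0\<in>?I. 1 / (real n)\<^sup>2)" by (intro sum_mono prob_bad_window) simp
  also have "\<dots> = real (card ?I) * (1 / (real n)\<^sup>2)" by simp
  also have "\<dots> \<le> real n * (1 / (real n)\<^sup>2)" using cI by (intro mult_right_mono) auto
  also have "\<dots> = 1 / real n" using n_pos by (simp add: power2_eq_square)
  finally have "measure_pmf.prob ?D (\<Union>i0\<in>?I. ?bad i0) \<le> 1 / real n" .
  moreover have "{\<omega>. \<forall>i0. i0 + Q \<le> n \<longrightarrow> good_window {i0..<i0 + Q} r B cap \<omega>} = space (measure_pmf ?D) - (\<Union>i0\<in>?I. ?bad i0)"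
    by auto
  then have "measure_pmf.prob ?D {\<omega>. \<forall>i0. i0 + Q \<le> n \<longrightarrow> good_window {i0..<i0 + Q} r B cap \<omega>}
     = 1 - measure_pmf.prob ?D (\<Union>i0\<in>?I. ?bad i0)"
    by (simp only:) (rule measure_pmf.prob_compl, simp)
  ultimately show ?thesis by simp
qed

end

lemma good_window_cong:
  assumes "\<And>i. i < r * B \<Longrightarrow> \<omega> i = \<omega>' i" and B: "0 < B"
  shows "good_window I r B cap \<omega> = good_window I r B cap \<omega>'"
proof -
  have clean: "clean_block I B \<omega> (i div B) = clean_block I B \<omega>' (i div B)" if "i < r * B" for i
  proof -
    have "(i div B + 1) * B \<le> r * B"
      using that B by (intro mult_right_mono) (auto simp: less_mult_imp_div_less Suc_leI)
    then have "i' < r * B" if "i' \<in> {i div B * B..<i div B * B + B}" for i' using that by auto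
    then show ?thesis unfolding clean_block_def using assms(1) by auto
  qed
  have eqs: "{i. i < r * B \<and> R (\<omega> i)} = {i. i < r * B \<and> R (\<omega>' i)}" for R using assms(1) by auto
  have ex: "(\<exists>i<r * B. fst (\<omega> i) \<subseteq> I \<and> odd (card (fst (\<omega> i) \<inter> V)) \<and> clean_block I B \<omega> (i div B)) \<longleftrightarrow>
     (\<exists>i<r * B. fst (\<omega>' i) \<subseteq> I \<and> odd (card (fst (\<omega>' i) \<inter> V)) \<and> clean_block I B \<omega>' (i div B))" for V
    using assms(1) clean by (intro iffI; elim exE conjE; metis)
  show ?thesis
    unfolding good_window_def ex
    using eqs[of "\<lambda>z. fst z \<subseteq> I"] eqs[of "\<lambda>z. fst z \<subseteq> I \<and> odd (card (fst z \<inter> V)) \<and> snd z" for V]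
      eqs[of "\<lambda>z. fst z \<subseteq> I \<and> odd (card (fst z \<inter> V)) \<and> \<not> snd z" for V]
    by simp
qed

section \<open>The three bounds\<close>

context regime
begin

abbreviation "K \<equiv> 512 * 65 * Gc\<^sup>2"
abbreviation "ex \<equiv> 1 + (1 - \<delta>) * ((real k - 1) / 2)"

lemma Gc1: "1 \<le> Gc" using Gc \<gamma>0 by simp

lemma K1: "1 \<le> K"
proof -
  have "1 \<le> Gc\<^sup>2" using Gc1 by (rule one_le_power)
  then show ?thesis by simp
qed

text \<open>The origin of the exponent in the sample bound: \<open>n / q\<close> has exponent
  \<open>(1 - \<delta>) / 2\<close>, and one factor \<open>q\<close> comes from
  \<open>M\<close>.\<close>

lemma q_power: "q * (real n / q) ^ k = real n powr ex"
proof -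
  have "real n / q = real n powr (1 - (1 + \<delta>) / 2)" using n_pos by (simp add: powr_diff)
  moreover have "0 < real n / q" using n_pos by simp
  ultimately have "(real n / q) ^ k = (real n powr (1 - (1 + \<delta>) / 2)) powr real k" using n_pos by (simp add: powr_realpow)
  then have "q * (real n / q) ^ k = real n powr ((1 + \<delta>) / 2 + (1 - (1 + \<delta>) / 2) * real k)"
    by (simp only: powr_powr powr_add)
  also have "(1 + \<delta>) / 2 + (1 - (1 + \<delta>) / 2) * real k = ex" by (simp add: field_simps)
  finally show ?thesis .
qed

lemma M_div_p: "real M / p \<le> K * mx * real n powr ex"
proof -
  have q0: "0 < q" using q_ge1 by linarith
  have "1 / p \<le> 1 / (q / real n) ^ k" using p_ge p_pos q0 n_pos by (intro divide_left_mono) auto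
  also have "\<dots> = (real n / q) ^ k" by (simp add: power_divide)
  finally have "real M * (1 / p) \<le> K * (q * mx) * (real n / q) ^ k"
    using M_le_mx q0 n_pos p_pos by (intro mult_mono) auto
  also have "\<dots> = K * mx * (q * (real n / q) ^ k)" by (simp only: mult_ac)
  finally show ?thesis unfolding q_power by simp
qed

lemma samples: "real m \<le> sample_bound (282 * K) n k \<eta> \<delta>"
proof -
  have "\<eta> * real M \<le> 1 / 2 * real M" using \<eta>_half by (intro mult_right_mono) auto
  moreover have "real r = 8 * real r'" using r_eq(1) by simp
  \<comment> \<open>\<open>276 = 256 + 4 + 16\<close>, from the three summands of
    \<open>8 * r'\<close>.\<close>
  ultimately have "real r \<le> 276 * real M" using r'_bounds(4) l_le_M by linarith
  moreover have M: "real M * 1 \<le> real M * (1 / p)" using p_pos by (intro mult_left_mono) auto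
  ultimately have "real m \<le> 282 * (real M / p)"
    using m0_bounds(2) B_bounds(3) l_le_M(2) by simp
  also have "\<dots> \<le> 282 * (K * mx * real n powr ex)" using M_div_p by (intro mult_left_mono) auto
  also have "\<dots> = mx * ((282 * K) * real n powr ex)" by (simp only: mult_ac)
  also have "\<dots> \<le> Max {1, ln n / k, \<eta> * n powr ((1 + \<delta>) / 2) * ln n / real k ^ 2} * (282 * K * n) powr ex"
  proof (intro mult_mono)
    \<comment> \<open>As the exponent is at least 1, a constant factor may be moved into the base,
      where the sample bound has its constant.\<close>
    have "1 \<le> ex" using \<delta> k0 by simp
    then have "(282 * K) powr 1 \<le> (282 * K) powr ex" using K1 by (intro powr_mono) auto
    then have "282 * K \<le> (282 * K) powr ex" using K1 by simp
    then show "282 * K * real n powr ex \<le> (282 * K * n) powr ex"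
      using K1 n_pos by (simp add: powr_mult mult_right_mono)
  qed (use K1 in auto)
  finally show ?thesis by (simp only: sample_bound_def)
qed

lemma two_power_r: "2 ^ r \<le> real n powr 528 * exp (8 * K * (\<eta> * q * mx))"
proof -
  have "\<eta> * real M \<le> K * (\<eta> * q * mx)"
    using mult_left_mono[OF M_le_mx \<eta>(1)] by (simp only: mult_ac)
  then have "real r \<le> 256 * real l + 8 * K * (\<eta> * q * mx) + 16" using r_eq(1) r'_bounds(4) by simp
  have l: "real l * ln 2 \<le> 2 * ln (real n)"
  proof -
    have "real l * ln 2 = ln (2 ^ l)" by (simp add: ln_realpow)
    also have "\<dots> \<le> ln (2 * real n)" using two_l n_pos by (subst ln_le_cancel_iff) auto
    also have "\<dots> = ln 2 + ln (real n)" using n_pos by (simp add: ln_mult)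
    also have "ln 2 \<le> ln (real n)" using n8 by simp
    finally show ?thesis by simp
  qed
  define y where "y = K * (\<eta> * q * mx)"
  have y0: "0 \<le> y" unfolding y_def using \<eta>(1) by (intro mult_nonneg_nonneg) auto
  have r: "real r \<le> 256 * real l + (8 * y + 16)" using \<open>real r \<le> _\<close> by (simp add: y_def)
  have "real r * ln 2 \<le> (256 * real l + (8 * y + 16)) * ln 2"
    using r by (intro mult_right_mono) auto
  also have "\<dots> = 256 * (real l * ln 2) + (8 * y + 16) * ln 2" by (simp only: distrib_right mult.assoc)
  also have "(8 * y + 16) * ln 2 \<le> (8 * y + 16) * 1"
    using y0 ln_2_less_1 by (intro mult_left_mono) auto
  \<comment> \<open>\<open>528 = 512 + 16\<close>: the logarithmic part of \<open>r\<close> becomes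
    a fixed power of \<open>n\<close>.\<close>
  also have "256 * (real l * ln 2) + (8 * y + 16) * 1 \<le> 528 * ln (real n) + 8 * y" 
  proof -
    have "256 * (real l * ln 2) \<le> 256 * (2 * ln (real n))" using l by (rule mult_left_mono) simp
    then show ?thesis using ln_n by simp
  qed
  finally have "exp (real r * ln 2) \<le> exp (528 * ln (real n) + 8 * y)" by simp
  moreover have "exp (real r * ln 2) = 2 ^ r" by (simp add: exp_of_nat_mult)
  moreover have "exp (528 * ln (real n) + 8 * y) = real n powr 528 * exp (8 * K * (\<eta> * q * mx))"
    using n_pos by (simp add: y_def exp_add powr_def mult.assoc)
  ultimately show ?thesis by simp
qed

lemma running_time:
  "real (n ^ E\<^sub>0 * load P) \<le> time_bound (282 * K) (8 * K) (real E\<^sub>0 + 529) n k \<eta> \<delta>"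
proof -
  let ?e = "exp (8 * K * (\<eta> * q * mx))" and ?s = "sample_bound (282 * K) n k \<eta> \<delta>"
  have n0: "1 \<le> real n powr 528" using n_pos by (intro ge_one_powr_ge_zero) auto
  have s0: "0 \<le> ?s" using samples by (rule order.trans[rotated]) simp
  have "1 \<le> (2 :: real) ^ r" by (rule one_le_power) simp
  then have "real (load P) \<le> 2 * 2 ^ r + real m" by (simp add: load_def)
  also have "\<dots> \<le> 2 * (real n powr 528 * ?e) + real n powr 528 * ?s"
    using two_power_r samples mult_right_mono[OF n0 s0] by simp
  also have "\<dots> \<le> 2 * (real n powr 528 * (?e + ?s))"
    using n0 s0 by (simp add: algebra_simps)
  also have "\<dots> \<le> real n * (real n powr 528 * (?e + ?s))"
    using n8 n0 s0 by (intro mult_right_mono mult_nonneg_nonneg add_nonneg_nonneg) auto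
  also have "\<dots> = real n powr 529 * (?e + ?s)"
    using n_pos powr_add[of "real n" 1 528] by simp
  finally have "real n powr real E\<^sub>0 * real (load P) \<le> real n powr real E\<^sub>0 * (real n powr 529 * (?e + ?s))"
    by (intro mult_left_mono) auto
  then show ?thesis using n_pos by (simp add: time_bound_def powr_add powr_realpow mult.assoc)
qed

lemma valid: "valid P"
proof -
  have "real G \<le> real n" using G_bounds(2) nGc by linarith
  then have "G \<le> n" by (simp only: of_nat_le_iff)
  moreover have "k \<le> n" by (rule kn)
  ultimately show ?thesis using n8 k0 \<eta>(1) \<eta>_half \<delta> P by (simp add: valid_def)
qed

lemma solves:
  assumes s: "s \<in> carrier_vec n"
    and E\<^sub>0: "\<And>\<omega>. \<exists>c. reach P \<omega> (initial (compile fullP) P) c \<and> todo c = []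
        \<and> mem_of c = machine.M10 P \<omega> \<and> cost c \<le> dimension P ^ E\<^sub>0 * load P"
  shows "solves_sparse_LPN (compile fullP) P s (sample_bound (282 * K) n k \<eta> \<delta>)
     (time_bound (282 * K) (8 * K) (real E\<^sub>0 + 529) n k \<eta> \<delta>) (1 - 1 / real n)"
proof (rule solves_of_tapes[where d = "(0\<^sub>v n, 0)" and m = m and T = "n ^ E\<^sub>0 * load P"
      and good = "\<lambda>\<omega>. \<forall>i0. i0 + Q \<le> n \<longrightarrow> good_window {i0..<i0 + Q} r B cap (\<lambda>i. dec n s (\<omega> i))"])
  fix \<omega>
  interpret M: machine P \<omega> by unfold_locales (rule valid)
  obtain c where c: "reach P \<omega> (initial (compile fullP) P) c" "todo c = []" "mem_of c = M.M10"
      "cost c \<le> dimension P ^ E\<^sub>0 * load P"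
    using E\<^sub>0 by blast
  obtain t where t: "drun P \<omega> t (initial (compile fullP) P) = c" using c(1) unfolding reach_def by blast
  have "drawn c = m" using M.M10_md by (simp add: mem_of_def flip: c(3))
  moreover have "outputs P s c"
    if "\<forall>i0. i0 + Q \<le> n \<longrightarrow> good_window {i0..<i0 + Q} r B cap (\<lambda>i. dec n s (\<omega> i))"
  proof -
    have "ma M.M10 0 x = nat_of_bit (vec_index s x)" if "x < n" for x
      using M.M10_correct[of s x] s that \<open>\<forall>i0. _\<close> P by simp
    then show ?thesis using P by (simp add: outputs_def mem_of_def flip: c(3))
  qed
  ultimately show "\<exists>t. todo (drun P \<omega> t (initial (compile fullP) P)) = [] \<and>
      drawn (drun P \<omega> t (initial (compile fullP) P)) = m \<and>
      cost (drun P \<omega> t (initial (compile fullP) P)) \<le> n ^ E\<^sub>0 * load P \<and>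
      ((\<forall>i0. i0 + Q \<le> n \<longrightarrow> good_window {i0..<i0 + Q} r B cap (\<lambda>i. dec n s (\<omega> i))) \<longrightarrow>
        outputs P s (drun P \<omega> t (initial (compile fullP) P)))"
    using t c(2,4) P(1) by auto
next
  fix \<omega> \<omega>' :: "nat \<Rightarrow> bit Matrix.vec \<times> bit"
  assume "\<forall>i<m. \<omega> i = \<omega>' i"
  then have "good_window I r B cap (\<lambda>i. dec n s (\<omega> i)) = good_window I r B cap (\<lambda>i. dec n s (\<omega>' i))" for I
    by (intro good_window_cong) (auto simp: par_m_def par_B_def)
  then show "(\<forall>i0. i0 + Q \<le> n \<longrightarrow> good_window {i0..<i0 + Q} r B cap (\<lambda>i. dec n s (\<omega> i)))
     = (\<forall>i0. i0 + Q \<le> n \<longrightarrow> good_window {i0..<i0 + Q} r B cap (\<lambda>i. dec n s (\<omega>' i)))" by simp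
next
  \<comment> \<open>The default cell of the sample tape must decode to the default cell of the
    decoded tape for the two product laws to correspond.\<close>
  have "dec n s (0\<^sub>v n, 0) = ({}, False)" using s by (simp add: dec_def)
  from Pi_pmf_dec[OF kn _ this, of "{..<m}" \<eta>] have
    "map_pmf (\<lambda>\<omega> i. dec n s (\<omega> i)) (Pi_pmf {..<m} (0\<^sub>v n, 0) (\<lambda>_. lpn_sample n k \<eta> s))
      = Pi_pmf {..<m} ({}, False) (\<lambda>_. dec_sample n k \<eta>)" by simp
  from prob_all_windows[folded this]
  show "1 - 1 / real n \<le> measure_pmf.prob (Pi_pmf {..<m} (0\<^sub>v n, 0) (\<lambda>_. lpn_sample n k \<eta> s))
      {\<omega>. \<forall>i0. i0 + Q \<le> n \<longrightarrow> good_window {i0..<i0 + Q} r B cap (\<lambda>i. dec n s (\<omega> i))}"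
    by simp
qed (use flipless_comp P samples running_time in simp_all)

end

lemma eventually_regime:
  fixes k :: "nat \<Rightarrow> nat" and \<eta> \<delta> :: "nat \<Rightarrow> real"
  assumes \<eta>0: "\<eta>\<^sub>0 < 1 / 2" and k: "\<forall>n. odd (k n)" and \<eta>: "\<forall>n. 0 \<le> \<eta> n \<and> \<eta> n \<le> \<eta>\<^sub>0"
    and \<delta>: "\<forall>n. 0 < \<delta> n \<and> \<delta> n < 1"
    and small: "(\<lambda>n. real (k n)) \<in> o(\<lambda>n. real n powr ((1 + \<delta> n) / 2))"
  defines "\<gamma>\<^sub>0 \<equiv> 1 - 2 * \<eta>\<^sub>0"
  shows "\<forall>\<^sub>F n in sequentially. regime \<lparr>dimension = n, sparsity = k n, noise = \<eta> n, tradeoff = \<delta> n\<rparr>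
    n (k n) (\<eta> n) (\<delta> n) \<gamma>\<^sub>0 (2 / \<gamma>\<^sub>0 + 1)"
proof -
  have \<gamma>0: "0 < \<gamma>\<^sub>0" using \<eta>0 by (simp add: \<gamma>\<^sub>0_def)
  define D where "D = 512 * (2 / \<gamma>\<^sub>0 + 1)\<^sup>2"
  have D0: "0 < D" using \<gamma>0 unfolding D_def by (intro mult_pos_pos zero_less_power add_pos_pos) auto
  have "\<forall>\<^sub>F n in sequentially. norm (real (k n)) \<le> 1 / 8 * norm (real n powr ((1 + \<delta> n) / 2))"
    using landau_o.smallD[OF small, of "1 / 8"] by simp
  moreover have "\<forall>\<^sub>F n in sequentially. 8 \<le> n" by (rule eventually_ge_at_top)
  moreover have "\<forall>\<^sub>F n in sequentially. 2 / \<gamma>\<^sub>0 + 1 \<le> real n" by real_asymp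
  moreover have "\<forall>\<^sub>F n in sequentially. 4 \<le> \<gamma>\<^sub>0 * real n" using \<gamma>0 by real_asymp
  moreover have "\<forall>\<^sub>F n in sequentially. D * (real n + 3 * real n * ln (real n) + 1) \<le> (real n)\<^sup>2"
    using D0 by real_asymp
  moreover have "\<forall>\<^sub>F n in sequentially. 3 * ln (real n) \<le> sqrt (real n)" by real_asymp
  ultimately show ?thesis
  proof eventually_elim
    case (elim n)
    show ?case
    proof (unfold_locales)
      show "\<gamma>\<^sub>0 \<le> 1 - 2 * \<eta> n" using \<eta> by (simp add: \<gamma>\<^sub>0_def)
      show "512 * (2 / \<gamma>\<^sub>0 + 1)\<^sup>2 * (real n + 3 * real n * ln (real n) + 1) \<le> (real n)\<^sup>2"
        using elim by (simp only: D_def)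
    qed (use elim k \<eta> \<delta> \<gamma>0 in simp_all)
  qed
qed

theorem theorem10:
  "\<exists>A :: com. \<forall>\<eta>\<^sub>0 < 1 / 2. \<exists>C > 0. \<exists>B > 0. \<exists>E > 0.
     \<forall>(k :: nat \<Rightarrow> nat) (\<eta> :: nat \<Rightarrow> real) (\<delta> :: nat \<Rightarrow> real).
       (\<forall>n. odd (k n)) \<longrightarrow>
       (\<forall>n. 0 \<le> \<eta> n \<and> \<eta> n \<le> \<eta>\<^sub>0) \<longrightarrow>
       (\<forall>n. 0 < \<delta> n \<and> \<delta> n < 1) \<longrightarrow>
       (\<lambda>n. real (k n)) \<in> o(\<lambda>n. real n powr ((1 + \<delta> n) / 2)) \<longrightarrow>
       (\<forall>\<^sub>F n in sequentially. \<forall>s \<in> carrier_vec n.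
          solves_sparse_LPN A
            \<lparr>dimension = n, sparsity = k n, noise = \<eta> n, tradeoff = \<delta> n\<rparr> s
            (sample_bound C n (k n) (\<eta> n) (\<delta> n))
            (time_bound C B E n (k n) (\<eta> n) (\<delta> n))
            (1 - 1 / real n))"
proof -
  obtain E\<^sub>0 where E\<^sub>0: "\<And>P \<omega>. valid P \<Longrightarrow> \<exists>c. reach P \<omega> (initial (compile fullP) P) c \<and> todo c = []
      \<and> mem_of c = machine.M10 P \<omega> \<and> cost c \<le> dimension P ^ E\<^sub>0 * load P"
    using program_cost by blast
  show ?thesis
  proof (intro exI[of _ "compile fullP"] allI impI)
    fix \<eta>\<^sub>0 :: real
    assume \<eta>0: "\<eta>\<^sub>0 < 1 / 2"
    define \<gamma>\<^sub>0 where "\<gamma>\<^sub>0 = 1 - 2 * \<eta>\<^sub>0"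
    define K where "K = 512 * 65 * (2 / \<gamma>\<^sub>0 + 1)\<^sup>2"
    have K: "0 < K" unfolding K_def using \<eta>0 by (intro mult_pos_pos zero_less_power add_pos_pos) (auto simp: \<gamma>\<^sub>0_def)
    show "\<exists>C > 0. \<exists>B > 0. \<exists>E > 0.
     \<forall>(k :: nat \<Rightarrow> nat) (\<eta> :: nat \<Rightarrow> real) (\<delta> :: nat \<Rightarrow> real).
       (\<forall>n. odd (k n)) \<longrightarrow>
       (\<forall>n. 0 \<le> \<eta> n \<and> \<eta> n \<le> \<eta>\<^sub>0) \<longrightarrow>
       (\<forall>n. 0 < \<delta> n \<and> \<delta> n < 1) \<longrightarrow>
       (\<lambda>n. real (k n)) \<in> o(\<lambda>n. real n powr ((1 + \<delta> n) / 2)) \<longrightarrow>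
       (\<forall>\<^sub>F n in sequentially. \<forall>s \<in> carrier_vec n.
          solves_sparse_LPN (compile fullP)
            \<lparr>dimension = n, sparsity = k n, noise = \<eta> n, tradeoff = \<delta> n\<rparr> s
            (sample_bound C n (k n) (\<eta> n) (\<delta> n))
            (time_bound C B E n (k n) (\<eta> n) (\<delta> n))
            (1 - 1 / real n))"
    proof (rule exI[of _ "282 * K"], rule conjI, simp add: K, rule exI[of _ "8 * K"], rule conjI, simp add: K,
        rule exI[of _ "real E\<^sub>0 + 529"], rule conjI, simp, intro allI impI)
      fix k :: "nat \<Rightarrow> nat" and \<eta> \<delta> :: "nat \<Rightarrow> real"
      assume "\<forall>n. odd (k n)" "\<forall>n. 0 \<le> \<eta> n \<and> \<eta> n \<le> \<eta>\<^sub>0" "\<forall>n. 0 < \<delta> n \<and> \<delta> n < 1"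
        "(\<lambda>n. real (k n)) \<in> o(\<lambda>n. real n powr ((1 + \<delta> n) / 2))"
      from eventually_regime[OF \<eta>0 this, folded \<gamma>\<^sub>0_def]
      show "\<forall>\<^sub>F n in sequentially. \<forall>s \<in> carrier_vec n.
          solves_sparse_LPN (compile fullP)
            \<lparr>dimension = n, sparsity = k n, noise = \<eta> n, tradeoff = \<delta> n\<rparr> s
            (sample_bound (282 * K) n (k n) (\<eta> n) (\<delta> n))
            (time_bound (282 * K) (8 * K) (real E\<^sub>0 + 529) n (k n) (\<eta> n) (\<delta> n))
            (1 - 1 / real n)"
      proof eventually_elim
        case (elim n)
        then show ?case
          unfolding K_def by (intro ballI regime.solves E\<^sub>0 regime.valid)
      qed
    qed
  qed
qed

end
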